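(* Let $m_e$ denote the maximal number of edges in (the boundary of) a subdomain $\Omega_i$, let $\nu:=\max_{e}\#\{i:\overline{\Omega_i}\cap\mathring e\neq\emptyset\}$, let $\widetilde\omega:=\max_{i=1,\dots,M}\#\{e:\Omega_e\cap\Omega_i\neq\emptyset\}$, and let $c_t:=\max_e c_{t,e}$, $c_p:=\max_e c_{p,e}$ (all maxima over $e$ are over all edges of the interface $\Gamma$). Let $m\in\mathbb N$ be an upper bound for the number of overlapping subdomains $\Omega_i'$ that any finite element node in $\Omega$ can belong to. Set $$C_0^2:=20+34\,m_e\,\nu\,\widetilde\omega\,\max\left\{\frac{c_t^2\,tol_{tr}\,(1+c_p^2)}{c_1^2},\ \frac1{tol_{dir}}\right\}.$$ Then, for every $u\in V_\Omega^0$, the functions $u_0$ and $u_i$, $i=1,\dots,M$, defined in the context form a stable decomposition with constant $C_0^2$, i.e. $$u=u_0+\sum_{i=1}^M E_{\Omega_i'\to\Omega}u_i,\qquad a_\Omega(u_0,u_0)+\sum_{i=1}^M a_{\Omega_i'}(u_i,u_i)\le C_0^2\,a_\Omega(u,u),$$ and the condition number of the two-level preconditioned operator with coarse space $X_0$ satisfies $$\kappa\big(\boldsymbol M_{AS-2}^{-1}\boldsymbol A\big)\le C_0^2\,(m+1).$$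
   Context: **Model problem.** $\Omega\subset\mathbb R^2$ is a bounded Lipschitz domain and $\alpha\in L^\infty(\Omega)$ with $0<\alpha_{min}\le\alpha\le\alpha_{max}<\infty$. $\tau_h$ is a quasi-uniform triangulation of $\Omega$ into triangles or quadrilaterals, and $\alpha$ is constant on each element. For a union $\omega$ of elements, $a_\omega(u,v)=\int_\omega\alpha\,\nabla u\cdot\nabla v\,dx$ and $|u|_{a,\omega}^2=a_\omega(u,u)$. $V_\Omega^0\subset H^1_0(\Omega)$ is the conforming P1 or Q1 finite element (FE) space on $\tau_h$ with zero trace. For $\omega\subset\Omega$ a union of elements, $V_\omega$ is the restriction of the FE space to $\omega$ and $V_\omega^0$ the subspace of functions vanishing on $\partial\omega$. $\boldsymbol A$ is the stiffness matrix of $a_\Omega$ on $V_\Omega^0$. **Domain decomposition.** $\Omega$ is decomposed into nonoverlapping subdomains $\Omega_i$, $i=1,\dots,M$, with Lipschitz boundaries, which are unions of elements: $\overline\Omega=\bigcup_i\overline{\Omega_i}$. The interface is $\Gamma=\bigcup_{i\ne j}(\partial\Omega_i\cap\partial\Omega_j)\setminus\partial\Omega$. It is partitioned into vertices $\mathcal V$ (nodes belonging to the closures of more than two subdomains) and edges $e$, whose interior nodes belong to the closures of exactly two (common) subdomains. $\mathring e$ is the discrete interior of $e$ (the nodes of $e$ without its endpoints). $V_e^0$ is the space of FE traces on $e$ vanishing at the endpoints of $e$, and $V_\Gamma^0$ the space of traces of $V_\Omega^0$ on $\Gamma$. $\{\Omega_i'\}_{i=1}^M$ is an overlapping decomposition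 with overlap $\delta\ge h$: each $\Omega_i'\supset\Omega_i$ is a union of elements containing all elements touching $\overline{\Omega_i}$. $E_{\Omega_i'\to\Omega}:V^0_{\Omega_i'}\to V^0_\Omega$ is extension by zero, $R_{\Omega\to\Omega_i'}:V_\Omega^0\to V_{\Omega_i'}^0$ is the nodal restriction (its matrix is the transpose of that of $E_{\Omega_i'\to\Omega}$), and $a_{\Omega_i'}(u_i,v_i)=a_\Omega(E_{\Omega_i'\to\Omega}u_i,E_{\Omega_i'\to\Omega}v_i)$. A node "belongs to" a subdomain if it lies in its closure. **Extensions.** $E_{e\to\Gamma}$ and $E_{\mathcal V\to\Gamma}$ extend by zero (at all other nodes) from $e$ or $\mathcal V$ to $\Gamma$. $H_{\Gamma\to\Omega}:V_\Gamma^0\to V_\Omega^0$ is the energy-minimizing extension: $H_{\Gamma\to\Omega}v=v$ on $\Gamma$ and $a_{\Omega_i}(H_{\Gamma\to\Omega}v,w)=0$ for all $w\in V_{\Omega_i}^0$ and all $i$. **Oversampling domains.** For each edge $e$, $\Omega_e\subset\Omega$ is a subdomain that is a union of elements, contains $e$ (and all elements touching $\mathring e$) and satisfies $\operatorname{dist}(\partial\Omega_e\setminus\partial\Omega,e)\ge\upsilon_e>0$. If $\partial\Omega_e\cap\partial\Omega\ne\emptyset$, then $V_{\Omega_e}$ and $V_{\partial\Omega_e}$ (FE traces on $\partial\Omega_e$) are replaced by their subspaces of functions vanishing on $\partial\Omega$. $E_{e\to\Omega_e}:V_e^0\to V_{\Omega_e}^0$ keeps the nodal values on $e$ and sets all other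 nodal values to zero. $b_e(\chi,\zeta):=a_{\Omega_e}(E_{e\to\Omega_e}\chi,E_{e\to\Omega_e}\zeta)$ on $V_e^0$. $I_{\mathcal V}v$ is the interpolation by the vertex functions, $I_{\mathcal V}v=\sum_{\mathcal V}v(\mathcal V)\,H_{\Gamma\to\Omega}E_{\mathcal V\to\Gamma}1$; $I_{\mathcal V,e}$ is its restriction to $e$ (same values at the endpoints, zero at interior nodes of $e$). **Dirichlet eigenproblem.** For $\chi\in V_e^0$, let $\hat\chi\in V_{\Omega_e}^0$ be the function equal to $\chi$ at the nodes of $\mathring e$ with $a_{\Omega_e}(\hat\chi,v)=0$ for all $v\in V_{\Omega_e}^0$ vanishing at the nodes of $\mathring e$; put $d_e(\chi,\zeta)=a_{\Omega_e}(\hat\chi,\hat\zeta)$. Let $(\psi_e^{(i)},\mu^{(i)})$, with $\psi_e^{(i)}$ a $b_e$-orthonormal basis of $V_e^0$, solve $d_e(\psi_e^{(i)},\chi)=\mu^{(i)}b_e(\psi_e^{(i)},\chi)$ for all $\chi\in V_e^0$, eigenvalues nondecreasing. Given $tol_{dir}>0$, let $n_{dir,e}$ be the number of $i$ with $\mu^{(i)}\le tol_{dir}$, and $\Pi_{e,dir}v=\sum_{i\le n_{dir,e}}b_e(v,\psi_e^{(i)})\psi_e^{(i)}$. **Transfer eigenproblem.** $V_{\Omega_e,ha}=\{w\in V_{\Omega_e}: a_{\Omega_e}(w,v)=0\ \forall v\in V_{\Omega_e}^0\}$. $(\cdot,\cdot)_{\partial\Omega_e}$ is an inner product on $V_{\partial\Omega_e}$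 whose norm satisfies $c_1\|\zeta\|_{\partial\Omega_e}\le\sqrt{\alpha_{min}}\|\zeta\|_{L^2(\partial\Omega_e)}\le c_2\|\zeta\|_{\partial\Omega_e}$ for all $\zeta\in V_{\partial\Omega_e}$, with constants $c_1,c_2>0$ independent of the mesh size and of $\alpha$ (and valid for all edges). $H_{\partial\Omega_e\to\Omega_e}:V_{\partial\Omega_e}\to V_{\Omega_e,ha}$ is the discrete $a$-harmonic extension, and $T\varsigma=(I-I_{\mathcal V,e})\big((H_{\partial\Omega_e\to\Omega_e}\varsigma)|_e\big)$. Let $(\phi_e^{(i)},\lambda^{(i)})$, $\phi_e^{(i)}\in V_{\Omega_e,ha}$ with traces forming a $(\cdot,\cdot)_{\partial\Omega_e}$-orthonormal basis of $V_{\partial\Omega_e}$, solve $b_e(T(\phi_e^{(i)}|_{\partial\Omega_e}),T(w|_{\partial\Omega_e}))=\lambda^{(i)}(\phi_e^{(i)}|_{\partial\Omega_e},w|_{\partial\Omega_e})_{\partial\Omega_e}$ for all $w\in V_{\Omega_e,ha}$, eigenvalues nonincreasing. Given $tol_{tr}>0$, let $n_{tr,e}$ be the number of $i$ with $\lambda^{(i)}>tol_{tr}$, $\varphi_e^{(i)}=T(\phi_e^{(i)}|_{\partial\Omega_e})$, and $\Pi_{e,tr}v=\sum_{i\le n_{tr,e}}\frac1{\lambda^{(i)}}b_e(v,\varphi_e^{(i)})\varphi_e^{(i)}$. **Coarse space.** $X_0$ is the sum of $X_{vert}=\operatorname{span}\{H_{\Gamma\to\Omega}E_{\mathcal V\to\Gamma}1\}$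 over vertices, $X_{const}=\operatorname{span}\{H_{\Gamma\to\Omega}E_{e\to\Gamma}1\}$ over edges (value $1$ at nodes of $\mathring e$, $0$ at all other interface nodes), $X_{dir}=\operatorname{span}\{H_{\Gamma\to\Omega}E_{e\to\Gamma}\psi_e^{(i)}: e \text{ edge},\ \mu^{(i)}\le tol_{dir}\}$ and $X_{tr}=\operatorname{span}\{H_{\Gamma\to\Omega}E_{e\to\Gamma}\varphi_e^{(i)}: e\text{ edge},\ \lambda^{(i)}>tol_{tr}\}$. **Two-level Schwarz operator.** The columns of $\boldsymbol E_0$ are the FE coefficients of a basis of $X_0$, $\boldsymbol R_0=\boldsymbol E_0^T$, $\boldsymbol A_0=\boldsymbol R_0\boldsymbol A\boldsymbol E_0$, $\boldsymbol A_{\Omega_i'}=\boldsymbol R_{\Omega\to\Omega_i'}\boldsymbol A\boldsymbol E_{\Omega_i'\to\Omega}$, and $\boldsymbol M_{AS-2}^{-1}\boldsymbol A=\boldsymbol E_0\boldsymbol A_0^{-1}\boldsymbol R_0\boldsymbol A+\sum_{i=1}^M\boldsymbol E_{\Omega_i'\to\Omega}\boldsymbol A_{\Omega_i'}^{-1}\boldsymbol R_{\Omega\to\Omega_i'}\boldsymbol A$. This operator is self-adjoint and positive with respect to the $\boldsymbol A$-inner product; $\kappa$ is the ratio of its largest and smallest eigenvalues. **Decomposition of $u\in V_\Omega^0$.** For each edge, $u|_{\Omega_e}=u_{\Omega_e,ha}+u_{\Omega_e,ha}^\perp$ with $u_{\Omega_e,ha}\in V_{\Omega_e,ha}$, $u_{\Omega_e,ha}=u$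 on $\partial\Omega_e$, and $u_{\Omega_e,ha}^\perp\in V_{\Omega_e}^0$. Put $c_u=\frac1{|\Omega_e|}\int_{\Omega_e}u_{\Omega_e,ha}$ if $\partial\Omega_e\cap\partial\Omega=\emptyset$ and $c_u=0$ otherwise; $\widehat{u_{\Omega_e,ha}}=u_{\Omega_e,ha}-c_u\mathbb 1_{\Omega_e}$. Set $u_{0,\Omega_e,ha}=H_{\Gamma\to\Omega}E_{e\to\Gamma}\big[\Pi_{e,tr}(\widehat{u_{\Omega_e,ha}}|_e-I_{\mathcal V,e}\widehat{u_{\Omega_e,ha}}|_e)+c_u\mathbb 1_e-I_{\mathcal V,e}c_u\mathbb 1_e\big]$, $u_{0,\Omega_e,ha}^\perp=H_{\Gamma\to\Omega}E_{e\to\Gamma}\Pi_{e,dir}(u_{\Omega_e,ha}^\perp|_e-I_{\mathcal V,e}u_{\Omega_e,ha}^\perp|_e)$, $u_0=H_{\Gamma\to\Omega}((I_{\mathcal V}u)|_\Gamma)+\sum_{e\subset\Gamma}(u_{0,\Omega_e,ha}+u_{0,\Omega_e,ha}^\perp)$, $u_i=R_{\Omega\to\Omega_i'}I^h(\theta_i(u-u_0))$, where $I^h$ is nodal interpolation and $\theta_i$ has nodal values $1$ at nodes in the interior of $\Omega_i$, $1/m_{x_h}$ at nodes $x_h\in\Gamma\cap\overline{\Omega_i}$ ($m_{x_h}$ = number of subdomains $\Omega_j$ to which $x_h$ belongs), and $0$ at other nodes. **Constants.** $c_{t,e}=\sup_{v\in V_{\Omega_e,ha}}\frac{\|v|_{\partial\Omega_e}\|_{L^2(\partial\Omega_e)}}{\|v\|_{H^1(\Omega_e)}}$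 and $c_{p,e}=\sup_{v\in V_{\Omega_e,ha}}\frac{\|v-\frac{c_{\Omega_e}}{|\Omega_e|}\int_{\Omega_e}v\,\mathbb 1_{\Omega_e}\|_{L^2(\Omega_e)}}{\|\nabla v\|_{L^2(\Omega_e)}}$, where $c_{\Omega_e}=1$ if $\partial\Omega_e\cap\partial\Omega=\emptyset$ and $0$ otherwise (suprema over $v$ with nonzero denominator). *)

theory Defs
  imports
    "HOL-Analysis.Analysis"
    "HOL-Library.Function_Algebras"
    "HOL-Library.Set_Algebras"
    "Jordan_Normal_Form.Gauss_Jordan_Elimination"
    "Jordan_Normal_Form.Char_Poly"
begin

section \<open>Function spaces\<close>

instantiation "fun" :: (type, real_vector) real_vector
begin

definition scaleR_fun :: "real \<Rightarrow> ('a \<Rightarrow> 'b) \<Rightarrow> 'a \<Rightarrow> 'b"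
  where "scaleR_fun c f = (\<lambda>x. c *\<^sub>R f x)"

instance
  by standard (auto simp: scaleR_fun_def fun_eq_iff algebra_simps)

end

type_synonym pt = "real \<times> real"
type_synonym scalar_fun = "real \<times> real \<Rightarrow> real"

text \<open>
  A function on a set \<open>S\<close> is represented by a total function vanishing outside \<open>S\<close>. Hence \<open>restr S\<close>
  is the restriction to \<open>S\<close>, and, applied to a function that is given on \<open>S\<close> only, also its
  extension by zero.
\<close>

definition restr :: "pt set \<Rightarrow> scalar_fun \<Rightarrow> scalar_fun"
  where "restr S v = (\<lambda>x. if x \<in> S then v x else 0)"

definition inner_product_on :: "scalar_fun set \<Rightarrow> (scalar_fun \<Rightarrow> scalar_fun \<Rightarrow> real) \<Rightarrow> bool"
  where "inner_product_on V ip \<longleftrightarrow>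
    (\<forall>v\<in>V. \<forall>w\<in>V. ip v w = ip w v) \<and>
    (\<forall>v\<in>V. \<forall>w\<in>V. \<forall>z\<in>V. \<forall>c. ip (c *\<^sub>R v + w) z = c * ip v z + ip w z) \<and>
    (\<forall>v\<in>V. v \<noteq> 0 \<longrightarrow> ip v v > 0)"

text \<open>The \<open>THE\<close> is only meaningful at points of differentiability. Finite element functions are
  differentiable in the interior of each element, that is, almost everywhere.\<close>

definition grad :: "scalar_fun \<Rightarrow> pt \<Rightarrow> pt"
  where "grad v x = (THE D. GDERIV v x :> D)"

definition L2_norm_on :: "pt set \<Rightarrow> scalar_fun \<Rightarrow> real"
  where "L2_norm_on \<omega> v = sqrt (LINT x:\<omega>|lebesgue. (v x)\<^sup>2)"

definition grad_L2_norm_on :: "pt set \<Rightarrow> scalar_fun \<Rightarrow> real"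
  where "grad_L2_norm_on \<omega> v = sqrt (LINT x:\<omega>|lebesgue. (norm (grad v x))\<^sup>2)"

definition H1_norm_on :: "pt set \<Rightarrow> scalar_fun \<Rightarrow> real"
  where "H1_norm_on \<omega> v = sqrt ((L2_norm_on \<omega> v)\<^sup>2 + (grad_L2_norm_on \<omega> v)\<^sup>2)"


section \<open>Domains and meshes\<close>

text \<open>Near each boundary point the domain is, in a rotated orthonormal frame \<open>(t, n)\<close>, the part of
  the plane lying strictly above a Lipschitz graph.\<close>

definition lipschitz_domain :: "pt set \<Rightarrow> bool"
  where "lipschitz_domain D \<longleftrightarrow> D \<noteq> {} \<and> bounded D \<and> open D \<and> connected D \<and>
    (\<forall>x\<in>frontier D. \<exists>U t n g L. open U \<and> x \<in> U \<and> norm t = 1 \<and> norm n = 1 \<and> t \<bullet> n = 0 \<and>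
       L-lipschitz_on UNIV (g :: real \<Rightarrow> real) \<and>
       D \<inter> U = {y \<in> U. g (y \<bullet> t) < y \<bullet> n})"

definition quadrilateral :: "pt set \<Rightarrow> bool"
  where "quadrilateral T \<longleftrightarrow> polytope T \<and> aff_dim T = 2 \<and> card {p. p extreme_point_of T} = 4"

text \<open>Elements are closed and intersect in common faces, so there are no hanging nodes.\<close>

definition conforming_mesh :: "pt set \<Rightarrow> pt set set \<Rightarrow> bool"
  where "conforming_mesh D \<T> \<longleftrightarrow> finite \<T> \<and> \<Union>\<T> = closure D \<and>
    ((\<forall>T\<in>\<T>. 2 simplex T) \<or> (\<forall>T\<in>\<T>. quadrilateral T)) \<and>
    (\<forall>T\<in>\<T>. \<forall>T'\<in>\<T>. (T \<inter> T') face_of T \<and> (T \<inter> T') face_of T')"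

text \<open>Every element contains a disc whose radius is comparable to the largest element diameter.\<close>

definition quasi_uniform :: "real \<Rightarrow> pt set set \<Rightarrow> bool"
  where "quasi_uniform \<sigma> \<T> \<longleftrightarrow> \<sigma> > 0 \<and> (\<forall>T\<in>\<T>. \<forall>T'\<in>\<T>. \<exists>z. ball z (\<sigma> * diameter T') \<subseteq> T)"

definition P1_on :: "pt set \<Rightarrow> scalar_fun \<Rightarrow> bool"
  where "P1_on T v \<longleftrightarrow> (\<exists>a b. \<forall>x\<in>T. v x = a \<bullet> x + b)"

text \<open>Q1 functions are bilinear on the unit square, transported to the quadrilateral by the bilinear
  map that sends the corners of the square to its consecutive vertices \<open>p\<close>, \<open>q\<close>, \<open>r\<close>, \<open>s\<close>.\<close>

definition bilinear_map :: "pt \<Rightarrow> pt \<Rightarrow> pt \<Rightarrow> pt \<Rightarrow> real \<Rightarrow> real \<Rightarrow> pt"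
  where "bilinear_map p q r s \<xi> \<eta> =
    ((1 - \<xi>) * (1 - \<eta>)) *\<^sub>R p + (\<xi> * (1 - \<eta>)) *\<^sub>R q + (\<xi> * \<eta>) *\<^sub>R r + ((1 - \<xi>) * \<eta>) *\<^sub>R s"

definition Q1_on :: "pt set \<Rightarrow> scalar_fun \<Rightarrow> bool"
  where "Q1_on T v \<longleftrightarrow> (\<exists>p q r s. {x. x extreme_point_of T} = {p, q, r, s} \<and>
    closed_segment p q edge_of T \<and> closed_segment q r edge_of T \<and>
    closed_segment r s edge_of T \<and> closed_segment s p edge_of T \<and>
    (\<exists>a b c d. \<forall>\<xi>\<in>{0..1}. \<forall>\<eta>\<in>{0..1}. v (bilinear_map p q r s \<xi> \<eta>) = a + b * \<xi> + c * \<eta> + d * \<xi> * \<eta>))"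

definition fe_on :: "pt set \<Rightarrow> scalar_fun \<Rightarrow> bool"
  where "fe_on T v \<longleftrightarrow> (if 2 simplex T then P1_on T v else Q1_on T v)"


section \<open>The data of the method\<close>

text \<open>
  Domains (\<open>Omega\<close>, the subdomains \<open>sub i\<close>, the overlapping subdomains \<open>osub i\<close> and the oversampling
  domains \<open>esub e\<close>) are open sets; \<open>i\<close> ranges over \<open>1, \<dots>, nsub\<close>. An edge \<open>e\<close> of the interface is
  represented by the curve without its endpoints, see \<open>edges\<close> below. The fields \<open>psi\<close>, \<open>mu\<close> hold the
  eigenpairs of the Dirichlet eigenproblem and \<open>phi\<close>, \<open>lam\<close> those of the transfer eigenproblem, with
  indices starting at 1; \<open>bip e\<close> is the inner product on the boundary of \<open>esub e\<close>.
\<close>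

record dd_setting =
  Omega :: "pt set"
  mesh :: "pt set set"
  alpha :: scalar_fun
  nsub :: nat
  sub :: "nat \<Rightarrow> pt set"
  osub :: "nat \<Rightarrow> pt set"
  esub :: "pt set \<Rightarrow> pt set"
  bip :: "pt set \<Rightarrow> scalar_fun \<Rightarrow> scalar_fun \<Rightarrow> real"
  psi :: "pt set \<Rightarrow> nat \<Rightarrow> scalar_fun"
  mu :: "pt set \<Rightarrow> nat \<Rightarrow> real"
  phi :: "pt set \<Rightarrow> nat \<Rightarrow> scalar_fun"
  lam :: "pt set \<Rightarrow> nat \<Rightarrow> real"
  tol_dir :: real
  tol_tr :: real


section \<open>Finite element spaces\<close>

definition nodes :: "dd_setting \<Rightarrow> pt set"
  where "nodes P = {x. \<exists>T\<in>mesh P. x extreme_point_of T}"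

definition elem_union :: "dd_setting \<Rightarrow> pt set \<Rightarrow> bool"
  where "elem_union P \<omega> \<longleftrightarrow> (\<exists>S\<subseteq>mesh P. \<omega> = interior (\<Union>S))"

definition coefficient_ok :: "dd_setting \<Rightarrow> real \<Rightarrow> real \<Rightarrow> bool"
  where "coefficient_ok P \<alpha>min \<alpha>max \<longleftrightarrow> 0 < \<alpha>min \<and>
    (\<forall>T\<in>mesh P. \<exists>a\<in>{\<alpha>min..\<alpha>max}. \<forall>x\<in>interior T. alpha P x = a)"

definition energy :: "dd_setting \<Rightarrow> pt set \<Rightarrow> scalar_fun \<Rightarrow> scalar_fun \<Rightarrow> real"
  where "energy P \<omega> u v = (LINT x:\<omega>|lebesgue. alpha P x * (grad u x \<bullet> grad v x))"

definition fe_space :: "dd_setting \<Rightarrow> scalar_fun set"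
  where "fe_space P = {v. continuous_on (closure (Omega P)) v \<and> (\<forall>T\<in>mesh P. fe_on T v) \<and>
    (\<forall>x. x \<notin> closure (Omega P) \<longrightarrow> v x = 0)}"

definition V0 :: "dd_setting \<Rightarrow> scalar_fun set"
  where "V0 P = {v \<in> fe_space P. \<forall>x\<in>frontier (Omega P). v x = 0}"

definition Vloc :: "dd_setting \<Rightarrow> pt set \<Rightarrow> scalar_fun set"
  where "Vloc P \<omega> = restr (closure \<omega>) ` fe_space P"

definition Vloc0 :: "dd_setting \<Rightarrow> pt set \<Rightarrow> scalar_fun set"
  where "Vloc0 P \<omega> = {v \<in> Vloc P \<omega>. \<forall>x\<in>frontier \<omega>. v x = 0}"

text \<open>Nodal interpolation; only the values of \<open>f\<close> at the nodes matter.\<close>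

definition interp :: "dd_setting \<Rightarrow> scalar_fun \<Rightarrow> scalar_fun"
  where "interp P f = (THE v. v \<in> fe_space P \<and> (\<forall>x\<in>nodes P. v x = f x))"


section \<open>Domain decomposition\<close>

definition nonoverlapping_decomposition :: "dd_setting \<Rightarrow> bool"
  where "nonoverlapping_decomposition P \<longleftrightarrow>
    (\<forall>i\<in>{1..nsub P}. lipschitz_domain (sub P i) \<and> elem_union P (sub P i)) \<and>
    (\<forall>i\<in>{1..nsub P}. \<forall>j\<in>{1..nsub P}. i \<noteq> j \<longrightarrow> sub P i \<inter> sub P j = {}) \<and>
    closure (Omega P) = (\<Union>i\<in>{1..nsub P}. closure (sub P i))"

definition overlapping_decomposition :: "dd_setting \<Rightarrow> bool"
  where "overlapping_decomposition P \<longleftrightarrow>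
    (\<forall>i\<in>{1..nsub P}. elem_union P (osub P i) \<and> sub P i \<subseteq> osub P i \<and>
       (\<forall>T\<in>mesh P. T \<inter> closure (sub P i) \<noteq> {} \<longrightarrow> T \<subseteq> closure (osub P i)))"

definition subs_at :: "dd_setting \<Rightarrow> pt \<Rightarrow> nat set"
  where "subs_at P x = {i \<in> {1..nsub P}. x \<in> closure (sub P i)}"

definition interface :: "dd_setting \<Rightarrow> pt set"
  where "interface P =
    (\<Union>i\<in>{1..nsub P}. \<Union>j\<in>{1..nsub P} - {i}. frontier (sub P i) \<inter> frontier (sub P j)) - frontier (Omega P)"

definition vertices :: "dd_setting \<Rightarrow> pt set"
  where "vertices P = {x \<in> nodes P \<inter> interface P. card (subs_at P x) > 2}"

text \<open>An edge is given by the corresponding connected component \<open>e\<close> of the interface without the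
  vertices. The edge including its endpoints is \<open>closure e\<close>, and its endpoints form \<open>closure e - e\<close>;
  they are vertices or lie on the boundary of \<open>Omega\<close>. The points of \<open>e\<close> belong to the closures of
  exactly two subdomains, which are the same along \<open>e\<close>.\<close>

definition edges :: "dd_setting \<Rightarrow> pt set set"
  where "edges P = components (interface P - vertices P)"

definition edge_nodes :: "dd_setting \<Rightarrow> pt set \<Rightarrow> pt set"
  where "edge_nodes P e = nodes P \<inter> e"

definition oversampling_domains :: "dd_setting \<Rightarrow> bool"
  where "oversampling_domains P \<longleftrightarrow>
    (\<forall>e\<in>edges P. elem_union P (esub P e) \<and> esub P e \<noteq> {} \<and> connected (esub P e) \<and>
       esub P e \<subseteq> Omega P \<and> closure e \<subseteq> closure (esub P e) \<and>
       (\<forall>T\<in>mesh P. T \<inter> edge_nodes P e \<noteq> {} \<longrightarrow> T \<subseteq> closure (esub P e)) \<and>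
       (\<exists>\<upsilon>>0. \<forall>x\<in>frontier (esub P e) - frontier (Omega P). \<forall>y\<in>closure e. \<upsilon> \<le> dist x y))"


section \<open>Extensions and interpolation\<close>

definition ext_edge_interface :: "dd_setting \<Rightarrow> pt set \<Rightarrow> scalar_fun \<Rightarrow> scalar_fun"
  where "ext_edge_interface P e \<eta> = restr (interface P) (interp P (\<lambda>x. if x \<in> edge_nodes P e then \<eta> x else 0))"

definition vertex_fun_interface :: "dd_setting \<Rightarrow> pt \<Rightarrow> scalar_fun"
  where "vertex_fun_interface P p = restr (interface P) (interp P (\<lambda>x. if x = p then 1 else 0))"

definition ext_interface :: "dd_setting \<Rightarrow> scalar_fun \<Rightarrow> scalar_fun"
  where "ext_interface P g = (THE v. v \<in> V0 P \<and> (\<forall>x\<in>interface P. v x = g x) \<and>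
    (\<forall>i\<in>{1..nsub P}. \<forall>w\<in>Vloc0 P (sub P i). energy P (sub P i) v w = 0))"

definition interp_vertices :: "dd_setting \<Rightarrow> scalar_fun \<Rightarrow> scalar_fun"
  where "interp_vertices P v = (\<Sum>p\<in>vertices P. v p *\<^sub>R ext_interface P (vertex_fun_interface P p))"

definition interp_endpoints :: "dd_setting \<Rightarrow> pt set \<Rightarrow> scalar_fun \<Rightarrow> scalar_fun"
  where "interp_endpoints P e v = restr (closure e) (interp P (\<lambda>x. if x \<in> closure e - e then v x else 0))"


section \<open>Spaces and forms on an edge\<close>

definition Vedge0 :: "dd_setting \<Rightarrow> pt set \<Rightarrow> scalar_fun set"
  where "Vedge0 P e = {restr (closure e) v |v. v \<in> fe_space P \<and> (\<forall>x\<in>closure e - e. v x = 0)}"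

definition ext_edge_esub :: "dd_setting \<Rightarrow> pt set \<Rightarrow> scalar_fun \<Rightarrow> scalar_fun"
  where "ext_edge_esub P e \<eta> =
    restr (closure (esub P e)) (interp P (\<lambda>x. if x \<in> closure e then \<eta> x else 0))"

definition bform :: "dd_setting \<Rightarrow> pt set \<Rightarrow> scalar_fun \<Rightarrow> scalar_fun \<Rightarrow> real"
  where "bform P e \<eta> \<zeta> = energy P (esub P e) (ext_edge_esub P e \<eta>) (ext_edge_esub P e \<zeta>)"

text \<open>The condition on the boundary of \<open>Omega\<close> is void if the boundaries of \<open>esub P e\<close> and \<open>Omega P\<close>
  do not meet.\<close>

definition Vesub :: "dd_setting \<Rightarrow> pt set \<Rightarrow> scalar_fun set"
  where "Vesub P e = {v \<in> Vloc P (esub P e). \<forall>x\<in>frontier (esub P e) \<inter> frontier (Omega P). v x = 0}"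

definition Vbd :: "dd_setting \<Rightarrow> pt set \<Rightarrow> scalar_fun set"
  where "Vbd P e = restr (frontier (esub P e)) ` Vesub P e"

definition Vha :: "dd_setting \<Rightarrow> pt set \<Rightarrow> scalar_fun set"
  where "Vha P e = {w \<in> Vesub P e. \<forall>v\<in>Vloc0 P (esub P e). energy P (esub P e) w v = 0}"

definition ext_ha :: "dd_setting \<Rightarrow> pt set \<Rightarrow> scalar_fun \<Rightarrow> scalar_fun"
  where "ext_ha P e \<zeta> = (THE w. w \<in> Vha P e \<and> (\<forall>x\<in>frontier (esub P e). w x = \<zeta> x))"

text \<open>The boundary of a union of elements consists of sides of elements. Each side is counted twice,
  as \<open>(p, q)\<close> and as \<open>(q, p)\<close>, which explains the factor 1/2.\<close>

definition bd_L2_norm :: "dd_setting \<Rightarrow> pt set \<Rightarrow> scalar_fun \<Rightarrow> real"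
  where "bd_L2_norm P \<omega> v = sqrt (1 / 2 *
    (\<Sum>(p, q)\<in>{(p, q). (\<exists>T\<in>mesh P. closed_segment p q edge_of T) \<and> closed_segment p q \<subseteq> frontier \<omega>}.
       dist p q * integral {0..1} (\<lambda>s. (v (linepath p q s))\<^sup>2)))"


section \<open>Eigenproblems\<close>

definition dir_ext :: "dd_setting \<Rightarrow> pt set \<Rightarrow> scalar_fun \<Rightarrow> scalar_fun"
  where "dir_ext P e \<eta> = (THE w. w \<in> Vloc0 P (esub P e) \<and> (\<forall>x\<in>edge_nodes P e. w x = \<eta> x) \<and>
    (\<forall>v\<in>Vloc0 P (esub P e). (\<forall>x\<in>edge_nodes P e. v x = 0) \<longrightarrow> energy P (esub P e) w v = 0))"

definition dform :: "dd_setting \<Rightarrow> pt set \<Rightarrow> scalar_fun \<Rightarrow> scalar_fun \<Rightarrow> real"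
  where "dform P e \<eta> \<zeta> = energy P (esub P e) (dir_ext P e \<eta>) (dir_ext P e \<zeta>)"

definition dirichlet_eigenpairs :: "dd_setting \<Rightarrow> pt set \<Rightarrow> bool"
  where "dirichlet_eigenpairs P e \<longleftrightarrow> (let I = {1..dim (Vedge0 P e)} in
    psi P e ` I \<subseteq> Vedge0 P e \<and> span (psi P e ` I) = Vedge0 P e \<and>
    (\<forall>i\<in>I. \<forall>j\<in>I. bform P e (psi P e i) (psi P e j) = (if i = j then 1 else 0)) \<and>
    (\<forall>i\<in>I. \<forall>\<eta>\<in>Vedge0 P e. dform P e (psi P e i) \<eta> = mu P e i * bform P e (psi P e i) \<eta>) \<and>
    (\<forall>i\<in>I. \<forall>j\<in>I. i \<le> j \<longrightarrow> mu P e i \<le> mu P e j))"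

definition n_dir :: "dd_setting \<Rightarrow> pt set \<Rightarrow> nat"
  where "n_dir P e = card {i \<in> {1..dim (Vedge0 P e)}. mu P e i \<le> tol_dir P}"

definition proj_dir :: "dd_setting \<Rightarrow> pt set \<Rightarrow> scalar_fun \<Rightarrow> scalar_fun"
  where "proj_dir P e v = (\<Sum>i=1..n_dir P e. bform P e v (psi P e i) *\<^sub>R psi P e i)"

definition transfer :: "dd_setting \<Rightarrow> pt set \<Rightarrow> scalar_fun \<Rightarrow> scalar_fun"
  where "transfer P e \<zeta> = restr (closure e) (ext_ha P e \<zeta>) - interp_endpoints P e (ext_ha P e \<zeta>)"

definition transfer_eigenpairs :: "dd_setting \<Rightarrow> pt set \<Rightarrow> bool"
  where "transfer_eigenpairs P e \<longleftrightarrow>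
    (let I = {1..dim (Vbd P e)}; tr = restr (frontier (esub P e)) in
    phi P e ` I \<subseteq> Vha P e \<and> span ((\<lambda>i. tr (phi P e i)) ` I) = Vbd P e \<and>
    (\<forall>i\<in>I. \<forall>j\<in>I. bip P e (tr (phi P e i)) (tr (phi P e j)) = (if i = j then 1 else 0)) \<and>
    (\<forall>i\<in>I. \<forall>w\<in>Vha P e. bform P e (transfer P e (tr (phi P e i))) (transfer P e (tr w)) =
       lam P e i * bip P e (tr (phi P e i)) (tr w)) \<and>
    (\<forall>i\<in>I. \<forall>j\<in>I. i \<le> j \<longrightarrow> lam P e j \<le> lam P e i))"

definition n_tr :: "dd_setting \<Rightarrow> pt set \<Rightarrow> nat"
  where "n_tr P e = card {i \<in> {1..dim (Vbd P e)}. lam P e i > tol_tr P}"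

definition varphi :: "dd_setting \<Rightarrow> pt set \<Rightarrow> nat \<Rightarrow> scalar_fun"
  where "varphi P e i = transfer P e (restr (frontier (esub P e)) (phi P e i))"

definition proj_tr :: "dd_setting \<Rightarrow> pt set \<Rightarrow> scalar_fun \<Rightarrow> scalar_fun"
  where "proj_tr P e v = (\<Sum>i=1..n_tr P e. (1 / lam P e i * bform P e v (varphi P e i)) *\<^sub>R varphi P e i)"


section \<open>Coarse space\<close>

definition X_vert :: "dd_setting \<Rightarrow> scalar_fun set"
  where "X_vert P = span {ext_interface P (vertex_fun_interface P p) |p. p \<in> vertices P}"

definition X_const :: "dd_setting \<Rightarrow> scalar_fun set"
  where "X_const P = span {ext_interface P (ext_edge_interface P e (\<lambda>x. 1)) |e. e \<in> edges P}"

definition X_dir :: "dd_setting \<Rightarrow> scalar_fun set"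
  where "X_dir P = span {ext_interface P (ext_edge_interface P e (psi P e i)) |e i.
    e \<in> edges P \<and> i \<in> {1..dim (Vedge0 P e)} \<and> mu P e i \<le> tol_dir P}"

definition X_tr :: "dd_setting \<Rightarrow> scalar_fun set"
  where "X_tr P = span {ext_interface P (ext_edge_interface P e (varphi P e i)) |e i.
    e \<in> edges P \<and> i \<in> {1..dim (Vbd P e)} \<and> lam P e i > tol_tr P}"

definition X0 :: "dd_setting \<Rightarrow> scalar_fun set"
  where "X0 P = X_vert P + X_const P + X_dir P + X_tr P"


section \<open>Two-level Schwarz operator\<close>

text \<open>
  Coefficient vectors refer to an enumeration \<open>N\<close> of the nodes in \<open>Omega\<close>, those of the local spaces
  to an enumeration \<open>Ni\<close> of the nodes in an overlapping subdomain; \<open>B\<close> is a list of basis functions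
  of the coarse space.
\<close>

definition hat :: "dd_setting \<Rightarrow> pt \<Rightarrow> scalar_fun"
  where "hat P p = interp P (\<lambda>x. if x = p then 1 else 0)"

definition stiffness :: "dd_setting \<Rightarrow> pt list \<Rightarrow> real mat"
  where "stiffness P N = Matrix.mat (length N) (length N)
    (\<lambda>(k, l). energy P (Omega P) (hat P (N ! l)) (hat P (N ! k)))"

definition E_coarse :: "pt list \<Rightarrow> scalar_fun list \<Rightarrow> real mat"
  where "E_coarse N B = Matrix.mat (length N) (length B) (\<lambda>(k, l). (B ! l) (N ! k))"

definition E_loc :: "pt list \<Rightarrow> pt list \<Rightarrow> real mat"
  where "E_loc N Ni = Matrix.mat (length N) (length Ni) (\<lambda>(k, l). if N ! k = Ni ! l then 1 else 0)"

definition schwarz_term :: "real mat \<Rightarrow> real mat \<Rightarrow> real mat"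
  where "schwarz_term A E =
    E * the (mat_inverse (transpose_mat E * A * E)) * transpose_mat E * A"

definition schwarz_operator ::
    "dd_setting \<Rightarrow> pt list \<Rightarrow> (nat \<Rightarrow> pt list) \<Rightarrow> scalar_fun list \<Rightarrow> real mat"
  where "schwarz_operator P N Ns B = schwarz_term (stiffness P N) (E_coarse N B) +
    Matrix.mat (length N) (length N)
      (\<lambda>kl. \<Sum>i=1..nsub P. schwarz_term (stiffness P N) (E_loc N (Ns i)) $$ kl)"

definition cond_number :: "real mat \<Rightarrow> real"
  where "cond_number K = Max {k. eigenvalue K k} / Min {k. eigenvalue K k}"


section \<open>Decomposition of a finite element function\<close>

definition u_ha :: "dd_setting \<Rightarrow> pt set \<Rightarrow> scalar_fun \<Rightarrow> scalar_fun"
  where "u_ha P e u = ext_ha P e (restr (frontier (esub P e)) u)"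

definition u_perp :: "dd_setting \<Rightarrow> pt set \<Rightarrow> scalar_fun \<Rightarrow> scalar_fun"
  where "u_perp P e u = restr (closure (esub P e)) u - u_ha P e u"

definition c_u :: "dd_setting \<Rightarrow> pt set \<Rightarrow> scalar_fun \<Rightarrow> real"
  where "c_u P e u = (if frontier (esub P e) \<inter> frontier (Omega P) = {}
    then (LINT x:esub P e|lebesgue. u_ha P e u x) / measure lebesgue (esub P e) else 0)"

definition u_hat :: "dd_setting \<Rightarrow> pt set \<Rightarrow> scalar_fun \<Rightarrow> scalar_fun"
  where "u_hat P e u = u_ha P e u - c_u P e u *\<^sub>R indicator (closure (esub P e))"

definition u0_ha :: "dd_setting \<Rightarrow> pt set \<Rightarrow> scalar_fun \<Rightarrow> scalar_fun"
  where "u0_ha P e u = ext_interface P (ext_edge_interface P e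
    (proj_tr P e (restr (closure e) (u_hat P e u) - interp_endpoints P e (u_hat P e u))
     + c_u P e u *\<^sub>R indicator (closure e)
     - interp_endpoints P e (c_u P e u *\<^sub>R indicator (closure e))))"

definition u0_perp :: "dd_setting \<Rightarrow> pt set \<Rightarrow> scalar_fun \<Rightarrow> scalar_fun"
  where "u0_perp P e u = ext_interface P (ext_edge_interface P e
    (proj_dir P e (restr (closure e) (u_perp P e u) - interp_endpoints P e (u_perp P e u))))"

definition u_coarse :: "dd_setting \<Rightarrow> scalar_fun \<Rightarrow> scalar_fun"
  where "u_coarse P u = ext_interface P (restr (interface P) (interp_vertices P u))
    + (\<Sum>e\<in>edges P. u0_ha P e u + u0_perp P e u)"

definition theta :: "dd_setting \<Rightarrow> nat \<Rightarrow> scalar_fun"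
  where "theta P i x = (if x \<in> sub P i then 1
    else if x \<in> interface P \<inter> closure (sub P i) then 1 / real (card (subs_at P x)) else 0)"

definition ext_osub :: "dd_setting \<Rightarrow> nat \<Rightarrow> scalar_fun \<Rightarrow> scalar_fun"
  where "ext_osub P i v = restr (closure (osub P i)) v"

text \<open>Unlike \<open>restr\<close>, this drops the degrees of freedom outside the open set \<open>osub P i\<close>.\<close>

definition nodal_restr_osub :: "dd_setting \<Rightarrow> nat \<Rightarrow> scalar_fun \<Rightarrow> scalar_fun"
  where "nodal_restr_osub P i v =
    restr (closure (osub P i)) (interp P (\<lambda>x. if x \<in> osub P i then v x else 0))"

definition energy_osub :: "dd_setting \<Rightarrow> nat \<Rightarrow> scalar_fun \<Rightarrow> scalar_fun \<Rightarrow> real"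
  where "energy_osub P i v w = energy P (Omega P) (ext_osub P i v) (ext_osub P i w)"

definition u_local :: "dd_setting \<Rightarrow> nat \<Rightarrow> scalar_fun \<Rightarrow> scalar_fun"
  where "u_local P i u = nodal_restr_osub P i (interp P (theta P i * (u - u_coarse P u)))"


section \<open>Constants\<close>

text \<open>The element 0 is inserted so that suprema and maxima over empty sets (no function with nonzero
  denominator, no edge) are 0; all quantities involved are nonnegative.\<close>

definition c_t_edge :: "dd_setting \<Rightarrow> pt set \<Rightarrow> real"
  where "c_t_edge P e = Sup (insert 0
    {bd_L2_norm P (esub P e) v / H1_norm_on (esub P e) v |v. v \<in> Vha P e \<and> H1_norm_on (esub P e) v \<noteq> 0})"

definition c_p_edge :: "dd_setting \<Rightarrow> pt set \<Rightarrow> real"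
  where "c_p_edge P e = (let D = esub P e;
      c = (if frontier D \<inter> frontier (Omega P) = {} then 1 else 0 :: real) in
    Sup (insert 0
      {L2_norm_on D (v - (c / measure lebesgue D * (LINT x:D|lebesgue. v x)) *\<^sub>R indicator (closure D))
         / grad_L2_norm_on D v |v. v \<in> Vha P e \<and> grad_L2_norm_on D v \<noteq> 0}))"

definition c_t :: "dd_setting \<Rightarrow> real"
  where "c_t P = Max (insert 0 (c_t_edge P ` edges P))"

definition c_p :: "dd_setting \<Rightarrow> real"
  where "c_p P = Max (insert 0 (c_p_edge P ` edges P))"

definition max_edges :: "dd_setting \<Rightarrow> nat"
  where "max_edges P = Max ((\<lambda>i. card {e \<in> edges P. closure e \<subseteq> frontier (sub P i)}) ` {1..nsub P})"

definition max_subs_at_edge :: "dd_setting \<Rightarrow> nat"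
  where "max_subs_at_edge P = Max (insert 0
    ((\<lambda>e. card {i \<in> {1..nsub P}. closure (sub P i) \<inter> edge_nodes P e \<noteq> {}}) ` edges P))"

definition max_esubs :: "dd_setting \<Rightarrow> nat"
  where "max_esubs P = Max ((\<lambda>i. card {e \<in> edges P. esub P e \<inter> sub P i \<noteq> {}}) ` {1..nsub P})"

end

(*
  On an edge e, the error u - u_0 is the sum of the truncation errors of the two spectral projections,
  and its energy b_e is at most 2 K |u|^2 on Omega_e, where K is the maximum in C_0^2; at the vertices
  the error vanishes. Let y_e have these values at the nodes of e and vanish at all other nodes,
  Y = sum_e y_e and z = u - u_0 - Y. Then z vanishes on the interface, so it is orthogonal to the discrete
  harmonic function u_0 on every subdomain and |u_0|^2 + |z|^2 = |u - Y|^2. Moreover u_i is z + Y_i / 2 on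
  Omega_i and Y_i / 2 elsewhere, where Y_i is the sum of y_e over the edges touching Omega_i, and
  |Y|^2 = sum_i |Y_i|^2 restricted to Omega_i. Counting edges and oversampling domains gives
  |u_0|^2 + sum_i |u_i|^2 <= (4 + 9 m_e nu omega K) |u|^2.
  The summands of the Schwarz operator are orthogonal projections in the energy inner product. The stable
  decomposition bounds the eigenvalues from below by 1 / C_0^2; they are at most m + 1 because at most m
  of the local functions are nonzero on an element.
*)
theory Submission
  imports Defs "HOL-Computational_Algebra.Fundamental_Theorem_Algebra"
begin

section \<open>Cauchy-Schwarz, projection and domination without definiteness\<close>

section \<open>Positive semidefinite forms\<close>

text \<open>Extensions and constants of the method are defined by \<open>THE\<close>,
  \<open>Sup\<close>, \<open>Max\<close> and \<open>Min\<close>, so each raises an existence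
  question before it can be estimated. Finite dimension answers them: extensions come from
  orthogonal projections for a semidefinite form (constants may lie in the kernel of an energy,
  hence \<open>psd_form\<close> on an explicit carrier), suprema are finite by
  \<open>psd_form_domination\<close>, and a real eigenvalue of the Schwarz operator comes from the
  fundamental theorem of algebra and self-adjointness. The geometric obstacle is the weight 1/2 of
  the partition of unity: exactly two subdomains meet along an edge, which rests on the fact that at
  most two elements share a side. The constants: the 2 in 2 K is Young's factor for the two
  truncation errors, which belong to energy-orthogonal parts of u on Omega_e; the 4 is |u_0|^2 + 2
  |z|^2 <= 2 (|u_0|^2 + |z|^2) <= 4 |u|^2 + 4 |Y|^2; and 9 = 2 (4 + 1/2), where 1/2 is the share of
  Y_i / 2 in the energy of u_i. Both 4 and 9 stay below the 20 and 34 claimed.\<close>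

locale psd_form =
  fixes V :: "'a::real_vector set" and a :: "'a \<Rightarrow> 'a \<Rightarrow> real"
  assumes subspace_V: "subspace V"
    and sym: "u \<in> V \<Longrightarrow> v \<in> V \<Longrightarrow> a u v = a v u"
    and lin: "u \<in> V \<Longrightarrow> v \<in> V \<Longrightarrow> w \<in> V \<Longrightarrow> a (c *\<^sub>R u + v) w = c * a u w + a v w"
    and nonneg: "u \<in> V \<Longrightarrow> 0 \<le> a u u"
begin

lemma mem_zero [simp]: "0 \<in> V"
  by (simp add: subspace_V subspace_0)

lemma mem_add: "u \<in> V \<Longrightarrow> v \<in> V \<Longrightarrow> u + v \<in> V"
  by (simp add: subspace_V subspace_add)

lemma mem_diff: "u \<in> V \<Longrightarrow> v \<in> V \<Longrightarrow> u - v \<in> V"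
  by (simp add: subspace_V subspace_diff)

lemma mem_scale: "u \<in> V \<Longrightarrow> c *\<^sub>R u \<in> V"
  by (simp add: subspace_V subspace_scale)

lemma mem_sum: "(\<And>i. i \<in> I \<Longrightarrow> f i \<in> V) \<Longrightarrow> sum f I \<in> V"
  by (simp add: subspace_V subspace_sum)

lemmas mem = mem_add mem_diff mem_scale mem_sum

lemma add_left: "u \<in> V \<Longrightarrow> v \<in> V \<Longrightarrow> w \<in> V \<Longrightarrow> a (u + v) w = a u w + a v w"
  using lin[of u v w 1] by simp

lemma zero_left: "w \<in> V \<Longrightarrow> a 0 w = 0"
  using add_left[of 0 0 w] by simp

lemma scale_left: "u \<in> V \<Longrightarrow> w \<in> V \<Longrightarrow> a (c *\<^sub>R u) w = c * a u w"
  using lin[of u 0 w c] zero_left by simp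

lemma diff_left: "u \<in> V \<Longrightarrow> v \<in> V \<Longrightarrow> w \<in> V \<Longrightarrow> a (u - v) w = a u w - a v w"
  using lin[of v u w "-1"] by simp

lemma add_right: "u \<in> V \<Longrightarrow> v \<in> V \<Longrightarrow> w \<in> V \<Longrightarrow> a w (u + v) = a w u + a w v"
  by (metis add_left sym mem_add)

lemma zero_right: "w \<in> V \<Longrightarrow> a w 0 = 0"
  using sym zero_left mem_zero by metis

lemma scale_right: "u \<in> V \<Longrightarrow> w \<in> V \<Longrightarrow> a w (c *\<^sub>R u) = c * a w u"
  by (metis scale_left sym mem_scale)

lemma diff_right: "u \<in> V \<Longrightarrow> v \<in> V \<Longrightarrow> w \<in> V \<Longrightarrow> a w (u - v) = a w u - a w v"
  by (metis diff_left sym mem_diff)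

lemmas bilin = add_left add_right diff_left diff_right scale_left scale_right zero_left zero_right

lemma sum_left:
  assumes "\<And>i. i \<in> I \<Longrightarrow> f i \<in> V" "w \<in> V"
  shows "a (sum f I) w = (\<Sum>i\<in>I. a (f i) w)"
  using assms
proof (induction I rule: infinite_finite_induct)
  case (insert x F)
  then show ?case by (simp add: add_left mem_sum)
qed (simp_all add: zero_left)

lemma sum_right:
  assumes "\<And>i. i \<in> I \<Longrightarrow> f i \<in> V" "w \<in> V"
  shows "a w (sum f I) = (\<Sum>i\<in>I. a w (f i))"
  using assms
proof (induction I rule: infinite_finite_induct)
  case (insert x F)
  then show ?case by (simp add: add_right mem_sum)
qed (simp_all add: zero_right)

lemma cauchy_schwarz:
  assumes "u \<in> V" "v \<in> V"
  shows "(a u v)\<^sup>2 \<le> a u u * a v v"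
proof -
  have q: "0 \<le> a u u + 2 * t * a u v + t\<^sup>2 * a v v" for t
    using nonneg[of "u + t *\<^sub>R v"] assms sym[of u v]
    by (simp add: bilin mem power2_eq_square algebra_simps)
  show ?thesis
  proof (cases "a v v = 0")
    case True
    have "a u v = 0"
    proof (rule ccontr)
      assume "a u v \<noteq> 0"
      then show False
        \<comment> \<open>With \<open>a v v = 0\<close> the quadratic in \<open>t\<close> is affine,
          and at this \<open>t\<close> its value is -1.\<close>
        using q[of "- (a u u + 1) / (2 * a u v)"] True by (simp add: field_simps)
    qed
    then show ?thesis using True by simp
  next
    case False
    then have pos: "a v v > 0" using nonneg[OF assms(2)] by simp
    have "0 \<le> (a u u + 2 * (- a u v / a v v) * a u v + (- a u v / a v v)\<^sup>2 * a v v) * a v v"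
      using q[of "- a u v / a v v"] pos by simp
    also have "\<dots> = a u u * a v v - (a u v)\<^sup>2"
      using pos by (simp add: field_simps power2_eq_square)
    finally show ?thesis by simp
  qed
qed

text \<open>Takes the place of definiteness: vectors of zero norm drop out of every pairing.\<close>

lemma kernel: "u \<in> V \<Longrightarrow> v \<in> V \<Longrightarrow> a v v = 0 \<Longrightarrow> a u v = 0"
  using cauchy_schwarz[of u v] by simp

lemma add_sq: "u \<in> V \<Longrightarrow> v \<in> V \<Longrightarrow> a (u + v) (u + v) = a u u + 2 * a u v + a v v"
  using sym[of u v] by (simp add: bilin mem)

lemma add_le: 
  assumes "u \<in> V" "v \<in> V"
  shows "a (u + v) (u + v) \<le> 2 * a u u + 2 * a v v"
  using add_sq[OF assms] nonneg[of "u - v"] assms sym[of u v] by (simp add: bilin mem)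

lemma diff_le: 
  assumes "u \<in> V" "v \<in> V"
  shows "a (u - v) (u - v) \<le> 2 * a u u + 2 * a v v"
  using nonneg[of "u + v"] assms sym[of u v] by (simp add: bilin mem)

lemma two_le: "u \<in> V \<Longrightarrow> v \<in> V \<Longrightarrow> 2 * a u v \<le> a u u + a v v"
  using nonneg[of "u - v"] sym[of u v] by (simp add: bilin mem)

text \<open>Young's inequality summed over all pairs of indices. The cardinality later becomes the
  number of edges of a subdomain and the overlap bound \<open>m\<close>.\<close>

lemma sum_le_card:
  assumes "finite I" "\<And>i. i \<in> I \<Longrightarrow> f i \<in> V"
  shows "a (sum f I) (sum f I) \<le> real (card I) * (\<Sum>i\<in>I. a (f i) (f i))"
proof -
  have "a (sum f I) (sum f I) = (\<Sum>i\<in>I. \<Sum>j\<in>I. a (f i) (f j))"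
    using assms by (subst sum_left) (auto simp: mem_sum sum_right)
  then
  have "2 * a (sum f I) (sum f I) = (\<Sum>i\<in>I. \<Sum>j\<in>I. 2 * a (f i) (f j))"
    by (simp add: sum_distrib_left)
  also have "\<dots> \<le> (\<Sum>i\<in>I. \<Sum>j\<in>I. a (f i) (f i) + a (f j) (f j))"
    by (intro sum_mono two_le assms)
  also have "\<dots> = 2 * (real (card I) * (\<Sum>i\<in>I. a (f i) (f i)))"
    by (simp add: sum.distrib sum_distrib_left mult.commute)
  finally show ?thesis by simp
qed

lemma orthogonal_sum:
  assumes "finite I" "\<And>i. i \<in> I \<Longrightarrow> f i \<in> V"
    and orth: "\<And>i j. i \<in> I \<Longrightarrow> j \<in> I \<Longrightarrow> a (f i) (f j) = (if i = j then l i else 0)"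
  shows "a (\<Sum>i\<in>I. x i *\<^sub>R f i) (\<Sum>i\<in>I. x i *\<^sub>R f i) = (\<Sum>i\<in>I. (x i)\<^sup>2 * l i)"
proof -
  have "a (\<Sum>i\<in>I. x i *\<^sub>R f i) (\<Sum>i\<in>I. x i *\<^sub>R f i) = (\<Sum>i\<in>I. \<Sum>j\<in>I. x i * (x j * (if i = j then l i else 0)))"
    using assms(1,2) orth by (subst sum_left) (auto simp: mem sum_right bilin intro!: sum.cong)
  also have "\<dots> = (\<Sum>i\<in>I. (x i)\<^sup>2 * l i)"
  proof (rule sum.cong[OF refl])
    fix i assume "i \<in> I"
    have "(\<Sum>j\<in>I. x i * (x j * (if i = j then l i else 0))) = (\<Sum>j\<in>I. if j = i then x i * x i * l i else 0)"
      by (rule sum.cong) auto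
    then show "(\<Sum>j\<in>I. x i * (x j * (if i = j then l i else 0))) = (x i)\<^sup>2 * l i"
      using \<open>i \<in> I\<close> assms(1) by (simp add: power2_eq_square)
  qed
  finally show ?thesis .
qed

lemma subform: "subspace W \<Longrightarrow> W \<subseteq> V \<Longrightarrow> psd_form W a"
  by unfold_locales (use sym lin nonneg in \<open>auto simp: subset_iff\<close>)

text \<open>Gram-Schmidt by induction over the spanning set: a new direction \<open>b\<close> is
  replaced by its residual \<open>b'\<close>, which is orthogonal to the span reached so far. All
  harmonic extensions below are residuals of such projections.\<close>

lemma projection_exists:
  assumes "finite B" "B \<subseteq> V" "v \<in> V"
  shows "\<exists>w\<in>span B. \<forall>z\<in>span B. a (v - w) z = 0"
  using assms
proof (induction B arbitrary: v rule: finite_induct)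
  case empty
  then show ?case by (auto simp: zero_right)
next
  case (insert b B)
  have sB: "span B \<subseteq> V" using insert.prems by (simp add: span_minimal subspace_V)
  obtain p where p: "p \<in> span B" "\<forall>z\<in>span B. a (v - p) z = 0"
    using insert by (meson insert_subset)
  obtain q where q: "q \<in> span B" "\<forall>z\<in>span B. a (b - q) z = 0"
    using insert by (meson insert_subset)
  define b' where "b' = b - q"
  have mem': "p \<in> V" "q \<in> V" "b \<in> V" "v \<in> V" "b' \<in> V"
    using p q sB insert.prems by (auto simp: b'_def mem)
  \<comment> \<open>If \<open>b'\<close> has norm 0, the quotient is 0 and the identity for
    \<open>t\<close> still holds, since by \<open>kernel\<close> its left side vanishes.\<close>
  define t where "t = a (v - p) b' / a b' b'"
  have t: "a (v - p) b' = t * a b' b'"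
    using kernel[of "v - p" b'] mem' by (cases "a b' b' = 0") (auto simp: t_def mem)
  define w where "w = p + t *\<^sub>R b'"
  have mono: "span B \<subseteq> span (insert b B)" by (rule span_mono) auto
  have "b' \<in> span (insert b B)"
    unfolding b'_def using q mono by (meson insertI1 span_base span_diff subsetD)
  then have "w \<in> span (insert b B)"
    unfolding w_def using p mono by (meson span_add span_scale subsetD)
  moreover have "a (v - w) z = 0" if "z \<in> span (insert b B)" for z
  proof -
    obtain k where k: "z - k *\<^sub>R b \<in> span B" using \<open>z \<in> span (insert b B)\<close> unfolding span_insert by blast
    define y where "y = z - k *\<^sub>R b + k *\<^sub>R q"
    have y: "y \<in> span B" unfolding y_def using k q by (simp add: span_add span_scale)
    have z: "z = y + k *\<^sub>R b'" by (simp add: y_def b'_def algebra_simps)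
    have "y \<in> V" using y sB by auto
    have "a (v - p) y = 0" "a b' y = 0" using p(2) q(2) y by (auto simp: b'_def)
    then have "a (v - p) y = 0" "a b' y = 0" "a (v - p) b' = t * a b' b'" "v - p \<in> V"
      using t mem' by (auto simp: mem)
    moreover have "v - w = (v - p) - t *\<^sub>R b'" by (simp add: w_def)
    moreover have "a (x - t *\<^sub>R b') (y + k *\<^sub>R b') = 0"
      if "a x y = 0" "a b' y = 0" "a x b' = t * a b' b'" "x \<in> V" for x
      using that \<open>b' \<in> V\<close> \<open>y \<in> V\<close>
      by (simp add: add_right scale_right diff_left scale_left mem_diff mem_scale mem_add)
    ultimately show ?thesis unfolding z by metis
  qed
  ultimately show ?case by blast
qed

end

text \<open>In finite dimension inclusion of kernels already gives a bound. The induction follows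
  \<open>projection_exists\<close>: with a \<open>q\<close>-orthogonal residual, \<open>q\<close>
  splits by Pythagoras, while \<open>p\<close> splits up to a factor 2.\<close>

lemma psd_form_domination:
  assumes "finite B" "psd_form (span B) p" "psd_form (span B) q"
    and "\<And>v. v \<in> span B \<Longrightarrow> q v v = 0 \<Longrightarrow> p v v = 0"
  shows "\<exists>C\<ge>0. \<forall>v\<in>span B. p v v \<le> C * q v v"
  using assms
proof (induction B rule: finite_induct)
  case empty
  then show ?case
    using psd_form.zero_left[OF empty(1), of 0] by (auto intro: exI[of _ 0])
next
  case (insert b B)
  let ?V = "span (insert b B)"
  interpret p: psd_form ?V p by fact
  interpret q: psd_form ?V q by fact
  have sub: "span B \<subseteq> ?V" by (rule span_mono) auto
  have ps: "psd_form (span B) p" "psd_form (span B) q"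
    using p.subform q.subform sub by auto
  obtain C where C: "C \<ge> 0" "\<forall>v\<in>span B. p v v \<le> C * q v v"
    using insert.IH[OF ps] insert.prems(3) sub by blast
  have Bsub: "B \<subseteq> ?V" by (auto intro: span_base)
  obtain r where r: "r \<in> span B" "\<forall>z\<in>span B. q (b - r) z = 0"
    using q.projection_exists[OF insert.hyps(1) Bsub] by (meson insertI1 span_base)
  define b' where "b' = b - r"
  have b': "b' \<in> ?V" using r sub by (metis b'_def insertI1 span_base span_diff subsetD)
  \<comment> \<open>If \<open>q\<close> vanishes at \<open>b'\<close>, so does \<open>p\<close> by
    the kernel hypothesis, and the value 0 serves.\<close>
  define D where "D = (if q b' b' = 0 then 0 else p b' b' / q b' b')"
  have pb: "p b' b' = D * q b' b'" using insert.prems(3)[OF b'] by (auto simp: D_def)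
  have D: "D \<ge> 0" using p.nonneg[OF b'] q.nonneg[OF b'] by (auto simp: D_def)
  have "p v v \<le> (2 * C + 2 * D) * q v v" if v: "v \<in> ?V" for v
  proof -
    obtain k where k: "v - k *\<^sub>R b \<in> span B" using v unfolding span_insert by blast
    define y where "y = v - k *\<^sub>R b + k *\<^sub>R r"
    have y: "y \<in> span B" unfolding y_def using k r by (simp add: span_add span_scale)
    then have yV: "y \<in> ?V" using sub by auto
    have veq: "v = y + k *\<^sub>R b'" by (simp add: y_def b'_def algebra_simps)
    have qv: "q v v = q y y + k\<^sup>2 * q b' b'"
      using r(2) y yV b' q.sym[OF b' yV] unfolding veq
      by (simp add: q.bilin q.mem b'_def[symmetric] power2_eq_square)
    have "p v v \<le> 2 * p y y + 2 * (k\<^sup>2 * p b' b')"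
      unfolding veq using p.add_le[OF yV p.mem_scale[OF b', of k]] b'
      by (simp add: p.scale_left p.scale_right p.mem_scale power2_eq_square mult.assoc)
    also have "\<dots> \<le> 2 * (C * q y y) + 2 * (k\<^sup>2 * (D * q b' b'))"
      using C(2) y pb by simp
    also have "\<dots> \<le> (2 * C + 2 * D) * q v v"
      unfolding qv using C(1) D q.nonneg[OF yV] q.nonneg[OF b'] by (simp add: algebra_simps)
    finally show ?thesis .
  qed
  then show ?case using C(1) D by (intro exI[of _ "2 * C + 2 * D"]) auto
qed

section \<open>Signed areas, barycentric coordinates and half discs at a segment\<close>

section \<open>Planar geometry\<close>

text \<open>Twice the signed area of the triangle spanned by the two vectors; its sign tells the two
  sides of a line apart.\<close>

definition cross :: "pt \<Rightarrow> pt \<Rightarrow> real"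
  where "cross a b = fst a * snd b - snd a * fst b"

lemma cross_simps:
  "cross (a + b) c = cross a c + cross b c" "cross c (a + b) = cross c a + cross c b"
  "cross (a - b) c = cross a c - cross b c" "cross c (a - b) = cross c a - cross c b"
  "cross (t *\<^sub>R a) c = t * cross a c" "cross c (t *\<^sub>R a) = t * cross c a"
  "cross a a = 0" "cross 0 a = 0" "cross a 0 = 0"
  by (auto simp: cross_def algebra_simps)

lemma cross_commute: "cross a b = - cross b a"
  by (simp add: cross_def)

lemma continuous_on_cross [continuous_intros]:
  "continuous_on S f \<Longrightarrow> continuous_on S g \<Longrightarrow> continuous_on S (\<lambda>x. cross (f x) (g x))"
  unfolding cross_def by (intro continuous_intros)

lemma cross_inner: "cross a b = (- snd a, fst a) \<bullet> b"
  by (simp add: cross_def inner_prod_def)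

lemma cross_zero_parallel:
  assumes "cross d w = 0" "d \<noteq> 0"
  shows "\<exists>t. w = t *\<^sub>R d"
proof (cases "fst d = 0")
  case True
  then have "snd d \<noteq> 0" using assms(2) by (simp add: prod_eq_iff)
  then show ?thesis using assms(1) True
    by (intro exI[of _ "snd w / snd d"]) (auto simp: cross_def prod_eq_iff)
next
  case False
  then show ?thesis using assms(1)
    by (intro exI[of _ "fst w / fst d"]) (auto simp: cross_def prod_eq_iff field_simps)
qed

text \<open>Cramer's rule: the weights are quotients of signed areas.\<close>

lemma barycentric:
  assumes "cross (q - p) (r - p) \<noteq> 0"
  shows "x = (cross (q - x) (r - x) / cross (q - p) (r - p)) *\<^sub>R p
    + (cross (r - x) (p - x) / cross (q - p) (r - p)) *\<^sub>R q
    + (cross (p - x) (q - x) / cross (q - p) (r - p)) *\<^sub>R r"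
    and "cross (q - x) (r - x) / cross (q - p) (r - p) + cross (r - x) (p - x) / cross (q - p) (r - p)
      + cross (p - x) (q - x) / cross (q - p) (r - p) = 1"
proof -
  let ?D = "cross (q - p) (r - p)"
  have a: "cross (q - x) (r - x) + cross (r - x) (p - x) + cross (p - x) (q - x) = ?D"
    by (simp add: cross_def algebra_simps)
  then show "cross (q - x) (r - x) / ?D + cross (r - x) (p - x) / ?D + cross (p - x) (q - x) / ?D = 1"
    using assms by (metis add_divide_distrib divide_self)
  have "?D *\<^sub>R x = cross (q - x) (r - x) *\<^sub>R p + cross (r - x) (p - x) *\<^sub>R q + cross (p - x) (q - x) *\<^sub>R r"
    by (simp add: cross_def prod_eq_iff algebra_simps)
  then have "(1 / ?D) *\<^sub>R (?D *\<^sub>R x) = (1 / ?D) *\<^sub>R (cross (q - x) (r - x) *\<^sub>R p + cross (r - x) (p - x) *\<^sub>R q + cross (p - x) (q - x) *\<^sub>R r)"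
    by (rule arg_cong)
  then show "x = (cross (q - x) (r - x) / ?D) *\<^sub>R p + (cross (r - x) (p - x) / ?D) *\<^sub>R q + (cross (p - x) (q - x) / ?D) *\<^sub>R r"
    using assms by (simp add: scaleR_add_right)
qed

text \<open>At a point inside the segment the barycentric weights of \<open>p\<close> and
  \<open>q\<close> are positive, hence also nearby; the weight of \<open>z\<close> is nonnegative on
  the side of \<open>z\<close>.\<close>

lemma half_disc:
  assumes y: "y \<in> open_segment p q" and z: "cross (q - p) (z - p) \<noteq> 0"
  shows "\<exists>r>0. \<forall>w\<in>ball y r. cross (q - p) (w - p) * cross (q - p) (z - p) \<ge> 0 \<longrightarrow> w \<in> convex hull {p, q, z}"
proof -
  let ?D = "cross (q - p) (z - p)"
  obtain s where s: "0 < s" "s < 1" "y = (1 - s) *\<^sub>R p + s *\<^sub>R q"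
    using y by (auto simp: in_segment)
  define A where "A w = cross (q - w) (z - w) / ?D" for w
  define B where "B w = cross (z - w) (p - w) / ?D" for w
  have AB: "A y = 1 - s" "B y = s"
    using z unfolding A_def B_def s(3) by (simp_all add: cross_def field_simps)
  have cont: "isCont A y" "isCont B y"
    using z unfolding A_def B_def cross_def by (auto intro!: continuous_intros)
  have "eventually (\<lambda>w. A w > 0 \<and> B w > 0) (nhds y)"
    using cont AB s by (auto simp: isCont_def tendsto_at_iff_tendsto_nhds intro!: eventually_conj order_tendstoD(1))
  then obtain r where r: "r > 0" "\<forall>w\<in>ball y r. A w > 0 \<and> B w > 0"
    unfolding eventually_nhds_metric by (metis mem_ball dist_commute)
  have "w \<in> convex hull {p, q, z}" if w: "w \<in> ball y r" "cross (q - p) (w - p) * ?D \<ge> 0" for w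
  proof -
    have C: "cross (p - w) (q - w) / ?D \<ge> 0"
    proof -
      have "cross (p - w) (q - w) = cross (q - p) (w - p)" by (simp add: cross_def algebra_simps)
      then show ?thesis using w(2) by (simp add: zero_le_divide_iff zero_le_mult_iff)
    qed
    show ?thesis
      unfolding convex_hull_3
      using barycentric[OF z, of w] r w(1) C unfolding A_def B_def
      by (smt (verit, best) mem_Collect_eq)
  qed
  then show ?thesis using r by blast
qed

section \<open>Triangles and convex quadrilaterals as two-dimensional polytopes\<close>

section \<open>Geometry of elements\<close>

definition element :: "pt set \<Rightarrow> bool"
  where "element T \<longleftrightarrow> 2 simplex T \<or> quadrilateral T"

lemma element_polytope: "element T \<Longrightarrow> polytope T" "element T \<Longrightarrow> aff_dim T = 2"
  by (auto simp: element_def quadrilateral_def simplex_imp_polytope dest: aff_dim_simplex)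

lemma element_convex: "element T \<Longrightarrow> convex T"
  and element_compact: "element T \<Longrightarrow> compact T"
  and element_closed: "element T \<Longrightarrow> closed T"
  by (simp_all add: element_polytope polytope_imp_convex polytope_imp_compact polytope_imp_closed)

lemma element_rel_interior: "element T \<Longrightarrow> rel_interior T = interior T"
  using element_polytope(2)[of T] aff_dim_eq_full[of T] by (intro rel_interior_interior) simp

lemma element_interior_nonempty: "element T \<Longrightarrow> interior T \<noteq> {}"
  using element_polytope(2)[of T] rel_interior_eq_empty[of T]
  by (auto simp: element_rel_interior element_convex)

lemma element_closure_interior: "element T \<Longrightarrow> closure (interior T) = T"
  by (metis element_convex element_closed element_interior_nonempty convex_closure_interior closure_closed)

lemma element_hull: "element T \<Longrightarrow> T = convex hull {x. x extreme_point_of T}"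
  by (simp add: Krein_Milman_Minkowski element_compact element_convex)

lemma element_finite_extreme: "element T \<Longrightarrow> finite {x. x extreme_point_of T}"
  by (simp add: element_polytope finite_polyhedron_extreme_points polytope_imp_polyhedron)

lemma edge_endpoints:
  assumes "closed_segment p q edge_of T"
  shows "p extreme_point_of T" "q extreme_point_of T" "p \<noteq> q"
proof -
  have f: "closed_segment p q face_of T" "aff_dim (closed_segment p q) = 1"
    using assms by (auto simp: edge_of_def)
  show "p extreme_point_of T" "q extreme_point_of T"
    using extreme_point_of_face[OF f(1)] by (auto simp: extreme_point_of_segment)
  show "p \<noteq> q" using f(2) by auto
qed

text \<open>A point off the interior lies in a facet, and a facet has dimension 1, so as a compact
  convex collinear set it is a segment. Pointwise arguments on the mesh use this trichotomy.\<close>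

lemma element_cases:
  assumes "element T" "x \<in> T"
  obtains (interior) "x \<in> interior T"
  | (extreme) "x extreme_point_of T"
  | (edge) p q where "closed_segment p q edge_of T" "x \<in> open_segment p q"
proof (cases "x \<in> interior T")
  case False
  then have "x \<in> T - rel_interior T" using assms by (simp add: element_rel_interior)
  then obtain F where F: "F facet_of T" "x \<in> F"
    using rel_boundary_of_polyhedron[of T] assms by (auto simp: element_polytope polytope_imp_polyhedron)
  have F': "F face_of T" "aff_dim F = 1"
    using F(1) element_polytope(2)[OF assms(1)] by (auto simp: facet_of_def)
  have "polytope F" using F'(1) assms face_of_polytope_polytope element_polytope by blast
  moreover have "collinear F" using F' by (simp add: collinear_aff_dim)
  ultimately obtain p q where pq: "F = closed_segment p q"
    using compact_convex_collinear_segment F(2)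
    by (metis empty_iff polytope_imp_compact polytope_imp_convex)
  have e: "closed_segment p q edge_of T" using F' pq by (simp add: edge_of_def)
  show ?thesis
  proof (cases "x = p \<or> x = q")
    case True
    then show ?thesis using edge_endpoints[OF e] extreme by blast
  next
    case False
    then have "x \<in> open_segment p q" using F(2) pq by (simp add: open_segment_def)
    then show ?thesis using e edge by blast
  qed
qed (use interior in blast)

lemma triangle_obtain:
  assumes "2 simplex T"
  obtains p q r where "cross (q - p) (r - p) \<noteq> 0" "T = convex hull {p, q, r}"
    "{x. x extreme_point_of T} = {p, q, r}"
proof -
  obtain C where C: "finite C" "\<not> affine_dependent C" "int (card C) = 2 + 1" "T = convex hull C"
    using assms unfolding Polytope.simplex by auto
  then have "card C = 3" by linarith
  then obtain p q r where pqr: "C = {p, q, r}" "p \<noteq> q" "q \<noteq> r" "p \<noteq> r"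
    by (auto simp: card_3_iff)
  have "cross (q - p) (r - p) \<noteq> 0"
  proof
    assume "cross (q - p) (r - p) = 0"
    then obtain t where "r - p = t *\<^sub>R (q - p)" using cross_zero_parallel pqr by fastforce
    then have "r = t *\<^sub>R q + (1 - t) *\<^sub>R p" by (simp add: algebra_simps)
    then have "collinear {q, r, p}" unfolding collinear_3_expand by blast
    then have "collinear {p, q, r}" by (simp add: insert_commute)
    then show False
      using C(2) pqr by (auto simp: collinear_3_eq_affine_dependent)
  qed
  moreover have "{x. x extreme_point_of T} = {p, q, r}"
    using C pqr by (auto simp: extreme_point_of_convex_hull_affine_independent)
  ultimately show ?thesis using that C pqr by blast
qed

lemma extreme_not_in_hull:
  assumes "convex T" "x extreme_point_of T" "A \<subseteq> T" "x \<notin> A"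
  shows "x \<notin> convex hull A"
proof -
  have "convex (T - {x})" using assms extreme_point_of_stillconvex by blast
  moreover have "A \<subseteq> T - {x}" using assms by auto
  ultimately have "convex hull A \<subseteq> T - {x}" by (simp add: hull_minimal)
  then show ?thesis by blast
qed

text \<open>The four quantities are the values, at the corners of the unit square, of the Jacobian
  determinant of \<open>bilinear_map p q r s\<close>.\<close>

definition convex_quad :: "pt \<Rightarrow> pt \<Rightarrow> pt \<Rightarrow> pt \<Rightarrow> bool"
  where "convex_quad p q r s \<longleftrightarrow> cross (q - p) (s - p) > 0 \<and> cross (q - p) (r - q) > 0 \<and>
    cross (r - s) (s - p) > 0 \<and> cross (r - s) (r - q) > 0"

lemma convex_quad_rotate: "convex_quad p q r s \<Longrightarrow> convex_quad q r s p"
  unfolding convex_quad_def cross_def by (simp add: algebra_simps)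

text \<open>Otherwise division of the dependency by \<open>- \<alpha>\<close> writes
  \<open>a\<close> as a convex combination of the other three points.\<close>

lemma four_points_signs:
  fixes a b c d :: pt
  assumes na: "a \<notin> convex hull {b, c, d}" and w: "\<beta> \<ge> 0" "\<gamma> \<ge> 0" "\<delta> \<ge> 0" "\<alpha> + \<beta> + \<gamma> + \<delta> = 0"
    and e: "\<alpha> *\<^sub>R a + \<beta> *\<^sub>R b + \<gamma> *\<^sub>R c + \<delta> *\<^sub>R d = 0"
  shows "\<alpha> \<ge> 0"
proof (rule ccontr)
  assume "\<not> \<alpha> \<ge> 0"
  then have al: "- \<alpha> > 0" by simp
  have "(- \<alpha>) *\<^sub>R a = \<beta> *\<^sub>R b + \<gamma> *\<^sub>R c + \<delta> *\<^sub>R d"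
  proof -
    have "(- \<alpha>) *\<^sub>R a = (- \<alpha>) *\<^sub>R a + (\<alpha> *\<^sub>R a + \<beta> *\<^sub>R b + \<gamma> *\<^sub>R c + \<delta> *\<^sub>R d)" using e by simp
    also have "\<dots> = \<beta> *\<^sub>R b + \<gamma> *\<^sub>R c + \<delta> *\<^sub>R d" by (simp add: add.assoc)
    finally show ?thesis .
  qed
  then have "(1 / - \<alpha>) *\<^sub>R ((- \<alpha>) *\<^sub>R a) = (1 / - \<alpha>) *\<^sub>R (\<beta> *\<^sub>R b + \<gamma> *\<^sub>R c + \<delta> *\<^sub>R d)"
    by (rule arg_cong)
  then have "a = (\<beta> / - \<alpha>) *\<^sub>R b + (\<gamma> / - \<alpha>) *\<^sub>R c + (\<delta> / - \<alpha>) *\<^sub>R d"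
    using al by (simp add: scaleR_add_right)
  moreover have "\<beta> / - \<alpha> \<ge> 0" "\<gamma> / - \<alpha> \<ge> 0" "\<delta> / - \<alpha> \<ge> 0"
    using w al by (simp_all add: divide_nonneg_neg del: divide_minus_right)
  moreover have "\<beta> / - \<alpha> + \<gamma> / - \<alpha> + \<delta> / - \<alpha> = 1"
  proof -
    have "\<beta> / - \<alpha> + \<gamma> / - \<alpha> + \<delta> / - \<alpha> = (\<beta> + \<gamma> + \<delta>) / - \<alpha>"
      by (simp only: add_divide_distrib)
    also have "\<dots> = 1" using w(4) al by (simp add: field_simps)
    finally show ?thesis .
  qed
  ultimately have "a \<in> convex hull {b, c, d}"
    unfolding convex_hull_3 by blast
  then show False using na by simp
qed

text \<open>Radon's argument: the affine dependency of the four vertices has two positive and two negative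
  coefficients, since otherwise one vertex lies in the hull of the others; points with coefficients of
  the same sign are opposite.\<close>

lemma convex_quad_obtain:
  assumes T: "quadrilateral T"
  obtains p q r s where "convex_quad p q r s" "{x. x extreme_point_of T} = {p, q, r, s}"
proof -
  have el: "element T" using T by (simp add: element_def)
  obtain a b c d where abcd: "{x. x extreme_point_of T} = {a, b, c, d}"
    and ne: "a \<noteq> b" "a \<noteq> c" "a \<noteq> d" "b \<noteq> c" "b \<noteq> d" "c \<noteq> d"
  proof -
    have c4: "card {x. x extreme_point_of T} = 4" using T by (simp add: quadrilateral_def)
    then obtain a B where "{x. x extreme_point_of T} = insert a B" "a \<notin> B" "card B = 3"
      using card_eq_SucD[of "{x. x extreme_point_of T}" 3] by auto
    moreover obtain b c d where "B = {b, c, d}" "b \<noteq> c" "b \<noteq> d" "c \<noteq> d"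
      using \<open>card B = 3\<close> by (auto simp: card_3_iff)
    ultimately show ?thesis using that[of a b c d] by blast
  qed
  have nh: "x \<notin> convex hull A" if "x \<in> {a, b, c, d}" "A \<subseteq> {a, b, c, d}" "x \<notin> A" for x A
    using extreme_not_in_hull[OF element_convex[OF el], of x A] that abcd
    by (metis (no_types, lifting) element_convex[OF el] extreme_point_of_def mem_Collect_eq subset_iff)
  \<comment> \<open>Signed areas of the triangles obtained by omitting one vertex each; with
    alternating signs they are the coefficients of the affine dependency.\<close>
  define o1 where "o1 = cross (c - b) (d - b)"
  define o2 where "o2 = cross (c - a) (d - a)"
  define o3 where "o3 = cross (b - a) (d - a)"
  define o4 where "o4 = cross (b - a) (c - a)"
  have s: "o1 + (- o2) + o3 + (- o4) = 0"
    by (simp add: o1_def o2_def o3_def o4_def cross_def algebra_simps)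
  have e: "o1 *\<^sub>R a + (- o2) *\<^sub>R b + o3 *\<^sub>R c + (- o4) *\<^sub>R d = 0"
    by (simp add: o1_def o2_def o3_def o4_def cross_def prod_eq_iff algebra_simps)
  have A: "- o2 \<ge> 0 \<Longrightarrow> o3 \<ge> 0 \<Longrightarrow> - o4 \<ge> 0 \<Longrightarrow> o1 \<ge> 0"
    "o2 \<ge> 0 \<Longrightarrow> - o3 \<ge> 0 \<Longrightarrow> o4 \<ge> 0 \<Longrightarrow> - o1 \<ge> 0"
    using four_points_signs[OF nh[of a "{b, c, d}"], of "- o2" o3 "- o4" o1]
      four_points_signs[OF nh[of a "{b, c, d}"], of "o2" "- o3" "o4" "- o1"] ne s e
    by (auto simp: algebra_simps)
  have B: "o1 \<ge> 0 \<Longrightarrow> o3 \<ge> 0 \<Longrightarrow> - o4 \<ge> 0 \<Longrightarrow> - o2 \<ge> 0"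
    "- o1 \<ge> 0 \<Longrightarrow> - o3 \<ge> 0 \<Longrightarrow> o4 \<ge> 0 \<Longrightarrow> o2 \<ge> 0"
    using four_points_signs[OF nh[of b "{a, c, d}"], of "o1" o3 "- o4" "- o2"]
      four_points_signs[OF nh[of b "{a, c, d}"], of "- o1" "- o3" "o4" "o2"] ne s e
    by (auto simp: algebra_simps)
  have C: "o1 \<ge> 0 \<Longrightarrow> - o2 \<ge> 0 \<Longrightarrow> - o4 \<ge> 0 \<Longrightarrow> o3 \<ge> 0"
    "- o1 \<ge> 0 \<Longrightarrow> o2 \<ge> 0 \<Longrightarrow> o4 \<ge> 0 \<Longrightarrow> - o3 \<ge> 0"
    using four_points_signs[OF nh[of c "{a, b, d}"], of "o1" "- o2" "- o4" "o3"]
      four_points_signs[OF nh[of c "{a, b, d}"], of "- o1" "o2" "o4" "- o3"] ne s e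
    by (auto simp: algebra_simps)
  have D: "o1 \<ge> 0 \<Longrightarrow> - o2 \<ge> 0 \<Longrightarrow> o3 \<ge> 0 \<Longrightarrow> - o4 \<ge> 0"
    "- o1 \<ge> 0 \<Longrightarrow> o2 \<ge> 0 \<Longrightarrow> - o3 \<ge> 0 \<Longrightarrow> o4 \<ge> 0"
    using four_points_signs[OF nh[of d "{a, b, c}"], of "o1" "- o2" "o3" "- o4"]
      four_points_signs[OF nh[of d "{a, b, c}"], of "- o1" "o2" "- o3" "o4"] ne s e
    by (auto simp: algebra_simps)
  \<comment> \<open>If both areas vanish, \<open>c\<close> and \<open>d\<close> lie on the line
    through \<open>a\<close> and \<open>b\<close>, and \<open>T\<close> is not
    two-dimensional.\<close>
  have nz: "\<not> (o3 = 0 \<and> o4 = 0)"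
  proof
    assume 0: "o3 = 0 \<and> o4 = 0"
    obtain t u where tu: "d - a = t *\<^sub>R (b - a)" "c - a = u *\<^sub>R (b - a)"
      using cross_zero_parallel[of "b - a" "d - a"] cross_zero_parallel[of "b - a" "c - a"] 0 ne
      by (auto simp: o3_def o4_def)
    have "T \<subseteq> affine hull {a, b}"
    proof -
      have "a + v *\<^sub>R (b - a) \<in> affine hull {a, b}" for v :: real
        unfolding affine_hull_2
        by (rule CollectI, rule exI[of _ "1 - v"], rule exI[of _ v]) (simp add: algebra_simps)
      then have "{a, b, c, d} \<subseteq> affine hull {a, b}"
        using tu by (metis (no_types, lifting) add.commute diff_add_cancel empty_subsetI hull_inc insertCI insert_subset)
      then have "convex hull {a, b, c, d} \<subseteq> affine hull {a, b}"
        by (simp add: hull_minimal affine_imp_convex)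
      then show ?thesis using element_hull[OF el] abcd by simp
    qed
    then have "aff_dim T \<le> aff_dim {a, b}" by (metis aff_dim_affine_hull aff_dim_subset)
    then show False using element_polytope(2)[OF el] ne by (simp add: aff_dim_2)
  qed
  have quad: "\<exists>p q r s. convex_quad p q r s \<and> {p, q, r, s} = {a, b, c, d}"
    if "(o1 > 0 \<and> o2 > 0 \<and> o3 > 0 \<and> o4 > 0) \<or> (o1 < 0 \<and> o2 < 0 \<and> o3 < 0 \<and> o4 < 0)
      \<or> (o1 > 0 \<and> o2 < 0 \<and> o3 < 0 \<and> o4 > 0) \<or> (o1 < 0 \<and> o2 > 0 \<and> o3 > 0 \<and> o4 < 0)
      \<or> (o1 > 0 \<and> o2 > 0 \<and> o3 < 0 \<and> o4 < 0) \<or> (o1 < 0 \<and> o2 < 0 \<and> o3 > 0 \<and> o4 > 0)"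
    using that
  proof (elim disjE)
    assume "o1 > 0 \<and> o2 > 0 \<and> o3 > 0 \<and> o4 > 0"
    then have "convex_quad a b c d"
      unfolding convex_quad_def o1_def o2_def o3_def o4_def cross_def by (auto simp: algebra_simps)
    then show ?thesis by blast
  next
    assume "o1 < 0 \<and> o2 < 0 \<and> o3 < 0 \<and> o4 < 0"
    then have "convex_quad a d c b"
      unfolding convex_quad_def o1_def o2_def o3_def o4_def cross_def by (auto simp: algebra_simps)
    then show ?thesis by (metis insert_commute)
  next
    assume "o1 > 0 \<and> o2 < 0 \<and> o3 < 0 \<and> o4 > 0"
    then have "convex_quad a d b c"
      unfolding convex_quad_def o1_def o2_def o3_def o4_def cross_def by (auto simp: algebra_simps)
    then show ?thesis by (metis insert_commute)
  next
    assume "o1 < 0 \<and> o2 > 0 \<and> o3 > 0 \<and> o4 < 0"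
    then have "convex_quad a c b d"
      unfolding convex_quad_def o1_def o2_def o3_def o4_def cross_def by (auto simp: algebra_simps)
    then show ?thesis by (metis insert_commute)
  next
    assume "o1 > 0 \<and> o2 > 0 \<and> o3 < 0 \<and> o4 < 0"
    then have "convex_quad a c d b"
      unfolding convex_quad_def o1_def o2_def o3_def o4_def cross_def by (auto simp: algebra_simps)
    then show ?thesis by (metis insert_commute)
  next
    assume "o1 < 0 \<and> o2 < 0 \<and> o3 > 0 \<and> o4 > 0"
    then have "convex_quad a b d c"
      unfolding convex_quad_def o1_def o2_def o3_def o4_def cross_def by (auto simp: algebra_simps)
    then show ?thesis by (metis insert_commute)
  qed
  have "(o1 > 0 \<and> o2 > 0 \<and> o3 > 0 \<and> o4 > 0) \<or> (o1 < 0 \<and> o2 < 0 \<and> o3 < 0 \<and> o4 < 0)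
      \<or> (o1 > 0 \<and> o2 < 0 \<and> o3 < 0 \<and> o4 > 0) \<or> (o1 < 0 \<and> o2 > 0 \<and> o3 > 0 \<and> o4 < 0)
      \<or> (o1 > 0 \<and> o2 > 0 \<and> o3 < 0 \<and> o4 < 0) \<or> (o1 < 0 \<and> o2 < 0 \<and> o3 > 0 \<and> o4 > 0)"
    using A B C D nz s by argo
  from quad[OF this] show ?thesis using that abcd by auto
qed

locale quad_element =
  fixes T :: "pt set" and p q r s :: pt
  assumes quad: "quadrilateral T" and cq: "convex_quad p q r s"
    and ext: "{x. x extreme_point_of T} = {p, q, r, s}"
begin

lemma elem: "element T" using quad by (simp add: element_def)

text \<open>Cyclic symmetry: what is proved for the side from \<open>p\<close> to \<open>q\<close>
  holds for the other three sides by interpretation.\<close>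

lemma rotate: "quad_element T q r s p"
  by unfold_locales (use quad cq ext convex_quad_rotate in auto)

lemma hull: "T = convex hull {p, q, r, s}" using element_hull[OF elem] ext by simp

lemma distinct: "p \<noteq> q" "p \<noteq> r" "p \<noteq> s" "q \<noteq> r" "q \<noteq> s" "r \<noteq> s"
  using cq by (auto simp: convex_quad_def cross_def algebra_simps)

lemma cross_pos: "cross (q - p) (s - p) > 0" "cross (q - p) (r - q) > 0"
    "cross (r - s) (s - p) > 0" "cross (r - s) (r - q) > 0" 
  using cq by (auto simp: convex_quad_def)

lemma side_nonneg: "x \<in> T \<Longrightarrow> cross (q - p) (x - p) \<ge> 0"
proof -
  have "{p, q, r, s} \<subseteq> {x. cross (q - p) (x - p) \<ge> 0}"
    using cross_pos(1,2)
    by (auto simp: cross_simps(9) cross_def algebra_simps)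
  moreover have "{x. cross (q - p) (x - p) \<ge> 0} = {x. (- snd (q - p), fst (q - p)) \<bullet> x \<ge> (- snd (q - p), fst (q - p)) \<bullet> p}"
    by (simp add: cross_inner inner_diff_right)
  then have "convex {x. cross (q - p) (x - p) \<ge> 0}" by (simp only: convex_halfspace_ge)
  ultimately show "x \<in> T \<Longrightarrow> cross (q - p) (x - p) \<ge> 0"
    using hull hull_minimal by blast
qed

text \<open>The line through \<open>p\<close> and \<open>q\<close> supports \<open>T\<close>, and
  \<open>r\<close> and \<open>s\<close> lie strictly off it; so by Krein-Milman the face cut out by
  this line is spanned by \<open>p\<close> and \<open>q\<close>.\<close>

lemma side_edge: "closed_segment p q edge_of T"
proof -
  let ?n = "(- snd (q - p), fst (q - p))"
  let ?F = "T \<inter> {x. ?n \<bullet> x = ?n \<bullet> p}"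
  have "?F face_of T"
    by (rule face_of_Int_supporting_hyperplane_ge)
      (use side_nonneg in \<open>auto simp: element_convex[OF elem] cross_inner inner_diff_right simp del: inner_Pair\<close>)
  moreover have "?F = closed_segment p q"
  proof -
    have "compact ?F" "convex ?F"
      using face_of_imp_compact[OF _ _ \<open>?F face_of T\<close>] face_of_imp_convex[OF \<open>?F face_of T\<close>]
        element_convex[OF elem] element_compact[OF elem] by auto
    then have "?F = convex hull {x. x extreme_point_of ?F}" by (rule Krein_Milman_Minkowski)
    also have "{x. x extreme_point_of ?F} = {x. x extreme_point_of T} \<inter> ?F"
      using extreme_point_of_face[OF \<open>?F face_of T\<close>] by blast
    also have "\<dots> = {x. x extreme_point_of T} \<inter> {x. ?n \<bullet> x = ?n \<bullet> p}"
      unfolding extreme_point_of_def by blast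
    also have "\<dots> = {x \<in> {p, q, r, s}. ?n \<bullet> x = ?n \<bullet> p}"
      using ext by blast
    also have "\<dots> = {p, q}"
    proof -
      have "(?n \<bullet> x = ?n \<bullet> p) = (cross (q - p) (x - p) = 0)" for x
        by (simp add: cross_inner inner_diff_right)
      moreover have "cross (q - p) (r - p) > 0"
        using cross_pos(2) by (simp add: cross_def algebra_simps)
      ultimately show ?thesis using cross_pos(1) cross_commute[of p q]
        by (auto simp: cross_simps simp del: inner_Pair)
    qed
    finally show ?thesis by (simp add: segment_convex_hull)
  qed
  ultimately show ?thesis using distinct(1) by (simp add: edge_of_def segment_convex_hull aff_dim_convex_hull aff_dim_2)
qed

text \<open>The diagonals cross. A face that contains the crossing point contains the endpoints of
  the other diagonal, so \<open>q\<close> would lie between \<open>p\<close> and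
  \<open>r\<close>.\<close>

lemma diagonal_not_edge: "\<not> closed_segment p r edge_of T"
proof
  assume "closed_segment p r edge_of T"
  then have F: "closed_segment p r face_of T" by (simp add: edge_of_def)
  \<comment> \<open>The Jacobian at the corner opposite to each vertex serves as its weight; with
    these weights both diagonals have the same centroid.\<close>
  define \<alpha> where "\<alpha> = cross (r - s) (r - q)"
  define \<beta> where "\<beta> = cross (r - s) (s - p)"
  define \<gamma> where "\<gamma> = cross (q - p) (s - p)"
  define \<delta> where "\<delta> = cross (q - p) (r - q)"
  have pos: "\<alpha> > 0" "\<beta> > 0" "\<gamma> > 0" "\<delta> > 0" using cross_pos by (auto simp: \<alpha>_def \<beta>_def \<gamma>_def \<delta>_def)
  have sum: "\<alpha> + \<gamma> = \<beta> + \<delta>" by (simp add: \<alpha>_def \<beta>_def \<gamma>_def \<delta>_def cross_def algebra_simps)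
  have eq: "\<alpha> *\<^sub>R p + \<gamma> *\<^sub>R r = \<beta> *\<^sub>R q + \<delta> *\<^sub>R s"
    by (simp add: \<alpha>_def \<beta>_def \<gamma>_def \<delta>_def cross_def prod_eq_iff algebra_simps)
  define y where "y = (1 / (\<alpha> + \<gamma>)) *\<^sub>R (\<alpha> *\<^sub>R p + \<gamma> *\<^sub>R r)"
  have "y = (1 - \<gamma> / (\<alpha> + \<gamma>)) *\<^sub>R p + (\<gamma> / (\<alpha> + \<gamma>)) *\<^sub>R r"
    using pos by (simp add: y_def scaleR_add_right field_simps)
  then have y1: "y \<in> closed_segment p r" using pos by (auto simp: in_segment intro!: exI[of _ "\<gamma> / (\<alpha> + \<gamma>)"])
  have "y = (1 - \<delta> / (\<alpha> + \<gamma>)) *\<^sub>R q + (\<delta> / (\<alpha> + \<gamma>)) *\<^sub>R s"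
    using pos sum unfolding y_def eq by (simp add: scaleR_add_right field_simps)
  then have y2: "y \<in> open_segment q s"
    using pos sum distinct by (auto simp: in_segment intro!: exI[of _ "\<delta> / (\<alpha> + \<gamma>)"])
  have "q \<in> T" "s \<in> T" using ext by (auto simp: extreme_point_of_def)
  then have "q \<in> closed_segment p r" using face_ofD[OF F y2 _ _ y1] by blast
  then have "q \<in> open_segment p r" using distinct by (auto simp: open_segment_def)
  moreover have "q extreme_point_of T" "p \<in> T" "r \<in> T" using ext by (auto simp: extreme_point_of_def)
  ultimately show False by (auto simp: extreme_point_of_def)
qed

lemma edges: "closed_segment p q edge_of T" "closed_segment q r edge_of T"
    "closed_segment r s edge_of T" "closed_segment s p edge_of T"
  and not_edges: "\<not> closed_segment p r edge_of T" "\<not> closed_segment q s edge_of T"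
proof -
  interpret a: quad_element T q r s p by (rule rotate)
  interpret b: quad_element T r s p q by (rule a.rotate)
  interpret c: quad_element T s p q r by (rule b.rotate)
  show "closed_segment p q edge_of T" "closed_segment q r edge_of T"
    "closed_segment r s edge_of T" "closed_segment s p edge_of T"
    "\<not> closed_segment p r edge_of T" "\<not> closed_segment q s edge_of T"
    using side_edge a.side_edge b.side_edge c.side_edge diagonal_not_edge a.diagonal_not_edge by auto
qed

lemma side_nonneg4: "x \<in> T \<Longrightarrow> cross (q - p) (x - p) \<ge> 0" "x \<in> T \<Longrightarrow> cross (r - q) (x - q) \<ge> 0"
    "x \<in> T \<Longrightarrow> cross (s - r) (x - r) \<ge> 0" "x \<in> T \<Longrightarrow> cross (p - s) (x - s) \<ge> 0"
proof -
  interpret a: quad_element T q r s p by (rule rotate)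
  interpret b: quad_element T r s p q by (rule a.rotate)
  interpret c: quad_element T s p q r by (rule b.rotate)
  show "x \<in> T \<Longrightarrow> cross (q - p) (x - p) \<ge> 0" "x \<in> T \<Longrightarrow> cross (r - q) (x - q) \<ge> 0"
    "x \<in> T \<Longrightarrow> cross (s - r) (x - r) \<ge> 0" "x \<in> T \<Longrightarrow> cross (p - s) (x - s) \<ge> 0"
    using side_nonneg a.side_nonneg b.side_nonneg c.side_nonneg by auto
qed

end

section \<open>The chart of a quadrilateral: independence of the corner order, bijectivity,
  derivative of the inverse\<close>

section \<open>Bilinear maps onto quadrilaterals\<close>

text \<open>\<open>Q1_on\<close> leaves the enumeration of the corners open; this is its condition
  for a fixed one. Rotation and reflection of the square relate the admissible enumerations.\<close>

definition Q1_rep :: "pt \<Rightarrow> pt \<Rightarrow> pt \<Rightarrow> pt \<Rightarrow> scalar_fun \<Rightarrow> bool"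
  where "Q1_rep p q r s v \<longleftrightarrow> (\<exists>a b c d. \<forall>\<xi>\<in>{0..1}. \<forall>\<eta>\<in>{0..1}.
    v (bilinear_map p q r s \<xi> \<eta>) = a + b * \<xi> + c * \<eta> + d * \<xi> * \<eta>)"

lemma bilinear_map_rotate: "bilinear_map q r s p \<xi> \<eta> = bilinear_map p q r s (1 - \<eta>) \<xi>"
  by (simp add: bilinear_map_def algebra_simps)

lemma bilinear_map_flip: "bilinear_map p s r q \<xi> \<eta> = bilinear_map p q r s \<eta> \<xi>"
  by (simp add: bilinear_map_def algebra_simps)

lemma Q1_rep_rotate:
  assumes "Q1_rep q r s p v"
  shows "Q1_rep p q r s v"
proof -
  obtain a b c d where v: "\<And>\<xi> \<eta>. \<xi> \<in> {0..1} \<Longrightarrow> \<eta> \<in> {0..1} \<Longrightarrow>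
      v (bilinear_map q r s p \<xi> \<eta>) = a + b * \<xi> + c * \<eta> + d * \<xi> * \<eta>"
    using assms unfolding Q1_rep_def by blast
  have "v (bilinear_map p q r s \<xi> \<eta>) = (a + c) + (- c) * \<xi> + (b + d) * \<eta> + (- d) * \<xi> * \<eta>"
    if "\<xi> \<in> {0..1}" "\<eta> \<in> {0..1}" for \<xi> \<eta>
    using v[of \<eta> "1 - \<xi>"] that bilinear_map_rotate[of q r s p \<eta> "1 - \<xi>"] by (simp add: algebra_simps)
  then show ?thesis unfolding Q1_rep_def by blast
qed

lemma Q1_rep_flip:
  assumes "Q1_rep p s r q v"
  shows "Q1_rep p q r s v"
proof -
  obtain a b c d where v: "\<And>\<xi> \<eta>. \<xi> \<in> {0..1} \<Longrightarrow> \<eta> \<in> {0..1} \<Longrightarrow>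
      v (bilinear_map p s r q \<xi> \<eta>) = a + b * \<xi> + c * \<eta> + d * \<xi> * \<eta>"
    using assms unfolding Q1_rep_def by blast
  have "v (bilinear_map p q r s \<xi> \<eta>) = a + c * \<xi> + b * \<eta> + d * \<xi> * \<eta>"
    if "\<xi> \<in> {0..1}" "\<eta> \<in> {0..1}" for \<xi> \<eta>
    using v[of \<eta> \<xi>] that by (simp add: bilinear_map_flip[of p q r s] algebra_simps)
  then show ?thesis unfolding Q1_rep_def by blast
qed

lemma bilinear_map_corners:
  "bilinear_map p q r s 0 0 = p" "bilinear_map p q r s 1 0 = q"
  "bilinear_map p q r s 1 1 = r" "bilinear_map p q r s 0 1 = s"
  by (simp_all add: bilinear_map_def)

lemma bilinear_map_eq:
  "bilinear_map p q r s \<xi> \<eta> = (p + \<xi> *\<^sub>R (q - p)) + \<eta> *\<^sub>R ((1 - \<xi>) *\<^sub>R (s - p) + \<xi> *\<^sub>R (r - q))"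
  by (simp add: bilinear_map_def algebra_simps)

context quad_element
begin

text \<open>Consecutive corners must span edges of \<open>T\<close>, which rules out the diagonals.
  The eight enumerations left are generated by \<open>Q1_rep_rotate\<close> and
  \<open>Q1_rep_flip\<close>.\<close>

lemma Q1_on_iff: "Q1_on T v \<longleftrightarrow> Q1_rep p q r s v"
proof
  assume "Q1_rep p q r s v"
  then show "Q1_on T v" unfolding Q1_on_def Q1_rep_def using ext edges by blast
next
  assume "Q1_on T v"
  then have "\<exists>p' q' r' s'. {p, q, r, s} = {p', q', r', s'} \<and>
    closed_segment p' q' edge_of T \<and> closed_segment q' r' edge_of T \<and>
    closed_segment r' s' edge_of T \<and> closed_segment s' p' edge_of T \<and> Q1_rep p' q' r' s' v"
    by (simp only: Q1_on_def Q1_rep_def ext)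
  then obtain p' q' r' s' where *: "{p, q, r, s} = {p', q', r', s'}"
    "closed_segment p' q' edge_of T" "closed_segment q' r' edge_of T"
    "closed_segment r' s' edge_of T" "closed_segment s' p' edge_of T" "Q1_rep p' q' r' s' v"
    by (elim exE conjE)
  have "card {p', q', r', s'} = 4" using distinct by (simp flip: *(1))
  then have d: "p' \<noteq> q'" "p' \<noteq> r'" "p' \<noteq> s'" "q' \<noteq> r'" "q' \<noteq> s'" "r' \<noteq> s'"
    by (auto simp: card_insert_if split: if_splits)
  have opp: "b \<notin> {a, opp a}" if "closed_segment a b edge_of T" "a \<in> {p, q, r, s}"
      "opp = (\<lambda>x. if x = p then r else if x = q then s else if x = r then p else q)" for a b opp
  proof -
    have "b \<noteq> opp a"
    proof
      assume "b = opp a"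
      then have e: "closed_segment a (opp a) edge_of T" using that(1) by simp
      have "(a, opp a) \<in> {(p, r), (q, s), (r, p), (s, q)}"
        unfolding that(3) using that(2) distinct by auto
      then have "closed_segment p r edge_of T \<or> closed_segment q s edge_of T \<or>
          closed_segment r p edge_of T \<or> closed_segment s q edge_of T"
        using e by auto
      then show False using not_edges closed_segment_commute[of r p] closed_segment_commute[of s q] by simp
    qed
    then show ?thesis using edge_endpoints(3)[OF that(1)] by simp
  qed
  define opp where "opp = (\<lambda>x. if x = p then r else if x = q then s else if x = r then p else q)"
  have mem: "p' \<in> {p, q, r, s}" "q' \<in> {p, q, r, s}" "r' \<in> {p, q, r, s}" "s' \<in> {p, q, r, s}"
    using *(1) by auto
  have o: "opp p = r" "opp q = s" "opp r = p" "opp s = q" using distinct by (auto simp: opp_def)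
  have nb: "q' \<noteq> opp p'" "r' \<noteq> opp q'" "s' \<noteq> opp r'"
    using opp[OF *(2) mem(1) opp_def] opp[OF *(3) mem(2) opp_def] opp[OF *(4) mem(3) opp_def] by auto
  have flip: "Q1_rep p s r q v \<Longrightarrow> Q1_rep p q r s v" by (rule Q1_rep_flip)
  have all: "{p, q, r, s} = {p', opp p', q', opp q'}"
    using mem(1,2) d(1) nb(1) o by (elim insertE emptyE) auto
  have "r' = opp p'" using mem(3) d(2,4) nb(2) unfolding all by auto
  moreover have "s' = opp q'" using mem(4) d(3,5,6) calculation unfolding all by auto
  moreover note mem(1,2) d(1) nb(1) o
  ultimately consider "p' = p" "q' = q" "r' = r" "s' = s" | "p' = p" "q' = s" "r' = r" "s' = q"
    | "p' = q" "q' = p" "r' = s" "s' = r" | "p' = q" "q' = r" "r' = s" "s' = p"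
    | "p' = r" "q' = q" "r' = p" "s' = s" | "p' = r" "q' = s" "r' = p" "s' = q"
    | "p' = s" "q' = p" "r' = q" "s' = r" | "p' = s" "q' = r" "r' = q" "s' = p"
    by (elim insertE emptyE) simp_all
  then show "Q1_rep p q r s v"
    using *(6) Q1_rep_rotate Q1_rep_flip by cases metis+
qed

definition square :: "pt set" where "square = {0..1} \<times> {0..1}"

definition chart :: "pt \<Rightarrow> pt" where "chart z = bilinear_map p q r s (fst z) (snd z)"

text \<open>For fixed first coordinate the chart traces a straight ruling segment. By the
  intermediate value theorem the line of some ruling passes through the given point, and the two
  remaining sides place the point between the ends of the segment.\<close>

lemma chart_surj: "chart ` square = T"
proof
  show "chart ` square \<subseteq> T"
  proof
    fix x assume "x \<in> chart ` square"
    then obtain \<xi> \<eta> where h: "\<xi> \<in> {0..1}" "\<eta> \<in> {0..1}" "x = bilinear_map p q r s \<xi> \<eta>"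
      by (auto simp: chart_def square_def)
    have m: "p \<in> T" "q \<in> T" "r \<in> T" "s \<in> T" using ext by (auto simp: extreme_point_of_def)
    have "x = (1 - \<eta>) *\<^sub>R ((1 - \<xi>) *\<^sub>R p + \<xi> *\<^sub>R q) + \<eta> *\<^sub>R ((1 - \<xi>) *\<^sub>R s + \<xi> *\<^sub>R r)"
      by (simp add: h bilinear_map_def algebra_simps)
    then show "x \<in> T" using m h(1,2) element_convex[OF elem] by (simp add: convexD_alt)
  qed
  show "T \<subseteq> chart ` square"
  proof
    fix x assume x: "x \<in> T"
    define A where "A \<xi> = p + \<xi> *\<^sub>R (q - p)" for \<xi>
    define D where "D \<xi> = (1 - \<xi>) *\<^sub>R (s - p) + \<xi> *\<^sub>R (r - q)" for \<xi>
    \<comment> \<open>Vanishes when \<open>x\<close> lies on the line of the ruling with parameter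
      \<open>\<xi>\<close>; the signs at 0 and 1 say that \<open>x\<close> is on the inner side of
      two opposite sides.\<close>
    define f where "f \<xi> = cross (D \<xi>) (x - A \<xi>)" for \<xi>
    have "f 0 \<le> 0" "0 \<le> f 1"
      using side_nonneg4(2,4)[OF x] by (auto simp: f_def A_def D_def cross_def algebra_simps)
    moreover have "continuous_on {0..1} f"
      unfolding f_def A_def D_def by (intro continuous_intros)
    ultimately obtain \<xi> where \<xi>: "0 \<le> \<xi>" "\<xi> \<le> 1" "f \<xi> = 0"
      using IVT'[of f 0 0 1] by auto
    have pos: "cross (q - p) (D \<xi>) > 0"
    proof -
      have "cross (q - p) (D \<xi>) = (1 - \<xi>) * cross (q - p) (s - p) + \<xi> * cross (q - p) (r - q)"
        by (simp add: D_def cross_simps)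
      then show ?thesis using cross_pos(1,2) \<xi> by (cases "\<xi> = 0") (auto intro: add_nonneg_pos)
    qed
    have neg: "cross (s - r) (D \<xi>) < 0"
    proof -
      have "cross (r - s) (D \<xi>) = (1 - \<xi>) * cross (r - s) (s - p) + \<xi> * cross (r - s) (r - q)"
        by (simp add: D_def cross_simps)
      then have "cross (r - s) (D \<xi>) > 0" using cross_pos(3,4) \<xi> by (cases "\<xi> = 0") (auto intro: add_nonneg_pos)
      then show ?thesis by (simp add: cross_def algebra_simps)
    qed
    obtain t where t: "x - A \<xi> = t *\<^sub>R D \<xi>"
      using cross_zero_parallel[of "D \<xi>" "x - A \<xi>"] \<xi>(3) pos cross_simps(9)[of "q - p"]
      unfolding f_def by force
    have "cross (q - p) (x - p) = cross (q - p) (x - A \<xi>)"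
      by (simp add: A_def cross_def algebra_simps)
    also have "\<dots> = t * cross (q - p) (D \<xi>)" unfolding t by (simp add: cross_simps)
    finally have "t \<ge> 0" using side_nonneg4(1)[OF x] pos by (simp add: zero_le_mult_iff)
    have "x - r = (x - A \<xi>) - D \<xi> + (1 - \<xi>) *\<^sub>R (s - r)"
      by (simp add: A_def D_def algebra_simps)
    also have "\<dots> = (t - 1) *\<^sub>R D \<xi> + (1 - \<xi>) *\<^sub>R (s - r)"
      unfolding t by (simp add: algebra_simps)
    finally have "cross (s - r) (x - r) = (t - 1) * cross (s - r) (D \<xi>)"
      by (simp only: cross_simps(2,6,7) mult_zero_right add_0_right)
    then have "t \<le> 1" using side_nonneg4(3)[OF x] neg by (simp add: zero_le_mult_iff)
    have "x = chart (\<xi>, t)"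
      using t unfolding chart_def bilinear_map_eq A_def D_def by (simp add: algebra_simps)
    then show "x \<in> chart ` square" using \<xi> \<open>t \<ge> 0\<close> \<open>t \<le> 1\<close> by (auto simp: square_def)
  qed
qed

text \<open>If the images agreed, a multiple of \<open>D\<close> would equal a positive multiple of
  the other tangent. The cross product of the two directions is the Jacobian at
  \<open>(\<xi>, \<eta>')\<close>, which is positive.\<close>

lemma chart_inj_aux:
  assumes "\<xi> \<in> {0..1}" "\<xi>' \<in> {0..1}" "\<eta> \<in> {0..1}" "\<eta>' \<in> {0..1}" "\<xi> < \<xi>'"
  shows "chart (\<xi>, \<eta>) \<noteq> chart (\<xi>', \<eta>')"
proof
  assume e: "chart (\<xi>, \<eta>) = chart (\<xi>', \<eta>')"
  define D where "D = (1 - \<xi>) *\<^sub>R (s - p) + \<xi> *\<^sub>R (r - q)"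
  have "chart (\<xi>, \<eta>) = (p + \<xi> *\<^sub>R (q - p)) + \<eta> *\<^sub>R D" by (simp add: chart_def bilinear_map_eq D_def)
  moreover have "chart (\<xi>', \<eta>') = (p + \<xi> *\<^sub>R (q - p)) + \<eta>' *\<^sub>R D
     + (\<xi>' - \<xi>) *\<^sub>R ((1 - \<eta>') *\<^sub>R (q - p) + \<eta>' *\<^sub>R (r - s))"
    by (simp add: chart_def bilinear_map_def D_def algebra_simps)
  ultimately have "(\<eta> - \<eta>') *\<^sub>R D = (\<xi>' - \<xi>) *\<^sub>R ((1 - \<eta>') *\<^sub>R (q - p) + \<eta>' *\<^sub>R (r - s))"
    using e by (simp add: algebra_simps)
  then have "cross ((\<xi>' - \<xi>) *\<^sub>R ((1 - \<eta>') *\<^sub>R (q - p) + \<eta>' *\<^sub>R (r - s))) D = cross ((\<eta> - \<eta>') *\<^sub>R D) D"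
    by simp
  then have z: "cross ((1 - \<eta>') *\<^sub>R (q - p) + \<eta>' *\<^sub>R (r - s)) D = 0"
    using assms(5) by (simp only: cross_simps(5) cross_simps(7)) simp
  have "cross ((1 - \<eta>') *\<^sub>R (q - p) + \<eta>' *\<^sub>R (r - s)) D
    = (1 - \<eta>') * ((1 - \<xi>) * cross (q - p) (s - p) + \<xi> * cross (q - p) (r - q))
      + \<eta>' * ((1 - \<xi>) * cross (r - s) (s - p) + \<xi> * cross (r - s) (r - q))"
    by (simp only: D_def cross_simps(1,2,5,6)) (simp add: algebra_simps)
  also have "\<dots> > 0"
  proof -
    have "(1 - \<xi>) * cross (q - p) (s - p) + \<xi> * cross (q - p) (r - q) > 0"
      "(1 - \<xi>) * cross (r - s) (s - p) + \<xi> * cross (r - s) (r - q) > 0"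
      using cross_pos assms(1) by (cases "\<xi> = 0"; auto intro: add_nonneg_pos)+
    then show ?thesis using assms(4) by (cases "\<eta>' = 0") (auto intro: add_nonneg_pos)
  qed
  finally show False using z by simp
qed

lemma chart_inj: "inj_on chart square"
proof (rule inj_onI)
  fix x y assume x: "x \<in> square" and y: "y \<in> square" and e: "chart x = chart y"
  have f: "fst x = fst y"
  proof (rule ccontr)
    assume "fst x \<noteq> fst y"
    then show False
      using chart_inj_aux[of "fst x" "fst y" "snd x" "snd y"]
        chart_inj_aux[of "fst y" "fst x" "snd y" "snd x"] x y e
      by (cases "fst x < fst y") (auto simp: square_def)
  qed
  define D where "D = (1 - fst x) *\<^sub>R (s - p) + fst x *\<^sub>R (r - q)"
  have "snd x *\<^sub>R D = snd y *\<^sub>R D" using e f by (simp add: chart_def bilinear_map_eq D_def)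
  moreover have "cross (q - p) D > 0"
  proof -
    have "cross (q - p) D = (1 - fst x) * cross (q - p) (s - p) + fst x * cross (q - p) (r - q)"
      by (simp add: D_def cross_simps)
    then show ?thesis
      using cross_pos(1,2) x by (cases "fst x = 0") (auto simp: square_def intro: add_nonneg_pos)
  qed
  then have "D \<noteq> 0" by (auto simp: cross_simps)
  ultimately have "snd x = snd y" by (metis scaleR_cancel_right)
  then show "x = y" using f by (simp add: prod_eq_iff)
qed

definition coord :: "pt \<Rightarrow> pt" where "coord = inv_into square chart"

lemma coord_chart: "z \<in> square \<Longrightarrow> coord (chart z) = z"
  by (simp add: coord_def chart_inj)

lemma chart_coord: "x \<in> T \<Longrightarrow> chart (coord x) = x"
  unfolding coord_def by (simp add: chart_surj f_inv_into_f)

lemma coord_square: "x \<in> T \<Longrightarrow> coord x \<in> square"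
  unfolding coord_def by (metis chart_surj inv_into_into)

lemma continuous_coord: "continuous_on T coord"
proof -
  have "continuous_on square chart"
    unfolding chart_def bilinear_map_def by (intro continuous_intros)
  moreover have "compact square" unfolding square_def by (intro compact_Times compact_Icc)
  ultimately show ?thesis
    using continuous_on_inv[of square chart coord] coord_chart chart_surj by auto
qed

definition col1 :: "pt \<Rightarrow> pt" where "col1 z = (1 - snd z) *\<^sub>R (q - p) + snd z *\<^sub>R (r - s)"
definition col2 :: "pt \<Rightarrow> pt" where "col2 z = (1 - fst z) *\<^sub>R (s - p) + fst z *\<^sub>R (r - q)"

text \<open>The Jacobian is the bilinear interpolant of its corner values, which are positive by
  \<open>convex_quad\<close>.\<close>

lemma jacobian_pos: "z \<in> square \<Longrightarrow> cross (col1 z) (col2 z) > 0"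
proof -
  assume z: "z \<in> square"
  let ?a = "(1 - fst z) * cross (q - p) (s - p) + fst z * cross (q - p) (r - q)"
  let ?b = "(1 - fst z) * cross (r - s) (s - p) + fst z * cross (r - s) (r - q)"
  have "cross (col1 z) (col2 z) = (1 - snd z) * ?a + snd z * ?b"
    by (simp only: col1_def col2_def cross_simps(1,2,5,6)) (simp add: algebra_simps)
  moreover have "?a > 0" "?b > 0"
    using cross_pos z by (cases "fst z = 0"; auto simp: square_def intro: add_nonneg_pos)+
  ultimately show ?thesis
    using z by (cases "snd z = 0") (auto simp: square_def intro: add_nonneg_pos)
qed

lemma chart_derivative: "(chart has_derivative (\<lambda>h. fst h *\<^sub>R col1 z + snd h *\<^sub>R col2 z)) (at z)"
proof -
  have c: "chart = (\<lambda>z. (p + fst z *\<^sub>R (q - p)) + snd z *\<^sub>R (s - p) + (fst z * snd z) *\<^sub>R (p - q + r - s))"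
    by (simp add: chart_def bilinear_map_def fun_eq_iff algebra_simps)
  show ?thesis
    unfolding c
    by (rule has_derivative_eq_rhs, (rule derivative_intros)+)
      (auto simp: col1_def col2_def fun_eq_iff algebra_simps prod_eq_iff)
qed

text \<open>Cramer's rule for the matrix with columns \<open>col1 z\<close> and
  \<open>col2 z\<close>, that is, the inverse of the derivative of the chart.\<close>

definition solve :: "pt \<Rightarrow> pt \<Rightarrow> pt"
  where "solve z w = (cross w (col2 z) / cross (col1 z) (col2 z), cross (col1 z) w / cross (col1 z) (col2 z))"

text \<open>Inverse function rule; the continuity of \<open>coord\<close> that it requires comes
  from the compactness of the square.\<close>

lemma coord_derivative:
  assumes x: "x \<in> interior T"
  shows "(coord has_derivative solve (coord x)) (at x)"
proof (rule has_derivative_inverse_basic[where f = chart and T = "interior T"])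
  let ?z = "coord x"
  have xT: "x \<in> T" using x interior_subset by blast
  have J: "cross (col1 ?z) (col2 ?z) \<noteq> 0" using jacobian_pos[OF coord_square[OF xT]] by simp
  show "(chart has_derivative (\<lambda>h. fst h *\<^sub>R col1 ?z + snd h *\<^sub>R col2 ?z)) (at (coord x))"
    by (rule chart_derivative)
  show "bounded_linear (solve ?z)"
    unfolding solve_def cross_def
    by (intro bounded_linear_Pair) (auto intro!: linear_conv_bounded_linear[THEN iffD1] linearI simp: algebra_simps add_divide_distrib diff_divide_distrib)
  show "solve ?z \<circ> (\<lambda>h. fst h *\<^sub>R col1 ?z + snd h *\<^sub>R col2 ?z) = id"
    using J by (simp add: solve_def fun_eq_iff cross_simps)
  show "continuous (at x) coord"
    using continuous_coord x by (metis continuous_on_interior)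
qed (use x chart_coord interior_subset in auto)

text \<open>\<open>fe_on\<close> takes its Q1 branch because the element has four extreme points,
  more than a triangle can have.\<close>

lemma fe_iff: "fe_on T v \<longleftrightarrow> (\<exists>a b c d. \<forall>x\<in>T. v x = a + b * fst (coord x) + c * snd (coord x) + d * (fst (coord x) * snd (coord x)))"
proof -
  have "\<not> 2 simplex T"
  proof
    assume "2 simplex T"
    then obtain p' q' r' where "{x. x extreme_point_of T} = {p', q', r'}" by (rule triangle_obtain)
    moreover have "card {p', q', r'} \<le> 3" by (simp add: card_insert_if)
    moreover have "card {p, q, r, s} = 4" using distinct by simp
    ultimately show False using ext by simp
  qed
  then have "fe_on T v \<longleftrightarrow> Q1_rep p q r s v" by (simp add: fe_on_def Q1_on_iff)
  also have "\<dots> \<longleftrightarrow> (\<exists>a b c d. \<forall>z\<in>square. v (chart z) = a + b * fst z + c * snd z + d * (fst z * snd z))"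
    unfolding Q1_rep_def chart_def square_def by (simp add: mult.assoc)
  also have "\<dots> \<longleftrightarrow> (\<exists>a b c d. \<forall>x\<in>chart ` square. v x = a + b * fst (coord x) + c * snd (coord x) + d * (fst (coord x) * snd (coord x)))"
    by (simp add: coord_chart)
  finally show ?thesis by (simp only: chart_surj)
qed

lemma coord_corners: "coord p = (0, 0)" "coord q = (1, 0)" "coord r = (1, 1)" "coord s = (0, 1)"
  using coord_chart[of "(0, 0)"] coord_chart[of "(1, 0)"] coord_chart[of "(1, 1)"] coord_chart[of "(0, 1)"]
  by (auto simp: square_def chart_def bilinear_map_corners)

lemma fe_affine_side:
  assumes "fe_on T v" "t \<in> {0..1}"
  shows "v (linepath p q t) = (1 - t) * v p + t * v q"
proof -
  obtain a b c d where v: "\<forall>x\<in>T. v x = a + b * fst (coord x) + c * snd (coord x) + d * (fst (coord x) * snd (coord x))"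
    using assms(1) fe_iff by blast
  have "linepath p q t = chart (t, 0)" by (simp add: linepath_def chart_def bilinear_map_def)
  moreover have "(t, 0) \<in> square" using assms(2) by (simp add: square_def)
  ultimately have "coord (linepath p q t) = (t, 0)" "linepath p q t \<in> T"
    using coord_chart chart_surj by auto
  moreover have "p \<in> T" "q \<in> T" using ext by (auto simp: extreme_point_of_def)
  ultimately show ?thesis using v by (simp add: coord_corners algebra_simps)
qed

end

section \<open>Unisolvence, traces on sides and gradients\<close>

section \<open>Finite elements on a single element\<close>

lemma quad_element_obtain:
  assumes "element T" "\<not> 2 simplex T"
  obtains p q r s where "quad_element T p q r s"
proof -
  have "quadrilateral T" using assms by (simp add: element_def)
  then show ?thesis using convex_quad_obtain that by (metis quad_element.intro)
qed

lemma fe_on_cong: "element T \<Longrightarrow> (\<And>x. x \<in> T \<Longrightarrow> u x = v x) \<Longrightarrow> fe_on T u \<longleftrightarrow> fe_on T v"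
proof (cases "2 simplex T")
  case False
  assume "element T" and uv: "\<And>x. x \<in> T \<Longrightarrow> u x = v x"
  then obtain p q r s where "quad_element T p q r s"
    using False \<open>element T\<close> quad_element_obtain by blast
  then interpret quad_element T p q r s .
  show ?thesis unfolding fe_iff using uv by (intro ex_cong1 ball_cong refl) auto
qed (auto simp: fe_on_def P1_on_def)

lemma fe_on_lincomb:
  assumes "element T" "fe_on T u" "fe_on T v"
  shows "fe_on T (c *\<^sub>R u + v)"
proof (cases "2 simplex T")
  case True
  then obtain a b a' b' where uv: "\<And>x. x \<in> T \<Longrightarrow> u x = a \<bullet> x + b" "\<And>x. x \<in> T \<Longrightarrow> v x = a' \<bullet> x + b'"
    using assms by (auto simp: fe_on_def P1_on_def)
  have "(c *\<^sub>R u + v) x = (c *\<^sub>R a + a') \<bullet> x + (c * b + b')" if "x \<in> T" for x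
    using uv[OF that] by (simp add: scaleR_fun_def inner_add_left algebra_simps)
  then have "\<forall>x\<in>T. (c *\<^sub>R u + v) x = (c *\<^sub>R a + a') \<bullet> x + (c * b + b')" by blast
  then show ?thesis using True by (simp only: fe_on_def P1_on_def if_True) blast
next
  case False
  then obtain p q r s where "quad_element T p q r s"
    using assms(1) quad_element_obtain by blast
  then interpret quad_element T p q r s .
  obtain a1 b1 c1 d1 a2 b2 c2 d2 where
    uv: "\<forall>x\<in>T. u x = a1 + b1 * fst (coord x) + c1 * snd (coord x) + d1 * (fst (coord x) * snd (coord x))"
       "\<forall>x\<in>T. v x = a2 + b2 * fst (coord x) + c2 * snd (coord x) + d2 * (fst (coord x) * snd (coord x))"
    using assms(2,3) unfolding fe_iff by blast
  have "\<forall>x\<in>T. (c *\<^sub>R u + v) x = (c * a1 + a2) + (c * b1 + b2) * fst (coord x) + (c * c1 + c2) * snd (coord x)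
      + (c * d1 + d2) * (fst (coord x) * snd (coord x))"
    using uv by (simp add: scaleR_fun_def algebra_simps)
  then show ?thesis unfolding fe_iff by blast
qed

lemma fe_on_const: "element T \<Longrightarrow> fe_on T (\<lambda>x. k)"
proof (cases "2 simplex T")
  case True
  have "\<forall>x\<in>T. k = 0 \<bullet> x + k" by simp
  then have "P1_on T (\<lambda>x. k)" unfolding P1_on_def by blast
  then show ?thesis using True by (simp add: fe_on_def)
next
  case False
  assume "element T"
  then obtain p q r s where "quad_element T p q r s"
    using False \<open>element T\<close> quad_element_obtain by blast
  then interpret quad_element T p q r s .
  have "\<forall>x\<in>T. k = k + 0 * fst (coord x) + 0 * snd (coord x) + 0 * (fst (coord x) * snd (coord x))"
    by simp
  then show ?thesis unfolding fe_iff by blast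
qed

lemma cross_affine: "\<exists>a b. \<forall>x. cross (q - x) (r - x) = a \<bullet> x + (b::real)"
proof -
  have "cross (q - x) (r - x) = (snd q - snd r, fst r - fst q) \<bullet> x + cross q r" for x
    by (cases x) (simp add: cross_def algebra_simps)
  then show ?thesis by blast
qed

text \<open>The witnesses are the combination of barycentric coordinates on a triangle and the
  bilinear interpolant in the chart on a quadrilateral.\<close>

lemma fe_on_exists:
  assumes "element T"
  shows "\<exists>v. fe_on T v \<and> (\<forall>x. x extreme_point_of T \<longrightarrow> v x = f x)"
proof (cases "2 simplex T")
  case True
  then obtain p q r where T: "cross (q - p) (r - p) \<noteq> 0" "{x. x extreme_point_of T} = {p, q, r}"
    using triangle_obtain by metis
  define D where "D = cross (q - p) (r - p)"
  define v where "v x = f p / D * cross (q - x) (r - x) + f q / D * cross (r - x) (p - x) + f r / D * cross (p - x) (q - x)" for x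
  have D: "cross (r - q) (p - q) = D" "cross (p - r) (q - r) = D" "D \<noteq> 0"
    using T by (auto simp: D_def cross_def algebra_simps)
  obtain a1 b1 a2 b2 a3 b3 where ab: "\<And>x. cross (q - x) (r - x) = a1 \<bullet> x + b1"
    "\<And>x. cross (r - x) (p - x) = a2 \<bullet> x + b2" "\<And>x. cross (p - x) (q - x) = a3 \<bullet> x + b3"
    using cross_affine by metis
  have "v x = ((f p / D) *\<^sub>R a1 + (f q / D) *\<^sub>R a2 + (f r / D) *\<^sub>R a3) \<bullet> x
      + (f p / D * b1 + f q / D * b2 + f r / D * b3)" for x
    unfolding v_def ab by (simp add: inner_add_left algebra_simps add_divide_distrib)
  then have "P1_on T v" unfolding P1_on_def by blast
  moreover have "v p = f p" "v q = f q" "v r = f r"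
    using D D_def[symmetric] by (simp_all add: v_def cross_simps(8,9))
  then have "v x = f x" if "x extreme_point_of T" for x
    using that T(2) by auto
  ultimately show ?thesis using True by (auto simp: fe_on_def)
next
  case False
  then obtain p q r s where "quad_element T p q r s"
    using assms(1) quad_element_obtain by blast
  then interpret quad_element T p q r s .
  define v where "v x = f p + (f q - f p) * fst (coord x) + (f s - f p) * snd (coord x)
    + (f p - f q + f r - f s) * (fst (coord x) * snd (coord x))" for x
  have "v x = f x" if "x extreme_point_of T" for x
  proof -
    have "x \<in> {p, q, r, s}" using that ext by blast
    then show ?thesis by (auto simp: v_def coord_corners)
  qed
  moreover have "fe_on T v" unfolding fe_iff v_def by blast
  ultimately show ?thesis by blast
qed

text \<open>Unisolvence: on a triangle the zero set of an affine function is convex, so it contains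
  the hull of the corners; on a quadrilateral the four corner values determine the four
  coefficients.\<close>

lemma fe_on_zero:
  assumes "element T" "fe_on T v" "\<And>x. x extreme_point_of T \<Longrightarrow> v x = 0" "x \<in> T"
  shows "v x = 0"
proof (cases "2 simplex T")
  case True
  then obtain a b where v: "\<forall>x\<in>T. v x = a \<bullet> x + b"
    using assms(2) by (auto simp: fe_on_def P1_on_def)
  have "convex {x. a \<bullet> x = - b}" by (rule convex_hyperplane)
  moreover have "{x. x extreme_point_of T} \<subseteq> {x. a \<bullet> x = - b}"
    using assms(3) v by (force simp: extreme_point_of_def)
  ultimately have "T \<subseteq> {x. a \<bullet> x = - b}"
    using element_hull[OF assms(1)] hull_minimal by blast
  then show ?thesis using v assms(4) by auto
next
  case False
  then obtain p q r s where "quad_element T p q r s"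
    using assms(1) quad_element_obtain by blast
  then interpret quad_element T p q r s .
  obtain a b c d where v: "\<forall>x\<in>T. v x = a + b * fst (coord x) + c * snd (coord x) + d * (fst (coord x) * snd (coord x))"
    using assms(2) unfolding fe_iff by blast
  have "p \<in> T" "q \<in> T" "r \<in> T" "s \<in> T" using ext by (auto simp: extreme_point_of_def)
  moreover have "v p = 0" "v q = 0" "v r = 0" "v s = 0" using assms(3) ext by blast+
  ultimately have "a = 0" "b = 0" "c = 0" "d = 0"
    using v by (auto simp: coord_corners)
  then show ?thesis using v assms(4) by simp
qed

text \<open>The trace on a side depends only on its endpoint values and not on the element, so
  neighbouring elements fit together.\<close>

lemma fe_on_affine_edge:
  assumes "element T" "fe_on T v" "closed_segment a b edge_of T" "t \<in> {0..1}"
  shows "v (linepath a b t) = (1 - t) * v a + t * v b"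
proof (cases "2 simplex T")
  case True
  then obtain g k where v: "\<forall>x\<in>T. v x = g \<bullet> x + k"
    using assms(2) by (auto simp: fe_on_def P1_on_def)
  have sub: "closed_segment a b \<subseteq> T" using assms(3) by (auto simp: edge_of_def dest: face_of_imp_subset)
  moreover have "linepath a b t \<in> closed_segment a b" using assms(4) by (auto simp: linepath_def in_segment)
  ultimately have "a \<in> T" "b \<in> T" "linepath a b t \<in> T" by auto
  then show ?thesis
    using v by (simp add: linepath_def inner_add_right inner_diff_right algebra_simps)
next
  case False
  then obtain p q r s where "quad_element T p q r s"
    using assms(1) quad_element_obtain by blast
  then interpret quad_element T p q r s .
  interpret A: quad_element T q r s p by (rule rotate)
  interpret B: quad_element T r s p q by (rule A.rotate)
  interpret C: quad_element T s p q r by (rule B.rotate)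
  have flip: "v (linepath a b t) = (1 - t) * v a + t * v b"
    if "\<And>t. t \<in> {0..1} \<Longrightarrow> v (linepath b a t) = (1 - t) * v b + t * v a" for a b
    using that[of "1 - t"] assms(4) by (simp add: linepath_def algebra_simps)
  note sides = fe_affine_side[OF assms(2)] A.fe_affine_side[OF assms(2)]
      B.fe_affine_side[OF assms(2)] C.fe_affine_side[OF assms(2)]
  have "a \<in> {p, q, r, s}" "b \<in> {p, q, r, s}" "a \<noteq> b"
    using edge_endpoints[OF assms(3)] ext by auto
  moreover have "(a, b) \<notin> {(p, r), (r, p), (q, s), (s, q)}"
  proof -
    have "\<not> closed_segment r p edge_of T" "\<not> closed_segment s q edge_of T"
      using not_edges by (metis closed_segment_commute)+
    then show ?thesis using assms(3) not_edges by auto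
  qed
  ultimately have "(a, b) \<in> {(p, q), (q, r), (r, s), (s, p), (q, p), (r, q), (s, r), (p, s)}"
    by (elim insertE emptyE) simp_all
  then show ?thesis using sides assms(4) flip[OF sides(1)] flip[OF sides(2)] flip[OF sides(3)] flip[OF sides(4)]
    by (elim insertE emptyE) simp_all
qed

text \<open>On a quadrilateral the chain rule divides by the Jacobian, which is nonzero on the
  closed element. Continuity up to the boundary is what makes the energies integrable.\<close>

lemma fe_on_gradient:
  assumes "element T" "fe_on T v"
  shows "\<exists>G. continuous_on T G \<and> (\<forall>x\<in>interior T. GDERIV v x :> G x)"
proof (cases "2 simplex T")
  case True
  then obtain a b where v: "\<forall>x\<in>T. v x = a \<bullet> x + b"
    using assms(2) by (auto simp: fe_on_def P1_on_def)
  have "GDERIV v x :> a" if "x \<in> interior T" for x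
  proof -
    have "((\<lambda>x. a \<bullet> x + b) has_derivative (\<lambda>h. h \<bullet> a)) (at x)"
      by (rule has_derivative_eq_rhs, (rule derivative_intros)+) (simp add: inner_commute)
    then show ?thesis unfolding gderiv_def
      by (rule has_derivative_transform_within_open[OF _ open_interior that])
        (metis v interior_subset subsetD)
  qed
  then show ?thesis by (intro exI[of _ "\<lambda>x. a"]) auto
next
  case False
  then obtain p q r s where "quad_element T p q r s"
    using assms(1) quad_element_obtain by blast
  then interpret quad_element T p q r s .
  obtain a b c d where v: "\<forall>x\<in>T. v x = a + b * fst (coord x) + c * snd (coord x) + d * (fst (coord x) * snd (coord x))"
    using assms(2) unfolding fe_iff by blast
  define J where "J z = cross (col1 z) (col2 z)" for z
  define G where "G x = (let z = coord x in
    (((b + d * snd z) * snd (col2 z) - (c + d * fst z) * snd (col1 z)) / J z,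
     ((c + d * fst z) * fst (col1 z) - (b + d * snd z) * fst (col2 z)) / J z))" for x
  have J: "J (coord x) \<noteq> 0" if "x \<in> T" for x
    using jacobian_pos[OF coord_square[OF that]] by (simp add: J_def)
  have "continuous_on T G"
    unfolding G_def Let_def
    using J unfolding J_def cross_def col1_def col2_def
    by (intro continuous_intros continuous_coord) auto
  moreover have "GDERIV v x :> G x" if x: "x \<in> interior T" for x
  proof -
    let ?z = "coord x"
    have xT: "x \<in> T" using x interior_subset by blast
    note cd = coord_derivative[OF x]
    have "((\<lambda>x. a + b * fst (coord x) + c * snd (coord x) + d * (fst (coord x) * snd (coord x))) has_derivative
       (\<lambda>h. b * fst (solve ?z h) + c * snd (solve ?z h) + d * (fst ?z * snd (solve ?z h) + fst (solve ?z h) * snd ?z))) (at x)"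
      by (rule has_derivative_eq_rhs, (rule derivative_intros cd has_derivative_fst has_derivative_snd)+) auto
    moreover have "(\<lambda>h. b * fst (solve ?z h) + c * snd (solve ?z h) + d * (fst ?z * snd (solve ?z h) + fst (solve ?z h) * snd ?z))
        = (\<lambda>h. h \<bullet> G x)"
    proof
      fix h
      have "b * fst (solve ?z h) + c * snd (solve ?z h) + d * (fst ?z * snd (solve ?z h) + fst (solve ?z h) * snd ?z)
        = ((b + d * snd ?z) * cross h (col2 ?z) + (c + d * fst ?z) * cross (col1 ?z) h) / J ?z"
        unfolding solve_def fst_conv snd_conv J_def[symmetric]
        by (simp add: algebra_simps add_divide_distrib)
      also have "\<dots> = h \<bullet> G x"
        by (simp add: G_def Let_def inner_prod_def cross_def algebra_simps add_divide_distrib diff_divide_distrib)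
      finally show "b * fst (solve ?z h) + c * snd (solve ?z h) + d * (fst ?z * snd (solve ?z h) + fst (solve ?z h) * snd ?z) = h \<bullet> G x" .
    qed
    ultimately show ?thesis unfolding gderiv_def
      by (metis (no_types, lifting) has_derivative_transform_within_open[OF _ open_interior x] interior_subset subsetD v)
  qed
  ultimately show ?thesis by blast
qed

lemma fe_on_continuous:
  assumes "element T" "fe_on T v"
  shows "continuous_on T v"
proof (cases "2 simplex T")
  case True
  then obtain a b where v: "\<forall>x\<in>T. v x = a \<bullet> x + b"
    using assms(2) by (auto simp: fe_on_def P1_on_def)
  have "continuous_on T (\<lambda>x. a \<bullet> x + b)" by (intro continuous_intros)
  then show ?thesis using v continuous_on_cong by (metis (no_types, lifting))
next
  case False
  then obtain p q r s where "quad_element T p q r s"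
    using assms(1) quad_element_obtain by blast
  then interpret quad_element T p q r s .
  obtain a b c d where v: "\<forall>x\<in>T. v x = a + b * fst (coord x) + c * snd (coord x) + d * (fst (coord x) * snd (coord x))"
    using assms(2) unfolding fe_iff by blast
  have "continuous_on T (\<lambda>x. a + b * fst (coord x) + c * snd (coord x) + d * (fst (coord x) * snd (coord x)))"
    by (intro continuous_intros continuous_coord)
  then show ?thesis using v continuous_on_cong by (metis (no_types, lifting))
qed

lemma grad_eqI: "GDERIV v x :> D \<Longrightarrow> grad v x = D"
  unfolding grad_def gderiv_def
proof (rule the_equality)
  fix D' assume "(v has_derivative (\<lambda>h. h \<bullet> D)) (at x)" "(v has_derivative (\<lambda>h. h \<bullet> D')) (at x)"
  then have "(\<lambda>h. h \<bullet> D) = (\<lambda>h. h \<bullet> D')" by (rule has_derivative_unique)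
  then show "D' = D" by (metis vector_eq_ldot)
qed

lemma fe_on_grad:
  assumes "element T" "fe_on T v"
  obtains G where "continuous_on T G" "\<And>x. x \<in> interior T \<Longrightarrow> GDERIV v x :> G x"
    "\<And>x. x \<in> interior T \<Longrightarrow> grad v x = G x"
  using fe_on_gradient[OF assms] grad_eqI by blast

lemma fe_on_GDERIV:
  assumes "element T" "fe_on T v" "x \<in> interior T"
  shows "GDERIV v x :> grad v x"
  using fe_on_grad[OF assms(1,2)] assms(3) by metis

lemma fe_on_grad_lincomb:
  assumes "element T" "fe_on T u" "fe_on T v" "x \<in> interior T"
  shows "grad (c *\<^sub>R u + v) x = c *\<^sub>R grad u x + grad v x"
proof (rule grad_eqI)
  have "((\<lambda>x. c *\<^sub>R u x + v x) has_derivative (\<lambda>h. c *\<^sub>R (h \<bullet> grad u x) + h \<bullet> grad v x)) (at x)"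
    using fe_on_GDERIV[OF assms(1,2,4)] fe_on_GDERIV[OF assms(1,3,4)]
    unfolding gderiv_def by (intro derivative_intros)
  moreover have "(\<lambda>x. c *\<^sub>R u x + v x) = c *\<^sub>R u + v" by (simp add: fun_eq_iff scaleR_fun_def)
  ultimately show "GDERIV (c *\<^sub>R u + v) x :> c *\<^sub>R grad u x + grad v x"
    unfolding gderiv_def by (simp add: inner_add_right)
qed

lemma fe_on_zero_grad_const:
  assumes "element T" "fe_on T v" "\<And>x. x \<in> interior T \<Longrightarrow> grad v x = 0" "x \<in> T" "y \<in> T"
  shows "v x = v y"
proof -
  have "convex (interior T)" using element_convex[OF assms(1)] by (rule convex_interior)
  moreover have "(v has_derivative (\<lambda>h. 0)) (at x within interior T)" if "x \<in> interior T" for x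
    using fe_on_GDERIV[OF assms(1,2) that] assms(3)[OF that]
    by (simp add: gderiv_def has_derivative_at_withinI)
  ultimately obtain c where c: "\<forall>x\<in>interior T. v x = c"
    using has_derivative_zero_constant[of "interior T" v] by auto
  have "v x = c" if "x \<in> closure (interior T)" for x
  proof (rule continuous_constant_on_closure[OF _ _ that])
    show "continuous_on (closure (interior T)) v"
      using fe_on_continuous[OF assms(1,2)] element_closure_interior[OF assms(1)] by simp
  qed (use c in auto)
  then show ?thesis using assms(4,5) element_closure_interior[OF assms(1)] by simp
qed

lemma grad_cong:
  assumes "open S" "x \<in> S" "\<And>y. y \<in> S \<Longrightarrow> u y = v y"
  shows "grad u x = grad v x"
proof -
  have "(GDERIV u x :> D) = (GDERIV v x :> D)" for D
    unfolding gderiv_def using assms has_derivative_transform_within_open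
    by (metis (no_types, lifting))
  then show ?thesis by (simp add: grad_def)
qed

section \<open>Cells, sides shared by elements, and gluing of local functions\<close>

section \<open>Conforming meshes\<close>

declare split_paired_All [simp del] split_paired_Ex [simp del] split_paired_all [simp del]

definition els :: "dd_setting \<Rightarrow> pt set \<Rightarrow> pt set set"
  where "els P \<omega> = {T \<in> mesh P. interior T \<subseteq> \<omega>}"

text \<open>A cell is the interior of an element, an open side of an element, or a node.\<close>

definition cellular :: "dd_setting \<Rightarrow> pt set \<Rightarrow> bool"
  where "cellular P A \<longleftrightarrow> (\<forall>T\<in>mesh P. interior T \<inter> A \<noteq> {} \<longrightarrow> interior T \<subseteq> A) \<and>
    (\<forall>T\<in>mesh P. \<forall>p q. closed_segment p q edge_of T \<longrightarrow> open_segment p q \<inter> A \<noteq> {} \<longrightarrow> open_segment p q \<subseteq> A)"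

text \<open>The points strictly below the graph form an open set outside the closure, and a small
  step against \<open>n\<close> leads there from any boundary point. Hence the domain has no slits
  and is the interior of the union of its elements.\<close>

lemma lipschitz_domain_regular:
  assumes "lipschitz_domain D"
  shows "interior (closure D) = D"
proof
  have op: "open D" using assms by (simp add: lipschitz_domain_def)
  then show "D \<subseteq> interior (closure D)" by (simp add: interior_maximal closure_subset)
  show "interior (closure D) \<subseteq> D"
  proof
    fix x assume x: "x \<in> interior (closure D)"
    show "x \<in> D"
    proof (rule ccontr)
      assume nx: "x \<notin> D"
      have "x \<in> frontier D"
        using x nx op interior_subset by (auto simp: frontier_def interior_open)
      then obtain U and t n :: pt and g L where U: "open U" "x \<in> U" "norm n = 1" "t \<bullet> n = 0"
        "L-lipschitz_on UNIV (g :: real \<Rightarrow> real)" "D \<inter> U = {y \<in> U. g (y \<bullet> t) < y \<bullet> n}"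
        using assms unfolding lipschitz_domain_def by blast
      have "continuous_on UNIV g" using U(5) by (rule lipschitz_on_continuous_on)
      then have cont: "continuous_on UNIV (\<lambda>y. g (y \<bullet> t))"
        by (rule continuous_on_compose2) (auto intro!: continuous_intros)
      define W where "W = U \<inter> {y. y \<bullet> n < g (y \<bullet> t)}"
      have "open W" unfolding W_def
        by (intro open_Int U(1) open_Collect_less cont continuous_intros)
      have "W \<inter> D = {}"
      proof (rule equals0I)
        fix y assume y: "y \<in> W \<inter> D"
        then have "y \<in> D \<inter> U" by (simp add: W_def)
        then have "g (y \<bullet> t) < y \<bullet> n" unfolding U(6) by simp
        then show False using y by (simp add: W_def)
      qed
      then have "W \<inter> closure D = {}" using \<open>open W\<close> by (metis open_Int_closure_eq_empty)
      have "open (U \<inter> interior (closure D))" using U(1) by auto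
      then obtain e where e: "e > 0" "ball x e \<subseteq> U \<inter> interior (closure D)"
        using U(2) x by (meson IntI openE)
      define y where "y = x - (e / 2) *\<^sub>R n"
      have "y \<in> ball x e" using e(1) U(3) by (simp add: y_def dist_norm)
      then have yy: "y \<in> U" "y \<in> closure D" using e(2) interior_subset by blast+
      have "x \<bullet> n \<le> g (x \<bullet> t)" using nx U(2,6) by force
      moreover have "y \<bullet> n = x \<bullet> n - e / 2"
        using U(3) by (simp add: y_def inner_diff_left dot_square_norm)
      moreover have "y \<bullet> t = x \<bullet> t" using U(4) by (simp add: y_def inner_diff_left inner_diff_right inner_commute)
      ultimately have "y \<in> W" using yy(1) e(1) by (simp add: W_def)
      then show False using yy(2) \<open>W \<inter> closure D = {}\<close> by blast
    qed
  qed
qed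

locale fe_mesh =
  fixes P :: dd_setting and \<alpha>min \<alpha>max :: real
  assumes lipschitz: "lipschitz_domain (Omega P)"
    and conforming: "conforming_mesh (Omega P) (mesh P)"
    and coefficient: "coefficient_ok P \<alpha>min \<alpha>max"
begin

lemma finite_mesh: "finite (mesh P)"
  and mesh_Union: "\<Union>(mesh P) = closure (Omega P)"
  and mesh_element: "T \<in> mesh P \<Longrightarrow> element T"
  and mesh_face: "T \<in> mesh P \<Longrightarrow> T' \<in> mesh P \<Longrightarrow> (T \<inter> T') face_of T"
    "T \<in> mesh P \<Longrightarrow> T' \<in> mesh P \<Longrightarrow> (T \<inter> T') face_of T'"
  using conforming by (auto simp: conforming_mesh_def element_def)

lemma open_Omega: "open (Omega P)" and bounded_Omega: "bounded (Omega P)"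
  and connected_Omega: "connected (Omega P)" and Omega_nonempty: "Omega P \<noteq> {}"
  using lipschitz by (auto simp: lipschitz_domain_def)

lemma Omega_eq: "Omega P = interior (\<Union>(mesh P))"
  using lipschitz_domain_regular[OF lipschitz] mesh_Union by simp

text \<open>The intersection is a face of \<open>T\<close> with a point of the interior, hence all
  of \<open>T\<close>; and a face of \<open>T'\<close> of full dimension is
  \<open>T'\<close>.\<close>

lemma mesh_interior_unique:
  assumes T: "T \<in> mesh P" "T' \<in> mesh P" and x: "x \<in> interior T" "x \<in> T'"
  shows "T = T'"
proof -
  have "x \<in> (T \<inter> T') \<inter> rel_interior T"
    using x interior_subset element_rel_interior[OF mesh_element[OF T(1)]] by auto
  then have "T \<subseteq> T \<inter> T'" using subset_of_face_of[OF mesh_face(1)[OF T], of T] by blast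
  then have f: "T face_of T'" using mesh_face(2)[OF T] by (simp add: Int_absorb2)
  show ?thesis
    using face_of_aff_dim_lt[OF element_convex[OF mesh_element[OF T(2)]] f]
      element_polytope(2)[OF mesh_element[OF T(1)]] element_polytope(2)[OF mesh_element[OF T(2)]] by auto
qed

lemma mesh_extreme:
  assumes T: "T \<in> mesh P" "T' \<in> mesh P" and x: "x extreme_point_of T" "x \<in> T'"
  shows "x extreme_point_of T'"
proof -
  have "x \<in> T" using x(1) by (simp add: extreme_point_of_def)
  then have "x extreme_point_of (T \<inter> T')" using extreme_point_of_face[OF mesh_face(1)[OF T]] x by blast
  then show ?thesis using extreme_point_of_face[OF mesh_face(2)[OF T]] by blast
qed

lemma node_extreme: "x \<in> nodes P \<Longrightarrow> T \<in> mesh P \<Longrightarrow> x \<in> T \<Longrightarrow> x extreme_point_of T"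
  using mesh_extreme unfolding nodes_def by blast

lemma mesh_edge:
  assumes T: "T \<in> mesh P" "T' \<in> mesh P" and e: "closed_segment p q edge_of T"
    and x: "x \<in> open_segment p q" "x \<in> T'"
  shows "closed_segment p q edge_of T'"
proof -
  have f: "closed_segment p q face_of T" using e by (simp add: edge_of_def)
  have sub: "closed_segment p q \<subseteq> T" using f by (rule face_of_imp_subset)
  have "x \<in> rel_interior (closed_segment p q)" using x(1) edge_endpoints(3)[OF e] by (simp add: rel_interior_closed_segment)
  moreover have "x \<in> T" using x(1) sub open_closed_segment by blast
  ultimately have "closed_segment p q \<subseteq> T \<inter> T'"
    using subset_of_face_of[OF mesh_face(1)[OF T] sub] x(2) by blast
  then have "closed_segment p q face_of (T \<inter> T')" using face_of_subset[OF f] by blast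
  then have "closed_segment p q face_of T'" using mesh_face(2)[OF T] face_of_trans by blast
  then show ?thesis using e by (simp add: edge_of_def)
qed

lemma els_subset: "els P \<omega> \<subseteq> mesh P"
  by (auto simp: els_def)

lemma finite_els: "finite (els P \<omega>)"
  using els_subset finite_mesh finite_subset by blast

lemma els_interior_Union:
  assumes "S \<subseteq> mesh P"
  shows "els P (interior (\<Union>S)) = S"
proof
  show "S \<subseteq> els P (interior (\<Union>S))"
    using assms by (auto simp: els_def intro: interior_mono[THEN subsetD, rotated])
  show "els P (interior (\<Union>S)) \<subseteq> S"
  proof
    fix T assume T: "T \<in> els P (interior (\<Union>S))"
    then have Tm: "T \<in> mesh P" by (simp add: els_def)
    obtain x where x: "x \<in> interior T" using element_interior_nonempty[OF mesh_element[OF Tm]] by blast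
    then have "x \<in> \<Union>S" using T x interior_subset unfolding els_def by blast
    then show "T \<in> S" using mesh_interior_unique[OF Tm _ x] assms by blast
  qed
qed

lemma elem_union_eq: "elem_union P \<omega> \<Longrightarrow> \<omega> = interior (\<Union>(els P \<omega>))"
  by (metis elem_union_def els_interior_Union)

lemma elem_union_open: "elem_union P \<omega> \<Longrightarrow> open \<omega>"
  by (metis elem_union_def open_interior)

lemma elem_union_Omega: "elem_union P (Omega P)"
  unfolding elem_union_def using Omega_eq by blast

lemma elem_union_subset: "elem_union P \<omega> \<Longrightarrow> \<omega> \<subseteq> Omega P"
  unfolding elem_union_def Omega_eq by (meson Union_mono interior_mono)

lemma els_Omega: "els P (Omega P) = mesh P"
  using els_interior_Union[of "mesh P"] Omega_eq by simp

text \<open>An element is the closure of its interior, so an open set that meets the element also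
  meets its interior.\<close>

lemma elem_union_meets:
  assumes \<omega>: "elem_union P \<omega>" and T: "T \<in> mesh P" "T \<inter> \<omega> \<noteq> {}"
  shows "T \<in> els P \<omega>"
proof -
  have "closure (interior T) \<inter> \<omega> \<noteq> {}" using T element_closure_interior[OF mesh_element[OF T(1)]] by simp
  then have "interior T \<inter> \<omega> \<noteq> {}"
    using open_Int_closure_eq_empty[OF elem_union_open[OF \<omega>]] by (metis Int_commute)
  then obtain x where x: "x \<in> interior T" "x \<in> \<omega>" by blast
  then have "x \<in> \<Union>(els P \<omega>)" using elem_union_eq[OF \<omega>] interior_subset by blast
  then show ?thesis using mesh_interior_unique[OF T(1) _ x(1)] els_subset by blast
qed

lemma els_closure: "T \<in> els P \<omega> \<Longrightarrow> T \<subseteq> closure \<omega>"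
  by (metis (no_types, lifting) closure_mono element_closure_interior els_def mem_Collect_eq mesh_element)

lemma closure_elem_union:
  assumes "elem_union P \<omega>"
  shows "closure \<omega> = \<Union>(els P \<omega>)"
proof
  have "closed (\<Union>(els P \<omega>))"
    using finite_els els_subset mesh_element element_closed by (intro closed_Union) blast+
  then show "closure \<omega> \<subseteq> \<Union>(els P \<omega>)"
    by (metis closure_minimal elem_union_eq[OF assms] interior_subset)
qed (use els_closure in blast)

lemma els_iff_closure:
  assumes "elem_union P \<omega>" "T \<in> mesh P"
  shows "T \<in> els P \<omega> \<longleftrightarrow> T \<subseteq> closure \<omega>"
proof
  assume T: "T \<subseteq> closure \<omega>"
  obtain x where x: "x \<in> interior T" using element_interior_nonempty[OF mesh_element[OF assms(2)]] by blast
  then have "x \<in> \<Union>(els P \<omega>)" using T closure_elem_union[OF assms(1)] interior_subset by blast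
  then show "T \<in> els P \<omega>" using mesh_interior_unique[OF assms(2) _ x] els_subset by blast
qed (rule els_closure)

lemma closure_subset_Omega: "elem_union P \<omega> \<Longrightarrow> closure \<omega> \<subseteq> closure (Omega P)"
  using elem_union_subset closure_mono by blast

text \<open>The elements outside \<open>S\<close> are finitely many closed sets that miss
  \<open>x\<close>; removing them from the domain leaves a neighbourhood of \<open>x\<close> inside
  the union.\<close>

lemma interior_Union_local:
  assumes "S \<subseteq> mesh P" "x \<in> Omega P" "\<And>T. T \<in> mesh P \<Longrightarrow> x \<in> T \<Longrightarrow> T \<in> S"
  shows "x \<in> interior (\<Union>S)"
proof -
  let ?N = "Omega P - \<Union>(mesh P - S)"
  have "closed (\<Union>(mesh P - S))"
    using finite_mesh mesh_element element_closed by (intro closed_Union) auto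
  then have "open ?N" using open_Omega by (simp add: open_Diff)
  moreover have "?N \<subseteq> \<Union>S" using Omega_eq interior_subset by blast
  moreover have "x \<in> ?N" using assms by blast
  ultimately show ?thesis using interior_maximal by blast
qed

lemma elem_union_local:
  "elem_union P \<omega> \<Longrightarrow> x \<in> Omega P \<Longrightarrow> (\<And>T. T \<in> mesh P \<Longrightarrow> x \<in> T \<Longrightarrow> T \<in> els P \<omega>) \<Longrightarrow> x \<in> \<omega>"
  using interior_Union_local[OF els_subset] elem_union_eq by metis

lemma finite_nodes: "finite (nodes P)"
proof -
  have "nodes P = (\<Union>T\<in>mesh P. {x. x extreme_point_of T})" by (auto simp: nodes_def)
  then show ?thesis using finite_mesh element_finite_extreme mesh_element by simp
qed

subsection \<open>Sides\<close>

lemma cross_open_segment: "x \<in> open_segment p q \<Longrightarrow> cross (q - p) (x - p) = 0"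
proof -
  assume "x \<in> open_segment p q"
  then obtain u where "x = (1 - u) *\<^sub>R p + u *\<^sub>R q" by (auto simp: in_segment)
  then have "x - p = u *\<^sub>R (q - p)" by (simp add: algebra_simps)
  then show ?thesis by (simp only: cross_simps(6,7) mult_zero_right)
qed

text \<open>Near any point of an open side, the elements having that side fill one or two half discs.\<close>

lemma interior_Union_edge:
  assumes S: "S \<subseteq> mesh P" and T0: "T0 \<in> mesh P" "closed_segment p q edge_of T0"
    and x: "x \<in> open_segment p q" "x \<in> interior (\<Union>S)" and y: "y \<in> open_segment p q"
  shows "y \<in> interior (\<Union>S)"
proof -
  define n where "n = (- snd (q - p), fst (q - p))"
  have "p \<noteq> q" using T0(2) edge_endpoints(3) by blast
  then have "fst q - fst p \<noteq> 0 \<or> snd q - snd p \<noteq> 0" by (auto simp: prod_eq_iff)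
  then have "(fst q - fst p)\<^sup>2 + (snd q - snd p)\<^sup>2 > 0" by (simp add: sum_power2_gt_zero_iff)
  then have nn: "cross (q - p) n > 0" by (simp add: n_def cross_def power2_eq_square algebra_simps)
  have side: "\<exists>r>0. \<forall>w\<in>ball y r. cross (q - p) (w - p) * s \<ge> 0 \<longrightarrow> w \<in> \<Union>S" if s: "s \<noteq> 0" for s
  proof -
    \<comment> \<open>Elements of \<open>S\<close> that meet this neighbourhood of \<open>x\<close>
      contain \<open>x\<close>, and by \<open>mesh_edge\<close> they have the whole segment as a
      side.\<close>
    let ?N = "interior (\<Union>S) - \<Union>{T \<in> S. x \<notin> T}"
    have "closed (\<Union>{T \<in> S. x \<notin> T})"
      using finite_mesh S mesh_element element_closed by (intro closed_Union) (auto intro: finite_subset)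
    then have "open ?N" by (simp add: open_Diff)
    then obtain e where e: "e > 0" "ball x e \<subseteq> ?N" using x(2) by (metis (no_types, lifting) DiffI UnionE mem_Collect_eq openE)
    define k where "k = (e / 2 / norm n) * sgn s"
    have "n \<noteq> 0" using nn by (auto simp: cross_simps(9))
    then have k: "k * s > 0" using e(1) s nn by (auto simp: k_def sgn_if cross_simps zero_less_mult_iff)
    define z where "z = x + k *\<^sub>R n"
    have "norm (k *\<^sub>R n) < e" using e(1) s by (auto simp: k_def abs_mult abs_sgn_eq)
    then have "z \<in> ball x e" by (simp add: z_def dist_norm)
    then obtain T where T: "T \<in> S" "z \<in> T" "x \<in> T" using e(2) interior_subset by blast
    have "closed_segment p q edge_of T" using mesh_edge[OF T0(1) _ T0(2) x(1) T(3)] T S by blast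
    then have "p \<in> T" "q \<in> T" using edge_endpoints(1,2)[of p q T] by (auto simp: extreme_point_of_def)
    then have hull: "convex hull {p, q, z} \<subseteq> T"
      using T S element_convex mesh_element by (intro hull_minimal) auto
    have "z - p = (x - p) + k *\<^sub>R n" by (simp add: z_def)
    then have zc: "cross (q - p) (z - p) = k * cross (q - p) n"
      using cross_open_segment[OF x(1)] by (simp only: cross_simps(2,6) add_0_left)
    then have "cross (q - p) (z - p) \<noteq> 0" using k nn by auto
    then obtain r where r: "r > 0" "\<forall>w\<in>ball y r. cross (q - p) (w - p) * cross (q - p) (z - p) \<ge> 0 \<longrightarrow> w \<in> convex hull {p, q, z}"
      using half_disc[OF y] by blast
    have "w \<in> \<Union>S" if "w \<in> ball y r" "cross (q - p) (w - p) * s \<ge> 0" for w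
    proof -
      have "cross (q - p) (w - p) * cross (q - p) (z - p) \<ge> 0"
      proof -
        have "c * d \<ge> 0" if "c * s \<ge> 0" "d * s > 0" for c d :: real
          using that by (auto simp: zero_le_mult_iff zero_less_mult_iff)
        moreover have "(k * cross (q - p) n) * s > 0" using mult_pos_pos[OF k nn] by (simp add: mult_ac)
        ultimately show ?thesis using that(2) unfolding zc by blast
      qed
      then show ?thesis using r(2) that(1) hull T(1) by blast
    qed
    then show ?thesis using r(1) by blast
  qed
  obtain r1 where r1: "r1 > 0" "\<forall>w\<in>ball y r1. cross (q - p) (w - p) * 1 \<ge> 0 \<longrightarrow> w \<in> \<Union>S"
    using side[of 1] by auto
  obtain r2 where r2: "r2 > 0" "\<forall>w\<in>ball y r2. cross (q - p) (w - p) * (-1) \<ge> 0 \<longrightarrow> w \<in> \<Union>S"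
    using side[of "-1"] by auto
  have "ball y (min r1 r2) \<subseteq> \<Union>S"
  proof
    fix w assume "w \<in> ball y (min r1 r2)"
    then show "w \<in> \<Union>S" using r1(2) r2(2) by (cases "cross (q - p) (w - p) \<ge> 0") auto
  qed
  moreover have "y \<in> ball y (min r1 r2)" using r1 r2 by simp
  ultimately show ?thesis by (meson interiorI open_ball)
qed

text \<open>Around the midpoint of the common side both elements contain the half disc on the same
  side of the line, so a point interior to one lies in the other.\<close>

lemma same_side_unique:
  assumes T: "T1 \<in> mesh P" "T2 \<in> mesh P" "closed_segment p q edge_of T1" "closed_segment p q edge_of T2"
    and z: "z1 \<in> T1" "z2 \<in> T2" "cross (q - p) (z1 - p) * cross (q - p) (z2 - p) > 0"
  shows "T1 = T2"
proof -
  define c1 where "c1 = cross (q - p) (z1 - p)"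
  define c2 where "c2 = cross (q - p) (z2 - p)"
  have c: "c1 * c2 > 0" using z by (simp add: c1_def c2_def)
  define y where "y = midpoint p q"
  have y: "y \<in> open_segment p q" using edge_endpoints(3)[OF T(3)] by (simp add: y_def)
  have hull: "convex hull {p, q, z1} \<subseteq> T1" "convex hull {p, q, z2} \<subseteq> T2"
  proof -
    have "p \<in> T1" "q \<in> T1" "p \<in> T2" "q \<in> T2"
      using edge_endpoints(1,2)[OF T(3)] edge_endpoints(1,2)[OF T(4)] by (auto simp: extreme_point_of_def)
    then show "convex hull {p, q, z1} \<subseteq> T1" "convex hull {p, q, z2} \<subseteq> T2"
      using z T element_convex mesh_element by (simp_all add: hull_minimal)
  qed
  have c0: "cross (q - p) (z1 - p) \<noteq> 0" "cross (q - p) (z2 - p) \<noteq> 0"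
    using c by (auto simp: c1_def c2_def)
  obtain r1 where r1: "r1 > 0" "\<forall>w\<in>ball y r1. cross (q - p) (w - p) * c1 \<ge> 0 \<longrightarrow> w \<in> T1"
    using half_disc[OF y c0(1)] hull(1) unfolding c1_def by blast
  obtain r2 where r2: "r2 > 0" "\<forall>w\<in>ball y r2. cross (q - p) (w - p) * c2 \<ge> 0 \<longrightarrow> w \<in> T2"
    using half_disc[OF y c0(2)] hull(2) unfolding c2_def by blast
  define W where "W = ball y (min r1 r2) \<inter> {w. cross (q - p) (w - p) * c1 > 0}"
  have oW: "open W" unfolding W_def
    by (intro open_Int open_ball open_Collect_less continuous_intros)
  have W1: "W \<subseteq> T1" using r1(2) by (auto simp: W_def)
  have W2: "W \<subseteq> T2"
  proof
    fix w assume w: "w \<in> W"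
    then have "cross (q - p) (w - p) * c2 \<ge> 0"
      using c by (auto simp: W_def zero_less_mult_iff zero_le_mult_iff)
    then show "w \<in> T2" using r2(2) w by (auto simp: W_def)
  qed
  \<comment> \<open>Scaled so that the midpoint moves towards the side of \<open>z1\<close> by less
    than both radii; the summand 1 keeps the denominator positive.\<close>
  define k where "k = min r1 r2 / 2 / (1 + norm (z1 - p))"
  have k: "k > 0" using r1 r2 by (simp add: k_def add_pos_nonneg)
  have "norm (k *\<^sub>R (z1 - p)) < min r1 r2"
  proof -
    have "norm (k *\<^sub>R (z1 - p)) = k * norm (z1 - p)" using k by simp
    also have "\<dots> \<le> k * (1 + norm (z1 - p))" using k by (simp add: distrib_left)
    also have "\<dots> = min r1 r2 / 2"
    proof -
      have "m / 2 / y * y = m / 2" if "y \<noteq> 0" for m y :: real using that by simp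
      moreover have "1 + norm (z1 - p) \<noteq> 0" by (smt (verit) norm_ge_zero)
      ultimately show ?thesis unfolding k_def by blast
    qed
    also have "\<dots> < min r1 r2" using r1(1) r2(1) by (auto simp: min_def)
    finally show ?thesis .
  qed
  moreover have "cross (q - p) (y + k *\<^sub>R (z1 - p) - p) = k * c1"
  proof -
    have "y + k *\<^sub>R (z1 - p) - p = (y - p) + k *\<^sub>R (z1 - p)" by simp
    then show ?thesis using cross_open_segment[OF y] by (simp only: cross_simps(2,6) c1_def add_0_left)
  qed
  moreover have "k * c1 * c1 > 0"
    using k c by (auto simp: mult.assoc intro!: mult_pos_pos simp: zero_less_mult_iff)
  ultimately have w: "y + k *\<^sub>R (z1 - p) \<in> W"
    by (simp add: W_def dist_norm)
  then have "y + k *\<^sub>R (z1 - p) \<in> interior T1" using interior_maximal[OF W1 oW] by blast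
  then show ?thesis using mesh_interior_unique[OF T(1,2)] w W2 by blast
qed

text \<open>Each such element has a point off the line, and the sign of \<open>cross\<close> there
  is an injection into \<open>bool\<close>. This planar fact is behind the weight 1/2 at edge
  nodes.\<close>

lemma card_edge_elements: "card {T \<in> mesh P. closed_segment p q edge_of T} \<le> 2"
proof -
  let ?S = "{T \<in> mesh P. closed_segment p q edge_of T}"
  have "\<exists>z\<in>T. cross (q - p) (z - p) \<noteq> 0" if "T \<in> ?S" for T
  proof (rule ccontr)
    assume n: "\<not> (\<exists>z\<in>T. cross (q - p) (z - p) \<noteq> 0)"
    have "p \<noteq> q" using that edge_endpoints(3) by blast
    then have "(- snd (q - p), fst (q - p)) \<noteq> 0" by (auto simp: prod_eq_iff)
    moreover have "T \<subseteq> {x. (- snd (q - p), fst (q - p)) \<bullet> x = (- snd (q - p), fst (q - p)) \<bullet> p}"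
      using n unfolding cross_inner inner_diff_right by (auto simp del: inner_Pair)
    then have "interior T \<subseteq> interior {x. (- snd (q - p), fst (q - p)) \<bullet> x = (- snd (q - p), fst (q - p)) \<bullet> p}"
      by (rule interior_mono)
    ultimately have "interior T = {}" using interior_hyperplane by (metis subset_empty)
    then show False using element_interior_nonempty mesh_element that by blast
  qed
  then obtain z where z: "\<And>T. T \<in> ?S \<Longrightarrow> z T \<in> T \<and> cross (q - p) (z T - p) \<noteq> 0" by metis
  have "inj_on (\<lambda>T. cross (q - p) (z T - p) > 0) ?S"
  proof (rule inj_onI)
    fix T T' assume T: "T \<in> ?S" "T' \<in> ?S" "(cross (q - p) (z T - p) > 0) = (cross (q - p) (z T' - p) > 0)"
    then have "cross (q - p) (z T - p) * cross (q - p) (z T' - p) > 0"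
      using z[OF T(1)] z[OF T(2)] by (auto simp: zero_less_mult_iff)
    then show "T = T'" using same_side_unique[of T T' p q "z T" "z T'"] T z by blast
  qed
  then have "card ?S \<le> card (UNIV :: bool set)" by (rule card_inj_on_le) auto
  then show ?thesis by simp
qed

lemma cellular_elem_union:
  assumes "elem_union P \<omega>"
  shows "cellular P \<omega>"
  unfolding cellular_def
proof (intro conjI ballI allI impI)
  fix T assume T: "T \<in> mesh P" "interior T \<inter> \<omega> \<noteq> {}"
  then have "T \<in> els P \<omega>" using elem_union_meets[OF assms T(1)] interior_subset by blast
  then show "interior T \<subseteq> \<omega>" by (simp add: els_def)
next
  fix T p q assume T: "T \<in> mesh P" "closed_segment p q edge_of T" "open_segment p q \<inter> \<omega> \<noteq> {}"
  then show "open_segment p q \<subseteq> \<omega>"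
    using interior_Union_edge[OF els_subset T(1,2), of _ \<omega>] elem_union_eq[OF assms] by blast
qed

lemma cellular_UN: "(\<And>i. i \<in> I \<Longrightarrow> cellular P (A i)) \<Longrightarrow> cellular P (\<Union>i\<in>I. A i)"
  unfolding cellular_def by (intro conjI ballI allI impI; fast)

lemma open_segment_meets:
  fixes p q :: pt
  assumes "open A" "p \<in> A \<or> q \<in> A" "p \<noteq> q"
  shows "open_segment p q \<inter> A \<noteq> {}"
proof -
  have "p \<in> closure (open_segment p q)" "q \<in> closure (open_segment p q)"
    using assms(3) by (auto simp: closure_open_segment)
  then have "closure (open_segment p q) \<inter> A \<noteq> {}" using assms(2) by blast
  then show ?thesis using open_Int_closure_eq_empty[OF assms(1)] by (metis Int_commute)
qed

text \<open>Nodal values decide where a finite element function vanishes: all vertices of a cell outside \<open>A\<close>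
  are outside \<open>A\<close>, because \<open>A\<close> is open and contains a cell as soon as it meets it.\<close>

lemma vanish_outside:
  assumes A: "cellular P A" "open A" and T: "T \<in> mesh P" "fe_on T v"
    and v: "\<And>p. p extreme_point_of T \<Longrightarrow> p \<notin> A \<Longrightarrow> v p = 0" and x: "x \<in> T" "x \<notin> A"
  shows "v x = 0"
proof (cases rule: element_cases[OF mesh_element[OF T(1)] x(1)])
  case 1
  have "p \<notin> A" if "p extreme_point_of T" for p
  proof
    assume "p \<in> A"
    have "p \<in> closure (interior T)"
      using that element_closure_interior[OF mesh_element[OF T(1)]] by (simp add: extreme_point_of_def)
    then have "closure (interior T) \<inter> A \<noteq> {}" using \<open>p \<in> A\<close> by blast
    then have "interior T \<inter> A \<noteq> {}" using open_Int_closure_eq_empty[OF A(2)] by (metis Int_commute)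
    then show False using A(1) T(1) 1 x(2) unfolding cellular_def by blast
  qed
  then show ?thesis using fe_on_zero[OF mesh_element[OF T(1)] T(2)] v x(1) by blast
next
  case 2
  then show ?thesis using v x by blast
next
  case (3 p q)
  have "\<not> open_segment p q \<subseteq> A" using 3 x(2) by blast
  then have "open_segment p q \<inter> A = {}" using A(1) T(1) 3(1) unfolding cellular_def by blast
  then have "p \<notin> A" "q \<notin> A" using open_segment_meets[OF A(2)] edge_endpoints(3)[OF 3(1)] by blast+
  then have v0: "v p = 0" "v q = 0" using v edge_endpoints[OF 3(1)] by auto
  obtain t where t: "0 < t" "t < 1" "x = (1 - t) *\<^sub>R p + t *\<^sub>R q" using 3(2) by (auto simp: in_segment)
  show ?thesis
    using fe_on_affine_edge[OF mesh_element[OF T(1)] T(2) 3(1), of t] t v0 by (simp add: linepath_def)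
qed

subsection \<open>Nodal interpolation\<close>

text \<open>By the pasting lemma, a function continuous on each of finitely many closed elements is
  continuous on their union.\<close>

lemma fe_space_iff: "v \<in> fe_space P \<longleftrightarrow> (\<forall>T\<in>mesh P. fe_on T v) \<and> (\<forall>x. x \<notin> closure (Omega P) \<longrightarrow> v x = 0)"
proof -
  have "continuous_on (\<Union>T\<in>mesh P. T) v" if "\<forall>T\<in>mesh P. fe_on T v"
    using that finite_mesh mesh_element element_closed fe_on_continuous
    by (intro continuous_on_closed_Union) auto
  then show ?thesis using mesh_Union by (auto simp: fe_space_def)
qed

lemma fe_space_fe_on: "v \<in> fe_space P \<Longrightarrow> T \<in> mesh P \<Longrightarrow> fe_on T v"
  by (simp add: fe_space_iff)

lemma fe_space_continuous: "v \<in> fe_space P \<Longrightarrow> continuous_on (closure (Omega P)) v"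
  by (simp add: fe_space_def)

lemma fe_on_zero_fun: "element T \<Longrightarrow> fe_on T 0"
  using fe_on_const[of T 0] by (simp add: zero_fun_def)

lemma fe_on_scale: "element T \<Longrightarrow> fe_on T u \<Longrightarrow> fe_on T (c *\<^sub>R u)"
  using fe_on_lincomb[of T u 0 c] fe_on_zero_fun by simp

lemma fe_on_add: "element T \<Longrightarrow> fe_on T u \<Longrightarrow> fe_on T v \<Longrightarrow> fe_on T (u + v)"
  using fe_on_lincomb[of T u v 1] by simp

lemma fe_on_diff: "element T \<Longrightarrow> fe_on T u \<Longrightarrow> fe_on T v \<Longrightarrow> fe_on T (u - v)"
  using fe_on_lincomb[of T v u "-1"] by simp

lemma scaleR_fun_apply [simp]: "(c *\<^sub>R f) x = c *\<^sub>R f x"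
  by (simp add: scaleR_fun_def)

lemma sum_fun_apply: "(sum f I) x = (\<Sum>i\<in>I. f i x)"
  by (induction I rule: infinite_finite_induct) auto

lemma subspace_fe_space: "subspace (fe_space P)"
  unfolding subspace_def
  by (auto simp: fe_space_iff mesh_element fe_on_zero_fun fe_on_add fe_on_scale)

text \<open>Local interpolants are glued. Two elements meet in a common face, where they agree: at a
  shared vertex by the nodal value, on a shared side because both traces are affine with the same
  endpoint values.\<close>

lemma interp_exists: "\<exists>v\<in>fe_space P. \<forall>x\<in>nodes P. v x = f x"
proof -
  have "\<forall>T\<in>mesh P. \<exists>v. fe_on T v \<and> (\<forall>x. x extreme_point_of T \<longrightarrow> v x = f x)"
    using fe_on_exists mesh_element by blast
  then obtain w where w: "\<And>T. T \<in> mesh P \<Longrightarrow> fe_on T (w T)"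
    "\<And>T x. T \<in> mesh P \<Longrightarrow> x extreme_point_of T \<Longrightarrow> w T x = f x" by metis
  have agree: "w T x = w T' x" if T: "T \<in> mesh P" "T' \<in> mesh P" "x \<in> T" "x \<in> T'" for T T' x
  proof (cases rule: element_cases[OF mesh_element[OF T(1)] T(3)])
    case 1
    then show ?thesis using mesh_interior_unique T by blast
  next
    case 2
    then show ?thesis using mesh_extreme[OF T(1,2) 2 T(4)] w T by metis
  next
    case (3 p q)
    have e: "closed_segment p q edge_of T'" using mesh_edge[OF T(1,2) 3 T(4)] .
    obtain t where t: "0 < t" "t < 1" "x = linepath p q t" using 3(2) by (auto simp: in_segment linepath_def)
    have "w T p = w T' p" "w T q = w T' q"
      using w(2) T edge_endpoints[OF 3(1)] edge_endpoints[OF e] by metis+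
    then show ?thesis
      using fe_on_affine_edge[OF mesh_element[OF T(1)] w(1)[OF T(1)] 3(1), of t] t
        fe_on_affine_edge[OF mesh_element[OF T(2)] w(1)[OF T(2)] e, of t] by simp
  qed
  \<comment> \<open>By \<open>agree\<close> the choice among the elements containing
    \<open>x\<close> is immaterial.\<close>
  define v where "v x = (if x \<in> closure (Omega P) then w (SOME T. T \<in> mesh P \<and> x \<in> T) x else 0)" for x
  have vT: "v x = w T x" if "T \<in> mesh P" "x \<in> T" for T x
  proof -
    define T' where "T' = (SOME T. T \<in> mesh P \<and> x \<in> T)"
    have "T' \<in> mesh P \<and> x \<in> T'"
      unfolding T'_def by (rule someI[of _ T]) (use that in simp)
    then have "w T' x = w T x" using agree that by blast
    moreover have "x \<in> closure (Omega P)" using that mesh_Union by blast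
    ultimately show ?thesis by (simp add: v_def T'_def)
  qed
  have "fe_on T v" if "T \<in> mesh P" for T
    using fe_on_cong[OF mesh_element[OF that], of v "w T"] vT[OF that] w(1)[OF that] by blast
  then have "v \<in> fe_space P" by (simp add: fe_space_iff v_def)
  moreover have "v x = f x" if x: "x \<in> nodes P" for x
  proof -
    obtain T where T: "T \<in> mesh P" "x extreme_point_of T" using x by (auto simp: nodes_def)
    then show ?thesis using vT w(2) by (simp add: extreme_point_of_def)
  qed
  ultimately show ?thesis by blast
qed

lemma fe_space_eqI:
  assumes "u \<in> fe_space P" "v \<in> fe_space P" "\<And>x. x \<in> nodes P \<Longrightarrow> u x = v x"
  shows "u = v"
proof
  fix x
  show "u x = v x"
  proof (cases "x \<in> closure (Omega P)")
    case True
    then obtain T where T: "T \<in> mesh P" "x \<in> T" using mesh_Union by blast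
    have "(u - v) x = 0"
    proof (rule fe_on_zero[OF mesh_element[OF T(1)] _ _ T(2)])
      show "fe_on T (u - v)" using assms T by (simp add: fe_on_diff fe_space_fe_on mesh_element)
    qed (use assms(3) T in \<open>auto simp: nodes_def\<close>)
    then show ?thesis by simp
  qed (use assms in \<open>auto simp: fe_space_iff\<close>)
qed

lemma interp_unique: "\<exists>!v. v \<in> fe_space P \<and> (\<forall>x\<in>nodes P. v x = f x)"
  using interp_exists fe_space_eqI by (metis (no_types, lifting))

lemma interp_fe_space: "interp P f \<in> fe_space P"
  and interp_node: "x \<in> nodes P \<Longrightarrow> interp P f x = f x"
  using theI'[OF interp_unique[of f]] by (auto simp: interp_def)

lemma interp_eqI: "v \<in> fe_space P \<Longrightarrow> (\<And>x. x \<in> nodes P \<Longrightarrow> v x = f x) \<Longrightarrow> interp P f = v"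
  by (rule fe_space_eqI) (auto simp: interp_fe_space interp_node)

lemma interp_cong: "(\<And>x. x \<in> nodes P \<Longrightarrow> f x = g x) \<Longrightarrow> interp P f = interp P g"
  by (rule interp_eqI) (auto simp: interp_fe_space interp_node)

lemma fe_space_span: "fe_space P = span (hat P ` nodes P)"
proof
  show "span (hat P ` nodes P) \<subseteq> fe_space P"
    by (rule span_minimal) (auto simp: hat_def interp_fe_space subspace_fe_space)
  show "fe_space P \<subseteq> span (hat P ` nodes P)"
  proof
    fix v assume v: "v \<in> fe_space P"
    have "v = (\<Sum>p\<in>nodes P. v p *\<^sub>R hat P p)"
    proof (rule fe_space_eqI[OF v])
      show "(\<Sum>p\<in>nodes P. v p *\<^sub>R hat P p) \<in> fe_space P"
        by (intro subspace_sum subspace_scale subspace_fe_space) (auto simp: hat_def interp_fe_space)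
      fix x assume x: "x \<in> nodes P"
      have "(\<Sum>p\<in>nodes P. v p *\<^sub>R hat P p) x = (\<Sum>p\<in>nodes P. v p * hat P p x)"
        by (simp add: sum_fun_apply)
      also have "\<dots> = (\<Sum>p\<in>nodes P. if p = x then v x else 0)"
        by (rule sum.cong) (auto simp: hat_def interp_node x)
      also have "\<dots> = v x" using x finite_nodes by simp
      finally show "v x = (\<Sum>p\<in>nodes P. v p *\<^sub>R hat P p) x" by simp
    qed
    also have "\<dots> \<in> span (hat P ` nodes P)"
      by (intro span_sum span_scale span_base) auto
    finally show "v \<in> span (hat P ` nodes P)" .
  qed
qed

end

section \<open>Energies as sums over elements, and what vanishing energy implies\<close>

section \<open>Integrals of finite element functions\<close>

text \<open>Asks for nothing across element boundaries or outside \<open>\<omega>\<close>.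
  Restrictions to a closure, constants and indicators belong to it, so the forms have one common
  domain.\<close>

definition broken :: "dd_setting \<Rightarrow> pt set \<Rightarrow> scalar_fun set"
  where "broken P \<omega> = {u. \<forall>T\<in>els P \<omega>. fe_on T u}"

text \<open>With weight \<open>alpha P\<close> this is the energy, with weight 1 the squared
  gradient norm occurring in \<open>c_t\<close> and \<open>c_p\<close>.\<close>

definition grad_form :: "scalar_fun \<Rightarrow> pt set \<Rightarrow> scalar_fun \<Rightarrow> scalar_fun \<Rightarrow> real"
  where "grad_form w \<omega> u v = (LINT x:\<omega>|lebesgue. w x * (grad u x \<bullet> grad v x))"

definition L2_form :: "pt set \<Rightarrow> scalar_fun \<Rightarrow> scalar_fun \<Rightarrow> real"
  where "L2_form \<omega> u v = (LINT x:\<omega>|lebesgue. u x * v x)"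

definition elementwise_constant :: "dd_setting \<Rightarrow> scalar_fun \<Rightarrow> bool"
  where "elementwise_constant P w \<longleftrightarrow> (\<forall>T\<in>mesh P. \<exists>a\<ge>0. \<forall>x\<in>interior T. w x = a)"

lemma energy_grad_form: "energy P = grad_form (alpha P)"
  by (simp add: fun_eq_iff energy_def grad_form_def)

lemma set_integrable_continuous_interior:
  fixes f :: "pt \<Rightarrow> real"
  assumes "compact T" "continuous_on T g" "\<And>x. x \<in> interior T \<Longrightarrow> f x = g x"
  shows "set_integrable lebesgue (interior T) f"
proof -
  have l: "integrable lborel (\<lambda>x. indicator T x *\<^sub>R g x)"
    using borel_integrable_compact[OF assms(1,2)] .
  then have "integrable lebesgue (\<lambda>x. indicator T x *\<^sub>R g x)"
    using integrable_completion[of "\<lambda>x. indicator T x *\<^sub>R g x" lborel] by auto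
  then have "set_integrable lebesgue T g" by (simp add: set_integrable_def)
  then have "set_integrable lebesgue (interior T) g"
    by (rule set_integrable_subset) (auto simp: interior_subset)
  then show ?thesis using assms(3) by (subst set_integrable_cong[OF refl refl]) auto
qed

text \<open>A positive value would persist on a nonempty open set, whereas the integrand vanishes
  almost everywhere.\<close>

lemma continuous_integral_zero:
  fixes f :: "pt \<Rightarrow> real"
  assumes U: "open U" "continuous_on U f" "\<And>x. x \<in> U \<Longrightarrow> 0 \<le> f x"
    and i: "set_integrable lebesgue U f" "(LINT x:U|lebesgue. f x) = 0" and x: "x \<in> U"
  shows "f x = 0"
proof (rule ccontr)
  assume "f x \<noteq> 0"
  then have fx: "f x > 0" using U(3)[OF x] by simp
  let ?g = "\<lambda>x. indicator U x *\<^sub>R f x"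
  have "AE x in lebesgue. ?g x = 0"
    using integral_nonneg_eq_0_iff_AE[of lebesgue ?g] i U(3)
    by (auto simp: set_integrable_def set_lebesgue_integral_def indicator_def)
  then obtain N where N: "N \<in> null_sets lebesgue" "{x \<in> space lebesgue. ?g x \<noteq> 0} \<subseteq> N"
    unfolding eventually_ae_filter by blast
  have "continuous (at x) f" using U x by (simp add: continuous_on_eq_continuous_at)
  then have "eventually (\<lambda>y. f y > 0) (at x)"
    using fx by (simp add: isCont_def order_tendstoD)
  then have "eventually (\<lambda>y. f y > 0) (nhds x)"
    using fx by (simp add: eventually_nhds_conv_at)
  moreover have "eventually (\<lambda>y. y \<in> U) (nhds x)" using U(1) x by (simp add: eventually_nhds_in_open)
  ultimately have "eventually (\<lambda>y. f y > 0 \<and> y \<in> U) (nhds x)" by (rule eventually_conj)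
  then obtain W where W: "open W" "x \<in> W" "\<forall>y\<in>W. f y > 0 \<and> y \<in> U" unfolding eventually_nhds by blast
  then have "W \<subseteq> N" using N(2) by (force simp: indicator_def)
  then have "negligible W" using N(1) negligible_iff_null_sets negligible_subset by blast
  then show False using open_not_negligible W by blast
qed

context fe_mesh
begin

lemma restr_closure_cong: "x \<in> closure S \<Longrightarrow> restr (closure S) v x = v x"
  by (simp add: restr_def)

lemma els_element: "T \<in> els P \<omega> \<Longrightarrow> element T"
  by (simp add: els_def mesh_element)

lemma els_mesh: "T \<in> els P \<omega> \<Longrightarrow> T \<in> mesh P"
  by (simp add: els_def)

lemma subspace_broken: "subspace (broken P \<omega>)"
  unfolding subspace_def
  by (auto simp: broken_def els_element fe_on_zero_fun fe_on_add fe_on_scale)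

lemma fe_space_broken: "fe_space P \<subseteq> broken P \<omega>"
  using els_mesh by (auto simp: broken_def fe_space_iff)

lemma broken_cong: "(\<And>x. x \<in> closure \<omega> \<Longrightarrow> u x = v x) \<Longrightarrow> u \<in> broken P \<omega> \<longleftrightarrow> v \<in> broken P \<omega>"
proof -
  assume uv: "\<And>x. x \<in> closure \<omega> \<Longrightarrow> u x = v x"
  have "fe_on T u \<longleftrightarrow> fe_on T v" if T: "T \<in> els P \<omega>" for T
    by (rule fe_on_cong[OF els_element[OF T]]) (rule uv, rule subsetD[OF els_closure[OF T]])
  then show ?thesis by (simp add: broken_def)
qed

lemma const_broken: "(\<lambda>x. k) \<in> broken P \<omega>"
  by (auto simp: broken_def els_element fe_on_const)

lemma restr_broken: "v \<in> fe_space P \<Longrightarrow> restr (closure \<omega>) v \<in> broken P \<omega>"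
  using broken_cong[of \<omega> "restr (closure \<omega>) v" v] fe_space_broken by (auto simp: restr_closure_cong)

lemma Vloc_broken: "Vloc P \<omega> \<subseteq> broken P \<omega>"
  using restr_broken by (auto simp: Vloc_def)

text \<open>What the open elements leave of \<open>\<omega>\<close> lies in finitely many frontiers
  of convex sets, a negligible set.\<close>

lemma set_integral_elements:
  assumes \<omega>: "elem_union P \<omega>"
    and f: "\<And>T. T \<in> els P \<omega> \<Longrightarrow> set_integrable lebesgue (interior T) f"
  shows "set_integrable lebesgue \<omega> (f :: pt \<Rightarrow> real)"
    and "(LINT x:\<omega>|lebesgue. f x) = (\<Sum>T\<in>els P \<omega>. LINT x:interior T|lebesgue. f x)"
proof -
  let ?U = "\<Union>T\<in>els P \<omega>. interior T"
  have U: "?U \<subseteq> \<omega>" by (auto simp: els_def)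
  have "\<omega> - ?U \<subseteq> (\<Union>T\<in>els P \<omega>. frontier T)"
  proof
    fix x assume x: "x \<in> \<omega> - ?U"
    then have "x \<in> \<Union>(els P \<omega>)" using elem_union_eq[OF \<omega>] interior_subset by blast
    then obtain T where T: "T \<in> els P \<omega>" "x \<in> T" by blast
    then have "x \<in> frontier T" using x closure_subset unfolding frontier_def by blast
    then show "x \<in> (\<Union>T\<in>els P \<omega>. frontier T)" using T(1) by blast
  qed
  moreover have "negligible (\<Union>T\<in>els P \<omega>. frontier T)"
    using finite_els negligible_convex_frontier element_convex els_element by blast
  ultimately have neg: "negligible (\<omega> - ?U)" using negligible_subset by blast
  have n: "negligible {x \<in> ?U - \<omega>. f x \<noteq> 0}" "negligible {x \<in> \<omega> - ?U. f x \<noteq> 0}"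
  proof -
    have "{x \<in> ?U - \<omega>. f x \<noteq> 0} = {}" using U by blast
    then show "negligible {x \<in> ?U - \<omega>. f x \<noteq> 0}" by (metis negligible_empty)
    show "negligible {x \<in> \<omega> - ?U. f x \<noteq> 0}" by (rule negligible_subset[OF neg]) blast
  qed
  have iU: "set_integrable lebesgue ?U f"
    by (rule set_integrable_UN) (auto simp: finite_els f)
  then show i\<omega>: "set_integrable lebesgue \<omega> f"
    using absolutely_integrable_spike_set_eq[OF n] by simp
  have disj: "disjoint_family_on interior (els P \<omega>)"
    unfolding disjoint_family_on_def
  proof (intro ballI impI equals0I)
    fix T T' x assume T: "T \<in> els P \<omega>" "T' \<in> els P \<omega>" "T \<noteq> T'" "x \<in> interior T \<inter> interior T'"
    then have "x \<in> interior T" "x \<in> T'" using interior_subset by blast+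
    then show False using mesh_interior_unique[OF els_mesh[OF T(1)] els_mesh[OF T(2)]] T(3) by blast
  qed
  have "(LINT x:\<omega>|lebesgue. f x) = (LINT x:?U|lebesgue. f x)"
    unfolding set_lebesgue_integral_eq_integral(2)[OF iU] set_lebesgue_integral_eq_integral(2)[OF i\<omega>]
    by (rule integral_spike_set) (use n in auto)
  also have "\<dots> = (\<Sum>T\<in>els P \<omega>. LINT x:interior T|lebesgue. f x)"
    by (rule set_integral_finite_Union) (auto simp: finite_els f disj)
  finally show "(LINT x:\<omega>|lebesgue. f x) = (\<Sum>T\<in>els P \<omega>. LINT x:interior T|lebesgue. f x)" .
qed

lemma grad_integrable:
  assumes w: "elementwise_constant P w" and T: "T \<in> mesh P" and uv: "fe_on T u" "fe_on T v"
  shows "set_integrable lebesgue (interior T) (\<lambda>x. w x * (grad u x \<bullet> grad v x))"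
proof -
  obtain a where a: "\<forall>x\<in>interior T. w x = a" using w T by (auto simp: elementwise_constant_def)
  obtain G where G: "continuous_on T G" "\<And>x. x \<in> interior T \<Longrightarrow> grad u x = G x"
    using fe_on_grad[OF mesh_element[OF T] uv(1)] by metis
  obtain H where H: "continuous_on T H" "\<And>x. x \<in> interior T \<Longrightarrow> grad v x = H x"
    using fe_on_grad[OF mesh_element[OF T] uv(2)] by metis
  show ?thesis
    by (rule set_integrable_continuous_interior[where g = "\<lambda>x. a * (G x \<bullet> H x)"])
      (use a G H element_compact[OF mesh_element[OF T]] in \<open>auto intro!: continuous_intros\<close>)
qed

lemma L2_integrable:
  assumes T: "T \<in> mesh P" and uv: "fe_on T u" "fe_on T v"
  shows "set_integrable lebesgue (interior T) (\<lambda>x. u x * v x)"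
  by (rule set_integrable_continuous_interior[where g = "\<lambda>x. u x * v x"])
    (use uv fe_on_continuous[OF mesh_element[OF T]] element_compact[OF mesh_element[OF T]]
      in \<open>auto intro!: continuous_intros\<close>)

lemma psd_grad_form_element:
  assumes w: "elementwise_constant P w" and T: "T \<in> mesh P"
  shows "psd_form {u. fe_on T u} (grad_form w (interior T))"
proof
  note [simp] = mesh_element[OF T]
  show "subspace {u. fe_on T u}"
    unfolding subspace_def by (auto simp: fe_on_zero_fun fe_on_add fe_on_scale)
  fix u v z :: scalar_fun and c :: real
  assume u: "u \<in> {u. fe_on T u}"
  obtain a where a: "a \<ge> 0" "\<forall>x\<in>interior T. w x = a" using w T by (auto simp: elementwise_constant_def)
  show "0 \<le> grad_form w (interior T) u u"
    unfolding grad_form_def set_lebesgue_integral_def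
    by (rule Bochner_Integration.integral_nonneg) (use a in \<open>auto simp: indicator_def\<close>)
  assume v: "v \<in> {u. fe_on T u}"
  show "grad_form w (interior T) u v = grad_form w (interior T) v u"
    by (simp add: grad_form_def inner_commute)
  assume z: "z \<in> {u. fe_on T u}"
  have "grad_form w (interior T) (c *\<^sub>R u + v) z = 
    (LINT x:interior T|lebesgue. c * (w x * (grad u x \<bullet> grad z x)) + w x * (grad v x \<bullet> grad z x))"
    unfolding grad_form_def
    by (rule set_lebesgue_integral_cong)
      (use u v in \<open>simp_all add: fe_on_grad_lincomb[OF mesh_element[OF T]] inner_add_left distrib_left mult.left_commute\<close>)
  also have "\<dots> = c * grad_form w (interior T) u z + grad_form w (interior T) v z"
    unfolding grad_form_def using u v z grad_integrable[OF w T]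
    by (subst set_integral_add) auto
  finally show "grad_form w (interior T) (c *\<^sub>R u + v) z = c * grad_form w (interior T) u z + grad_form w (interior T) v z" .
qed

lemma psd_L2_form_element:
  assumes T: "T \<in> mesh P"
  shows "psd_form {u. fe_on T u} (L2_form (interior T))"
proof
  note [simp] = mesh_element[OF T]
  show "subspace {u. fe_on T u}"
    unfolding subspace_def by (auto simp: fe_on_zero_fun fe_on_add fe_on_scale)
  fix u v z :: scalar_fun and c :: real
  assume u: "u \<in> {u. fe_on T u}"
  show "0 \<le> L2_form (interior T) u u"
    unfolding L2_form_def set_lebesgue_integral_def
    by (rule Bochner_Integration.integral_nonneg) (auto simp: indicator_def)
  assume v: "v \<in> {u. fe_on T u}"
  show "L2_form (interior T) u v = L2_form (interior T) v u"
    by (simp add: L2_form_def mult.commute)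
  assume z: "z \<in> {u. fe_on T u}"
  have "L2_form (interior T) (c *\<^sub>R u + v) z = (LINT x:interior T|lebesgue. c * (u x * z x) + v x * z x)"
    unfolding L2_form_def
    by (rule set_lebesgue_integral_cong) (auto simp: algebra_simps)
  also have "\<dots> = c * L2_form (interior T) u z + L2_form (interior T) v z"
    unfolding L2_form_def using u v z L2_integrable[OF T]
    by (subst set_integral_add) auto
  finally show "L2_form (interior T) (c *\<^sub>R u + v) z = c * L2_form (interior T) u z + L2_form (interior T) v z" .
qed

lemma psd_form_sum:
  fixes f :: "scalar_fun \<Rightarrow> scalar_fun \<Rightarrow> real"
  assumes "finite I" "subspace V" "\<And>i. i \<in> I \<Longrightarrow> psd_form (W i) (a i)" "\<And>i. i \<in> I \<Longrightarrow> V \<subseteq> W i"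
    and f: "\<And>u v. u \<in> V \<Longrightarrow> v \<in> V \<Longrightarrow> f u v = (\<Sum>i\<in>I. a i u v)"
  shows "psd_form V f"
proof
  show "subspace V" by fact
  fix u v w :: scalar_fun and c :: real
  assume u: "u \<in> V"
  have W: "i \<in> I \<Longrightarrow> x \<in> V \<Longrightarrow> x \<in> W i" for i x using assms(4) by blast
  show "0 \<le> f u u" using u W psd_form.nonneg[OF assms(3)] by (auto simp: f intro!: sum_nonneg)
  assume v: "v \<in> V"
  show "f u v = f v u" using u v W psd_form.sym[OF assms(3)] by (auto simp: f intro!: sum.cong)
  assume w: "w \<in> V"
  have cu: "c *\<^sub>R u + v \<in> V" using u v assms(2) by (simp add: subspace_add subspace_scale)
  show "f (c *\<^sub>R u + v) w = c * f u w + f v w"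
    unfolding f[OF cu w] f[OF u w] f[OF v w] sum_distrib_left sum.distrib[symmetric]
    using u v w W psd_form.lin[OF assms(3)] by (auto intro!: sum.cong)
qed

lemma broken_fe_on: "u \<in> broken P \<omega> \<Longrightarrow> T \<in> els P \<omega> \<Longrightarrow> fe_on T u"
  by (simp add: broken_def)

lemma grad_form_sum:
  assumes "elementwise_constant P w" "elem_union P \<omega>" "u \<in> broken P \<omega>" "v \<in> broken P \<omega>"
  shows "grad_form w \<omega> u v = (\<Sum>T\<in>els P \<omega>. grad_form w (interior T) u v)"
  unfolding grad_form_def
  by (rule set_integral_elements) (use assms grad_integrable els_mesh broken_fe_on in auto)

lemma L2_form_sum:
  assumes "elem_union P \<omega>" "u \<in> broken P \<omega>" "v \<in> broken P \<omega>"
  shows "L2_form \<omega> u v = (\<Sum>T\<in>els P \<omega>. L2_form (interior T) u v)"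
  unfolding L2_form_def
  by (rule set_integral_elements) (use assms L2_integrable els_mesh broken_fe_on in auto)

lemma psd_grad_form:
  assumes "elementwise_constant P w" "elem_union P \<omega>"
  shows "psd_form (broken P \<omega>) (grad_form w \<omega>)"
  by (rule psd_form_sum[where I = "els P \<omega>" and W = "\<lambda>T. {u. fe_on T u}" and a = "\<lambda>T. grad_form w (interior T)"])
    (use finite_els subspace_broken psd_grad_form_element[OF assms(1) els_mesh] broken_fe_on grad_form_sum[OF assms] in auto)

lemma psd_L2_form:
  assumes "elem_union P \<omega>"
  shows "psd_form (broken P \<omega>) (L2_form \<omega>)"
  by (rule psd_form_sum[where I = "els P \<omega>" and W = "\<lambda>T. {u. fe_on T u}" and a = "\<lambda>T. L2_form (interior T)"])
    (use finite_els subspace_broken psd_L2_form_element[OF els_mesh] broken_fe_on L2_form_sum[OF assms] in auto)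

lemma alpha_min_pos: "0 < \<alpha>min"
  using coefficient by (simp add: coefficient_ok_def)

lemma elementwise_constant_alpha: "elementwise_constant P (alpha P)"
  unfolding elementwise_constant_def
proof
  fix T assume "T \<in> mesh P"
  then obtain a where "\<alpha>min \<le> a" "\<forall>x\<in>interior T. alpha P x = a"
    using coefficient unfolding coefficient_ok_def by (meson atLeastAtMost_iff)
  then show "\<exists>a\<ge>0. \<forall>x\<in>interior T. alpha P x = a"
    using alpha_min_pos by (intro exI[of _ a]) auto
qed

lemma elementwise_constant_const: "k \<ge> 0 \<Longrightarrow> elementwise_constant P (\<lambda>x. k)"
  by (auto simp: elementwise_constant_def)

lemma psd_energy: "elem_union P \<omega> \<Longrightarrow> psd_form (broken P \<omega>) (energy P \<omega>)"
  unfolding energy_grad_form by (rule psd_grad_form[OF elementwise_constant_alpha])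

lemma psd_energy_element: "T \<in> mesh P \<Longrightarrow> psd_form {u. fe_on T u} (energy P (interior T))"
  unfolding energy_grad_form by (rule psd_grad_form_element[OF elementwise_constant_alpha])

lemma energy_sum:
  "elem_union P \<omega> \<Longrightarrow> u \<in> broken P \<omega> \<Longrightarrow> v \<in> broken P \<omega> \<Longrightarrow>
    energy P \<omega> u v = (\<Sum>T\<in>els P \<omega>. energy P (interior T) u v)"
  unfolding energy_grad_form by (rule grad_form_sum[OF elementwise_constant_alpha])

lemma grad_form_cong:
  assumes "open \<omega>" "\<And>x. x \<in> \<omega> \<Longrightarrow> u x = u' x" "\<And>x. x \<in> \<omega> \<Longrightarrow> v x = v' x"
  shows "grad_form w \<omega> u v = grad_form w \<omega> u' v'"
  unfolding grad_form_def
proof (rule set_lebesgue_integral_cong)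
  have "grad u x = grad u' x" "grad v x = grad v' x" if "x \<in> \<omega>" for x
    by (rule grad_cong[OF assms(1) that], rule assms, assumption)+
  then show "\<forall>x. x \<in> \<omega> \<longrightarrow> w x * (grad u x \<bullet> grad v x) = w x * (grad u' x \<bullet> grad v' x)" by simp
qed (use assms in auto)

lemma energy_cong:
  "open \<omega> \<Longrightarrow> (\<And>x. x \<in> \<omega> \<Longrightarrow> u x = u' x) \<Longrightarrow> (\<And>x. x \<in> \<omega> \<Longrightarrow> v x = v' x) \<Longrightarrow> energy P \<omega> u v = energy P \<omega> u' v'"
  unfolding energy_grad_form by (rule grad_form_cong)

lemma energy_element_zero:
  assumes "T \<in> mesh P" "fe_on T v" "\<And>x. x \<in> T \<Longrightarrow> u x = 0"
  shows "energy P (interior T) u v = 0" "energy P (interior T) v u = 0"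
proof -
  interpret psd_form "{u. fe_on T u}" "energy P (interior T)" by (rule psd_energy_element[OF assms(1)])
  have z: "u x = 0 x" if "x \<in> interior T" for x
    using assms(3)[of x] that interior_subset[of T] by (simp add: zero_fun_def subset_iff)
  show "energy P (interior T) u v = 0"
    using energy_cong[of "interior T" u 0 v v] z zero_left[of v] assms(2) by simp
  show "energy P (interior T) v u = 0"
    using energy_cong[of "interior T" v v u 0] z zero_right[of v] assms(2) by simp
qed

lemma grad_form_zero_const:
  assumes w: "elementwise_constant P w" "\<forall>T\<in>mesh P. \<forall>x\<in>interior T. 0 < w x"
    and \<omega>: "elem_union P \<omega>" "u \<in> broken P \<omega>" "grad_form w \<omega> u u = 0"
    and T: "T \<in> els P \<omega>" "x \<in> T" "y \<in> T"
  shows "u x = u y"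
proof -
  have nn: "T \<in> els P \<omega> \<Longrightarrow> 0 \<le> grad_form w (interior T) u u" for T
    using psd_form.nonneg[OF psd_grad_form_element[OF w(1) els_mesh]] broken_fe_on[OF \<omega>(2)] by blast
  have z: "grad_form w (interior T) u u = 0"
    using \<omega>(3) T(1) nn unfolding grad_form_sum[OF w(1) \<omega>(1,2,2)] by (simp add: sum_nonneg_eq_0_iff finite_els)
  note Tm = els_mesh[OF T(1)] and Te = els_element[OF T(1)] and fe = broken_fe_on[OF \<omega>(2) T(1)]
  obtain G where G: "continuous_on T G" "\<And>x. x \<in> interior T \<Longrightarrow> grad u x = G x"
    using fe_on_grad[OF Te fe] by metis
  obtain a where a: "\<forall>x\<in>interior T. w x = a" using w(1) Tm unfolding elementwise_constant_def by blast
  have "w x * (grad u x \<bullet> grad u x) = 0" if x: "x \<in> interior T" for x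
  proof (rule continuous_integral_zero[OF open_interior _ _ _ _ x])
    have "continuous_on (interior T) (\<lambda>x. a * (G x \<bullet> G x))"
      using continuous_on_subset[OF G(1) interior_subset] by (intro continuous_intros)
    then show "continuous_on (interior T) (\<lambda>x. w x * (grad u x \<bullet> grad u x))"
      using a G(2) by (subst continuous_on_cong[OF refl]) auto
    show "set_integrable lebesgue (interior T) (\<lambda>x. w x * (grad u x \<bullet> grad u x))"
      by (rule grad_integrable[OF w(1) Tm fe fe])
    show "(LINT x:interior T|lebesgue. w x * (grad u x \<bullet> grad u x)) = 0"
      using z by (simp add: grad_form_def)
  qed (use w(2) Tm in \<open>simp add: less_imp_le\<close>)
  then have "grad u x = 0" if "x \<in> interior T" for x
    using w(2) Tm that by (metis inner_eq_zero_iff less_irrefl mult_eq_0_iff)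
  then show ?thesis using fe_on_zero_grad_const[OF Te fe] T by blast
qed

lemma alpha_ge: "T \<in> mesh P \<Longrightarrow> x \<in> interior T \<Longrightarrow> \<alpha>min \<le> alpha P x"
  using coefficient unfolding coefficient_ok_def by fastforce

text \<open>The function is constant on each element, so it takes finitely many values; a finite
  connected image has at most one point. No path through neighbouring elements has to be
  constructed.\<close>

lemma grad_form_zero_connected:
  assumes w: "elementwise_constant P w" "\<forall>T\<in>mesh P. \<forall>x\<in>interior T. 0 < w x"
    and \<omega>: "elem_union P \<omega>" "connected \<omega>" "u \<in> broken P \<omega>" "continuous_on (closure \<omega>) u" "grad_form w \<omega> u u = 0"
    and xy: "x \<in> closure \<omega>" "y \<in> closure \<omega>"
  shows "u x = u y"
proof -
  have "u ` closure \<omega> \<subseteq> (\<lambda>T. u (SOME x. x \<in> T)) ` els P \<omega>"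
  proof
    fix z assume "z \<in> u ` closure \<omega>"
    then obtain x where x: "x \<in> closure \<omega>" "z = u x" by blast
    then obtain T where T: "T \<in> els P \<omega>" "x \<in> T" using closure_elem_union[OF \<omega>(1)] by blast
    have "(SOME x. x \<in> T) \<in> T" using T(2) by (rule someI)
    then have "z = u (SOME x. x \<in> T)" using grad_form_zero_const[OF w \<omega>(1,3,5) T] x(2) by blast
    then show "z \<in> (\<lambda>T. u (SOME x. x \<in> T)) ` els P \<omega>" using T(1) by blast
  qed
  then have "finite (u ` closure \<omega>)" using finite_els finite_subset by blast
  moreover have "connected (u ` closure \<omega>)"
    using connected_continuous_image[OF \<omega>(4)] \<omega>(2) connected_imp_connected_closure by blast
  ultimately obtain a where "u ` closure \<omega> = {} \<or> u ` closure \<omega> = {a}"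
    using connected_finite_iff_sing by blast
  then show ?thesis using xy by (metis empty_iff image_eqI singletonD)
qed

section \<open>Zero-trace spaces inside the global space, and definiteness of the energy\<close>

lemma V0_iff: "v \<in> V0 P \<longleftrightarrow> v \<in> fe_space P \<and> (\<forall>x. x \<notin> Omega P \<longrightarrow> v x = 0)"
  using open_Omega by (auto simp: V0_def fe_space_iff frontier_def interior_open)

text \<open>Elements outside \<open>els P \<omega>\<close> miss \<open>\<omega>\<close>, so
  extension by zero stays a finite element function. Local test functions thereby become global
  ones.\<close>

lemma Vloc0_iff:
  assumes \<omega>: "elem_union P \<omega>"
  shows "v \<in> Vloc0 P \<omega> \<longleftrightarrow> v \<in> fe_space P \<and> (\<forall>x. x \<notin> \<omega> \<longrightarrow> v x = 0)"
proof
  assume "v \<in> Vloc0 P \<omega>"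
  then obtain v' where v': "v' \<in> fe_space P" "v = restr (closure \<omega>) v'" and z: "\<forall>x\<in>frontier \<omega>. v x = 0"
    by (auto simp: Vloc0_def Vloc_def)
  have out: "v x = 0" if "x \<notin> \<omega>" for x
  proof (cases "x \<in> closure \<omega>")
    case True
    then show ?thesis using z that elem_union_open[OF \<omega>] by (simp add: frontier_def interior_open)
  qed (simp add: v'(2) restr_def)
  have "fe_on T v" if T: "T \<in> mesh P" for T
  proof (cases "T \<in> els P \<omega>")
    case True
    have "v x = v' x" if "x \<in> T" for x using els_closure[OF True] that v'(2) by (auto simp: restr_def)
    then show ?thesis using fe_on_cong[OF mesh_element[OF T]] fe_space_fe_on[OF v'(1) T] by metis
  next
    case False
    then have "T \<inter> \<omega> = {}" using elem_union_meets[OF \<omega> T] by blast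
    then have "v x = 0 x" if "x \<in> T" for x
      using out[of x] that unfolding zero_fun_def by blast
    then show ?thesis using fe_on_cong[OF mesh_element[OF T], of v 0] fe_on_zero_fun[OF mesh_element[OF T]] by metis
  qed
  moreover have "v x = 0" if "x \<notin> closure (Omega P)" for x
    using out that elem_union_subset[OF \<omega>] closure_subset by blast
  ultimately show "v \<in> fe_space P \<and> (\<forall>x. x \<notin> \<omega> \<longrightarrow> v x = 0)"
    using out by (simp add: fe_space_iff)
next
  assume v: "v \<in> fe_space P \<and> (\<forall>x. x \<notin> \<omega> \<longrightarrow> v x = 0)"
  then have "v x = 0" if "x \<notin> closure \<omega>" for x
    using that closure_subset by blast
  then have "v = restr (closure \<omega>) v" unfolding restr_def fun_eq_iff by presburger
  then have "v \<in> Vloc P \<omega>" using v unfolding Vloc_def by blast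
  then show "v \<in> Vloc0 P \<omega>"
    using v elem_union_open[OF \<omega>] by (auto simp: Vloc0_def frontier_def interior_open)
qed

lemma Vloc0_subset_V0: "elem_union P \<omega> \<Longrightarrow> Vloc0 P \<omega> \<subseteq> V0 P"
  using Vloc0_iff V0_iff elem_union_subset by blast

lemma V0_eq_Vloc0: "V0 P = Vloc0 P (Omega P)"
  using V0_iff Vloc0_iff[OF elem_union_Omega] by blast

lemma fe_space_vanish:
  assumes A: "cellular P A" "open A" and v: "v \<in> fe_space P" "\<And>p. p \<in> nodes P \<Longrightarrow> p \<notin> A \<Longrightarrow> v p = 0"
    and x: "x \<notin> A"
  shows "v x = 0"
proof (cases "x \<in> closure (Omega P)")
  case True
  then obtain T where T: "T \<in> mesh P" "x \<in> T" using mesh_Union by blast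
  show ?thesis
    using vanish_outside[OF A T(1) fe_space_fe_on[OF v(1) T(1)] _ T(2) x] v(2) T(1) by (auto simp: nodes_def)
qed (use v fe_space_iff in blast)

text \<open>Links the definition by traces with the nodal restrictions and with the enumerations
  \<open>Ns\<close> of the Schwarz operator.\<close>

lemma Vloc0_nodes:
  assumes "elem_union P \<omega>"
  shows "v \<in> Vloc0 P \<omega> \<longleftrightarrow> v \<in> fe_space P \<and> (\<forall>p\<in>nodes P - \<omega>. v p = 0)"
  using Vloc0_iff[OF assms] fe_space_vanish[OF cellular_elem_union[OF assms] elem_union_open[OF assms]] by blast

lemma energy_Vloc0:
  assumes \<omega>: "elem_union P \<omega>" and v: "v \<in> Vloc0 P \<omega>" and w: "w \<in> fe_space P"
  shows "energy P (Omega P) v w = energy P \<omega> v w" "energy P (Omega P) w v = energy P \<omega> w v"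
proof -
  have vf: "v \<in> fe_space P" "\<And>x. x \<notin> \<omega> \<Longrightarrow> v x = 0" using v Vloc0_iff[OF \<omega>] by auto
  have z: "v x = 0" if "T \<in> mesh P - els P \<omega>" "x \<in> T" for T x
    using elem_union_meets[OF \<omega>, of T] that vf(2) by blast
  have br: "v \<in> broken P A" "w \<in> broken P A" for A
    using vf(1) w fe_space_broken by auto
  have e: "energy P (interior T) v w = 0" "energy P (interior T) w v = 0" if "T \<in> mesh P - els P \<omega>" for T
    using energy_element_zero[of T w v] z[OF that] fe_space_fe_on[OF w] that by auto
  show "energy P (Omega P) v w = energy P \<omega> v w" "energy P (Omega P) w v = energy P \<omega> w v"
    unfolding energy_sum[OF elem_union_Omega br] energy_sum[OF \<omega> br]
      energy_sum[OF elem_union_Omega br(2,1)] energy_sum[OF \<omega> br(2,1)] els_Omega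
    by (rule sum.mono_neutral_right; use finite_mesh els_subset e in auto)+
qed

text \<open>Zero energy forces a constant on the connected closure, and a bounded nonempty domain
  has a boundary point, where this constant is 0.\<close>

lemma energy_V0_definite:
  assumes v: "v \<in> V0 P" "energy P (Omega P) v v = 0"
  shows "v = 0"
proof
  fix x
  have vf: "v \<in> fe_space P" "\<And>x. x \<notin> Omega P \<Longrightarrow> v x = 0" using v V0_iff by auto
  have "frontier (Omega P) \<noteq> {}"
    using frontier_eq_empty[of "Omega P"] Omega_nonempty bounded_Omega not_bounded_UNIV by metis
  then obtain y where y: "y \<in> frontier (Omega P)" by blast
  then have y': "y \<in> closure (Omega P)" "v y = 0"
    using vf(2) open_Omega by (auto simp: frontier_def interior_open)
  have pos: "\<forall>T\<in>mesh P. \<forall>x\<in>interior T. 0 < alpha P x"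
    using alpha_ge alpha_min_pos by (meson less_le_trans)
  show "v x = 0 x"
  proof (cases "x \<in> closure (Omega P)")
    case True
    have "v x = v y"
      using grad_form_zero_connected[OF elementwise_constant_alpha pos elem_union_Omega connected_Omega _
          fe_space_continuous[OF vf(1)] _ True y'(1)] v(2) vf(1) fe_space_broken
      unfolding energy_grad_form by blast
    then show ?thesis using y'(2) by simp
  next
    case False
    then have "x \<notin> Omega P" using closure_subset by blast
    then show ?thesis using vf(2) by (simp add: zero_fun_def)
  qed
qed

lemma finite_dim_fe_space: "\<exists>B. finite B \<and> span B = V" if "subspace V" "V \<subseteq> fe_space P" for V
proof -
  obtain B where B: "B \<subseteq> V" "independent B" "V \<subseteq> span B" by (rule basis_exists[of V])
  then have "span B = V" using span_subspace[OF B(1,3) that(1)] by simp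
  have "finite B"
    using independent_span_bound[of "hat P ` nodes P" B] finite_nodes B(1,2) that fe_space_span by blast
  then show ?thesis using \<open>span B = V\<close> by blast
qed

end

section \<open>Which subdomains meet at a point, and the structure of the interface\<close>

section \<open>The interface and its edges\<close>

locale fe_decomposition = fe_mesh +
  assumes nonoverlapping: "nonoverlapping_decomposition P"
    and overlapping: "overlapping_decomposition P"
    and oversampling: "oversampling_domains P"
begin

abbreviation subs :: "nat set" where "subs \<equiv> {1..nsub P}"

abbreviation skeleton_complement :: "pt set" where "skeleton_complement \<equiv> (\<Union>i\<in>subs. sub P i)"

lemma sub_elem_union: "i \<in> subs \<Longrightarrow> elem_union P (sub P i)"
  and sub_disjoint: "i \<in> subs \<Longrightarrow> j \<in> subs \<Longrightarrow> i \<noteq> j \<Longrightarrow> sub P i \<inter> sub P j = {}"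
  and closure_Omega_subs: "closure (Omega P) = (\<Union>i\<in>subs. closure (sub P i))"
  using nonoverlapping unfolding nonoverlapping_decomposition_def by blast+

lemma osub_elem_union: "i \<in> subs \<Longrightarrow> elem_union P (osub P i)"
  and osub_touching: "i \<in> subs \<Longrightarrow> T \<in> mesh P \<Longrightarrow> T \<inter> closure (sub P i) \<noteq> {} \<Longrightarrow> T \<subseteq> closure (osub P i)"
  using overlapping unfolding overlapping_decomposition_def by blast+

lemma sub_open: "i \<in> subs \<Longrightarrow> open (sub P i)"
  using sub_elem_union elem_union_open by blast

lemma els_sub_exists:
  assumes "T \<in> mesh P"
  shows "\<exists>i\<in>subs. T \<in> els P (sub P i)"
proof -
  obtain x where x: "x \<in> interior T" using element_interior_nonempty[OF mesh_element[OF assms]] by blast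
  then have "x \<in> closure (Omega P)" using assms mesh_Union interior_subset by blast
  then obtain i where i: "i \<in> subs" "x \<in> closure (sub P i)" using closure_Omega_subs by blast
  then obtain T' where T': "T' \<in> els P (sub P i)" "x \<in> T'" using closure_elem_union[OF sub_elem_union] by blast
  then have "T = T'" using mesh_interior_unique[OF assms els_mesh x] by blast
  then show ?thesis using i T' by blast
qed

lemma els_sub_unique:
  assumes "T \<in> els P (sub P i)" "T \<in> els P (sub P j)" "i \<in> subs" "j \<in> subs"
  shows "i = j"
proof (rule ccontr)
  assume "i \<noteq> j"
  then have "interior T \<subseteq> {}" using sub_disjoint[OF assms(3,4)] assms(1,2) by (auto simp: els_def)
  then show False using element_interior_nonempty[OF els_element[OF assms(1)]] by blast
qed

lemma closure_sub_meets: "i \<in> subs \<Longrightarrow> j \<in> subs \<Longrightarrow> x \<in> closure (sub P i) \<Longrightarrow> x \<in> sub P j \<Longrightarrow> i = j"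
  using sub_disjoint[of i j] open_Int_closure_eq_empty[OF sub_open[of j], of "sub P i"] by blast

lemma frontier_sub: "i \<in> subs \<Longrightarrow> frontier (sub P i) = closure (sub P i) - sub P i"
  using sub_open by (simp add: frontier_def interior_open)

lemma frontier_Omega: "frontier (Omega P) = closure (Omega P) - Omega P"
  using open_Omega by (simp add: frontier_def interior_open)

lemma closure_sub_subset: "i \<in> subs \<Longrightarrow> closure (sub P i) \<subseteq> closure (Omega P)"
  using closure_Omega_subs by blast

text \<open>If all elements at \<open>x\<close> belonged to one subdomain, \<open>x\<close> would be
  interior to it; so some element at \<open>x\<close> belongs to another one.\<close>

lemma two_subs_at:
  assumes x: "x \<in> Omega P" "x \<notin> skeleton_complement"
  shows "\<exists>i\<in>subs. \<exists>j\<in>subs. i \<noteq> j \<and> x \<in> closure (sub P i) \<and> x \<in> closure (sub P j)"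
proof -
  have "x \<in> closure (Omega P)" using x closure_subset by blast
  then obtain i where i: "i \<in> subs" "x \<in> closure (sub P i)" using closure_Omega_subs by blast
  obtain T where T: "T \<in> mesh P" "x \<in> T" "T \<notin> els P (sub P i)"
    using elem_union_local[OF sub_elem_union[OF i(1)] x(1)] x(2) i(1) by blast
  obtain j where j: "j \<in> subs" "T \<in> els P (sub P j)" using els_sub_exists[OF T(1)] by blast
  then have "x \<in> closure (sub P j)" using els_closure T(2) by blast
  moreover have "i \<noteq> j" using T(3) j(2) by blast
  ultimately show ?thesis using i j(1) by blast
qed

text \<open>In this form the interface is the domain minus an open cellular set, so
  \<open>fe_space_vanish\<close> applies: a function in \<open>V0 P\<close> that is zero at the
  interface nodes is zero on the interface.\<close>

lemma interface_eq: "interface P = Omega P - skeleton_complement"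
proof (intro equalityI subsetI)
  fix x assume "x \<in> interface P"
  then obtain i j where ij: "i \<in> subs" "j \<in> subs" "i \<noteq> j" "x \<in> frontier (sub P i)" "x \<in> frontier (sub P j)"
    and nf: "x \<notin> frontier (Omega P)" unfolding interface_def by blast
  have c: "x \<in> closure (sub P i)" "x \<in> closure (sub P j)" using ij frontier_sub by auto
  have "x \<in> Omega P" using c(1) closure_sub_subset[OF ij(1)] nf unfolding frontier_Omega by blast
  moreover have "x \<notin> sub P k" if "k \<in> subs" for k
    using closure_sub_meets[OF ij(1) that c(1)] closure_sub_meets[OF ij(2) that c(2)] ij(3) by blast
  ultimately show "x \<in> Omega P - skeleton_complement" by blast
next
  fix x assume x: "x \<in> Omega P - skeleton_complement"
  then obtain i j where ij: "i \<in> subs" "j \<in> subs" "i \<noteq> j" "x \<in> closure (sub P i)" "x \<in> closure (sub P j)"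
    using two_subs_at by (metis DiffE)
  then have "x \<in> frontier (sub P i)" "x \<in> frontier (sub P j)" using x frontier_sub by blast+
  moreover have "x \<notin> frontier (Omega P)" using x unfolding frontier_Omega by blast
  ultimately show "x \<in> interface P" using ij unfolding interface_def by blast
qed

lemma cellular_skeleton_complement: "cellular P skeleton_complement" "open skeleton_complement"
  using sub_elem_union cellular_elem_union sub_open by (intro cellular_UN open_UN; blast)+

lemma interface_subset: "interface P \<subseteq> Omega P"
  using interface_eq by blast

lemma interior_not_interface: "T \<in> mesh P \<Longrightarrow> x \<in> interior T \<Longrightarrow> x \<notin> interface P"
  using els_sub_exists[of T] unfolding interface_eq els_def by blast

lemma cellular_segment:
  "cellular P A \<Longrightarrow> T \<in> mesh P \<Longrightarrow> closed_segment p q edge_of T \<Longrightarrow> x \<in> open_segment p q \<Longrightarrow> x \<in> A \<Longrightarrow>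
    open_segment p q \<subseteq> A"
  using conjunct2[OF cellular_def[THEN iffD1], rule_format, of P A T p q] by blast

lemma interface_segment:
  assumes "T \<in> mesh P" "closed_segment p q edge_of T" "x \<in> open_segment p q" "x \<in> interface P"
  shows "open_segment p q \<subseteq> interface P"
proof -
  have "open_segment p q \<subseteq> Omega P"
    using cellular_segment[OF cellular_elem_union[OF elem_union_Omega] assms(1-3)] assms(4) interface_subset by blast
  moreover have "open_segment p q \<inter> skeleton_complement = {}"
    using cellular_segment[OF cellular_skeleton_complement(1) assms(1,2)] assms(3,4) unfolding interface_eq by blast
  ultimately show ?thesis unfolding interface_eq by blast
qed

lemma segment_not_node:
  assumes "T \<in> mesh P" "closed_segment p q edge_of T" "x \<in> open_segment p q"
  shows "x \<notin> nodes P"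
proof
  assume "x \<in> nodes P"
  have s: "closed_segment p q \<subseteq> T" using assms(2) by (auto simp: edge_of_def dest: face_of_imp_subset)
  then have "x \<in> T" using assms(3) open_closed_segment by blast
  then have "x extreme_point_of T" using node_extreme[OF \<open>x \<in> nodes P\<close> assms(1)] by blast
  moreover have "p \<in> T" "q \<in> T" using s by auto
  ultimately show False using assms(3) by (auto simp: extreme_point_of_def)
qed

lemma interface_cases:
  assumes "x \<in> interface P"
  obtains (node) "x \<in> nodes P" | (segment) T p q where "T \<in> mesh P" "closed_segment p q edge_of T" "x \<in> open_segment p q"
proof -
  have "x \<in> closure (Omega P)" using assms interface_subset closure_subset by blast
  then obtain T where T: "T \<in> mesh P" "x \<in> T" using mesh_Union by blast
  show ?thesis
  proof (cases rule: element_cases[OF mesh_element[OF T(1)] T(2)])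
    case 1
    then show ?thesis using interior_not_interface[OF T(1)] assms by blast
  next
    case 2
    then show ?thesis using node T(1) unfolding nodes_def by blast
  next
    case (3 p q)
    then show ?thesis using segment T(1) by blast
  qed
qed

lemma subs_at_subset: "subs_at P x \<subseteq> subs" and finite_subs_at: "finite (subs_at P x)"
  by (auto simp: subs_at_def)

lemma card_subs_at_ge: "x \<in> interface P \<Longrightarrow> 2 \<le> card (subs_at P x)"
proof -
  assume "x \<in> interface P"
  then obtain i j where ij: "i \<in> subs" "j \<in> subs" "i \<noteq> j" "x \<in> closure (sub P i)" "x \<in> closure (sub P j)"
    using two_subs_at unfolding interface_eq by (metis DiffE)
  then have "{i, j} \<subseteq> subs_at P x" by (auto simp: subs_at_def)
  then have "card {i, j} \<le> card (subs_at P x)" by (rule card_mono[OF finite_subs_at])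
  then show ?thesis using ij(3) by simp
qed

lemma subs_at_element:
  assumes "i \<in> subs_at P x"
  obtains T where "T \<in> els P (sub P i)" "x \<in> T"
  using assms closure_elem_union[OF sub_elem_union] by (auto simp: subs_at_def)

text \<open>At a node the bound is the definition of a vertex. Any other interface point lies on an
  open side, where each subdomain at the point contributes an element having that side, and there
  are at most two of these.\<close>

lemma card_subs_at:
  assumes x: "x \<in> interface P - vertices P"
  shows "card (subs_at P x) = 2"
proof -
  have xi: "x \<in> interface P" using x by blast
  have "card (subs_at P x) \<le> 2"
  proof (cases rule: interface_cases[OF xi])
    case 1
    then show ?thesis using x by (auto simp: vertices_def)
  next
    case (2 T p q)
    define E where "E = {T \<in> mesh P. closed_segment p q edge_of T}"
    define f where "f T = (SOME i. i \<in> subs \<and> T \<in> els P (sub P i))" for T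
    have "subs_at P x \<subseteq> f ` E"
    proof
      fix i assume i: "i \<in> subs_at P x"
      obtain T' where T': "T' \<in> els P (sub P i)" "x \<in> T'" using subs_at_element[OF i] .
      have iI: "i \<in> subs" using i subs_at_subset by blast
      have "T' \<in> E" using mesh_edge[OF 2(1) els_mesh[OF T'(1)] 2(2,3) T'(2)] els_mesh[OF T'(1)] by (simp add: E_def)
      moreover have "f T' \<in> subs \<and> T' \<in> els P (sub P (f T'))"
        unfolding f_def by (rule someI[of _ i]) (use iI T'(1) in blast)
      then have "f T' = i" using els_sub_unique T'(1) iI by blast
      ultimately show "i \<in> f ` E" by blast
    qed
    moreover have "finite E" using finite_mesh by (simp add: E_def)
    ultimately have "card (subs_at P x) \<le> card E" using surj_card_le by blast
    then show ?thesis using card_edge_elements[of p q] unfolding E_def by linarith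
  qed
  then show ?thesis using card_subs_at_ge[OF xi] by linarith
qed

text \<open>Closures that miss \<open>x\<close> also miss a neighbourhood, so the set can only
  shrink nearby; both cardinalities being 2, it does not.\<close>

lemma subs_at_locally_constant:
  assumes x: "x \<in> interface P - vertices P"
  shows "eventually (\<lambda>y. subs_at P x = subs_at P y) (at x within (interface P - vertices P))"
proof -
  let ?C = "\<Union>i\<in>subs - subs_at P x. closure (sub P i)"
  have "closed ?C" by auto
  moreover have "x \<notin> ?C" by (auto simp: subs_at_def)
  ultimately have "eventually (\<lambda>y. y \<in> - ?C) (nhds x)" by (intro eventually_nhds_in_open) auto
  then have "eventually (\<lambda>y. y \<in> - ?C) (at x within (interface P - vertices P))"
    by (simp add: eventually_at_filter eventually_mono)
  moreover have "eventually (\<lambda>y. y \<in> interface P - vertices P) (at x within (interface P - vertices P))"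
    by (simp add: eventually_at_filter)
  ultimately show ?thesis
  proof eventually_elim
    case (elim y)
    then have "subs_at P y \<subseteq> subs_at P x" by (auto simp: subs_at_def)
    then show ?case
      using card_subs_at[OF x] card_subs_at[OF elim(2)] by (metis card_subset_eq finite_subs_at)
  qed
qed

section \<open>Edges as connected components: cells, endpoints, adjacent subdomains\<close>

lemma edge_subset: "e \<in> edges P \<Longrightarrow> e \<subseteq> interface P - vertices P"
  unfolding edges_def using in_components_subset by blast

lemma edge_nonempty: "e \<in> edges P \<Longrightarrow> e \<noteq> {}"
  unfolding edges_def using in_components_nonempty by blast

lemma edges_disjoint: "e \<in> edges P \<Longrightarrow> e' \<in> edges P \<Longrightarrow> x \<in> e \<Longrightarrow> x \<in> e' \<Longrightarrow> e = e'"
  unfolding edges_def using components_eq by blast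

lemma edge_exists: "x \<in> interface P - vertices P \<Longrightarrow> \<exists>e\<in>edges P. x \<in> e"
  unfolding edges_def by (metis Union_components UnionE)

text \<open>A locally constant map is constant on a connected set.\<close>

lemma subs_at_edge:
  assumes "e \<in> edges P" "x \<in> e" "y \<in> e"
  shows "subs_at P x = subs_at P y"
proof (rule connected_local_const[where f = "subs_at P" and A = e])
  show "connected e" using assms(1) in_components_connected unfolding edges_def by blast
  show "\<forall>a\<in>e. \<forall>\<^sub>F b in at a within e. subs_at P a = subs_at P b"
    using subs_at_locally_constant edge_subset[OF assms(1)] at_le[OF edge_subset[OF assms(1)]]
    by (meson filter_leD subsetD)
qed (use assms in auto)

lemma edge_segment:
  assumes e: "e \<in> edges P" and T: "T \<in> mesh P" "closed_segment p q edge_of T" and x: "x \<in> open_segment p q" "x \<in> e"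
  shows "open_segment p q \<subseteq> e"
proof -
  have "open_segment p q \<subseteq> interface P"
    using interface_segment[OF T x(1)] x(2) edge_subset[OF e] by blast
  moreover have "open_segment p q \<inter> vertices P = {}"
    using segment_not_node[OF T] by (auto simp: vertices_def)
  ultimately have "open_segment p q \<subseteq> interface P - vertices P" by blast
  then show ?thesis
    using components_maximal[of e "interface P - vertices P" "open_segment p q"] e x
    by (auto simp: edges_def convex_connected)
qed

lemma edge_cell:
  assumes e: "e \<in> edges P" and x: "x \<in> e"
  obtains (node) "x \<in> nodes P" | (segment) p q where "p \<in> nodes P" "q \<in> nodes P" "x \<in> open_segment p q" "open_segment p q \<subseteq> e"
proof -
  have xi: "x \<in> interface P" using e x edge_subset by blast
  show ?thesis
  proof (cases rule: interface_cases[OF xi])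
    case (2 T p q)
    have "p \<in> nodes P" "q \<in> nodes P" using edge_endpoints[OF 2(2)] 2(1) by (auto simp: nodes_def)
    then show ?thesis using edge_segment[OF e 2 x] segment 2(3) by blast
  qed (use node in blast)
qed

text \<open>Each edge contains a node or an open segment between two nodes. These cells are finitely
  many, and disjointness of the edges makes the cell determine the edge.\<close>

lemma finite_edges: "finite (edges P)"
proof -
  define C where "C = (\<lambda>x. {x}) ` nodes P \<union> (\<lambda>(p, q). open_segment p q) ` (nodes P \<times> nodes P)"
  define g where "g c = (SOME e. e \<in> edges P \<and> c \<inter> e \<noteq> {})" for c
  have "edges P \<subseteq> g ` C"
  proof
    fix e assume e: "e \<in> edges P"
    then obtain x where x: "x \<in> e" using edge_nonempty by blast
    have "\<exists>c\<in>C. x \<in> c \<and> c \<subseteq> e"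
    proof (cases rule: edge_cell[OF e x])
      case 1
      then show ?thesis using x by (auto simp: C_def)
    next
      case (2 p q)
      then have "open_segment p q \<in> C" unfolding C_def by auto
      then show ?thesis using 2 by blast
    qed
    then obtain c where c: "c \<in> C" "x \<in> c" "c \<subseteq> e" by blast
    have "g c \<in> edges P \<and> c \<inter> g c \<noteq> {}" unfolding g_def by (rule someI[of _ e]) (use e c x in blast)
    then have "g c = e" using c(3) edges_disjoint e by blast
    then show "e \<in> g ` C" using c(1) by blast
  qed
  moreover have "finite C" using finite_nodes by (simp add: C_def)
  ultimately show ?thesis using finite_subset by blast
qed

text \<open>The closure stays in a finite union of closed segments and nodes, so only nodes can be
  added. Thus interpolation sees the values at the endpoints.\<close>

lemma edge_closure_nodes:
  assumes e: "e \<in> edges P"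
  shows "closure e - e \<subseteq> nodes P"
proof -
  define Q where "Q = {(p, q) \<in> nodes P \<times> nodes P. open_segment p q \<subseteq> e}"
  define Z where "Z = (\<Union>(p, q)\<in>Q. closed_segment p q) \<union> nodes P"
  have "finite Q" 
    by (rule finite_subset[of _ "nodes P \<times> nodes P"]) (auto simp: Q_def finite_nodes)
  then have "closed (\<Union>(p, q)\<in>Q. closed_segment p q)"
    by (rule closed_UN) (simp add: case_prod_beta)
  then have "closed Z"
    unfolding Z_def using finite_imp_closed[OF finite_nodes] by (rule closed_Un)
  moreover have "e \<subseteq> Z"
  proof
    fix x assume x: "x \<in> e"
    show "x \<in> Z"
    proof (cases rule: edge_cell[OF e x])
      case (2 p q)
      then have "(p, q) \<in> Q" "x \<in> closed_segment p q" using open_closed_segment by (auto simp: Q_def)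
      then show ?thesis unfolding Z_def by blast
    qed (simp add: Z_def)
  qed
  ultimately have "closure e \<subseteq> Z" by (simp add: closure_minimal)
  moreover have "x \<in> nodes P" if x: "x \<in> Z" "x \<notin> e" for x
  proof (cases "x \<in> nodes P")
    case False
    then obtain p q where pq: "(p, q) \<in> Q" "x \<in> closed_segment p q" using x(1) unfolding Z_def by blast
    have "x \<notin> open_segment p q" using pq(1) x(2) by (auto simp: Q_def)
    then have "x = p \<or> x = q" using pq(2) by (auto simp: open_segment_def)
    then show ?thesis using pq(1) by (auto simp: Q_def)
  qed
  ultimately show ?thesis by blast
qed

lemma esub_elem_union: "e \<in> edges P \<Longrightarrow> elem_union P (esub P e)"
  and esub_connected: "e \<in> edges P \<Longrightarrow> connected (esub P e)"
  and esub_nonempty: "e \<in> edges P \<Longrightarrow> esub P e \<noteq> {}"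
  and closure_edge_esub: "e \<in> edges P \<Longrightarrow> closure e \<subseteq> closure (esub P e)"
  using oversampling unfolding oversampling_domains_def by blast+

lemma esub_open: "e \<in> edges P \<Longrightarrow> open (esub P e)"
  using esub_elem_union elem_union_open by blast

lemma frontier_esub: "e \<in> edges P \<Longrightarrow> frontier (esub P e) = closure (esub P e) - esub P e"
  using esub_open by (simp add: frontier_def interior_open)

lemma edge_subset_Omega: "e \<in> edges P \<Longrightarrow> e \<subseteq> Omega P"
  using edge_subset interface_subset by blast

text \<open>The distance \<open>\<upsilon>\<close> keeps the edge off the frontier inside the
  domain, and the edge lies in the open domain, so it avoids the rest of the frontier too.\<close>

lemma edge_subset_esub:
  assumes e: "e \<in> edges P"
  shows "e \<subseteq> esub P e"
proof
  fix x assume x: "x \<in> e"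
  obtain \<upsilon> where \<upsilon>: "\<upsilon> > 0" "\<forall>x\<in>frontier (esub P e) - frontier (Omega P). \<forall>y\<in>closure e. \<upsilon> \<le> dist x y"
    using oversampling e unfolding oversampling_domains_def by blast
  show "x \<in> esub P e"
  proof (rule ccontr)
    assume "x \<notin> esub P e"
    then have "x \<in> frontier (esub P e)"
      using x closure_edge_esub[OF e] closure_subset frontier_esub[OF e] by blast
    moreover have "x \<notin> frontier (Omega P)" using x edge_subset_Omega[OF e] by (auto simp: frontier_Omega)
    moreover have "x \<in> closure e" using x closure_subset by blast
    ultimately have "\<upsilon> \<le> dist x x" using \<upsilon>(2) by blast
    then show False using \<upsilon>(1) by simp
  qed
qed

text \<open>Since \<open>subs_at\<close> is constant along an edge, touching at one point means
  lying on the boundary as a whole. This reconciles \<open>max_edges\<close>, which counts edges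
  inside a boundary, with counts by nodes of an edge.\<close>

lemma edge_sub_frontier:
  assumes e: "e \<in> edges P" and i: "i \<in> subs" and x: "x \<in> e" "x \<in> closure (sub P i)"
  shows "closure e \<subseteq> frontier (sub P i)"
proof -
  have "y \<in> frontier (sub P i)" if y: "y \<in> e" for y
  proof -
    have "i \<in> subs_at P y" using subs_at_edge[OF e x(1) y] i x(2) by (auto simp: subs_at_def)
    moreover have "y \<notin> sub P i" using y edge_subset[OF e] i by (auto simp: interface_eq)
    ultimately show ?thesis using frontier_sub[OF i] by (auto simp: subs_at_def)
  qed
  then show ?thesis by (simp add: closure_minimal subsetI)
qed

section \<open>Orthogonality, existence and uniqueness for the energy-minimizing extension\<close>

section \<open>Discrete harmonic extension from the interface\<close>

lemma els_partition: "mesh P = (\<Union>i\<in>subs. els P (sub P i))"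
  using els_sub_exists els_subset by blast

lemma energy_subs:
  assumes "u \<in> fe_space P" "v \<in> fe_space P"
  shows "energy P (Omega P) u v = (\<Sum>i\<in>subs. energy P (sub P i) u v)"
proof -
  have b: "u \<in> broken P \<omega>" "v \<in> broken P \<omega>" for \<omega> using assms fe_space_broken by auto
  have "energy P (Omega P) u v = (\<Sum>T\<in>(\<Union>i\<in>subs. els P (sub P i)). energy P (interior T) u v)"
    using energy_sum[OF elem_union_Omega b] els_Omega els_partition by simp
  also have "\<dots> = (\<Sum>i\<in>subs. \<Sum>T\<in>els P (sub P i). energy P (interior T) u v)"
    by (rule sum.UNION_disjoint) (use finite_els els_sub_unique in auto)
  also have "\<dots> = (\<Sum>i\<in>subs. energy P (sub P i) u v)"
    by (rule sum.cong[OF refl]) (use energy_sum[OF sub_elem_union b] in simp)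
  finally show ?thesis .
qed

text \<open>The range of \<open>ext_interface\<close> on admissible traces; as a linear condition it
  replaces reasoning about \<open>THE\<close>.\<close>

definition harmonic :: "scalar_fun \<Rightarrow> bool"
  where "harmonic v \<longleftrightarrow> v \<in> V0 P \<and> (\<forall>i\<in>subs. \<forall>w\<in>Vloc0 P (sub P i). energy P (sub P i) v w = 0)"

lemma V0_fe_space: "v \<in> V0 P \<Longrightarrow> v \<in> fe_space P"
  by (simp add: V0_iff)

lemma subspace_V0: "subspace (V0 P)"
  using subspace_fe_space unfolding subspace_def by (simp add: V0_iff)

lemma psd_energy_fe: "elem_union P \<omega> \<Longrightarrow> psd_form (fe_space P) (energy P \<omega>)"
  using psd_form.subform[OF psd_energy subspace_fe_space fe_space_broken] .

text \<open>The boundary of a subdomain consists of points of the interface and of the outer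
  boundary, and \<open>w\<close> vanishes on both.\<close>

lemma Vloc0_sub_zero_trace:
  assumes w: "w \<in> V0 P" "\<And>x. x \<in> interface P \<Longrightarrow> w x = 0" and i: "i \<in> subs"
  shows "restr (closure (sub P i)) w \<in> Vloc0 P (sub P i)"
proof -
  have "w x = 0" if "x \<in> frontier (sub P i)" for x
  proof (cases "x \<in> Omega P")
    case True
    have "x \<notin> skeleton_complement"
      using that closure_sub_meets[OF i, of _ x] frontier_sub[OF i] by blast
    then show ?thesis using True w(2) by (simp add: interface_eq)
  qed (use w(1) V0_iff in blast)
  then show ?thesis
    using w(1) V0_fe_space by (auto simp: Vloc0_def Vloc_def restr_def)
qed

text \<open>A function with zero interface trace restricts to an admissible test function on each
  subdomain; the global statement is the sum.\<close>

lemma harmonic_orthogonal: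
  assumes v: "harmonic v" and w: "w \<in> V0 P" "\<And>x. x \<in> interface P \<Longrightarrow> w x = 0"
  shows "i \<in> subs \<Longrightarrow> energy P (sub P i) v w = 0" "energy P (Omega P) v w = 0"
proof -
  show i: "energy P (sub P i) v w = 0" if i: "i \<in> subs" for i
  proof -
    have "energy P (sub P i) v w = energy P (sub P i) v (restr (closure (sub P i)) w)"
      using closure_subset by (intro energy_cong sub_open i) (auto simp: restr_def)
    then show ?thesis using v Vloc0_sub_zero_trace[OF w i] i by (simp add: harmonic_def)
  qed
  have "v \<in> fe_space P" using v by (simp add: harmonic_def V0_iff)
  then show "energy P (Omega P) v w = 0"
    using energy_subs[of v w] w(1) V0_fe_space i by simp
qed

lemma harmonic_lincomb:
  assumes "harmonic u" "harmonic v"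
  shows "harmonic (c *\<^sub>R u + v)"
  unfolding harmonic_def
proof (intro conjI ballI)
  show "c *\<^sub>R u + v \<in> V0 P"
    using assms subspace_V0 by (simp add: harmonic_def subspace_add subspace_scale)
  fix i w assume i: "i \<in> subs" "w \<in> Vloc0 P (sub P i)"
  interpret psd_form "fe_space P" "energy P (sub P i)" by (rule psd_energy_fe[OF sub_elem_union[OF i(1)]])
  have "w \<in> fe_space P" using i Vloc0_iff[OF sub_elem_union] by blast
  then show "energy P (sub P i) (c *\<^sub>R u + v) w = 0"
    using assms i by (simp add: harmonic_def V0_fe_space lin)
qed

lemma harmonic_unique:
  assumes "harmonic u" "harmonic v" "\<And>x. x \<in> interface P \<Longrightarrow> u x = v x"
  shows "u = v"
proof -
  have h: "harmonic (u - v)" using harmonic_lincomb[OF assms(2,1), of "-1"] by simp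
  then have "u - v \<in> V0 P" by (simp add: harmonic_def)
  moreover have "energy P (Omega P) (u - v) (u - v) = 0"
    using harmonic_orthogonal(2)[OF h, of "u - v"] assms(3) h by (simp add: harmonic_def)
  ultimately show ?thesis using energy_V0_definite by fastforce
qed

text \<open>One global projection onto the functions vanishing on the interface suffices: a test
  function of a single subdomain, extended by zero, is among them.\<close>

lemma harmonic_exists:
  assumes v: "v \<in> V0 P"
  shows "\<exists>u. harmonic u \<and> (\<forall>x\<in>interface P. u x = v x)"
proof -
  define W where "W = {w \<in> V0 P. \<forall>x\<in>interface P. w x = 0}"
  have "subspace W" using subspace_V0 unfolding W_def subspace_def by auto
  moreover have "W \<subseteq> fe_space P" using V0_fe_space by (auto simp: W_def)
  ultimately obtain B where B: "finite B" "span B = W" using finite_dim_fe_space by blast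
  interpret psd_form "fe_space P" "energy P (Omega P)" by (rule psd_energy_fe[OF elem_union_Omega])
  have "B \<subseteq> fe_space P" using B \<open>W \<subseteq> fe_space P\<close> span_superset by blast
  then obtain w where w: "w \<in> W" "\<forall>z\<in>W. energy P (Omega P) (v - w) z = 0"
    using projection_exists[OF B(1), of v] v V0_fe_space unfolding B(2) by blast
  have wV: "w \<in> V0 P" "\<forall>x\<in>interface P. w x = 0" using w(1) by (auto simp: W_def)
  have vw: "v - w \<in> V0 P" using v wV subspace_V0 by (simp add: subspace_diff)
  have "energy P (sub P i) (v - w) z = 0" if i: "i \<in> subs" and z: "z \<in> Vloc0 P (sub P i)" for i z
  proof -
    have "z \<in> V0 P" using z Vloc0_subset_V0[OF sub_elem_union[OF i]] by blast
    moreover have "z x = 0" if "x \<in> interface P" for x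
      using z Vloc0_iff[OF sub_elem_union[OF i]] that i unfolding interface_eq by blast
    ultimately have "energy P (Omega P) (v - w) z = 0" using w(2) by (auto simp: W_def)
    then show ?thesis using energy_Vloc0(2)[OF sub_elem_union[OF i] z] vw V0_fe_space by metis
  qed
  then have "harmonic (v - w)" using vw by (simp add: harmonic_def)
  moreover have "\<forall>x\<in>interface P. (v - w) x = v x" using wV by simp
  ultimately show ?thesis by blast
qed

lemma ext_interface_harmonic:
  assumes "v \<in> V0 P" "\<And>x. x \<in> interface P \<Longrightarrow> g x = v x"
  shows "harmonic (ext_interface P g)" "x \<in> interface P \<Longrightarrow> ext_interface P g x = v x"
proof -
  have "\<exists>!u. harmonic u \<and> (\<forall>x\<in>interface P. u x = g x)"
    using harmonic_exists[OF assms(1)] assms(2) harmonic_unique by (metis (no_types, lifting))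
  moreover have "ext_interface P g = (THE u. harmonic u \<and> (\<forall>x\<in>interface P. u x = g x))"
    unfolding ext_interface_def harmonic_def by (rule arg_cong[where f = The]) auto
  ultimately have "harmonic (ext_interface P g) \<and> (\<forall>x\<in>interface P. ext_interface P g x = g x)"
    using theI'[of "\<lambda>u. harmonic u \<and> (\<forall>x\<in>interface P. u x = g x)"] by simp
  then show "harmonic (ext_interface P g)" "x \<in> interface P \<Longrightarrow> ext_interface P g x = v x"
    using assms(2) by auto
qed

lemma ext_interface_eqI:
  assumes "harmonic u" "\<And>x. x \<in> interface P \<Longrightarrow> u x = g x"
  shows "ext_interface P g = u"
proof -
  have "u \<in> V0 P" using assms(1) by (simp add: harmonic_def)
  then show ?thesis
    using ext_interface_harmonic[of u g] assms by (intro harmonic_unique) auto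
qed

lemma eq_on_interface:
  assumes "u \<in> V0 P" "v \<in> V0 P" "\<And>x. x \<in> nodes P \<Longrightarrow> x \<in> interface P \<Longrightarrow> u x = v x" and x: "x \<in> interface P"
  shows "u x = v x"
proof -
  have d: "u - v \<in> V0 P" using assms subspace_V0 by (simp add: subspace_diff)
  have "(u - v) x = 0"
  proof (rule fe_space_vanish[OF cellular_skeleton_complement V0_fe_space[OF d]])
    fix p assume p: "p \<in> nodes P" "p \<notin> skeleton_complement"
    show "(u - v) p = 0"
    proof (cases "p \<in> Omega P")
      case True
      then show ?thesis using p assms(3) by (simp add: interface_eq)
    next
      case False
      then show ?thesis using d by (simp add: V0_iff)
    qed
  qed (use x interface_eq in blast)
  then show ?thesis by simp
qed

text \<open>The finite element function common to \<open>ext_edge_interface\<close> and, for zero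
  endpoint values, \<open>ext_edge_esub\<close>. It turns \<open>bform\<close> into the global
  energy of a function in \<open>V0 P\<close>.\<close>

definition edge_fun :: "pt set \<Rightarrow> scalar_fun \<Rightarrow> scalar_fun"
  where "edge_fun e \<eta> = interp P (\<lambda>x. if x \<in> edge_nodes P e then \<eta> x else 0)"

lemma edge_fun_fe: "edge_fun e \<eta> \<in> fe_space P"
  by (simp add: edge_fun_def interp_fe_space)

lemma edge_fun_node: "x \<in> nodes P \<Longrightarrow> edge_fun e \<eta> x = (if x \<in> edge_nodes P e then \<eta> x else 0)"
  by (simp add: edge_fun_def interp_node)

lemma edge_fun_Vloc0: "e \<in> edges P \<Longrightarrow> edge_fun e \<eta> \<in> Vloc0 P (esub P e)"
  using edge_subset_esub[of e]
  by (auto simp: Vloc0_nodes[OF esub_elem_union] edge_fun_fe edge_fun_node edge_nodes_def)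

lemma edge_fun_V0: "e \<in> edges P \<Longrightarrow> edge_fun e \<eta> \<in> V0 P"
  using edge_fun_Vloc0 Vloc0_subset_V0[OF esub_elem_union] by blast

lemma edge_fun_lincomb: "edge_fun e (c *\<^sub>R \<eta> + \<zeta>) = c *\<^sub>R edge_fun e \<eta> + edge_fun e \<zeta>"
  unfolding edge_fun_def[of e "c *\<^sub>R \<eta> + \<zeta>"]
  by (rule interp_eqI) (auto simp: edge_fun_node subspace_fe_space subspace_add subspace_scale edge_fun_fe)

lemma ext_edge:
  assumes "e \<in> edges P"
  shows "harmonic (ext_interface P (ext_edge_interface P e \<eta>))"
    "x \<in> interface P \<Longrightarrow> ext_interface P (ext_edge_interface P e \<eta>) x = edge_fun e \<eta> x"
  using ext_interface_harmonic[OF edge_fun_V0[OF assms], of "ext_edge_interface P e \<eta>" \<eta>]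
  by (auto simp: ext_edge_interface_def edge_fun_def restr_def)

lemma ext_edge_lincomb:
  assumes "e \<in> edges P"
  shows "ext_interface P (ext_edge_interface P e (c *\<^sub>R \<eta> + \<zeta>))
    = c *\<^sub>R ext_interface P (ext_edge_interface P e \<eta>) + ext_interface P (ext_edge_interface P e \<zeta>)"
  by (rule harmonic_unique) (use ext_edge[OF assms] harmonic_lincomb edge_fun_lincomb in auto)

lemma ext_edge_cong:
  assumes "e \<in> edges P" "\<And>x. x \<in> edge_nodes P e \<Longrightarrow> \<eta> x = \<zeta> x"
  shows "ext_interface P (ext_edge_interface P e \<eta>) = ext_interface P (ext_edge_interface P e \<zeta>)"
proof -
  have "(\<lambda>x. if x \<in> edge_nodes P e then \<eta> x else 0) = (\<lambda>x. if x \<in> edge_nodes P e then \<zeta> x else 0)"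
    using assms(2) by auto
  then show ?thesis by (simp add: ext_edge_interface_def)
qed

lemma vertex_ext:
  assumes "p \<in> vertices P"
  shows "harmonic (ext_interface P (vertex_fun_interface P p))"
    "x \<in> interface P \<Longrightarrow> ext_interface P (vertex_fun_interface P p) x = hat P p x"
proof -
  have p: "p \<in> nodes P" "p \<in> Omega P" using assms interface_subset by (auto simp: vertices_def)
  then have "hat P p \<in> V0 P"
    unfolding V0_eq_Vloc0 by (auto simp: Vloc0_nodes[OF elem_union_Omega] hat_def interp_fe_space interp_node)
  then show "harmonic (ext_interface P (vertex_fun_interface P p))"
    "x \<in> interface P \<Longrightarrow> ext_interface P (vertex_fun_interface P p) x = hat P p x"
    using ext_interface_harmonic[of "hat P p" "vertex_fun_interface P p"]
    by (auto simp: vertex_fun_interface_def hat_def restr_def)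
qed

end

section \<open>Local harmonic splitting of u and the two forms of the Dirichlet problem\<close>

section \<open>Oversampling domains\<close>

context fe_decomposition
begin

abbreviation bd :: "pt set \<Rightarrow> scalar_fun \<Rightarrow> scalar_fun" where "bd e \<equiv> restr (frontier (esub P e))"

lemma restr_lincomb: "restr S (c *\<^sub>R u + v) = c *\<^sub>R restr S u + restr S v"
  by (auto simp: restr_def fun_eq_iff)

lemma subspace_Vloc: "subspace (Vloc P \<omega>)"
  unfolding subspace_def
proof (intro conjI ballI allI)
  have "restr (closure \<omega>) 0 = 0" by (auto simp: restr_def fun_eq_iff)
  then show "0 \<in> Vloc P \<omega>" unfolding Vloc_def using subspace_fe_space subspace_0 by (metis imageI)
  fix x y assume "x \<in> Vloc P \<omega>"
  then obtain x' where x': "x' \<in> fe_space P" "x = restr (closure \<omega>) x'" by (auto simp: Vloc_def)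
  { fix c :: real
    have "c *\<^sub>R x = restr (closure \<omega>) (c *\<^sub>R x')" by (auto simp: restr_def fun_eq_iff x'(2))
    then show "c *\<^sub>R x \<in> Vloc P \<omega>" unfolding Vloc_def using subspace_fe_space subspace_scale x'(1) by blast }
  assume "y \<in> Vloc P \<omega>"
  then obtain y' where y': "y' \<in> fe_space P" "y = restr (closure \<omega>) y'" by (auto simp: Vloc_def)
  have "x + y = restr (closure \<omega>) (x' + y')" by (auto simp: restr_def fun_eq_iff x'(2) y'(2))
  then show "x + y \<in> Vloc P \<omega>" unfolding Vloc_def using subspace_fe_space subspace_add x'(1) y'(1) by blast
qed

lemma subspace_Vesub: "subspace (Vesub P e)"
  using subspace_Vloc[of "esub P e"] unfolding subspace_def Vesub_def by auto

lemma Vesub_broken: "Vesub P e \<subseteq> broken P (esub P e)"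
  using Vloc_broken unfolding Vesub_def by blast

lemma psd_energy_esub: "e \<in> edges P \<Longrightarrow> psd_form (broken P (esub P e)) (energy P (esub P e))"
  by (rule psd_energy[OF esub_elem_union])

lemma subspace_Vha:
  assumes e: "e \<in> edges P"
  shows "subspace (Vha P e)"
proof -
  interpret psd_form "broken P (esub P e)" "energy P (esub P e)" by (rule psd_energy_esub[OF e])
  have b: "v \<in> broken P (esub P e)" if "v \<in> Vloc0 P (esub P e)" for v
    using that Vloc0_iff[OF esub_elem_union[OF e]] fe_space_broken by blast
  show ?thesis
    using subspace_Vesub[of e] Vesub_broken[of e] b unfolding subspace_def Vha_def
    by (auto simp: bilin subset_iff)
qed

lemma Vha_Vesub: "Vha P e \<subseteq> Vesub P e"
  by (auto simp: Vha_def)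

lemma Vesub_zero_trace:
  assumes "e \<in> edges P" "v \<in> Vesub P e" "\<And>x. x \<in> frontier (esub P e) \<Longrightarrow> v x = 0"
  shows "v \<in> Vloc0 P (esub P e)"
  using assms by (auto simp: Vesub_def Vloc0_def)

lemma Vloc0_Vesub: "e \<in> edges P \<Longrightarrow> Vloc0 P (esub P e) \<subseteq> Vesub P e"
  by (auto simp: Vesub_def Vloc0_def)

lemma Vloc0_definite:
  assumes \<omega>: "elem_union P \<omega>" and v: "v \<in> Vloc0 P \<omega>" "energy P \<omega> v v = 0"
  shows "v = 0"
proof -
  have "v \<in> V0 P" using v(1) Vloc0_subset_V0[OF \<omega>] by blast
  moreover have "energy P (Omega P) v v = 0"
    using energy_Vloc0(1)[OF \<omega> v(1)] v(2) calculation V0_fe_space by simp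
  ultimately show ?thesis by (rule energy_V0_definite)
qed

lemma Vha_unique:
  assumes e: "e \<in> edges P" and "u \<in> Vha P e" "v \<in> Vha P e" "\<And>x. x \<in> frontier (esub P e) \<Longrightarrow> u x = v x"
  shows "u = v"
proof -
  have d: "u - v \<in> Vha P e" using assms subspace_Vha[OF e] by (simp add: subspace_diff)
  then have "u - v \<in> Vloc0 P (esub P e)"
    using assms(4) Vha_Vesub by (intro Vesub_zero_trace[OF e]) auto
  moreover have "energy P (esub P e) (u - v) (u - v) = 0" using d calculation by (simp add: Vha_def)
  ultimately have "u - v = 0" by (rule Vloc0_definite[OF esub_elem_union[OF e]])
  then show ?thesis by simp
qed

lemma subspace_Vloc0: "subspace (Vloc0 P \<omega>)"
  using subspace_Vloc[of \<omega>] unfolding subspace_def Vloc0_def by auto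

lemma Vloc0_projection:
  assumes e: "elem_union P \<omega>" and v: "v \<in> broken P \<omega>" and W: "subspace W" "W \<subseteq> Vloc0 P \<omega>"
  shows "\<exists>w\<in>W. \<forall>z\<in>W. energy P \<omega> (v - w) z = 0"
proof -
  have sub: "W \<subseteq> fe_space P" using W Vloc0_iff[OF e] by blast
  then obtain B where B: "finite B" "span B = W"
    using finite_dim_fe_space[OF W(1)] by blast
  interpret psd_form "broken P \<omega>" "energy P \<omega>" by (rule psd_energy[OF e])
  have "B \<subseteq> broken P \<omega>"
    using B(2) sub fe_space_broken span_superset by blast
  then show ?thesis using projection_exists[OF B(1) _ v] unfolding B(2) by blast
qed

lemma Vha_exists:
  assumes e: "e \<in> edges P" and v: "v \<in> Vesub P e"
  shows "\<exists>u\<in>Vha P e. \<forall>x\<in>frontier (esub P e). u x = v x"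
proof -
  obtain w where w: "w \<in> Vloc0 P (esub P e)" "\<forall>z\<in>Vloc0 P (esub P e). energy P (esub P e) (v - w) z = 0"
    using Vloc0_projection[OF esub_elem_union[OF e] _ subspace_Vloc0 subset_refl] v Vesub_broken by blast
  have "v - w \<in> Vesub P e" using v w(1) Vloc0_Vesub[OF e] subspace_Vesub by (meson subsetD subspace_diff)
  then have "v - w \<in> Vha P e" using w(2) by (simp add: Vha_def)
  moreover have "\<forall>x\<in>frontier (esub P e). (v - w) x = v x" using w(1) by (simp add: Vloc0_def)
  ultimately show ?thesis by blast
qed

lemma ext_ha_eqI:
  assumes e: "e \<in> edges P" and "u \<in> Vha P e" "\<And>x. x \<in> frontier (esub P e) \<Longrightarrow> u x = \<zeta> x"
  shows "ext_ha P e \<zeta> = u"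
  unfolding ext_ha_def
proof (rule the_equality)
  fix w assume "w \<in> Vha P e \<and> (\<forall>x\<in>frontier (esub P e). w x = \<zeta> x)"
  then show "w = u" using assms(3) by (intro Vha_unique[OF e _ assms(2)]) auto
qed (use assms in auto)

lemma ext_ha_trace: "e \<in> edges P \<Longrightarrow> u \<in> Vha P e \<Longrightarrow> ext_ha P e (bd e u) = u"
  by (rule ext_ha_eqI) (auto simp: restr_def)

lemma V0_restr_Vesub:
  assumes e: "e \<in> edges P" and u: "u \<in> V0 P"
  shows "restr (closure (esub P e)) u \<in> Vesub P e"
proof -
  have "u x = 0" if "x \<in> frontier (Omega P)" for x
    using that u frontier_Omega unfolding V0_iff by blast
  then show ?thesis using u V0_fe_space by (auto simp: Vesub_def Vloc_def restr_def)
qed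

text \<open>\<open>u_perp\<close> vanishes on the boundary of the oversampling domain and is thus a
  test function for \<open>u_ha\<close>. The resulting Pythagoras identity lets two spectral errors
  be charged to one local energy of \<open>u\<close>.\<close>

lemma u_ha_props:
  assumes e: "e \<in> edges P" and u: "u \<in> V0 P"
  shows "u_ha P e u \<in> Vha P e" "x \<in> frontier (esub P e) \<Longrightarrow> u_ha P e u x = u x"
    "u_perp P e u \<in> Vloc0 P (esub P e)" "x \<in> closure (esub P e) \<Longrightarrow> u_perp P e u x + u_ha P e u x = u x"
    "energy P (esub P e) (u_ha P e u) (u_ha P e u) + energy P (esub P e) (u_perp P e u) (u_perp P e u)
      = energy P (esub P e) u u"
proof -
  let ?r = "restr (closure (esub P e)) u"
  have fc: "frontier (esub P e) \<subseteq> closure (esub P e)" by (simp add: frontier_def)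
  have r: "?r \<in> Vesub P e" using V0_restr_Vesub[OF e u] .
  obtain w where w: "w \<in> Vha P e" "\<forall>x\<in>frontier (esub P e). w x = ?r x" using Vha_exists[OF e r] by blast
  have wu: "w x = u x" if "x \<in> frontier (esub P e)" for x
    using w(2) that fc by (simp add: restr_def subset_iff)
  have "u_ha P e u = w"
    unfolding u_ha_def by (rule ext_ha_eqI[OF e w(1)]) (use wu in \<open>auto simp: restr_def\<close>)
  then show h: "u_ha P e u \<in> Vha P e" and t: "x \<in> frontier (esub P e) \<Longrightarrow> u_ha P e u x = u x" for x
    using w wu by auto
  have "u_perp P e u \<in> Vesub P e"
    unfolding u_perp_def using r h Vha_Vesub subspace_Vesub by (meson subsetD subspace_diff)
  then show p: "u_perp P e u \<in> Vloc0 P (esub P e)"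
    by (rule Vesub_zero_trace[OF e]) (use t fc in \<open>auto simp: u_perp_def restr_def\<close>)
  show "x \<in> closure (esub P e) \<Longrightarrow> u_perp P e u x + u_ha P e u x = u x"
    by (simp add: u_perp_def restr_def)
  interpret psd_form "broken P (esub P e)" "energy P (esub P e)" by (rule psd_energy_esub[OF e])
  have b: "u_ha P e u \<in> broken P (esub P e)" "u_perp P e u \<in> broken P (esub P e)"
    using h p Vha_Vesub Vloc0_Vesub[OF e] Vesub_broken by blast+
  have "energy P (esub P e) u u = energy P (esub P e) (u_ha P e u + u_perp P e u) (u_ha P e u + u_perp P e u)"
    using closure_subset[of "esub P e"] by (intro energy_cong esub_open e) (auto simp: u_perp_def restr_def)
  also have "\<dots> = energy P (esub P e) (u_ha P e u) (u_ha P e u) + energy P (esub P e) (u_perp P e u) (u_perp P e u)"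
    using add_sq[OF b] h p by (simp add: Vha_def)
  finally show "energy P (esub P e) (u_ha P e u) (u_ha P e u) + energy P (esub P e) (u_perp P e u) (u_perp P e u)
      = energy P (esub P e) u u" by simp
qed

subsection \<open>Forms on an edge\<close>

lemma subspace_Vedge0: "subspace (Vedge0 P e)"
  unfolding subspace_def
proof (intro conjI ballI allI)
  have "restr (closure e) 0 = 0" by (auto simp: restr_def fun_eq_iff)
  moreover have "0 \<in> fe_space P" using subspace_fe_space subspace_0 by blast
  ultimately show "0 \<in> Vedge0 P e" unfolding Vedge0_def by force
  fix x y assume "x \<in> Vedge0 P e"
  then obtain x' where x': "x' \<in> fe_space P" "x = restr (closure e) x'" "\<forall>z\<in>closure e - e. x' z = 0"
    unfolding Vedge0_def by blast
  { fix c :: real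
    have "c *\<^sub>R x = restr (closure e) (c *\<^sub>R x')" by (auto simp: restr_def fun_eq_iff x'(2))
    moreover have "c *\<^sub>R x' \<in> fe_space P" using subspace_fe_space subspace_scale x'(1) by blast
    ultimately show "c *\<^sub>R x \<in> Vedge0 P e" unfolding Vedge0_def using x'(3) by force }
  assume "y \<in> Vedge0 P e"
  then obtain y' where y': "y' \<in> fe_space P" "y = restr (closure e) y'" "\<forall>z\<in>closure e - e. y' z = 0"
    unfolding Vedge0_def by blast
  have "x + y = restr (closure e) (x' + y')" by (auto simp: restr_def fun_eq_iff x'(2) y'(2))
  moreover have "x' + y' \<in> fe_space P" using subspace_fe_space subspace_add x'(1) y'(1) by blast
  ultimately show "x + y \<in> Vedge0 P e" unfolding Vedge0_def using x'(3) y'(3) by force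
qed

lemma Vedge0_zero: "\<eta> \<in> Vedge0 P e \<Longrightarrow> x \<in> closure e - e \<Longrightarrow> \<eta> x = 0"
  by (auto simp: Vedge0_def restr_def)

lemma ext_edge_esub_eq:
  assumes e: "e \<in> edges P" and \<eta>: "\<eta> \<in> Vedge0 P e"
  shows "ext_edge_esub P e \<eta> = edge_fun e \<eta>"
proof -
  have "interp P (\<lambda>x. if x \<in> closure e then \<eta> x else 0) = edge_fun e \<eta>"
    unfolding edge_fun_def
    using Vedge0_zero[OF \<eta>] closure_subset[of e] by (intro interp_cong) (auto simp: edge_nodes_def)
  moreover have "edge_fun e \<eta> x = 0" if "x \<notin> closure (esub P e)" for x
    using edge_fun_Vloc0[OF e, of \<eta>] that closure_subset unfolding Vloc0_iff[OF esub_elem_union[OF e]] by blast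
  then have "restr (closure (esub P e)) (edge_fun e \<eta>) = edge_fun e \<eta>"
    unfolding restr_def fun_eq_iff by presburger
  ultimately show ?thesis by (simp add: ext_edge_esub_def)
qed

lemma bform_eq:
  assumes "e \<in> edges P" "\<eta> \<in> Vedge0 P e" "\<zeta> \<in> Vedge0 P e"
  shows "bform P e \<eta> \<zeta> = energy P (Omega P) (edge_fun e \<eta>) (edge_fun e \<zeta>)"
  using assms by (simp add: bform_def ext_edge_esub_eq energy_Vloc0(1)[OF esub_elem_union edge_fun_Vloc0 edge_fun_fe])

lemma psd_bform:
  assumes e: "e \<in> edges P"
  shows "psd_form (Vedge0 P e) (bform P e)"
proof
  interpret psd_form "fe_space P" "energy P (Omega P)" by (rule psd_energy_fe[OF elem_union_Omega])
  show "subspace (Vedge0 P e)" by (rule subspace_Vedge0)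
  fix u v w :: scalar_fun and c :: real
  assume u: "u \<in> Vedge0 P e"
  show "0 \<le> bform P e u u" using u by (simp add: bform_eq[OF e] edge_fun_fe nonneg)
  assume v: "v \<in> Vedge0 P e"
  show "bform P e u v = bform P e v u" using u v by (simp add: bform_eq[OF e] edge_fun_fe sym)
  assume w: "w \<in> Vedge0 P e"
  have "c *\<^sub>R u + v \<in> Vedge0 P e" using u v subspace_Vedge0 by (simp add: subspace_add subspace_scale)
  then show "bform P e (c *\<^sub>R u + v) w = c * bform P e u w + bform P e v w"
    using u v w by (simp add: bform_eq[OF e] edge_fun_fe edge_fun_lincomb lin)
qed

text \<open>Start from the zero extension \<open>edge_fun e \<eta>\<close> and subtract its
  projection onto the functions vanishing at the edge nodes; uniqueness is definiteness on the
  zero-trace space.\<close>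

lemma dir_ext_props:
  assumes e: "e \<in> edges P"
  shows "\<exists>!w. w \<in> Vloc0 P (esub P e) \<and> (\<forall>x\<in>edge_nodes P e. w x = \<eta> x) \<and>
    (\<forall>v\<in>Vloc0 P (esub P e). (\<forall>x\<in>edge_nodes P e. v x = 0) \<longrightarrow> energy P (esub P e) w v = 0)"
    (is "\<exists>!w. ?Q w")
proof -
  let ?V = "Vloc0 P (esub P e)"
  define W where "W = {v \<in> ?V. \<forall>x\<in>edge_nodes P e. v x = 0}"
  interpret psd_form "broken P (esub P e)" "energy P (esub P e)" by (rule psd_energy_esub[OF e])
  have Vb: "?V \<subseteq> broken P (esub P e)" using Vloc0_Vesub[OF e] Vesub_broken by blast
  have "subspace W" using subspace_Vloc0[of "esub P e"] unfolding W_def subspace_def by auto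
  moreover have "W \<subseteq> ?V" by (auto simp: W_def)
  moreover have "edge_fun e \<eta> \<in> broken P (esub P e)" using edge_fun_fe fe_space_broken by blast
  ultimately obtain w where w: "w \<in> W" "\<forall>z\<in>W. energy P (esub P e) (edge_fun e \<eta> - w) z = 0"
    using Vloc0_projection[OF esub_elem_union[OF e]] by blast
  have nodes: "edge_fun e \<eta> x = \<eta> x" if "x \<in> edge_nodes P e" for x
    using that by (auto simp: edge_fun_node edge_nodes_def)
  have "?Q (edge_fun e \<eta> - w)"
    using w edge_fun_Vloc0[OF e] subspace_Vloc0[of "esub P e"] nodes by (auto simp: W_def subspace_diff)
  moreover have "u = v" if u: "?Q u" and v: "?Q v" for u v
  proof -
    have d: "u - v \<in> W" using u v subspace_Vloc0[of "esub P e"] by (simp add: W_def subspace_diff)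
    then have "energy P (esub P e) u (u - v) = 0" "energy P (esub P e) v (u - v) = 0"
      using u v by (auto simp: W_def)
    then have "energy P (esub P e) (u - v) (u - v) = 0"
      using u v d Vb by (subst diff_left) (auto simp: W_def)
    moreover have "u - v \<in> Vloc0 P (esub P e)" using d by (simp add: W_def)
    ultimately have "u - v = 0" using Vloc0_definite[OF esub_elem_union[OF e]] by blast
    then show ?thesis by simp
  qed
  ultimately show ?thesis by blast
qed

lemma dir_ext:
  assumes e: "e \<in> edges P"
  shows "dir_ext P e \<eta> \<in> Vloc0 P (esub P e)" "x \<in> edge_nodes P e \<Longrightarrow> dir_ext P e \<eta> x = \<eta> x"
    "v \<in> Vloc0 P (esub P e) \<Longrightarrow> (\<And>x. x \<in> edge_nodes P e \<Longrightarrow> v x = 0) \<Longrightarrow> energy P (esub P e) (dir_ext P e \<eta>) v = 0"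
  using theI'[OF dir_ext_props[OF e, of \<eta>]] unfolding dir_ext_def[symmetric] by auto

lemma dir_ext_eqI:
  assumes e: "e \<in> edges P"
    and "w \<in> Vloc0 P (esub P e)" "\<And>x. x \<in> edge_nodes P e \<Longrightarrow> w x = \<eta> x"
    "\<And>v. v \<in> Vloc0 P (esub P e) \<Longrightarrow> (\<And>x. x \<in> edge_nodes P e \<Longrightarrow> v x = 0) \<Longrightarrow> energy P (esub P e) w v = 0"
  shows "dir_ext P e \<eta> = w"
  unfolding dir_ext_def by (rule the1_equality[OF dir_ext_props[OF e]]) (use assms in blast)

lemma dir_ext_lincomb:
  assumes e: "e \<in> edges P"
  shows "dir_ext P e (c *\<^sub>R \<eta> + \<zeta>) = c *\<^sub>R dir_ext P e \<eta> + dir_ext P e \<zeta>"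
proof (rule dir_ext_eqI[OF e])
  interpret psd_form "broken P (esub P e)" "energy P (esub P e)" by (rule psd_energy_esub[OF e])
  have Vb: "Vloc0 P (esub P e) \<subseteq> broken P (esub P e)" using Vloc0_Vesub[OF e] Vesub_broken by blast
  show "c *\<^sub>R dir_ext P e \<eta> + dir_ext P e \<zeta> \<in> Vloc0 P (esub P e)"
    using dir_ext(1)[OF e] subspace_Vloc0[of "esub P e"] by (simp add: subspace_add subspace_scale)
  show "x \<in> edge_nodes P e \<Longrightarrow> (c *\<^sub>R dir_ext P e \<eta> + dir_ext P e \<zeta>) x = (c *\<^sub>R \<eta> + \<zeta>) x" for x
    using dir_ext(2)[OF e] by simp
  fix v assume v: "v \<in> Vloc0 P (esub P e)" "\<And>x. x \<in> edge_nodes P e \<Longrightarrow> v x = 0"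
  show "energy P (esub P e) (c *\<^sub>R dir_ext P e \<eta> + dir_ext P e \<zeta>) v = 0"
    using dir_ext(3)[OF e v] dir_ext(1)[OF e] v(1) Vb by (subst lin) auto
qed

lemma psd_dform:
  assumes e: "e \<in> edges P"
  shows "psd_form (Vedge0 P e) (dform P e)"
proof
  interpret psd_form "broken P (esub P e)" "energy P (esub P e)" by (rule psd_energy_esub[OF e])
  have b: "dir_ext P e \<eta> \<in> broken P (esub P e)" for \<eta>
    using dir_ext(1)[OF e] Vloc0_Vesub[OF e] Vesub_broken by blast
  show "subspace (Vedge0 P e)" by (rule subspace_Vedge0)
  fix u v w :: scalar_fun and c :: real
  show "0 \<le> dform P e u u" using b by (simp add: dform_def nonneg)
  show "dform P e u v = dform P e v u" using b by (simp add: dform_def sym)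
  show "dform P e (c *\<^sub>R u + v) w = c * dform P e u w + dform P e v w"
    using b by (simp add: dform_def dir_ext_lincomb[OF e] lin)
qed

text \<open>Dirichlet principle: the difference to the extension is a test function. It bounds
  \<open>dform\<close> of the edge values of \<open>u_perp\<close> by the energy of
  \<open>u_perp\<close>.\<close>

lemma dform_minimal:
  assumes e: "e \<in> edges P" and v: "v \<in> Vloc0 P (esub P e)" "\<And>x. x \<in> edge_nodes P e \<Longrightarrow> v x = \<eta> x"
  shows "dform P e \<eta> \<eta> \<le> energy P (esub P e) v v"
proof -
  interpret psd_form "broken P (esub P e)" "energy P (esub P e)" by (rule psd_energy_esub[OF e])
  have Vb: "Vloc0 P (esub P e) \<subseteq> broken P (esub P e)" using Vloc0_Vesub[OF e] Vesub_broken by blast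
  define d where "d = v - dir_ext P e \<eta>"
  have d: "d \<in> Vloc0 P (esub P e)" unfolding d_def
    using v(1) dir_ext(1)[OF e] subspace_Vloc0 subspace_diff by blast
  have o: "energy P (esub P e) (dir_ext P e \<eta>) d = 0"
    by (rule dir_ext(3)[OF e d]) (simp add: d_def v(2) dir_ext(2)[OF e])
  have "v = dir_ext P e \<eta> + d" by (simp add: d_def)
  then have "energy P (esub P e) v v = dform P e \<eta> \<eta> + energy P (esub P e) d d"
    using add_sq[of "dir_ext P e \<eta>" d] o d dir_ext(1)[OF e, of \<eta>] Vb by (auto simp: dform_def)
  then show ?thesis using nonneg[of d] d Vb by auto
qed

text \<open>Subtracting the interpolant of the endpoint values makes the trace vanish there, because
  the endpoints are nodes.\<close>

lemma edge_part_Vedge0: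
  assumes e: "e \<in> edges P" and v: "v \<in> Vloc P (esub P e)"
  shows "restr (closure e) v - interp_endpoints P e v \<in> Vedge0 P e"
proof -
  obtain v' where v': "v' \<in> fe_space P" "v = restr (closure (esub P e)) v'" using v by (auto simp: Vloc_def)
  define g where "g = v' - interp P (\<lambda>x. if x \<in> closure e - e then v x else 0)"
  have vv: "v x = v' x" if "x \<in> closure e" for x
    using that closure_edge_esub[OF e] v'(2) by (auto simp: restr_def)
  have "restr (closure e) v - interp_endpoints P e v = restr (closure e) g"
    using vv by (auto simp: interp_endpoints_def g_def restr_def fun_eq_iff)
  moreover have "g \<in> fe_space P" unfolding g_def
    using v'(1) interp_fe_space subspace_fe_space subspace_diff by blast
  moreover have "g x = 0" if "x \<in> closure e - e" for x
    using that edge_closure_nodes[OF e] vv by (auto simp: g_def interp_node subset_iff)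
  ultimately show ?thesis unfolding Vedge0_def by blast
qed

lemma interp_endpoints_edge_node: "x \<in> edge_nodes P e \<Longrightarrow> interp_endpoints P e v x = 0"
  by (auto simp: interp_endpoints_def restr_def edge_nodes_def interp_node)

lemma edge_part_node:
  "x \<in> edge_nodes P e \<Longrightarrow> (restr (closure e) v - interp_endpoints P e v) x = v x"
  using closure_subset[of e] by (auto simp: interp_endpoints_edge_node restr_def edge_nodes_def)

lemma transfer_trace:
  "e \<in> edges P \<Longrightarrow> v \<in> Vha P e \<Longrightarrow> transfer P e (bd e v) = restr (closure e) v - interp_endpoints P e v"
  by (simp add: transfer_def ext_ha_trace)

lemma interp_endpoints_lincomb:
  "interp_endpoints P e (c *\<^sub>R u + v) = c *\<^sub>R interp_endpoints P e u + interp_endpoints P e v"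
proof -
  have "interp P (\<lambda>x. if x \<in> closure e - e then (c *\<^sub>R u + v) x else 0)
    = c *\<^sub>R interp P (\<lambda>x. if x \<in> closure e - e then u x else 0) + interp P (\<lambda>x. if x \<in> closure e - e then v x else 0)"
    by (rule interp_eqI)
      (auto simp: interp_fe_space subspace_fe_space subspace_add subspace_scale interp_node)
  then show ?thesis unfolding interp_endpoints_def by (simp add: restr_lincomb)
qed

lemma transfer_lincomb:
  assumes e: "e \<in> edges P" and v: "u \<in> Vha P e" "v \<in> Vha P e"
  shows "transfer P e (bd e (c *\<^sub>R u + v)) = c *\<^sub>R transfer P e (bd e u) + transfer P e (bd e v)"
proof -
  have cuv: "c *\<^sub>R u + v \<in> Vha P e" using v subspace_Vha[OF e] by (simp add: subspace_add subspace_scale)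
  have "transfer P e (bd e (c *\<^sub>R u + v)) = restr (closure e) (c *\<^sub>R u + v) - interp_endpoints P e (c *\<^sub>R u + v)"
    by (rule transfer_trace[OF e cuv])
  also have "\<dots> = c *\<^sub>R (restr (closure e) u - interp_endpoints P e u) + (restr (closure e) v - interp_endpoints P e v)"
    unfolding restr_lincomb interp_endpoints_lincomb by (simp add: scaleR_diff_right)
  finally show ?thesis by (simp add: transfer_trace[OF e] v)
qed

end

section \<open>Truncation of eigenfunction expansions on an edge\<close>

section \<open>Spectral estimates\<close>

lemma lincomb_sum:
  fixes F :: "'a::real_vector \<Rightarrow> 'b::real_vector"
  assumes V: "subspace V" and F: "\<And>c u v. u \<in> V \<Longrightarrow> v \<in> V \<Longrightarrow> F (c *\<^sub>R u + v) = c *\<^sub>R F u + F v"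
    and f: "\<And>i. i \<in> I \<Longrightarrow> f i \<in> V"
  shows "F (\<Sum>i\<in>I. c i *\<^sub>R f i) = (\<Sum>i\<in>I. c i *\<^sub>R F (f i))"
proof -
  have F0: "F 0 = 0" using F[of 0 0 1] V by (simp add: subspace_0)
  show ?thesis
    using f
  proof (induction I rule: infinite_finite_induct)
    case (insert x J)
    have "(\<Sum>i\<in>J. c i *\<^sub>R f i) \<in> V"
      using insert.prems V by (intro subspace_sum subspace_scale) auto
    then show ?case using insert F by simp
  qed (simp_all add: F0)
qed

text \<open>Coefficients are attached to indices instead of vectors, so repetitions in the family do
  no harm.\<close>

lemma span_image_sum:
  assumes "finite I" "v \<in> span (f ` I)"
  shows "\<exists>c. v = (\<Sum>i\<in>I. c i *\<^sub>R f i)"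
proof -
  let ?S = "{v. \<exists>c. v = (\<Sum>i\<in>I. c i *\<^sub>R f i)}"
  have "subspace ?S"
    unfolding subspace_def
  proof (intro conjI ballI allI)
    show "0 \<in> ?S" by (auto intro!: exI[of _ "\<lambda>i. 0"])
    fix x y assume "x \<in> ?S" "y \<in> ?S"
    then obtain c d where "x = (\<Sum>i\<in>I. c i *\<^sub>R f i)" "y = (\<Sum>i\<in>I. d i *\<^sub>R f i)" by blast
    then have "x + y = (\<Sum>i\<in>I. (c i + d i) *\<^sub>R f i)" by (simp add: sum.distrib scaleR_add_left)
    then show "x + y \<in> ?S" by (intro CollectI exI[of _ "\<lambda>i. c i + d i"])
  next
    fix k x assume "x \<in> ?S"
    then obtain c where "x = (\<Sum>i\<in>I. c i *\<^sub>R f i)" by blast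
    then have "k *\<^sub>R x = (\<Sum>i\<in>I. (k * c i) *\<^sub>R f i)" by (simp add: scaleR_sum_right)
    then show "k *\<^sub>R x \<in> ?S" by (intro CollectI exI[of _ "\<lambda>i. k * c i"])
  qed
  moreover have "f ` I \<subseteq> ?S"
  proof
    fix x assume "x \<in> f ` I"
    then obtain j where j: "j \<in> I" "x = f j" by blast
    have "(\<Sum>i\<in>I. (if i = j then 1 else 0) *\<^sub>R f i) = (\<Sum>i\<in>I. if i = j then f i else 0)"
      by (rule sum.cong) auto
    also have "\<dots> = x" using j assms(1) by simp
    finally show "x \<in> ?S" by (intro CollectI exI[of _ "\<lambda>i. if i = j then 1 else 0"]) simp
  qed
  ultimately show ?thesis using span_minimal[of "f ` I" ?S] assms(2) by blast
qed

text \<open>The projections sum over \<open>1..n\<close> with \<open>n\<close> a cardinality;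
  monotonicity of the eigenvalues identifies this range with the selected indices.\<close>

lemma initial_segment:
  assumes "\<And>i j. i \<in> {1..d::nat} \<Longrightarrow> j \<in> {1..d} \<Longrightarrow> i \<le> j \<Longrightarrow> Q j \<Longrightarrow> Q i"
  shows "{1..card {i \<in> {1..d}. Q i}} = {i \<in> {1..d}. Q i}"
proof (cases "{i \<in> {1..d}. Q i} = {}")
  case True
  then show ?thesis unfolding True by simp
next
  case False
  let ?S = "{i \<in> {1..d}. Q i}"
  have m: "Max ?S \<in> ?S" using False by (intro Max_in) auto
  have "?S = {1..Max ?S}"
  proof
    show "?S \<subseteq> {1..Max ?S}" by auto
    show "{1..Max ?S} \<subseteq> ?S"
    proof
      fix i assume "i \<in> {1..Max ?S}"
      then show "i \<in> ?S" using m assms[of i "Max ?S"] by auto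
    qed
  qed
  then show ?thesis by (metis card_atLeastAtMost diff_Suc_1)
qed

lemma inner_product_on_psd:
  assumes "subspace V" "inner_product_on V ip"
  shows "psd_form V ip"
proof
  show "subspace V" by fact
  fix u v w :: scalar_fun and c :: real
  have lin: "\<And>u v w c. u \<in> V \<Longrightarrow> v \<in> V \<Longrightarrow> w \<in> V \<Longrightarrow> ip (c *\<^sub>R u + v) w = c * ip u w + ip v w"
    using assms(2) unfolding inner_product_on_def by blast
  note ipd = assms(2)[unfolded inner_product_on_def]
  note sym = ipd[THEN conjunct1] and pos = ipd[THEN conjunct2, THEN conjunct2]
  assume u: "u \<in> V"
  have "ip 0 0 = 0" using lin[of 0 0 0 1] assms(1) by (simp add: subspace_0)
  then show "0 \<le> ip u u" using u pos by (cases "u = 0") (auto simp: less_imp_le)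
  assume v: "v \<in> V"
  show "ip u v = ip v u" using u v sym by blast
  assume w: "w \<in> V"
  show "ip (c *\<^sub>R u + v) w = c * ip u w + ip v w" using lin u v w .
qed

context fe_decomposition
begin

lemma subspace_Vbd: "subspace (Vbd P e)"
  unfolding subspace_def
proof (intro conjI ballI allI)
  have "bd e 0 = 0" by (auto simp: restr_def fun_eq_iff)
  then show "0 \<in> Vbd P e" unfolding Vbd_def using subspace_Vesub subspace_0 by (metis imageI)
  fix x y assume "x \<in> Vbd P e"
  then obtain x' where x': "x' \<in> Vesub P e" "x = bd e x'" by (auto simp: Vbd_def)
  { fix c :: real
    have "c *\<^sub>R x = bd e (c *\<^sub>R x')" by (auto simp: restr_def fun_eq_iff x'(2))
    then show "c *\<^sub>R x \<in> Vbd P e" unfolding Vbd_def using subspace_Vesub subspace_scale x'(1) by blast }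
  assume "y \<in> Vbd P e"
  then obtain y' where y': "y' \<in> Vesub P e" "y = bd e y'" by (auto simp: Vbd_def)
  have "x + y = bd e (x' + y')" by (auto simp: restr_def fun_eq_iff x'(2) y'(2))
  then show "x + y \<in> Vbd P e" unfolding Vbd_def using subspace_Vesub subspace_add x'(1) y'(1) by blast
qed

lemma transfer_Vedge0: "e \<in> edges P \<Longrightarrow> v \<in> Vha P e \<Longrightarrow> transfer P e (bd e v) \<in> Vedge0 P e"
  using edge_part_Vedge0 Vha_Vesub by (auto simp: transfer_trace Vesub_def)

lemma sum_split_tail:
  fixes f :: "nat \<Rightarrow> 'a::ab_group_add"
  assumes "finite I" "S \<subseteq> I"
  shows "sum f I - sum f S = sum f (I - S)"
  using sum_diff[OF assms, of f] by simp

text \<open>Truncated singular value expansion of the transfer operator. Orthonormal boundary traces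
  are mapped to \<open>bform\<close>-orthogonal functions \<open>varphi\<close> of squared norm
  \<open>lam\<close>; the components left by the projection have \<open>lam\<close> at most the
  tolerance, and their coefficients are coordinates of the trace of \<open>v\<close>.\<close>

lemma transfer_spectral_estimate:
  assumes e: "e \<in> edges P" and ip: "inner_product_on (Vbd P e) (bip P e)"
    and eig: "transfer_eigenpairs P e" and tol: "0 < tol_tr P" and v: "v \<in> Vha P e"
  defines "w \<equiv> restr (closure e) v - interp_endpoints P e v"
  shows "w - proj_tr P e w \<in> Vedge0 P e"
    "bform P e (w - proj_tr P e w) (w - proj_tr P e w) \<le> tol_tr P * bip P e (bd e v) (bd e v)"
    "proj_tr P e w \<in> span (varphi P e ` {i \<in> {1..dim (Vbd P e)}. lam P e i > tol_tr P})"
proof -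
  define I where "I = {1..dim (Vbd P e)}"
  define S where "S = {i \<in> I. lam P e i > tol_tr P}"
  interpret b: psd_form "Vedge0 P e" "bform P e" by (rule psd_bform[OF e])
  interpret p: psd_form "Vbd P e" "bip P e" by (rule inner_product_on_psd[OF subspace_Vbd ip])
  have phi: "phi P e i \<in> Vha P e" if "i \<in> I" for i
    using conjunct1[OF eig[unfolded transfer_eigenpairs_def Let_def]] that unfolding I_def by (rule subsetD[OF _ imageI])
  note E = eig[unfolded transfer_eigenpairs_def Let_def, folded I_def, THEN conjunct2]
  note sp = E[THEN conjunct1] and orth = E[THEN conjunct2, THEN conjunct1, rule_format]
    and ev = E[THEN conjunct2, THEN conjunct2, THEN conjunct1, rule_format]
    and mono = E[THEN conjunct2, THEN conjunct2, THEN conjunct2, rule_format]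
  have vb: "bd e v \<in> Vbd P e" using v Vha_Vesub by (auto simp: Vbd_def)
  have fI: "finite I" by (simp add: I_def)
  obtain \<beta> where \<beta>: "bd e v = (\<Sum>i\<in>I. \<beta> i *\<^sub>R bd e (phi P e i))"
    using span_image_sum[OF fI, of "bd e v"] vb sp by blast
  have "bd e (\<Sum>i\<in>I. \<beta> i *\<^sub>R phi P e i) = (\<Sum>i\<in>I. \<beta> i *\<^sub>R bd e (phi P e i))"
    by (rule lincomb_sum[where F = "bd e", OF subspace_Vha[OF e] restr_lincomb phi])
  then have bv: "bd e v = bd e (\<Sum>i\<in>I. \<beta> i *\<^sub>R phi P e i)" using \<beta> by simp
  have w: "w = (\<Sum>i\<in>I. \<beta> i *\<^sub>R varphi P e i)"
  proof -
    have "w = transfer P e (bd e (\<Sum>i\<in>I. \<beta> i *\<^sub>R phi P e i))"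
      unfolding w_def bv[symmetric] by (rule transfer_trace[OF e v, symmetric])
    also have "\<dots> = (\<Sum>i\<in>I. \<beta> i *\<^sub>R transfer P e (bd e (phi P e i)))"
      by (rule lincomb_sum[where F = "\<lambda>u. transfer P e (bd e u)", OF subspace_Vha[OF e]])
        (use phi transfer_lincomb[OF e] in auto)
    finally show ?thesis by (simp add: varphi_def)
  qed
  have vE: "varphi P e i \<in> Vedge0 P e" if "i \<in> I" for i
    unfolding varphi_def by (rule transfer_Vedge0[OF e phi[OF that]])
  have bo: "bform P e (varphi P e i) (varphi P e j) = (if i = j then lam P e i else 0)" if "i \<in> I" "j \<in> I" for i j
    using ev[OF that(1) phi[OF that(2)]] orth[OF that] by (simp add: varphi_def)
  have Seq: "{1..n_tr P e} = S"
    unfolding n_tr_def S_def I_def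
  proof (rule initial_segment)
    fix i j assume "i \<in> {1..dim (Vbd P e)}" "j \<in> {1..dim (Vbd P e)}" "i \<le> j" "tol_tr P < lam P e j"
    then show "tol_tr P < lam P e i" using mono[of i j] by (simp add: I_def)
  qed
  have SI: "S \<subseteq> I" by (auto simp: S_def)
  have "bform P e w (varphi P e i) = \<beta> i * lam P e i" if i: "i \<in> I" for i
  proof -
    have "bform P e w (varphi P e i) = (\<Sum>j\<in>I. \<beta> j * bform P e (varphi P e j) (varphi P e i))"
      unfolding w using vE i by (subst b.sum_left) (auto simp: b.mem b.bilin)
    also have "\<dots> = (\<Sum>j\<in>I. if j = i then \<beta> i * lam P e i else 0)"
      by (rule sum.cong[OF refl]) (use bo i in auto)
    also have "\<dots> = \<beta> i * lam P e i" using i fI by simp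
    finally show ?thesis .
  qed
  \<comment> \<open>The division by \<open>lam\<close> in \<open>proj_tr\<close> is legitimate,
    since \<open>lam\<close> exceeds the positive tolerance on \<open>S\<close>.\<close>
  then have proj: "proj_tr P e w = (\<Sum>i\<in>S. \<beta> i *\<^sub>R varphi P e i)"
    unfolding proj_tr_def Seq using SI tol by (intro sum.cong) (auto simp: S_def)
  have d: "w - proj_tr P e w = (\<Sum>i\<in>I - S. \<beta> i *\<^sub>R varphi P e i)"
    unfolding proj by (subst w) (rule sum_split_tail[OF fI SI])
  show "w - proj_tr P e w \<in> Vedge0 P e"
    unfolding d using vE by (intro b.mem_sum b.mem_scale) auto
  have "bform P e (w - proj_tr P e w) (w - proj_tr P e w) = (\<Sum>i\<in>I - S. (\<beta> i)\<^sup>2 * lam P e i)"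
    unfolding d by (rule b.orthogonal_sum) (use fI vE bo in auto)
  also have "\<dots> \<le> (\<Sum>i\<in>I - S. (\<beta> i)\<^sup>2 * tol_tr P)"
    by (intro sum_mono mult_left_mono) (auto simp: S_def)
  also have "\<dots> \<le> (\<Sum>i\<in>I. (\<beta> i)\<^sup>2 * tol_tr P)"
    using fI tol by (intro sum_mono2) auto
  also have "\<dots> = tol_tr P * (\<Sum>i\<in>I. (\<beta> i)\<^sup>2 * 1)" by (simp add: sum_distrib_left mult.commute)
  also have "(\<Sum>i\<in>I. (\<beta> i)\<^sup>2 * 1) = bip P e (bd e v) (bd e v)"
    unfolding \<beta> by (rule p.orthogonal_sum[symmetric]) (use fI phi Vha_Vesub orth in \<open>auto simp: Vbd_def\<close>)
  finally show "bform P e (w - proj_tr P e w) (w - proj_tr P e w) \<le> tol_tr P * bip P e (bd e v) (bd e v)" .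
  show "proj_tr P e w \<in> span (varphi P e ` {i \<in> {1..dim (Vbd P e)}. lam P e i > tol_tr P})"
    unfolding proj I_def[symmetric] S_def[symmetric] by (intro span_sum span_scale span_base) auto
qed

text \<open>Here the roles are reversed: the basis is orthonormal for the form to be estimated, and
  the discarded components have \<open>mu\<close> above the tolerance, so each is dominated by its
  part of \<open>dform\<close> divided by the tolerance.\<close>

lemma dirichlet_spectral_estimate:
  assumes e: "e \<in> edges P" and eig: "dirichlet_eigenpairs P e" and tol: "0 < tol_dir P" and w: "w \<in> Vedge0 P e"
  shows "w - proj_dir P e w \<in> Vedge0 P e"
    "bform P e (w - proj_dir P e w) (w - proj_dir P e w) \<le> 1 / tol_dir P * dform P e w w"
    "proj_dir P e w \<in> span (psi P e ` {i \<in> {1..dim (Vedge0 P e)}. mu P e i \<le> tol_dir P})"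
proof -
  define I where "I = {1..dim (Vedge0 P e)}"
  define S where "S = {i \<in> I. mu P e i \<le> tol_dir P}"
  interpret b: psd_form "Vedge0 P e" "bform P e" by (rule psd_bform[OF e])
  interpret d: psd_form "Vedge0 P e" "dform P e" by (rule psd_dform[OF e])
  have vE: "psi P e i \<in> Vedge0 P e" if "i \<in> I" for i
    using conjunct1[OF eig[unfolded dirichlet_eigenpairs_def Let_def]] that unfolding I_def by (rule subsetD[OF _ imageI])
  note E = eig[unfolded dirichlet_eigenpairs_def Let_def, folded I_def, THEN conjunct2]
  note sp = E[THEN conjunct1] and bo = E[THEN conjunct2, THEN conjunct1, rule_format]
    and ev = E[THEN conjunct2, THEN conjunct2, THEN conjunct1, rule_format]
    and mono = E[THEN conjunct2, THEN conjunct2, THEN conjunct2, rule_format]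
  have fI: "finite I" by (simp add: I_def)
  obtain \<beta> where \<beta>: "w = (\<Sum>i\<in>I. \<beta> i *\<^sub>R psi P e i)"
    using span_image_sum[OF fI, of w "psi P e"] w sp by blast
  have do: "dform P e (psi P e i) (psi P e j) = (if i = j then mu P e i else 0)" if "i \<in> I" "j \<in> I" for i j
    using ev[OF that(1) vE[OF that(2)]] bo[OF that] by simp
  have mu0: "mu P e i \<ge> 0" if "i \<in> I" for i
    using d.nonneg[OF vE[OF that]] do[OF that that] by simp
  have Seq: "{1..n_dir P e} = S"
    unfolding n_dir_def S_def I_def
  proof (rule initial_segment)
    fix i j assume "i \<in> {1..dim (Vedge0 P e)}" "j \<in> {1..dim (Vedge0 P e)}" "i \<le> j" "mu P e j \<le> tol_dir P"
    then show "mu P e i \<le> tol_dir P" using mono[of i j] by (simp add: I_def)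
  qed
  have SI: "S \<subseteq> I" by (auto simp: S_def)
  have "bform P e w (psi P e i) = \<beta> i" if i: "i \<in> I" for i
  proof -
    have "bform P e w (psi P e i) = (\<Sum>j\<in>I. \<beta> j * bform P e (psi P e j) (psi P e i))"
      unfolding \<beta> using vE i by (subst b.sum_left) (auto simp: b.mem b.bilin)
    also have "\<dots> = (\<Sum>j\<in>I. if j = i then \<beta> i else 0)"
      by (rule sum.cong[OF refl]) (use bo i in auto)
    also have "\<dots> = \<beta> i" using i fI by simp
    finally show ?thesis .
  qed
  then have proj: "proj_dir P e w = (\<Sum>i\<in>S. \<beta> i *\<^sub>R psi P e i)"
    unfolding proj_dir_def Seq using SI by (intro sum.cong) auto
  have df: "w - proj_dir P e w = (\<Sum>i\<in>I - S. \<beta> i *\<^sub>R psi P e i)"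
    unfolding proj by (subst \<beta>) (rule sum_split_tail[OF fI SI])
  show "w - proj_dir P e w \<in> Vedge0 P e"
    unfolding df using vE by (intro b.mem_sum b.mem_scale) auto
  have "bform P e (w - proj_dir P e w) (w - proj_dir P e w) = (\<Sum>i\<in>I - S. (\<beta> i)\<^sup>2 * 1)"
    unfolding df by (rule b.orthogonal_sum) (use fI vE bo in auto)
  also have "\<dots> \<le> (\<Sum>i\<in>I - S. 1 / tol_dir P * ((\<beta> i)\<^sup>2 * mu P e i))"
  proof (rule sum_mono)
    fix i assume "i \<in> I - S"
    then have "tol_dir P \<le> mu P e i" by (auto simp: S_def)
    then have "(\<beta> i)\<^sup>2 * tol_dir P \<le> (\<beta> i)\<^sup>2 * mu P e i" by (rule mult_left_mono) simp
    then show "(\<beta> i)\<^sup>2 * 1 \<le> 1 / tol_dir P * ((\<beta> i)\<^sup>2 * mu P e i)"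
      using tol by (simp add: field_simps)
  qed
  also have "\<dots> \<le> (\<Sum>i\<in>I. 1 / tol_dir P * ((\<beta> i)\<^sup>2 * mu P e i))"
    using fI tol mu0 by (intro sum_mono2) auto
  also have "\<dots> = 1 / tol_dir P * (\<Sum>i\<in>I. (\<beta> i)\<^sup>2 * mu P e i)" by (simp add: sum_distrib_left)
  also have "(\<Sum>i\<in>I. (\<beta> i)\<^sup>2 * mu P e i) = dform P e w w"
    unfolding \<beta> by (rule d.orthogonal_sum[symmetric]) (use fI vE do in auto)
  finally show "bform P e (w - proj_dir P e w) (w - proj_dir P e w) \<le> 1 / tol_dir P * dform P e w w" .
  show "proj_dir P e w \<in> span (psi P e ` {i \<in> {1..dim (Vedge0 P e)}. mu P e i \<le> tol_dir P})"
    unfolding proj I_def[symmetric] S_def[symmetric] by (intro span_sum span_scale span_base) auto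
qed

section \<open>Finiteness of the suprema behind \<open>c_t\<close> and \<open>c_p\<close>\<close>

section \<open>Trace and Poincare constants\<close>

definition trace_form :: "pt set \<Rightarrow> scalar_fun \<Rightarrow> scalar_fun \<Rightarrow> real"
  where "trace_form \<omega> u v = 1 / 2 *
    (\<Sum>(p, q)\<in>{(p, q). (\<exists>T\<in>mesh P. closed_segment p q edge_of T) \<and> closed_segment p q \<subseteq> frontier \<omega>}.
       dist p q * integral {0..1} (\<lambda>s. u (linepath p q s) * v (linepath p q s)))"

lemma bd_L2_norm_trace_form: "bd_L2_norm P \<omega> v = sqrt (trace_form \<omega> v v)"
  by (simp add: bd_L2_norm_def trace_form_def power2_eq_square)

lemma L2_norm_form: "L2_norm_on \<omega> v = sqrt (L2_form \<omega> v v)"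
  by (simp add: L2_norm_on_def L2_form_def power2_eq_square)

lemma grad_norm_form: "grad_L2_norm_on \<omega> v = sqrt (grad_form (\<lambda>x. 1) \<omega> v v)"
  by (simp add: grad_L2_norm_on_def grad_form_def power2_norm_eq_inner)

lemma Vloc_continuous: "elem_union P \<omega> \<Longrightarrow> v \<in> Vloc P \<omega> \<Longrightarrow> continuous_on (closure \<omega>) v"
proof -
  assume \<omega>: "elem_union P \<omega>" and "v \<in> Vloc P \<omega>"
  then obtain v' where v': "v' \<in> fe_space P" "v = restr (closure \<omega>) v'" by (auto simp: Vloc_def)
  have "continuous_on (closure \<omega>) v'"
    using fe_space_continuous[OF v'(1)] closure_subset_Omega[OF \<omega>] continuous_on_subset by blast
  then show ?thesis by (subst continuous_on_cong[OF refl, of _ v v']) (auto simp: v'(2) restr_def)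
qed

lemma segment_integrable:
  assumes \<omega>: "elem_union P \<omega>" and uv: "u \<in> Vloc P \<omega>" "v \<in> Vloc P \<omega>" and pq: "closed_segment p q \<subseteq> frontier \<omega>"
  shows "(\<lambda>s. u (linepath p q s) * v (linepath p q s)) integrable_on {0..1}"
proof -
  have sub: "linepath p q ` {0..1} \<subseteq> closure \<omega>"
    using pq by (auto simp: linepath_image_01 frontier_def)
  have "continuous_on {0..1} (\<lambda>s. w (linepath p q s))" if "w \<in> Vloc P \<omega>" for w
    by (rule continuous_on_compose2[OF Vloc_continuous[OF \<omega> that] continuous_on_linepath sub])
  then show ?thesis using uv by (intro integrable_continuous_interval continuous_intros) auto
qed

lemma psd_trace_form:
  assumes \<omega>: "elem_union P \<omega>"
  shows "psd_form (Vloc P \<omega>) (trace_form \<omega>)"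
proof
  show "subspace (Vloc P \<omega>)" by (rule subspace_Vloc)
  fix u v w :: scalar_fun and c :: real
  show "trace_form \<omega> u v = trace_form \<omega> v u" by (simp add: trace_form_def mult.commute)
  \<comment> \<open>A function that is not integrable has integral 0, so the sign is right for every
    \<open>u\<close>.\<close>
  have "0 \<le> integral {0..1} (\<lambda>s. u (linepath p q s) * u (linepath p q s))" for p q
    by (cases "(\<lambda>s. u (linepath p q s) * u (linepath p q s)) integrable_on {0..1}")
      (auto intro: Henstock_Kurzweil_Integration.integral_nonneg simp: not_integrable_integral)
  then show "0 \<le> trace_form \<omega> u u"
    unfolding trace_form_def by (intro mult_nonneg_nonneg sum_nonneg) (auto simp: case_prod_beta)
  assume uvw: "u \<in> Vloc P \<omega>" "v \<in> Vloc P \<omega>" "w \<in> Vloc P \<omega>"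
  let ?X = "{(p, q). (\<exists>T\<in>mesh P. closed_segment p q edge_of T) \<and> closed_segment p q \<subseteq> frontier \<omega>}"
  let ?i = "\<lambda>u p q. dist p q * integral {0..1} (\<lambda>s. u (linepath p q s) * w (linepath p q s))"
  have "?i (c *\<^sub>R u + v) p q = c * ?i u p q + ?i v p q" if "closed_segment p q \<subseteq> frontier \<omega>" for p q
  proof -
    note i = segment_integrable[OF \<omega> uvw(1,3) that] segment_integrable[OF \<omega> uvw(2,3) that]
    have "(\<lambda>s. (c *\<^sub>R u + v) (linepath p q s) * w (linepath p q s))
      = (\<lambda>s. c * (u (linepath p q s) * w (linepath p q s)) + v (linepath p q s) * w (linepath p q s))"
      by (auto simp: fun_eq_iff algebra_simps)
    then have "integral {0..1} (\<lambda>s. (c *\<^sub>R u + v) (linepath p q s) * w (linepath p q s))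
      = c * integral {0..1} (\<lambda>s. u (linepath p q s) * w (linepath p q s))
        + integral {0..1} (\<lambda>s. v (linepath p q s) * w (linepath p q s))"
      using i by (simp add: integral_add integrable_on_mult_right)
    then show ?thesis by (simp add: algebra_simps)
  qed
  then have "(\<Sum>(p, q)\<in>?X. ?i (c *\<^sub>R u + v) p q) = (\<Sum>(p, q)\<in>?X. c * ?i u p q + ?i v p q)"
    by (intro sum.cong) auto
  also have "\<dots> = c * (\<Sum>(p, q)\<in>?X. ?i u p q) + (\<Sum>(p, q)\<in>?X. ?i v p q)"
    by (simp add: case_prod_beta sum.distrib sum_distrib_left)
  finally show "trace_form \<omega> (c *\<^sub>R u + v) w = c * trace_form \<omega> u w + trace_form \<omega> v w"
    unfolding trace_form_def by (simp add: algebra_simps)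
qed

lemma bd_L2_norm_restr: "bd_L2_norm P (esub P e) (bd e v) = bd_L2_norm P (esub P e) v"
proof -
  have "integral {0..1} (\<lambda>s. (bd e v (linepath p q s))\<^sup>2) = integral {0..1} (\<lambda>s. (v (linepath p q s))\<^sup>2)"
    if "closed_segment p q \<subseteq> frontier (esub P e)" for p q
  proof (rule Henstock_Kurzweil_Integration.integral_cong)
    fix s :: real assume "s \<in> {0..1}"
    then have "linepath p q s \<in> frontier (esub P e)" using that linepath_in_path by blast
    then show "(bd e v (linepath p q s))\<^sup>2 = (v (linepath p q s))\<^sup>2" by (simp add: restr_def)
  qed
  then show ?thesis unfolding bd_L2_norm_def
    by (intro arg_cong[where f = sqrt] arg_cong2[where f = times] refl sum.cong) auto
qed

lemma finite_dim_Vloc: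
  assumes "subspace V" "V \<subseteq> Vloc P \<omega>"
  shows "\<exists>B. finite B \<and> span B = V"
proof -
  let ?S = "restr (closure \<omega>) ` hat P ` nodes P"
  have "Vloc P \<omega> \<subseteq> span ?S"
  proof
    fix v assume "v \<in> Vloc P \<omega>"
    then obtain v' where v': "v' \<in> span (hat P ` nodes P)" "v = restr (closure \<omega>) v'"
      using fe_space_span by (auto simp: Vloc_def)
    obtain c where c: "v' = (\<Sum>p\<in>nodes P. c p *\<^sub>R hat P p)" using span_image_sum[OF finite_nodes v'(1)] by blast
    have "v = (\<Sum>p\<in>nodes P. c p *\<^sub>R restr (closure \<omega>) (hat P p))"
      unfolding v'(2) c 
      by (rule lincomb_sum[where V = UNIV and F = "restr (closure \<omega>)"]) (auto simp: restr_lincomb)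
    then show "v \<in> span ?S" by (simp only:) (intro span_sum span_scale span_base imageI)
  qed
  then have VS: "V \<subseteq> span ?S" using assms(2) by blast
  obtain B where B: "B \<subseteq> V" "independent B" "V \<subseteq> span B" by (rule basis_exists[of V])
  have "finite B" using independent_span_bound[of ?S B] finite_nodes B VS by blast
  moreover have "span B = V" using span_subspace[OF B(1,3) assms(1)] by simp
  ultimately show ?thesis by blast
qed

lemma psd_form_add:
  assumes "psd_form V a" "psd_form V b"
  shows "psd_form V (\<lambda>u v. a u v + b u v)"
proof -
  interpret a: psd_form V a by fact
  interpret b: psd_form V b by fact
  show ?thesis
    by unfold_locales (use a.subspace_V a.sym b.sym a.lin b.lin a.nonneg b.nonneg in \<open>auto simp: algebra_simps\<close>)
qed

lemma Vha_Vloc: "Vha P e \<subseteq> Vloc P (esub P e)"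
  by (auto simp: Vha_def Vesub_def)

lemma Vha_broken: "Vha P e \<subseteq> broken P (esub P e)"
  using Vha_Vloc Vloc_broken by blast

text \<open>By finite dimension, the suprema that define \<open>c_t_edge\<close> and \<open>c_p_edge\<close> are finite as soon as the
  numerator vanishes where the denominator does.\<close>

lemma Vha_domination:
  assumes e: "e \<in> edges P" and p: "psd_form (Vha P e) p" and q: "psd_form (Vha P e) q"
    and ker: "\<And>v. v \<in> Vha P e \<Longrightarrow> q v v = 0 \<Longrightarrow> p v v = 0"
  shows "\<exists>C\<ge>0. \<forall>v\<in>Vha P e. sqrt (p v v) \<le> C * sqrt (q v v)"
proof -
  obtain B where B: "finite B" "span B = Vha P e"
    using finite_dim_Vloc[OF subspace_Vha[OF e] Vha_Vloc] by blast
  obtain C where C: "C \<ge> 0" "\<forall>v\<in>Vha P e. p v v \<le> C * q v v"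
    using psd_form_domination[OF B(1), of p q] p q ker unfolding B(2) by blast
  have "sqrt (p v v) \<le> sqrt C * sqrt (q v v)" if "v \<in> Vha P e" for v
    using C(2) that by (simp flip: real_sqrt_mult)
  then show ?thesis using C(1) by (intro exI[of _ "sqrt C"]) auto
qed

text \<open>The bound \<open>C\<close> makes the set of quotients bounded, so that
  \<open>Sup\<close> is an upper bound at all; where \<open>g\<close> vanishes, \<open>C\<close>
  forces \<open>f v\<close> to be at most 0.\<close>

lemma quotient_sup_bound:
  assumes "C \<ge> 0" "\<And>v. v \<in> V \<Longrightarrow> f v \<le> C * g v" "\<And>v. v \<in> V \<Longrightarrow> 0 \<le> (f v :: real)" "\<And>v. v \<in> V \<Longrightarrow> 0 \<le> g v"
    and v: "v \<in> V"
  shows "f v \<le> Sup (insert 0 {f v / g v |v. v \<in> V \<and> g v \<noteq> 0}) * g v"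
    and "0 \<le> Sup (insert 0 {f v / g v |v. v \<in> V \<and> g v \<noteq> 0})"
proof -
  let ?X = "insert 0 {f v / g v |v. v \<in> V \<and> g v \<noteq> 0}"
  have bdd: "bdd_above ?X"
  proof (rule bdd_aboveI[of _ C])
    fix x assume "x \<in> ?X"
    then show "x \<le> C"
    proof
      assume "x \<in> {f v / g v |v. v \<in> V \<and> g v \<noteq> 0}"
      then obtain v where v: "x = f v / g v" "v \<in> V" "g v \<noteq> 0" by blast
      then have "g v > 0" using assms(4)[OF v(2)] by simp
      then show "x \<le> C" using v(1) assms(2)[OF v(2)] by (simp add: pos_divide_le_eq)
    qed (use assms(1) in simp)
  qed
  show "0 \<le> Sup ?X" by (rule cSup_upper[OF _ bdd]) simp
  show "f v \<le> Sup ?X * g v"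
  proof (cases "g v = 0")
    case True
    then show ?thesis using assms(2)[OF v] by simp
  next
    case False
    then have "g v > 0" using assms(4)[OF v] by simp
    have "f v / g v \<le> Sup ?X" by (rule cSup_upper[OF _ bdd]) (use v False in blast)
    then show ?thesis using \<open>g v > 0\<close> by (simp add: field_simps)
  qed
qed

lemma H1_norm_form: "H1_norm_on \<omega> v = sqrt (L2_form \<omega> v v + grad_form (\<lambda>x. 1) \<omega> v v)"
  if "elem_union P \<omega>" "v \<in> broken P \<omega>"
  using psd_form.nonneg[OF psd_L2_form[OF that(1)] that(2)]
    psd_form.nonneg[OF psd_grad_form[OF elementwise_constant_const[of 1] that(1)] that(2)]
  by (simp add: H1_norm_on_def L2_norm_form grad_norm_form)

lemma L2_form_zero:
  assumes \<omega>: "elem_union P \<omega>" and v: "v \<in> Vloc P \<omega>" "L2_form \<omega> v v = 0"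
  shows "v = 0"
proof
  fix x
  have cont: "continuous_on (closure \<omega>) v" by (rule Vloc_continuous[OF \<omega> v(1)])
  have b: "v \<in> broken P \<omega>" using v(1) Vloc_broken by blast
  have "v x * v x = 0" if "x \<in> \<omega>" for x
  proof (rule continuous_integral_zero[OF elem_union_open[OF \<omega>] _ _ _ _ that])
    show "continuous_on \<omega> (\<lambda>x. v x * v x)"
      using continuous_on_subset[OF cont closure_subset] by (intro continuous_intros)
    show "set_integrable lebesgue \<omega> (\<lambda>x. v x * v x)"
      by (rule set_integral_elements(1)[OF \<omega>]) (use L2_integrable els_mesh broken_fe_on[OF b] in blast)
    show "(LINT x:\<omega>|lebesgue. v x * v x) = 0" using v(2) by (simp add: L2_form_def)
  qed auto
  then have z: "v x = 0" if "x \<in> \<omega>" for x using that by simp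
  show "v x = 0 x"
  proof (cases "x \<in> closure \<omega>")
    case True
    then show ?thesis using continuous_constant_on_closure[OF cont, of 0 x] z by auto
  next
    case False
    then show ?thesis using v(1) by (auto simp: Vloc_def restr_def)
  qed
qed

text \<open>The kernel condition holds because a zero H1 norm contains a zero L2 norm, and this
  forces the continuous function to vanish.\<close>

lemma trace_bound:
  assumes e: "e \<in> edges P" and v: "v \<in> Vha P e"
  shows "bd_L2_norm P (esub P e) v \<le> c_t_edge P e * H1_norm_on (esub P e) v" "0 \<le> c_t_edge P e"
proof -
  note \<omega> = esub_elem_union[OF e]
  let ?q = "\<lambda>u v. L2_form (esub P e) u v + grad_form (\<lambda>x. 1) (esub P e) u v"
  have l: "psd_form (Vha P e) (L2_form (esub P e))"
    by (rule psd_form.subform[OF psd_L2_form[OF \<omega>] subspace_Vha[OF e] Vha_broken])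
  have g: "psd_form (Vha P e) (grad_form (\<lambda>x. 1) (esub P e))"
    by (rule psd_form.subform[OF psd_grad_form[OF elementwise_constant_const \<omega>] subspace_Vha[OF e] Vha_broken]) simp
  have t: "psd_form (Vha P e) (trace_form (esub P e))"
    by (rule psd_form.subform[OF psd_trace_form[OF \<omega>] subspace_Vha[OF e] Vha_Vloc])
  have "\<exists>C\<ge>0. \<forall>v\<in>Vha P e. sqrt (trace_form (esub P e) v v) \<le> C * sqrt (?q v v)"
  proof (rule Vha_domination[OF e t psd_form_add[OF l g]])
    fix v assume v: "v \<in> Vha P e" "?q v v = 0"
    then have "L2_form (esub P e) v v = 0"
      using psd_form.nonneg[OF l v(1)] psd_form.nonneg[OF g v(1)] by linarith
    then have "v = 0" using L2_form_zero[OF \<omega>] v(1) Vha_Vloc by blast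
    then show "trace_form (esub P e) v v = 0" using psd_form.zero_left[OF t v(1)] by simp
  qed
  then obtain C where C: "C \<ge> 0" "\<forall>v\<in>Vha P e. bd_L2_norm P (esub P e) v \<le> C * H1_norm_on (esub P e) v"
    using H1_norm_form[OF \<omega>] Vha_broken unfolding bd_L2_norm_trace_form by (metis subsetD)
  have nn: "0 \<le> bd_L2_norm P (esub P e) v" "0 \<le> H1_norm_on (esub P e) v" if "v \<in> Vha P e" for v
    using psd_form.nonneg[OF t that] by (auto simp: bd_L2_norm_trace_form H1_norm_on_def)
  show "bd_L2_norm P (esub P e) v \<le> c_t_edge P e * H1_norm_on (esub P e) v" "0 \<le> c_t_edge P e"
    unfolding c_t_edge_def
    using quotient_sup_bound[of C "Vha P e" "bd_L2_norm P (esub P e)" "H1_norm_on (esub P e)", OF C(1) _ nn v] C(2) by blast+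
qed

text \<open>At \<open>u_ha P e u\<close> this is \<open>c_u\<close>, and in general the factor of
  the indicator in \<open>c_p_edge\<close>; written as a linear functional of
  \<open>v\<close>.\<close>

definition mean_coeff :: "pt set \<Rightarrow> scalar_fun \<Rightarrow> real"
  where "mean_coeff e v = (if frontier (esub P e) \<inter> frontier (Omega P) = {}
    then (LINT x:esub P e|lebesgue. v x) / measure lebesgue (esub P e) else 0)"

abbreviation centre :: "pt set \<Rightarrow> scalar_fun \<Rightarrow> scalar_fun"
  where "centre e v \<equiv> v - mean_coeff e v *\<^sub>R indicator (closure (esub P e))"

lemma indicator_broken: "indicator (closure \<omega>) \<in> broken P \<omega>"
  using broken_cong[of \<omega> "indicator (closure \<omega>)" "\<lambda>x. 1"] const_broken by auto

lemma mean_coeff_lincomb: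
  assumes e: "e \<in> edges P" and uv: "u \<in> broken P (esub P e)" "v \<in> broken P (esub P e)"
  shows "mean_coeff e (c *\<^sub>R u + v) = c * mean_coeff e u + mean_coeff e v"
proof -
  have L: "(LINT x:esub P e|lebesgue. w x) = L2_form (esub P e) w (\<lambda>x. 1)" for w
    by (simp add: L2_form_def)
  have "L2_form (esub P e) (c *\<^sub>R u + v) (\<lambda>x. 1) = c * L2_form (esub P e) u (\<lambda>x. 1) + L2_form (esub P e) v (\<lambda>x. 1)"
    by (rule psd_form.lin[OF psd_L2_form[OF esub_elem_union[OF e]] uv const_broken])
  then show ?thesis unfolding mean_coeff_def L by (simp add: add_divide_distrib)
qed

lemma centre_lincomb:
  assumes "e \<in> edges P" "u \<in> broken P (esub P e)" "v \<in> broken P (esub P e)"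
  shows "centre e (c *\<^sub>R u + v) = c *\<^sub>R centre e u + centre e v"
  unfolding mean_coeff_lincomb[OF assms] by (simp add: fun_eq_iff algebra_simps)

lemma centre_broken: "u \<in> broken P (esub P e) \<Longrightarrow> centre e u \<in> broken P (esub P e)"
  using subspace_broken indicator_broken by (meson subspace_diff subspace_scale)

lemma esub_measure: "e \<in> edges P \<Longrightarrow> measure lebesgue (esub P e) \<noteq> 0"
proof
  assume e: "e \<in> edges P" and 0: "measure lebesgue (esub P e) = 0"
  have "bounded (esub P e)" using bounded_Omega elem_union_subset[OF esub_elem_union[OF e]] bounded_subset by blast
  then have "esub P e \<in> lmeasurable" using esub_open[OF e] lmeasurable_open by blast
  then have "negligible (esub P e)" using 0 negligible_iff_measure by blast
  then show False using open_not_negligible[OF esub_open[OF e] esub_nonempty[OF e]] by blast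
qed

text \<open>A zero gradient makes \<open>v\<close> constant on the connected domain. Away from the
  outer boundary the mean subtracts this constant; otherwise the boundary condition makes it
  0.\<close>

lemma poincare_bound:
  assumes e: "e \<in> edges P" and v: "v \<in> Vha P e"
  shows "L2_norm_on (esub P e) (centre e v) \<le> c_p_edge P e * grad_L2_norm_on (esub P e) v" "0 \<le> c_p_edge P e"
proof -
  note \<omega> = esub_elem_union[OF e]
  let ?p = "\<lambda>u v. L2_form (esub P e) (centre e u) (centre e v)"
  interpret l: psd_form "broken P (esub P e)" "L2_form (esub P e)" by (rule psd_L2_form[OF \<omega>])
  have vb: "v \<in> Vha P e \<Longrightarrow> v \<in> broken P (esub P e)" for v using Vha_broken by blast
  have g: "psd_form (Vha P e) (grad_form (\<lambda>x. 1) (esub P e))"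
    by (rule psd_form.subform[OF psd_grad_form[OF elementwise_constant_const \<omega>] subspace_Vha[OF e] Vha_broken]) simp
  have p: "psd_form (Vha P e) ?p"
  proof
    show "subspace (Vha P e)" by (rule subspace_Vha[OF e])
    fix u v w :: scalar_fun and c :: real
    assume u: "u \<in> Vha P e"
    note cu = centre_broken[OF vb[OF u]]
    show "0 \<le> ?p u u" by (rule l.nonneg[OF cu])
    assume v: "v \<in> Vha P e"
    note cv = centre_broken[OF vb[OF v]]
    show "?p u v = ?p v u" by (rule l.sym[OF cu cv])
    assume w: "w \<in> Vha P e"
    show "?p (c *\<^sub>R u + v) w = c * ?p u w + ?p v w"
      unfolding centre_lincomb[OF e vb[OF u] vb[OF v]] by (rule l.lin[OF cu cv centre_broken[OF vb[OF w]]])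
  qed
  have "\<exists>C\<ge>0. \<forall>v\<in>Vha P e. sqrt (?p v v) \<le> C * sqrt (grad_form (\<lambda>x. 1) (esub P e) v v)"
  proof (rule Vha_domination[OF e p g])
    fix v assume v: "v \<in> Vha P e" "grad_form (\<lambda>x. 1) (esub P e) v v = 0"
    have vl: "v \<in> Vloc P (esub P e)" using v(1) Vha_Vloc by blast
    have const: "v x = v y" if "x \<in> closure (esub P e)" "y \<in> closure (esub P e)" for x y
      by (rule grad_form_zero_connected[OF elementwise_constant_const _ \<omega> esub_connected[OF e] vb[OF v(1)]
            Vloc_continuous[OF \<omega> vl] v(2) that]) auto
    have "centre e v x = 0" if x: "x \<in> closure (esub P e)" for x
    proof (cases "frontier (esub P e) \<inter> frontier (Omega P) = {}")
      case True
      have "(LINT y:esub P e|lebesgue. v y) = (LINT y:esub P e|lebesgue. v x)"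
        by (rule set_lebesgue_integral_cong)
          (use const[OF _ x] closure_subset[of "esub P e"] esub_open[OF e] in auto)
      also have "\<dots> = v x * measure lebesgue (esub P e)"
        by (simp add: set_lebesgue_integral_def mult.commute)
      finally have "mean_coeff e v = v x" using True esub_measure[OF e] by (simp add: mean_coeff_def)
      then show ?thesis using x by simp
    next
      case False
      then obtain y where y: "y \<in> frontier (esub P e)" "y \<in> frontier (Omega P)" by blast
      then have "v y = 0" using v(1) by (auto simp: Vha_def Vesub_def)
      then have "v x = 0" using const[OF x, of y] y(1) by (simp add: frontier_def)
      then show ?thesis using False by (simp add: mean_coeff_def)
    qed
    then have "?p v v = L2_form (esub P e) 0 0"
      unfolding L2_form_def using closure_subset[of "esub P e"] esub_open[OF e]
      by (intro set_lebesgue_integral_cong) (auto simp: subset_iff)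
    then show "?p v v = 0" using l.zero_left[of 0] by simp
  qed
  then obtain C where C: "C \<ge> 0"
    "\<forall>v\<in>Vha P e. L2_norm_on (esub P e) (centre e v) \<le> C * grad_L2_norm_on (esub P e) v"
    unfolding L2_norm_form grad_norm_form by blast
  have nn: "0 \<le> L2_norm_on (esub P e) (centre e v)" "0 \<le> grad_L2_norm_on (esub P e) v" if "v \<in> Vha P e" for v
    using psd_form.nonneg[OF p that] psd_form.nonneg[OF g that] by (auto simp: L2_norm_form grad_norm_form)
  have cp: "c_p_edge P e = Sup (insert 0 {L2_norm_on (esub P e) (centre e v) / grad_L2_norm_on (esub P e) v |v.
      v \<in> Vha P e \<and> grad_L2_norm_on (esub P e) v \<noteq> 0})"
    unfolding c_p_edge_def Let_def mean_coeff_def by (simp add: if_distrib cong: if_cong)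
  show "L2_norm_on (esub P e) (centre e v) \<le> c_p_edge P e * grad_L2_norm_on (esub P e) v" "0 \<le> c_p_edge P e"
    unfolding cp
    using quotient_sup_bound[of C "Vha P e" "\<lambda>v. L2_norm_on (esub P e) (centre e v)" "grad_L2_norm_on (esub P e)", OF C(1) _ nn v] C(2) by blast+
qed

end

section \<open>From the local constants to the energy of the whole splitting\<close>

section \<open>The stable decomposition\<close>

locale fe_method = fe_decomposition +
  fixes c1 c2 :: real
  assumes inner_products: "\<forall>e\<in>edges P. inner_product_on (Vbd P e) (bip P e)"
    and norm_equivalence: "0 < c1" "0 < c2"
      "\<forall>e\<in>edges P. \<forall>\<zeta>\<in>Vbd P e.
         c1 * sqrt (bip P e \<zeta> \<zeta>) \<le> sqrt \<alpha>min * bd_L2_norm P (esub P e) \<zeta> \<and>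
         sqrt \<alpha>min * bd_L2_norm P (esub P e) \<zeta> \<le> c2 * sqrt (bip P e \<zeta> \<zeta>)"
    and tolerances: "0 < tol_dir P" "0 < tol_tr P"
    and eigenpairs: "\<forall>e\<in>edges P. dirichlet_eigenpairs P e" "\<forall>e\<in>edges P. transfer_eigenpairs P e"
begin

definition spectral_bound :: real
  where "spectral_bound = max ((c_t P)\<^sup>2 * tol_tr P * (1 + (c_p P)\<^sup>2) / c1\<^sup>2) (1 / tol_dir P)"

lemma spectral_bound_nonneg: "0 \<le> spectral_bound"
  using tolerances by (simp add: spectral_bound_def le_max_iff_disj)

lemma u_hat_centre: "u_hat P e u = centre e (u_ha P e u)"
  by (simp add: u_hat_def c_u_def mean_coeff_def)

lemma grad_form_const:
  assumes "open \<omega>"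
  shows "grad_form w \<omega> (indicator (closure \<omega>)) v = 0"
proof -
  have g: "grad (\<lambda>x. 1) x = 0" for x :: pt
    by (rule grad_eqI) (auto simp: gderiv_def)
  have "grad (indicator (closure \<omega>)) x = (0 :: pt)" if "x \<in> \<omega>" for x :: pt
    using grad_cong[OF assms that, of "indicator (closure \<omega>)" "\<lambda>x. 1"] closure_subset[of \<omega>] g
    by (auto simp: indicator_def subset_iff)
  then have "grad_form w \<omega> (indicator (closure \<omega>)) v = (LINT x:\<omega>|lebesgue. 0)"
    unfolding grad_form_def using assms by (intro set_lebesgue_integral_cong) auto
  then show ?thesis by (simp add: set_lebesgue_integral_def)
qed

lemma indicator_Vloc: "elem_union P \<omega> \<Longrightarrow> indicator (closure \<omega>) \<in> Vloc P \<omega>"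
proof -
  assume \<omega>: "elem_union P \<omega>"
  have "restr (closure (Omega P)) (\<lambda>x. 1) \<in> fe_space P"
    unfolding fe_space_iff
  proof (intro conjI ballI allI impI)
    fix T assume T: "T \<in> mesh P"
    have "restr (closure (Omega P)) (\<lambda>x. 1) x = 1" if "x \<in> T" for x
      using that T mesh_Union by (auto simp: restr_def)
    then show "fe_on T (restr (closure (Omega P)) (\<lambda>x. 1))"
      using fe_on_cong[OF mesh_element[OF T], of "restr (closure (Omega P)) (\<lambda>x. 1)" "\<lambda>x. 1"]
        fe_on_const[OF mesh_element[OF T]] by blast
  qed (simp add: restr_def)
  moreover have "indicator (closure \<omega>) = restr (closure \<omega>) (restr (closure (Omega P)) (\<lambda>x. 1))"
    using closure_subset_Omega[OF \<omega>] by (auto simp: restr_def indicator_def fun_eq_iff subset_iff)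
  ultimately show ?thesis unfolding Vloc_def by blast
qed

text \<open>Constants have zero energy with everything, but satisfy the boundary condition only if
  the oversampling domain stays away from the outer boundary; in the other case \<open>c_u\<close>
  is 0.\<close>

lemma u_hat_Vha:
  assumes e: "e \<in> edges P" and u: "u \<in> V0 P"
  shows "u_hat P e u \<in> Vha P e"
proof (cases "frontier (esub P e) \<inter> frontier (Omega P) = {}")
  case True
  have "indicator (closure (esub P e)) \<in> Vha P e"
    using indicator_Vloc[OF esub_elem_union[OF e]] True grad_form_const[OF esub_open[OF e]]
    by (auto simp: Vha_def Vesub_def energy_grad_form)
  then show ?thesis unfolding u_hat_centre
    using u_ha_props(1)[OF e u] subspace_Vha[OF e] by (meson subspace_diff subspace_scale)
next
  case False
  then show ?thesis using u_ha_props(1)[OF e u] by (simp add: u_hat_centre mean_coeff_def)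
qed

lemma energy_ge_grad:
  assumes \<omega>: "elem_union P \<omega>" and v: "v \<in> broken P \<omega>"
  shows "\<alpha>min * grad_form (\<lambda>x. 1) \<omega> v v \<le> energy P \<omega> v v"
proof -
  have "\<alpha>min * grad_form (\<lambda>x. 1) (interior T) v v \<le> energy P (interior T) v v" if T: "T \<in> els P \<omega>" for T
  proof -
    note i = grad_integrable[OF _ els_mesh[OF T] broken_fe_on[OF v T] broken_fe_on[OF v T]]
    have "\<alpha>min * grad_form (\<lambda>x. 1) (interior T) v v = (LINT x:interior T|lebesgue. \<alpha>min * (1 * (grad v x \<bullet> grad v x)))"
      by (simp add: grad_form_def)
    also have "\<dots> \<le> energy P (interior T) v v"
      unfolding energy_def
    proof (rule set_integral_mono)
      show "set_integrable lebesgue (interior T) (\<lambda>x. \<alpha>min * (1 * (grad v x \<bullet> grad v x)))"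
        using i[OF elementwise_constant_const[of 1]] by (intro set_integrable_mult_right) auto
      show "set_integrable lebesgue (interior T) (\<lambda>x. alpha P x * (grad v x \<bullet> grad v x))"
        by (rule i[OF elementwise_constant_alpha])
      show "\<alpha>min * (1 * (grad v x \<bullet> grad v x)) \<le> alpha P x * (grad v x \<bullet> grad v x)" if "x \<in> interior T" for x
        using alpha_ge[OF els_mesh[OF T] that] by (simp add: mult_right_mono)
    qed
    finally show ?thesis .
  qed
  then show ?thesis
    unfolding energy_sum[OF \<omega> v v] grad_form_sum[OF elementwise_constant_const[of 1, OF zero_le_one] \<omega> v v] sum_distrib_left
    by (rule sum_mono)
qed

lemma constants_edge:
  assumes e: "e \<in> edges P"
  shows "c_t_edge P e \<le> c_t P" "c_p_edge P e \<le> c_p P"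
  using finite_edges e by (auto simp: c_t_def c_p_def intro!: Max_ge)

text \<open>Norm equivalence, trace bound and Poincare bound in a row. The factor
  \<open>\<alpha>min\<close> brought in by the norm equivalence is absorbed when the gradient norm
  is replaced by the energy, so the bound is free of the contrast.\<close>

lemma trace_estimate:
  assumes e: "e \<in> edges P" and u: "u \<in> V0 P"
  shows "tol_tr P * bip P e (bd e (u_hat P e u)) (bd e (u_hat P e u))
    \<le> spectral_bound * energy P (esub P e) (u_ha P e u) (u_ha P e u)"
proof -
  note \<omega> = esub_elem_union[OF e]
  let ?h = "u_hat P e u" and ?w = "u_ha P e u" and ?G = "grad_form (\<lambda>x. 1) (esub P e)"
  have w: "?w \<in> Vha P e" and h: "?h \<in> Vha P e" using u_ha_props(1)[OF e u] u_hat_Vha[OF e u] .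
  have wb: "?w \<in> broken P (esub P e)" and hb: "?h \<in> broken P (esub P e)" using w h Vha_broken by auto
  interpret g: psd_form "broken P (esub P e)" ?G
    by (rule psd_grad_form[OF elementwise_constant_const \<omega>]) simp
  \<comment> \<open>Subtracting a constant does not change the gradient.\<close>
  have G: "?G ?h ?h = ?G ?w ?w"
  proof -
    have c: "indicator (closure (esub P e)) \<in> broken P (esub P e)" by (rule indicator_broken)
    have "?G (indicator (closure (esub P e))) v = 0" "?G v (indicator (closure (esub P e))) = 0"
      if "v \<in> broken P (esub P e)" for v
      using grad_form_const[OF esub_open[OF e]] g.sym[OF that c] by auto
    then show ?thesis unfolding u_hat_centre using wb c by (simp add: g.bilin g.mem)
  qed
  have "bd e ?h \<in> Vbd P e" using h Vha_Vesub by (auto simp: Vbd_def)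
  then have "c1 * sqrt (bip P e (bd e ?h) (bd e ?h)) \<le> sqrt \<alpha>min * bd_L2_norm P (esub P e) ?h"
    using norm_equivalence(3) e bd_L2_norm_restr by metis
  also have "\<dots> \<le> sqrt \<alpha>min * (c_t P * H1_norm_on (esub P e) ?h)"
  proof -
    have "bd_L2_norm P (esub P e) ?h \<le> c_t_edge P e * H1_norm_on (esub P e) ?h" by (rule trace_bound(1)[OF e h])
    also have "\<dots> \<le> c_t P * H1_norm_on (esub P e) ?h"
      by (rule mult_right_mono[OF constants_edge(1)[OF e]]) (simp add: H1_norm_on_def)
    finally show ?thesis using alpha_min_pos by (simp add: mult_left_mono)
  qed
  finally have 1: "c1 * sqrt (bip P e (bd e ?h) (bd e ?h)) \<le> sqrt \<alpha>min * (c_t P * H1_norm_on (esub P e) ?h)" .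
  have bip0: "0 \<le> bip P e (bd e ?h) (bd e ?h)"
    using psd_form.nonneg[OF inner_product_on_psd[OF subspace_Vbd]] inner_products e \<open>bd e ?h \<in> Vbd P e\<close> by blast
  have "(c1 * sqrt (bip P e (bd e ?h) (bd e ?h)))\<^sup>2 \<le> (sqrt \<alpha>min * (c_t P * H1_norm_on (esub P e) ?h))\<^sup>2"
    by (rule power_mono[OF 1]) (use norm_equivalence(1) bip0 in simp)
  then have 2: "c1\<^sup>2 * bip P e (bd e ?h) (bd e ?h) \<le> \<alpha>min * ((c_t P)\<^sup>2 * (H1_norm_on (esub P e) ?h)\<^sup>2)"
    using bip0 alpha_min_pos by (simp add: power_mult_distrib)
  have L: "L2_form (esub P e) ?h ?h \<le> (c_p P)\<^sup>2 * ?G ?w ?w"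
  proof -
    have "L2_norm_on (esub P e) ?h \<le> c_p_edge P e * grad_L2_norm_on (esub P e) ?w"
      unfolding u_hat_centre by (rule poincare_bound(1)[OF e w])
    also have "\<dots> \<le> c_p P * grad_L2_norm_on (esub P e) ?w"
      by (rule mult_right_mono[OF constants_edge(2)[OF e]]) (use g.nonneg[OF wb] in \<open>simp add: grad_norm_form\<close>)
    finally have "L2_norm_on (esub P e) ?h \<le> c_p P * grad_L2_norm_on (esub P e) ?w" .
    moreover have "0 \<le> L2_form (esub P e) ?h ?h" by (rule psd_form.nonneg[OF psd_L2_form[OF \<omega>] hb])
    ultimately have "(L2_norm_on (esub P e) ?h)\<^sup>2 \<le> (c_p P * grad_L2_norm_on (esub P e) ?w)\<^sup>2"
      by (intro power_mono) (auto simp: L2_norm_form)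
    then show ?thesis using \<open>0 \<le> L2_form (esub P e) ?h ?h\<close> g.nonneg[OF wb]
      by (simp add: L2_norm_form grad_norm_form power_mult_distrib)
  qed
  have "(H1_norm_on (esub P e) ?h)\<^sup>2 = L2_form (esub P e) ?h ?h + ?G ?w ?w"
    using H1_norm_form[OF \<omega> hb] psd_form.nonneg[OF psd_L2_form[OF \<omega>] hb] g.nonneg[OF hb] G by simp
  then have 3: "(H1_norm_on (esub P e) ?h)\<^sup>2 \<le> (1 + (c_p P)\<^sup>2) * ?G ?w ?w" using L by (simp add: algebra_simps)
  have "c1\<^sup>2 * bip P e (bd e ?h) (bd e ?h) \<le> \<alpha>min * ((c_t P)\<^sup>2 * ((1 + (c_p P)\<^sup>2) * ?G ?w ?w))"
  proof -
    have "\<alpha>min * ((c_t P)\<^sup>2 * (H1_norm_on (esub P e) ?h)\<^sup>2) \<le> \<alpha>min * ((c_t P)\<^sup>2 * ((1 + (c_p P)\<^sup>2) * ?G ?w ?w))"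
      using alpha_min_pos by (intro mult_left_mono 3) auto
    then show ?thesis using 2 by linarith
  qed
  also have "\<dots> = (c_t P)\<^sup>2 * (1 + (c_p P)\<^sup>2) * (\<alpha>min * ?G ?w ?w)" by simp
  also have "\<dots> \<le> (c_t P)\<^sup>2 * (1 + (c_p P)\<^sup>2) * energy P (esub P e) ?w ?w"
    by (rule mult_left_mono[OF energy_ge_grad[OF \<omega> wb]]) simp
  finally have "tol_tr P * (c1\<^sup>2 * bip P e (bd e ?h) (bd e ?h))
      \<le> tol_tr P * ((c_t P)\<^sup>2 * (1 + (c_p P)\<^sup>2) * energy P (esub P e) ?w ?w)"
    using tolerances(2) by (simp add: mult_left_mono)
  then have "tol_tr P * bip P e (bd e ?h) (bd e ?h)
      \<le> (c_t P)\<^sup>2 * tol_tr P * (1 + (c_p P)\<^sup>2) / c1\<^sup>2 * energy P (esub P e) ?w ?w"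
    using norm_equivalence(1) by (simp add: field_simps)
  also have "\<dots> \<le> spectral_bound * energy P (esub P e) ?w ?w"
    by (rule mult_right_mono) (use psd_form.nonneg[OF psd_energy[OF \<omega>] wb] in \<open>auto simp: spectral_bound_def\<close>)
  finally show ?thesis .
qed

section \<open>The truncation error on one edge and the nodal values of the coarse function\<close>

definition edge_ha :: "pt set \<Rightarrow> scalar_fun \<Rightarrow> scalar_fun"
  where "edge_ha e u = restr (closure e) (u_hat P e u) - interp_endpoints P e (u_hat P e u)"

definition edge_perp :: "pt set \<Rightarrow> scalar_fun \<Rightarrow> scalar_fun"
  where "edge_perp e u = restr (closure e) (u_perp P e u) - interp_endpoints P e (u_perp P e u)"

definition edge_error :: "pt set \<Rightarrow> scalar_fun \<Rightarrow> scalar_fun"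
  where "edge_error e u = (edge_ha e u - proj_tr P e (edge_ha e u)) + (edge_perp e u - proj_dir P e (edge_perp e u))"

text \<open>Each truncation error is bounded by \<open>spectral_bound\<close> times the energy of
  its part of \<open>u\<close>. Young's inequality costs the factor 2, and the two energies add up
  exactly to the local energy of \<open>u\<close>.\<close>

lemma edge_error_bound:
  assumes e: "e \<in> edges P" and u: "u \<in> V0 P"
  shows "edge_error e u \<in> Vedge0 P e"
    "bform P e (edge_error e u) (edge_error e u) \<le> 2 * spectral_bound * energy P (esub P e) u u"
proof -
  interpret b: psd_form "Vedge0 P e" "bform P e" by (rule psd_bform[OF e])
  have ip: "inner_product_on (Vbd P e) (bip P e)" and tr: "transfer_eigenpairs P e" and di: "dirichlet_eigenpairs P e"
    using inner_products eigenpairs e by auto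
  have p: "u_perp P e u \<in> Vloc0 P (esub P e)" by (rule u_ha_props(3)[OF e u])
  have pE: "edge_perp e u \<in> Vedge0 P e" unfolding edge_perp_def
    by (rule edge_part_Vedge0[OF e]) (use p in \<open>simp add: Vloc0_def\<close>)
  note T = transfer_spectral_estimate[OF e ip tr tolerances(2) u_hat_Vha[OF e u], folded edge_ha_def]
  note D = dirichlet_spectral_estimate[OF e di tolerances(1) pE]
  show "edge_error e u \<in> Vedge0 P e" unfolding edge_error_def by (rule b.mem_add[OF T(1) D(1)])
  have d: "dform P e (edge_perp e u) (edge_perp e u) \<le> energy P (esub P e) (u_perp P e u) (u_perp P e u)"
    by (rule dform_minimal[OF e p]) (simp only: edge_perp_def edge_part_node)
  have nn: "0 \<le> energy P (esub P e) (u_perp P e u) (u_perp P e u)"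
    using psd_form.nonneg[OF psd_energy_esub[OF e]] p Vloc0_Vesub[OF e] Vesub_broken by blast
  have "1 / tol_dir P * dform P e (edge_perp e u) (edge_perp e u)
      \<le> spectral_bound * energy P (esub P e) (u_perp P e u) (u_perp P e u)"
    by (rule mult_mono[OF _ d spectral_bound_nonneg psd_form.nonneg[OF psd_dform[OF e] pE]]) (simp add: spectral_bound_def)
  then have "bform P e (edge_perp e u - proj_dir P e (edge_perp e u)) (edge_perp e u - proj_dir P e (edge_perp e u))
      \<le> spectral_bound * energy P (esub P e) (u_perp P e u) (u_perp P e u)"
    using D(2) by linarith
  moreover have "bform P e (edge_ha e u - proj_tr P e (edge_ha e u)) (edge_ha e u - proj_tr P e (edge_ha e u))
      \<le> spectral_bound * energy P (esub P e) (u_ha P e u) (u_ha P e u)"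
    using T(2) trace_estimate[OF e u] by linarith
  ultimately have "bform P e (edge_error e u) (edge_error e u)
      \<le> 2 * (spectral_bound * energy P (esub P e) (u_ha P e u) (u_ha P e u))
       + 2 * (spectral_bound * energy P (esub P e) (u_perp P e u) (u_perp P e u))"
    unfolding edge_error_def using b.add_le[OF T(1) D(1)] by linarith
  also have "\<dots> = 2 * spectral_bound * energy P (esub P e) u u"
    unfolding u_ha_props(5)[OF e u, symmetric] by (simp add: algebra_simps)
  finally show "bform P e (edge_error e u) (edge_error e u) \<le> 2 * spectral_bound * energy P (esub P e) u u" .
qed

lemma subspace_harmonic: "subspace {v. harmonic v}"
proof -
  have "v \<in> fe_space P" if "w \<in> Vloc0 P (sub P i)" "i \<in> subs" "v = w" for v w i
    using that Vloc0_iff[OF sub_elem_union] by blast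
  then have "harmonic 0"
    using subspace_V0 psd_form.zero_left[OF psd_energy_fe[OF sub_elem_union]] by (auto simp: harmonic_def subspace_0)
  then show ?thesis
    unfolding subspace_def using harmonic_lincomb[where c = 1] harmonic_lincomb[where v = 0] by auto
qed

lemma finite_vertices: "finite (vertices P)"
  using finite_nodes by (auto simp: vertices_def intro: finite_subset)

lemma interp_vertices_harmonic: "harmonic (interp_vertices P u)"
  unfolding interp_vertices_def using vertex_ext(1)
  by (intro subspace_sum[OF subspace_harmonic, simplified] subspace_scale[OF subspace_harmonic, simplified])

lemma interp_vertices_node:
  assumes x: "x \<in> nodes P" "x \<in> interface P"
  shows "interp_vertices P u x = (if x \<in> vertices P then u x else 0)"
proof -
  have "interp_vertices P u x = (\<Sum>p\<in>vertices P. u p * hat P p x)"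
    using vertex_ext(2) x(2) by (simp add: interp_vertices_def sum_fun_apply)
  also have "\<dots> = (\<Sum>p\<in>vertices P. if p = x then u x else 0)"
    by (rule sum.cong) (auto simp: hat_def interp_node x)
  also have "\<dots> = (if x \<in> vertices P then u x else 0)" using finite_vertices by simp
  finally show ?thesis .
qed

text \<open>The vertex interpolant is already harmonic, so uniqueness returns it from its
  trace.\<close>

lemma ext_interp_vertices: "ext_interface P (restr (interface P) (interp_vertices P u)) = interp_vertices P u"
  by (rule ext_interface_eqI[OF interp_vertices_harmonic]) (simp add: restr_def)

definition edge_coarse :: "pt set \<Rightarrow> scalar_fun \<Rightarrow> scalar_fun"
  where "edge_coarse e u = u0_ha P e u + u0_perp P e u"

lemma u_coarse_eq: "u_coarse P u = interp_vertices P u + (\<Sum>e\<in>edges P. edge_coarse e u)"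
  by (simp add: u_coarse_def ext_interp_vertices edge_coarse_def)

lemma indicator_edge_node: "x \<in> edge_nodes P e \<Longrightarrow> indicator (closure e) x = (1::real)"
  using closure_subset[of e] by (auto simp: edge_nodes_def)

text \<open>Only values at the nodes of the open edge enter; there the endpoint interpolant is 0 and
  the indicator is 1. This exhibits the parts from \<open>X_const\<close> and
  \<open>X_tr\<close>.\<close>

lemma u0_ha_eq:
  assumes e: "e \<in> edges P"
  shows "u0_ha P e u = c_u P e u *\<^sub>R ext_interface P (ext_edge_interface P e (\<lambda>x. 1))
    + ext_interface P (ext_edge_interface P e (proj_tr P e (edge_ha e u)))"
  unfolding u0_ha_def edge_ha_def[symmetric] ext_edge_lincomb[OF e, symmetric]
  by (rule ext_edge_cong[OF e]) (simp add: interp_endpoints_edge_node indicator_edge_node)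

lemma edge_coarse_harmonic:
  assumes e: "e \<in> edges P"
  shows "harmonic (edge_coarse e u)"
proof -
  have "harmonic (u0_ha P e u)" "harmonic (u0_perp P e u)"
    unfolding u0_ha_def u0_perp_def using ext_edge(1)[OF e] by auto
  then show ?thesis using harmonic_lincomb[of "u0_ha P e u" "u0_perp P e u" 1] by (simp add: edge_coarse_def)
qed

text \<open>The constant subtracted in \<open>u_hat\<close> is added back by the coarse function, so
  only the spectral truncation separates it from \<open>u\<close>.\<close>

lemma edge_coarse_node:
  assumes e: "e \<in> edges P" and u: "u \<in> V0 P" and x: "x \<in> nodes P" "x \<in> interface P"
  shows "edge_coarse e u x = (if x \<in> edge_nodes P e then u x - edge_error e u x else 0)"
proof (cases "x \<in> edge_nodes P e")
  case True
  have "x \<in> esub P e" using True edge_subset_esub[OF e] by (auto simp: edge_nodes_def)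
  then have xc: "x \<in> closure (esub P e)" using closure_subset by blast
  have "edge_coarse e u x = c_u P e u + proj_tr P e (edge_ha e u) x + proj_dir P e (edge_perp e u) x"
    unfolding edge_coarse_def u0_ha_eq[OF e] u0_perp_def edge_perp_def[symmetric]
    using ext_edge(2)[OF e x(2)] edge_fun_node[OF x(1), of e] True by simp
  moreover have "edge_ha e u x = u_ha P e u x - c_u P e u"
    unfolding edge_ha_def edge_part_node[OF True] using xc by (simp add: u_hat_def)
  moreover have "edge_perp e u x = u_perp P e u x" by (simp only: edge_perp_def edge_part_node[OF True])
  moreover have "u_perp P e u x + u_ha P e u x = u x" by (rule u_ha_props(4)[OF e u xc])
  ultimately show ?thesis using True by (simp add: edge_error_def)
next
  case False
  then show ?thesis
    unfolding edge_coarse_def u0_ha_eq[OF e] u0_perp_def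
    using ext_edge(2)[OF e x(2)] edge_fun_node[OF x(1), of e] by simp
qed

lemma u_coarse_harmonic: "harmonic (u_coarse P u)"
proof -
  have "harmonic (\<Sum>e\<in>edges P. edge_coarse e u)"
    using subspace_sum[OF subspace_harmonic, of "edges P"] edge_coarse_harmonic by auto
  then show ?thesis unfolding u_coarse_eq
    using subspace_add[OF subspace_harmonic] interp_vertices_harmonic by auto
qed

lemma sum_edges_node:
  assumes "e0 \<in> edges P" "x \<in> edge_nodes P e0" "D \<subseteq> edges P"
  shows "(\<Sum>e\<in>D. if x \<in> edge_nodes P e then f e else (0::real)) = (if e0 \<in> D then f e0 else 0)"
proof -
  have "(\<Sum>e\<in>D. if x \<in> edge_nodes P e then f e else 0) = (\<Sum>e\<in>D. if e = e0 then f e0 else 0)"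
  proof (rule sum.cong[OF refl])
    fix e assume "e \<in> D"
    then have "x \<in> edge_nodes P e \<longleftrightarrow> e = e0"
      using assms edges_disjoint unfolding edge_nodes_def by blast
    then show "(if x \<in> edge_nodes P e then f e else 0) = (if e = e0 then f e0 else 0)" by simp
  qed
  then show ?thesis using finite_subset[OF assms(3) finite_edges] by simp
qed

lemma u_coarse_vertex:
  assumes u: "u \<in> V0 P" and x: "x \<in> vertices P"
  shows "u_coarse P u x = u x"
proof -
  have xn: "x \<in> nodes P" "x \<in> interface P" using x by (auto simp: vertices_def)
  have "x \<notin> edge_nodes P e" if "e \<in> edges P" for e
    using edge_subset[OF that] x by (auto simp: edge_nodes_def)
  then show ?thesis
    unfolding u_coarse_eq using x xn u by (simp add: sum_fun_apply interp_vertices_node edge_coarse_node)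
qed

lemma u_coarse_edge_node:
  assumes u: "u \<in> V0 P" and e: "e \<in> edges P" and x: "x \<in> edge_nodes P e"
  shows "u_coarse P u x = u x - edge_error e u x"
proof -
  have xn: "x \<in> nodes P" "x \<in> interface P" "x \<notin> vertices P" using x edge_subset[OF e] by (auto simp: edge_nodes_def)
  have "u_coarse P u x = (\<Sum>e\<in>edges P. if x \<in> edge_nodes P e then u x - edge_error e u x else 0)"
    unfolding u_coarse_eq using xn u by (simp add: sum_fun_apply interp_vertices_node edge_coarse_node cong: sum.cong)
  then show ?thesis using sum_edges_node[OF e x subset_refl] e by simp
qed

end

section \<open>Energy of the splitting for a fixed function u\<close>

locale fe_splitting = fe_method +
  fixes u :: scalar_fun
  assumes u: "u \<in> V0 P"
begin

abbreviation a :: "scalar_fun \<Rightarrow> scalar_fun \<Rightarrow> real" where "a \<equiv> energy P (Omega P)"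
abbreviation u0 :: scalar_fun where "u0 \<equiv> u_coarse P u"

text \<open>The function \<open>u - u0\<close> has at the nodes of an edge the values of \<open>edge_error\<close> and vanishes at the
  vertices, so \<open>z\<close> below vanishes on the interface.\<close>

definition y :: "pt set \<Rightarrow> scalar_fun" where "y e = edge_fun e (edge_error e u)"
definition Y :: "pt set set \<Rightarrow> scalar_fun" where "Y D = sum y D"
definition z :: scalar_fun where "z = u - u0 - Y (edges P)"
definition touching :: "nat \<Rightarrow> pt set set" where "touching i = {e \<in> edges P. edge_nodes P e \<inter> closure (sub P i) \<noteq> {}}"

sublocale a: psd_form "fe_space P" "energy P (Omega P)"
  by (rule psd_energy_fe[OF elem_union_Omega])

lemma touching_subset: "touching i \<subseteq> edges P" and finite_touching: "finite (touching i)"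
  using finite_edges by (auto simp: touching_def)

lemma y_fe: "y e \<in> fe_space P"
  by (simp add: y_def edge_fun_fe)

lemma Y_fe: "Y D \<in> fe_space P"
  by (simp add: Y_def a.mem_sum y_fe)

lemma y_V0: "e \<in> edges P \<Longrightarrow> y e \<in> V0 P"
  by (simp add: y_def edge_fun_V0)

lemma Y_V0: "D \<subseteq> edges P \<Longrightarrow> Y D \<in> V0 P"
  unfolding Y_def using y_V0 subspace_V0 by (intro subspace_sum) auto

lemma u0_V0: "u0 \<in> V0 P"
  using u_coarse_harmonic by (simp add: harmonic_def)

lemma z_V0: "z \<in> V0 P"
  unfolding z_def using u u0_V0 Y_V0 subspace_V0 by (simp add: subspace_diff)

lemma fe: "u \<in> fe_space P" "u0 \<in> fe_space P" "z \<in> fe_space P"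
  using u u0_V0 z_V0 V0_fe_space by auto

lemma Y_node:
  assumes "x \<in> nodes P"
  shows "Y D x = (\<Sum>e\<in>D. if x \<in> edge_nodes P e then edge_error e u x else 0)"
  using assms by (simp add: Y_def sum_fun_apply y_def edge_fun_node cong: sum.cong)

lemma Y_edge_node:
  assumes "e \<in> edges P" "x \<in> edge_nodes P e" "D \<subseteq> edges P"
  shows "Y D x = (if e \<in> D then edge_error e u x else 0)"
  using Y_node[of x D] sum_edges_node[OF assms, of "\<lambda>e. edge_error e u x"] assms(2) by (simp add: edge_nodes_def)

lemma Y_other_node:
  assumes "x \<in> nodes P" "D \<subseteq> edges P" "\<And>e. e \<in> D \<Longrightarrow> x \<notin> edge_nodes P e"
  shows "Y D x = 0"
  using Y_node[OF assms(1)] assms(3) by (simp add: sum.neutral)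

lemma z_interface: "x \<in> interface P \<Longrightarrow> z x = 0"
proof -
  assume x: "x \<in> interface P"
  have "z x = 0 x"
  proof (rule eq_on_interface[OF z_V0 _ _ x])
    show "0 \<in> V0 P" using subspace_V0 by (rule subspace_0)
    fix p assume p: "p \<in> nodes P" "p \<in> interface P"
    show "z p = 0 p"
    proof (cases "p \<in> vertices P")
      case True
      then have "p \<notin> edge_nodes P e" if "e \<in> edges P" for e
        using edge_subset[OF that] by (auto simp: edge_nodes_def)
      then show ?thesis using True p u u_coarse_vertex Y_other_node[OF p(1) subset_refl] by (simp add: z_def)
    next
      case False
      then obtain e where e: "e \<in> edges P" "p \<in> edge_nodes P e"
        using edge_exists p by (metis DiffI IntI edge_nodes_def)
      then show ?thesis using u_coarse_edge_node[OF u e] Y_edge_node[OF e subset_refl] by (simp add: z_def)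
    qed
  qed
  then show ?thesis by simp
qed

lemma coarse_energy: "a u0 u0 + a z z \<le> 2 * a u u + 2 * a (Y (edges P)) (Y (edges P))"
proof -
  have "a u0 z = 0" by (rule harmonic_orthogonal(2)[OF u_coarse_harmonic z_V0 z_interface])
  then have "a u0 u0 + a z z = a (u0 + z) (u0 + z)" using a.add_sq[OF fe(2,3)] by simp
  also have "u0 + z = u - Y (edges P)" by (simp add: z_def)
  also have "a \<dots> \<dots> \<le> 2 * a u u + 2 * a (Y (edges P)) (Y (edges P))"
    by (rule a.diff_le[OF fe(1) Y_fe])
  finally show ?thesis .
qed

text \<open>The vertices of an element of the subdomain lie in its closure, so none is a node of
  \<open>e\<close>; unisolvence gives the rest.\<close>

lemma y_sub_zero:
  assumes i: "i \<in> subs" and e: "e \<in> edges P - touching i" and x: "x \<in> closure (sub P i)"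
  shows "y e x = 0"
proof -
  obtain T where T: "T \<in> els P (sub P i)" "x \<in> T" using x closure_elem_union[OF sub_elem_union[OF i]] by blast
  show ?thesis
  proof (rule fe_on_zero[OF els_element[OF T(1)] fe_space_fe_on[OF y_fe els_mesh[OF T(1)]] _ T(2)])
    fix p assume p: "p extreme_point_of T"
    then have pn: "p \<in> nodes P" "p \<in> T" using els_mesh[OF T(1)] by (auto simp: nodes_def extreme_point_of_def)
    then have "p \<notin> edge_nodes P e" using e els_closure[OF T(1)] by (auto simp: touching_def)
    then show "y e p = 0" using pn(1) by (simp add: y_def edge_fun_node)
  qed
qed

lemma Y_sub:
  assumes i: "i \<in> subs" and x: "x \<in> closure (sub P i)"
  shows "Y (edges P) x = Y (touching i) x"
  unfolding Y_def sum_fun_apply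
  by (rule sum.mono_neutral_right) (use finite_edges touching_subset y_sub_zero[OF i _ x] in auto)

lemma energy_sub_le: "i \<in> subs \<Longrightarrow> v \<in> fe_space P \<Longrightarrow> energy P (sub P i) v v \<le> a v v"
proof -
  assume i: "i \<in> subs" and v: "v \<in> fe_space P"
  have "energy P (sub P i) v v \<le> (\<Sum>i\<in>subs. energy P (sub P i) v v)"
    by (rule member_le_sum) (use i psd_form.nonneg[OF psd_energy_fe[OF sub_elem_union] v] in auto)
  then show ?thesis using energy_subs[OF v v] by simp
qed

lemma Y_energy: "a (Y (edges P)) (Y (edges P)) \<le> (\<Sum>i\<in>subs. a (Y (touching i)) (Y (touching i)))"
  unfolding energy_subs[OF Y_fe Y_fe, of "edges P" "edges P"]
proof (rule sum_mono)
  fix i assume i: "i \<in> subs"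
  have "energy P (sub P i) (Y (edges P)) (Y (edges P)) = energy P (sub P i) (Y (touching i)) (Y (touching i))"
    using Y_sub[OF i] closure_subset by (intro energy_cong sub_open[OF i]) blast+
  then show "energy P (sub P i) (Y (edges P)) (Y (edges P)) \<le> a (Y (touching i)) (Y (touching i))"
    using energy_sub_le[OF i Y_fe] by simp
qed

lemma card_touching: "i \<in> subs \<Longrightarrow> card (touching i) \<le> max_edges P"
proof -
  assume i: "i \<in> subs"
  have "touching i \<subseteq> {e \<in> edges P. closure e \<subseteq> frontier (sub P i)}"
    using edge_sub_frontier[OF _ i] by (auto simp: touching_def edge_nodes_def)
  then have "card (touching i) \<le> card {e \<in> edges P. closure e \<subseteq> frontier (sub P i)}"
    by (rule card_mono[rotated]) (use finite_edges in simp)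
  also have "\<dots> \<le> max_edges P" unfolding max_edges_def using i by (intro Max_ge) auto
  finally show ?thesis .
qed

lemma card_touched: "e \<in> edges P \<Longrightarrow> card {i \<in> subs. e \<in> touching i} \<le> max_subs_at_edge P"
proof -
  assume e: "e \<in> edges P"
  then have "{i \<in> subs. e \<in> touching i} = {i \<in> {1..nsub P}. closure (sub P i) \<inter> edge_nodes P e \<noteq> {}}"
    by (auto simp: touching_def)
  then show ?thesis unfolding max_subs_at_edge_def using e finite_edges by (intro Max_ge) auto
qed

text \<open>Needed twice: for edges touching subdomains, and for elements inside oversampling
  domains.\<close>

lemma sum_double_count:
  fixes g :: "pt set \<Rightarrow> real"
  assumes "finite A" "finite B" "\<And>e. e \<in> B \<Longrightarrow> 0 \<le> g e" "\<And>e. e \<in> B \<Longrightarrow> card {i \<in> A. R i e} \<le> k"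
  shows "(\<Sum>i\<in>A. \<Sum>e\<in>{e \<in> B. R i e}. g e) \<le> real k * (\<Sum>e\<in>B. g e)"
proof -
  have "(\<Sum>i\<in>A. \<Sum>e\<in>{e \<in> B. R i e}. g e) = (\<Sum>e\<in>B. \<Sum>i\<in>{i \<in> A. R i e}. g e)"
    by (rule sum.swap_restrict[OF assms(1,2)])
  also have "\<dots> \<le> (\<Sum>e\<in>B. real k * g e)"
    by (rule sum_mono) (use assms(3,4) in \<open>simp add: mult_right_mono\<close>)
  finally show ?thesis by (simp add: sum_distrib_left)
qed

text \<open>An element belongs to some subdomain, and an oversampling domain containing the element
  meets that subdomain; so \<open>max_esubs\<close> bounds the multiplicity of each element.\<close>

lemma esub_energy_sum: "(\<Sum>e\<in>edges P. energy P (esub P e) u u) \<le> real (max_esubs P) * a u u"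
proof -
  have b: "u \<in> broken P \<omega>" for \<omega> using fe(1) fe_space_broken by blast
  have nn: "0 \<le> energy P (interior T) u u" if "T \<in> mesh P" for T
    using psd_form.nonneg[OF psd_energy_element[OF that]] fe_space_fe_on[OF fe(1) that] by blast
  have "(\<Sum>e\<in>edges P. energy P (esub P e) u u) = (\<Sum>e\<in>edges P. \<Sum>T\<in>{T \<in> mesh P. T \<in> els P (esub P e)}. energy P (interior T) u u)"
  proof (rule sum.cong[OF refl])
    fix e assume e: "e \<in> edges P"
    have "{T \<in> mesh P. T \<in> els P (esub P e)} = els P (esub P e)" using els_subset by blast
    then show "energy P (esub P e) u u = (\<Sum>T\<in>{T \<in> mesh P. T \<in> els P (esub P e)}. energy P (interior T) u u)"
      using energy_sum[OF esub_elem_union[OF e] b b] by simp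
  qed
  also have "\<dots> \<le> real (max_esubs P) * (\<Sum>T\<in>mesh P. energy P (interior T) u u)"
  proof (rule sum_double_count[OF finite_edges finite_mesh nn])
    fix T assume T: "T \<in> mesh P"
    obtain i where i: "i \<in> subs" "T \<in> els P (sub P i)" using els_sub_exists[OF T] by blast
    have "{e \<in> edges P. T \<in> els P (esub P e)} \<subseteq> {e \<in> edges P. esub P e \<inter> sub P i \<noteq> {}}"
      using i(2) element_interior_nonempty[OF mesh_element[OF T]] by (auto simp: els_def)
    then have "card {e \<in> edges P. T \<in> els P (esub P e)} \<le> card {e \<in> edges P. esub P e \<inter> sub P i \<noteq> {}}"
      by (rule card_mono[rotated]) (use finite_edges in simp)
    also have "\<dots> \<le> max_esubs P" unfolding max_esubs_def using i(1) by (intro Max_ge) auto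
    finally show "card {e \<in> edges P. T \<in> els P (esub P e)} \<le> max_esubs P" .
  qed
  also have "(\<Sum>T\<in>mesh P. energy P (interior T) u u) = a u u"
    using energy_sum[OF elem_union_Omega b b] els_Omega by simp
  finally show ?thesis .
qed

lemma y_energy: "e \<in> edges P \<Longrightarrow> a (y e) (y e) \<le> 2 * spectral_bound * energy P (esub P e) u u"
proof -
  assume e: "e \<in> edges P"
  note err = edge_error_bound[OF e u]
  show ?thesis unfolding y_def using err(2) bform_eq[OF e err(1) err(1)] by linarith
qed

text \<open>\<open>max_edges\<close> arises from the square of the sum over the edges of a
  subdomain, \<open>max_subs_at_edge\<close> from exchanging the sums over subdomains and edges,
  \<open>max_esubs\<close> from the overlap of the oversampling domains.\<close>

lemma Y_touching_energy:
  "(\<Sum>i\<in>subs. a (Y (touching i)) (Y (touching i)))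
    \<le> 2 * (real (max_edges P) * real (max_subs_at_edge P) * real (max_esubs P) * spectral_bound) * a u u"
proof -
  have nn: "0 \<le> a (y e) (y e)" for e by (rule a.nonneg[OF y_fe])
  have "a (Y (touching i)) (Y (touching i)) \<le> real (max_edges P) * (\<Sum>e\<in>touching i. a (y e) (y e))" if i: "i \<in> subs" for i
  proof -
    have "a (Y (touching i)) (Y (touching i)) \<le> real (card (touching i)) * (\<Sum>e\<in>touching i. a (y e) (y e))"
      unfolding Y_def by (rule a.sum_le_card[OF finite_touching y_fe])
    also have "\<dots> \<le> real (max_edges P) * (\<Sum>e\<in>touching i. a (y e) (y e))"
      using card_touching[OF i] nn by (intro mult_right_mono) (auto intro: sum_nonneg)
    finally show ?thesis .
  qed
  then have "(\<Sum>i\<in>subs. a (Y (touching i)) (Y (touching i))) \<le> (\<Sum>i\<in>subs. real (max_edges P) * (\<Sum>e\<in>touching i. a (y e) (y e)))"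
    by (rule sum_mono)
  also have "\<dots> = real (max_edges P) * (\<Sum>i\<in>subs. \<Sum>e\<in>{e \<in> edges P. e \<in> touching i}. a (y e) (y e))"
    using touching_subset by (simp add: sum_distrib_left Collect_conj_eq Int_absorb1)
  also have "\<dots> \<le> real (max_edges P) * (real (max_subs_at_edge P) * (\<Sum>e\<in>edges P. a (y e) (y e)))"
    by (intro mult_left_mono sum_double_count) (use finite_edges nn card_touched in auto)
  also have "\<dots> \<le> real (max_edges P) * (real (max_subs_at_edge P) * (2 * spectral_bound * (real (max_esubs P) * a u u)))"
  proof -
    have "(\<Sum>e\<in>edges P. a (y e) (y e)) \<le> (\<Sum>e\<in>edges P. 2 * spectral_bound * energy P (esub P e) u u)"
      by (rule sum_mono[OF y_energy])
    also have "\<dots> = 2 * spectral_bound * (\<Sum>e\<in>edges P. energy P (esub P e) u u)" by (simp add: sum_distrib_left)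
    also have "\<dots> \<le> 2 * spectral_bound * (real (max_esubs P) * a u u)"
      using esub_energy_sum spectral_bound_nonneg by (intro mult_left_mono) auto
    finally show ?thesis by (intro mult_left_mono) auto
  qed
  finally show ?thesis by (simp add: mult_ac)
qed

text \<open>This is \<open>u_local\<close> extended by zero: the weight \<open>theta\<close> is 1 inside the subdomain, where \<open>Y\<close> has no
  nodal values, and 1/2 at the nodes of the adjacent edges, where \<open>z\<close> vanishes.\<close>

definition f :: "nat \<Rightarrow> scalar_fun"
  where "f i = restr (closure (sub P i)) z + (1 / 2) *\<^sub>R Y (touching i)"

lemma z_restr: "i \<in> subs \<Longrightarrow> restr (closure (sub P i)) z \<in> Vloc0 P (sub P i)"
  by (rule Vloc0_sub_zero_trace[OF z_V0 z_interface])

lemma f_V0: "i \<in> subs \<Longrightarrow> f i \<in> V0 P"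
  unfolding f_def using z_restr Vloc0_subset_V0[OF sub_elem_union] Y_V0[OF touching_subset] subspace_V0
  by (intro subspace_add subspace_scale) auto

text \<open>At a vertex the weight does not matter, since \<open>u - u0\<close> is 0 there. At an
  edge node exactly two subdomains meet, so the weight is the factor 1/2 in \<open>f\<close>.
  Outside, an edge touching the subdomain lies on its boundary and has no nodes elsewhere.\<close>

lemma f_node:
  assumes i: "i \<in> subs" and x: "x \<in> nodes P"
  shows "f i x = theta P i x * (u - u0) x"
proof -
  consider (inside) "x \<in> sub P i" | (interface) "x \<notin> sub P i" "x \<in> interface P" "x \<in> closure (sub P i)"
    | (outside) "x \<notin> sub P i" "x \<notin> interface P \<or> x \<notin> closure (sub P i)" by blast
  then show ?thesis
  proof cases
    case inside
    then have xc: "x \<in> closure (sub P i)" and "x \<notin> interface P" using closure_subset i interface_eq by auto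
    then have n: "x \<notin> edge_nodes P e" if "e \<in> edges P" for e using edge_subset[OF that] by (auto simp: edge_nodes_def)
    have "Y (touching i) x = 0" "Y (edges P) x = 0"
      using Y_other_node[OF x touching_subset] Y_other_node[OF x subset_refl] n touching_subset by blast+
    then show ?thesis using inside xc by (simp add: f_def restr_def theta_def z_def)
  next
    case interface
    then have th: "theta P i x = 1 / real (card (subs_at P x))" by (simp add: theta_def)
    have z0: "restr (closure (sub P i)) z x = 0" using z_interface[OF interface(2)] by (simp add: restr_def)
    show ?thesis
    proof (cases "x \<in> vertices P")
      case True
      then have "x \<notin> edge_nodes P e" if "e \<in> edges P" for e using edge_subset[OF that] by (auto simp: edge_nodes_def)
      then have "Y (touching i) x = 0" using Y_other_node[OF x touching_subset] touching_subset by blast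
      then show ?thesis using u_coarse_vertex[OF u True] z0 by (simp add: f_def)
    next
      case False
      then obtain e where e: "e \<in> edges P" "x \<in> edge_nodes P e"
        using edge_exists interface(2) x by (metis DiffI IntI edge_nodes_def)
      have "card (subs_at P x) = 2" using card_subs_at interface(2) False by blast
      moreover have "e \<in> touching i" using e interface(3) by (auto simp: touching_def)
      ultimately show ?thesis
        using th z0 u_coarse_edge_node[OF u e] Y_edge_node[OF e touching_subset] by (simp add: f_def)
    qed
  next
    case outside
    then have th: "theta P i x = 0" by (auto simp: theta_def)
    have "restr (closure (sub P i)) z x = 0"
      using z_restr[OF i] outside(1) unfolding Vloc0_iff[OF sub_elem_union[OF i]] by blast
    moreover have "x \<notin> edge_nodes P e" if e: "e \<in> touching i" for e
    proof
      assume xe: "x \<in> edge_nodes P e"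
      obtain q where q: "q \<in> edge_nodes P e" "q \<in> closure (sub P i)" using e by (auto simp: touching_def)
      have eE: "e \<in> edges P" using e touching_subset by blast
      have "closure e \<subseteq> frontier (sub P i)"
        using edge_sub_frontier[OF eE i, of q] q unfolding edge_nodes_def by blast
      moreover have "x \<in> closure e" "x \<in> interface P"
        using xe closure_subset[of e] edge_subset[OF eE] by (auto simp: edge_nodes_def)
      ultimately show False using outside(2) frontier_sub[OF i] by blast
    qed
    then have "Y (touching i) x = 0" by (rule Y_other_node[OF x touching_subset])
    ultimately show ?thesis using th by (simp add: f_def)
  qed
qed

lemma f_interp: "i \<in> subs \<Longrightarrow> interp P (theta P i * (u - u0)) = f i"
  by (rule interp_eqI) (use f_V0 V0_fe_space f_node in auto)

text \<open>All elements at such a point touch the subdomain, so they belong to the overlapping one,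
  which therefore contains a neighbourhood.\<close>

lemma node_osub:
  assumes i: "i \<in> subs" and x: "x \<in> Omega P" "x \<in> closure (sub P i)"
  shows "x \<in> osub P i"
proof (rule elem_union_local[OF osub_elem_union[OF i] x(1)])
  fix T assume T: "T \<in> mesh P" "x \<in> T"
  then have "T \<subseteq> closure (osub P i)" using osub_touching[OF i T(1)] x(2) by blast
  then show "T \<in> els P (osub P i)" using els_iff_closure[OF osub_elem_union[OF i] T(1)] by blast
qed

lemma f_osub:
  assumes i: "i \<in> subs"
  shows "f i \<in> Vloc0 P (osub P i)"
  unfolding Vloc0_nodes[OF osub_elem_union[OF i]]
proof (intro conjI ballI)
  show "f i \<in> fe_space P" using f_V0[OF i] V0_fe_space by blast
  fix x assume x: "x \<in> nodes P - osub P i"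
  show "f i x = 0"
  proof (cases "x \<in> Omega P")
    case True
    then have "x \<notin> closure (sub P i)" using node_osub[OF i] x by blast
    then have "theta P i x = 0" using closure_subset[of "sub P i"] by (auto simp: theta_def)
    then show ?thesis using f_node[OF i] x by simp
  qed (use f_V0[OF i] V0_iff in blast)
qed

text \<open>\<open>f i\<close> vanishes outside the overlapping subdomain, so the nodal restriction
  drops no nonzero value.\<close>

lemma ext_osub_local: "i \<in> subs \<Longrightarrow> ext_osub P i (u_local P i u) = f i"
proof -
  assume i: "i \<in> subs"
  have out: "f i x = 0" if "x \<notin> osub P i" for x
    using f_osub[OF i] that unfolding Vloc0_iff[OF osub_elem_union[OF i]] by blast
  have r: "restr (closure (osub P i)) (f i) = f i"
  proof
    fix x show "restr (closure (osub P i)) (f i) x = f i x"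
      using out[of x] closure_subset[of "osub P i"] by (cases "x \<in> closure (osub P i)") (auto simp: restr_def)
  qed
  have "interp P (\<lambda>x. if x \<in> osub P i then f i x else 0) = f i"
    by (rule interp_eqI) (use f_V0[OF i] V0_fe_space out in auto)
  then have ul: "u_local P i u = f i" by (simp add: u_local_def f_interp[OF i] nodal_restr_osub_def r)
  show "ext_osub P i (u_local P i u) = f i" by (simp add: ul ext_osub_def r)
qed

lemma theta_sum:
  assumes x: "x \<in> Omega P"
  shows "(\<Sum>i\<in>subs. theta P i x) = 1"
proof (cases "x \<in> skeleton_complement")
  case True
  then obtain k where k: "k \<in> subs" "x \<in> sub P k" by blast
  have "theta P i x = (if i = k then 1 else 0)" if i: "i \<in> subs" for i
  proof -
    have "x \<notin> interface P" using True by (simp add: interface_eq)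
    moreover have "x \<in> sub P i \<longleftrightarrow> i = k" using k i sub_disjoint[OF i k(1)] by blast
    ultimately show ?thesis by (simp add: theta_def)
  qed
  then show ?thesis using k(1) by simp
next
  case False
  then have xi: "x \<in> interface P" using x by (simp add: interface_eq)
  have "(\<Sum>i\<in>subs. theta P i x) = (\<Sum>i\<in>subs. if i \<in> subs_at P x then 1 / real (card (subs_at P x)) else 0)"
    by (rule sum.cong[OF refl]) (use False xi in \<open>auto simp: theta_def subs_at_def\<close>)
  also have "\<dots> = (\<Sum>i\<in>subs_at P x. 1 / real (card (subs_at P x)))"
    using subs_at_subset by (simp add: sum.If_cases Int_absorb1)
  also have "\<dots> = 1" using card_subs_at_ge[OF xi] by simp
  finally show ?thesis .
qed

lemma decomposition: "u = u0 + (\<Sum>i\<in>subs. ext_osub P i (u_local P i u))"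
proof -
  have "(\<Sum>i\<in>subs. f i) = u - u0"
  proof (rule fe_space_eqI)
    show "(\<Sum>i\<in>subs. f i) \<in> fe_space P" using f_V0 V0_fe_space by (intro a.mem_sum) blast
    show "u - u0 \<in> fe_space P" by (rule a.mem_diff[OF fe(1,2)])
    fix x assume x: "x \<in> nodes P"
    have "(\<Sum>i\<in>subs. f i) x = (\<Sum>i\<in>subs. theta P i x) * (u - u0) x"
      unfolding sum_fun_apply sum_distrib_right by (rule sum.cong[OF refl]) (rule f_node[OF _ x])
    moreover have "(u - u0) x = 0" if "x \<notin> Omega P" using that u u0_V0 by (simp add: V0_iff)
    ultimately show "(\<Sum>i\<in>subs. f i) x = (u - u0) x" using theta_sum by (cases "x \<in> Omega P") auto
  qed
  moreover have "(\<Sum>i\<in>subs. ext_osub P i (u_local P i u)) = (\<Sum>i\<in>subs. f i)"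
    by (rule sum.cong[OF refl ext_osub_local])
  ultimately show ?thesis by simp
qed

lemma f_energy: "i \<in> subs \<Longrightarrow> a (f i) (f i) \<le> 2 * energy P (sub P i) z z + 1 / 2 * a (Y (touching i)) (Y (touching i))"
proof -
  assume i: "i \<in> subs"
  let ?z = "restr (closure (sub P i)) z"
  have zV: "?z \<in> Vloc0 P (sub P i)" by (rule z_restr[OF i])
  have zf: "?z \<in> fe_space P" using zV Vloc0_iff[OF sub_elem_union[OF i]] by blast
  have "a ?z ?z = energy P (sub P i) ?z ?z" by (rule energy_Vloc0(1)[OF sub_elem_union[OF i] zV zf])
  also have "\<dots> = energy P (sub P i) z z"
    using closure_subset[of "sub P i"] by (intro energy_cong sub_open[OF i]) (auto simp: restr_def)
  finally show ?thesis
    \<comment> \<open>The 1/2 is Young's factor 2 times the square of the weight 1/2.\<close>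
    unfolding f_def using a.add_le[OF zf a.mem_scale[OF Y_fe], of "1 / 2" "touching i"] Y_fe
    by (simp add: a.bilin a.mem)
qed

lemma total_energy:
  "a u0 u0 + (\<Sum>i\<in>subs. energy_osub P i (u_local P i u) (u_local P i u))
    \<le> (4 + 9 * (real (max_edges P) * real (max_subs_at_edge P) * real (max_esubs P) * spectral_bound)) * a u u"
proof -
  let ?S = "\<Sum>i\<in>subs. a (Y (touching i)) (Y (touching i))"
  have "(\<Sum>i\<in>subs. energy_osub P i (u_local P i u) (u_local P i u)) = (\<Sum>i\<in>subs. a (f i) (f i))"
    by (rule sum.cong[OF refl]) (simp add: energy_osub_def ext_osub_local)
  also have "\<dots> \<le> (\<Sum>i\<in>subs. 2 * energy P (sub P i) z z + 1 / 2 * a (Y (touching i)) (Y (touching i)))"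
    by (rule sum_mono[OF f_energy])
  also have "\<dots> = 2 * a z z + 1 / 2 * ?S"
    unfolding energy_subs[OF fe(3) fe(3)] by (simp add: sum.distrib sum_distrib_left)
  finally have 1: "(\<Sum>i\<in>subs. energy_osub P i (u_local P i u) (u_local P i u)) \<le> 2 * a z z + 1 / 2 * ?S" .
  have "0 \<le> a u0 u0" by (rule a.nonneg[OF fe(2)])
  \<comment> \<open>\<open>a u0 u0 + 2 * a z z\<close> is at most twice the left side of
    \<open>coarse_energy\<close>, giving 4 of each term; \<open>Y_energy\<close> replaces the second
    by \<open>?S\<close>, and the remaining half makes 9/2.\<close>
  then have "a u0 u0 + (\<Sum>i\<in>subs. energy_osub P i (u_local P i u) (u_local P i u)) \<le> 4 * a u u + 9 / 2 * ?S"
    using 1 coarse_energy Y_energy by linarith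
  also have "\<dots> \<le> 4 * a u u + 9 / 2 * (2 * (real (max_edges P) * real (max_subs_at_edge P) * real (max_esubs P) * spectral_bound) * a u u)"
    by (intro add_left_mono mult_left_mono Y_touching_energy) simp
  finally show ?thesis by (simp add: algebra_simps)
qed

end

section \<open>Matrices as projections, and bounds for their eigenvalues\<close>

section \<open>The two-level Schwarz operator\<close>

text \<open>The Galerkin equations: \<open>c\<close> solves the system with matrix \<open>G\<close>,
  so the term is the \<open>A\<close>-orthogonal projection onto the range of \<open>E\<close>.
  Positivity on that range makes \<open>G\<close> invertible.\<close>

lemma schwarz_term_projection:
  fixes A E :: "real mat"
  assumes A: "A \<in> carrier_mat n n" and E: "E \<in> carrier_mat n k"
    and pd: "\<forall>c\<in>carrier_vec k. (E *\<^sub>v c) \<bullet> (A *\<^sub>v (E *\<^sub>v c)) = 0 \<longrightarrow> c = 0\<^sub>v k"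
  shows "schwarz_term A E \<in> carrier_mat n n"
    and "x \<in> carrier_vec n \<Longrightarrow> \<exists>c\<in>carrier_vec k. schwarz_term A E *\<^sub>v x = E *\<^sub>v c \<and>
      (\<forall>d\<in>carrier_vec k. (E *\<^sub>v d) \<bullet> (A *\<^sub>v (E *\<^sub>v c)) = (E *\<^sub>v d) \<bullet> (A *\<^sub>v x))"
proof -
  define G where "G = transpose_mat E * A * E"
  have Et: "transpose_mat E \<in> carrier_mat k n" using E by simp
  have EtA: "transpose_mat E * A \<in> carrier_mat k n" using Et A by simp
  have G: "G \<in> carrier_mat k k" using EtA E by (simp add: G_def)
  have Gv: "G *\<^sub>v c = transpose_mat E *\<^sub>v (A *\<^sub>v (E *\<^sub>v c))" if "c \<in> carrier_vec k" for c
  proof -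
    have "E *\<^sub>v c \<in> carrier_vec n" using E that by simp
    then show ?thesis unfolding G_def
      using assoc_mult_mat_vec[OF EtA E that] assoc_mult_mat_vec[OF Et A] by simp
  qed
  have tr: "(E *\<^sub>v d) \<bullet> w = d \<bullet> (transpose_mat E *\<^sub>v w)" if "d \<in> carrier_vec k" "w \<in> carrier_vec n" for d w
    using transpose_vec_mult_scalar[OF Et that(2) that(1)] by simp
  \<comment> \<open>Pairing \<open>c\<close> with \<open>G c\<close> gives the energy of
    \<open>E c\<close>, so a null vector of \<open>G\<close> would contradict
    \<open>pd\<close>.\<close>
  have "Determinant.det G \<noteq> 0"
  proof
    assume "Determinant.det G = 0"
    then obtain c where c: "c \<in> carrier_vec k" "c \<noteq> 0\<^sub>v k" "G *\<^sub>v c = 0\<^sub>v k"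
      using det_0_iff_vec_prod_zero_field[OF G] by blast
    have Ec: "E *\<^sub>v c \<in> carrier_vec n" using E c by simp
    have "(E *\<^sub>v c) \<bullet> (A *\<^sub>v (E *\<^sub>v c)) = c \<bullet> (G *\<^sub>v c)"
      using tr[OF c(1), of "A *\<^sub>v (E *\<^sub>v c)"] Gv[OF c(1)] A Ec by simp
    then have "(E *\<^sub>v c) \<bullet> (A *\<^sub>v (E *\<^sub>v c)) = 0" using c by simp
    then show False using pd c(1,2) by blast
  qed
  then have "G \<in> Units (ring_mat TYPE(real) k ())" by (rule det_non_zero_imp_unit[OF G])
  \<comment> \<open>The inverse exists, so \<open>the\<close> in \<open>schwarz_term\<close> denotes
    it.\<close>
  then obtain Gi where Gi: "mat_inverse G = Some Gi" using mat_inverse(1)[OF G, where b = "()"] by (cases "mat_inverse G") auto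
  then have GG: "G * Gi = 1\<^sub>m k" "Gi \<in> carrier_mat k k" using mat_inverse(2)[OF G] by auto
  have M: "schwarz_term A E = E * Gi * transpose_mat E * A"
    using Gi by (simp add: schwarz_term_def G_def)
  have EGi: "E * Gi \<in> carrier_mat n k" using E GG by simp
  have EGiEt: "E * Gi * transpose_mat E \<in> carrier_mat n n" using EGi Et by simp
  then show "schwarz_term A E \<in> carrier_mat n n" using M A by simp
  assume x: "x \<in> carrier_vec n"
  define c where "c = Gi *\<^sub>v (transpose_mat E *\<^sub>v (A *\<^sub>v x))"
  have Ax: "A *\<^sub>v x \<in> carrier_vec n" using A x by simp
  have EtAx: "transpose_mat E *\<^sub>v (A *\<^sub>v x) \<in> carrier_vec k" using Et Ax by simp
  have c: "c \<in> carrier_vec k" using GG(2) EtAx by (simp add: c_def)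
  have "schwarz_term A E *\<^sub>v x = E *\<^sub>v c"
    unfolding M c_def
    using assoc_mult_mat_vec[OF EGiEt A x] assoc_mult_mat_vec[OF EGi Et Ax] assoc_mult_mat_vec[OF E GG(2) EtAx] by simp
  moreover have "(E *\<^sub>v d) \<bullet> (A *\<^sub>v (E *\<^sub>v c)) = (E *\<^sub>v d) \<bullet> (A *\<^sub>v x)" if d: "d \<in> carrier_vec k" for d
  proof -
    have Ec: "E *\<^sub>v c \<in> carrier_vec n" using E c by simp
    have "(E *\<^sub>v d) \<bullet> (A *\<^sub>v (E *\<^sub>v c)) = d \<bullet> (G *\<^sub>v c)"
      using tr[OF d, of "A *\<^sub>v (E *\<^sub>v c)"] Gv[OF c] A Ec by simp
    also have "G *\<^sub>v c = transpose_mat E *\<^sub>v (A *\<^sub>v x)"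
      unfolding c_def using assoc_mult_mat_vec[OF G GG(2) EtAx] GG(1) EtAx by simp
    also have "d \<bullet> \<dots> = (E *\<^sub>v d) \<bullet> (A *\<^sub>v x)" using tr[OF d Ax] by simp
    finally show ?thesis .
  qed
  ultimately show "\<exists>c\<in>carrier_vec k. schwarz_term A E *\<^sub>v x = E *\<^sub>v c \<and>
      (\<forall>d\<in>carrier_vec k. (E *\<^sub>v d) \<bullet> (A *\<^sub>v (E *\<^sub>v c)) = (E *\<^sub>v d) \<bullet> (A *\<^sub>v x))" using c by blast
qed

lemma mult_mat_vec_sum:
  "A \<in> carrier_mat n k \<Longrightarrow> c \<in> carrier_vec k \<Longrightarrow> i < n \<Longrightarrow> (A *\<^sub>v c) $ i = (\<Sum>l<k. A $$ (i, l) * c $ l)"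
  by (auto simp: scalar_prod_def atLeast0LessThan)

text \<open>A complex root of the characteristic polynomial exists in positive dimension; real and
  imaginary parts of an eigenvector give two coupled real equations. Self-adjointness later removes
  \<open>\<beta>\<close>.\<close>

lemma complex_eigenvector_parts:
  fixes K :: "real mat"
  assumes K: "K \<in> carrier_mat n n" and n: "0 < n"
  obtains x y \<alpha> \<beta> where "x \<in> carrier_vec n" "y \<in> carrier_vec n" "x \<noteq> 0\<^sub>v n \<or> y \<noteq> 0\<^sub>v n"
    "K *\<^sub>v x = \<alpha> \<cdot>\<^sub>v x - \<beta> \<cdot>\<^sub>v y" "K *\<^sub>v y = \<beta> \<cdot>\<^sub>v x + \<alpha> \<cdot>\<^sub>v y"
proof -
  define Kc where "Kc = map_mat complex_of_real K"
  have Kc: "Kc \<in> carrier_mat n n" using K by (simp add: Kc_def)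
  have "degree (char_poly Kc) = n" using degree_monic_char_poly[OF Kc] by simp
  then have "\<not> constant (poly (char_poly Kc))" using n by (simp add: constant_degree)
  then obtain \<mu> where "poly (char_poly Kc) \<mu> = 0" using fundamental_theorem_of_algebra by blast
  then have "eigenvalue Kc \<mu>" using eigenvalue_root_char_poly[OF Kc] by simp
  then obtain v where v: "v \<in> carrier_vec n" "v \<noteq> 0\<^sub>v n" "Kc *\<^sub>v v = \<mu> \<cdot>\<^sub>v v"
    using Kc unfolding eigenvalue_def eigenvector_def by auto
  define x where "x = map_vec Re v"
  define y where "y = map_vec Im v"
  have xy: "x \<in> carrier_vec n" "y \<in> carrier_vec n" using v(1) by (auto simp: x_def y_def)
  have dv: "dim_vec v = n" using v(1) by auto
  have row: "(\<Sum>l<n. complex_of_real (K $$ (i, l)) * v $ l) = \<mu> * v $ i" if i: "i < n" for i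
  proof -
    have "(Kc *\<^sub>v v) $ i = (\<mu> \<cdot>\<^sub>v v) $ i" using v(3) by simp
    then show ?thesis using mult_mat_vec_sum[OF Kc v(1) i] K i dv by (simp add: Kc_def)
  qed
  have "(K *\<^sub>v x) $ i = (Re \<mu> \<cdot>\<^sub>v x - Im \<mu> \<cdot>\<^sub>v y) $ i" if i: "i < n" for i
  proof -
    have "(K *\<^sub>v x) $ i = (\<Sum>l<n. K $$ (i, l) * Re (v $ l))"
      using mult_mat_vec_sum[OF K xy(1) i] dv by (simp add: x_def)
    also have "\<dots> = Re (\<Sum>l<n. complex_of_real (K $$ (i, l)) * v $ l)" by simp
    finally show ?thesis using row[OF i] i dv xy by (simp add: x_def y_def)
  qed
  then have 1: "K *\<^sub>v x = Re \<mu> \<cdot>\<^sub>v x - Im \<mu> \<cdot>\<^sub>v y" using K xy by (intro eq_vecI) auto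
  have "(K *\<^sub>v y) $ i = (Im \<mu> \<cdot>\<^sub>v x + Re \<mu> \<cdot>\<^sub>v y) $ i" if i: "i < n" for i
  proof -
    have "(K *\<^sub>v y) $ i = (\<Sum>l<n. K $$ (i, l) * Im (v $ l))"
      using mult_mat_vec_sum[OF K xy(2) i] dv by (simp add: y_def)
    also have "\<dots> = Im (\<Sum>l<n. complex_of_real (K $$ (i, l)) * v $ l)" by simp
    finally show ?thesis using row[OF i] i dv xy by (simp add: x_def y_def)
  qed
  then have 2: "K *\<^sub>v y = Im \<mu> \<cdot>\<^sub>v x + Re \<mu> \<cdot>\<^sub>v y" using K xy by (intro eq_vecI) auto
  have "x \<noteq> 0\<^sub>v n \<or> y \<noteq> 0\<^sub>v n"
  proof (rule ccontr)
    assume "\<not> ?thesis"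
    then have xz: "x = 0\<^sub>v n" and yz: "y = 0\<^sub>v n" by auto
    have "v $ i = 0" if "i < n" for i
    proof -
      have "x $ i = 0" "y $ i = 0" using that by (simp_all add: xz yz)
      then show ?thesis using that dv by (simp add: x_def y_def complex_eq_iff)
    qed
    then show False using v(2) dv by (auto intro!: eq_vecI)
  qed
  then show ?thesis using that xy 1 2 by blast
qed

locale fe_schwarz = fe_method +
  fixes m :: nat and N :: "pt list" and Ns :: "nat \<Rightarrow> pt list" and B :: "scalar_fun list"
  assumes overlap_bound: "\<forall>x\<in>nodes P \<inter> Omega P. card {i \<in> {1..nsub P}. x \<in> closure (osub P i)} \<le> m"
    and node_enumeration: "distinct N" "set N = nodes P \<inter> Omega P"
    and local_enumerations: "\<forall>i\<in>{1..nsub P}. distinct (Ns i) \<and> set (Ns i) = nodes P \<inter> osub P i"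
    and coarse_basis: "distinct B" "independent (set B)" "span (set B) = X0 P"
begin

abbreviation a :: "scalar_fun \<Rightarrow> scalar_fun \<Rightarrow> real" where "a \<equiv> energy P (Omega P)"
abbreviation n :: nat where "n \<equiv> length N"

sublocale a: psd_form "fe_space P" "energy P (Omega P)"
  by (rule psd_energy_fe[OF elem_union_Omega])

definition fe_fun :: "real vec \<Rightarrow> scalar_fun"
  where "fe_fun x = (\<Sum>k<n. x $ k *\<^sub>R hat P (N ! k))"

lemma N_node: "k < n \<Longrightarrow> N ! k \<in> nodes P" "k < n \<Longrightarrow> N ! k \<in> Omega P"
  using node_enumeration(2) nth_mem by blast+

lemma hat_fe: "hat P p \<in> fe_space P"
  by (simp add: hat_def interp_fe_space)

lemma hat_node: "x \<in> nodes P \<Longrightarrow> hat P p x = (if x = p then 1 else 0)"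
  by (simp add: hat_def interp_node)

lemma hat_V0: "p \<in> Omega P \<Longrightarrow> hat P p \<in> V0 P"
  unfolding V0_eq_Vloc0 by (auto simp: Vloc0_nodes[OF elem_union_Omega] hat_fe hat_node)

lemma fe_fun_V0: "fe_fun x \<in> V0 P"
  unfolding fe_fun_def using hat_V0 N_node subspace_V0 by (intro subspace_sum subspace_scale) auto

lemma fe_fun_fe: "fe_fun x \<in> fe_space P"
  using fe_fun_V0 V0_fe_space by blast

lemma fe_fun_node: "k < n \<Longrightarrow> fe_fun x (N ! k) = x $ k"
proof -
  assume k: "k < n"
  have "fe_fun x (N ! k) = (\<Sum>l<n. x $ l * hat P (N ! l) (N ! k))" by (simp add: fe_fun_def sum_fun_apply)
  also have "\<dots> = (\<Sum>l<n. if l = k then x $ k else 0)"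
    by (rule sum.cong[OF refl]) (use k N_node node_enumeration(1) in \<open>auto simp: hat_node nth_eq_iff_index_eq\<close>)
  finally show ?thesis using k by simp
qed

lemma V0_eqI:
  assumes "u \<in> V0 P" "v \<in> V0 P" "\<And>k. k < n \<Longrightarrow> u (N ! k) = v (N ! k)"
  shows "u = v"
proof (rule fe_space_eqI)
  fix x assume x: "x \<in> nodes P"
  show "u x = v x"
  proof (cases "x \<in> Omega P")
    case True
    then obtain k where "k < n" "x = N ! k" using x node_enumeration(2) by (metis IntI in_set_conv_nth)
    then show ?thesis using assms(3) by simp
  qed (use assms in \<open>auto simp: V0_iff\<close>)
qed (use assms V0_fe_space in auto)

lemma fe_fun_eqI:
  "v \<in> V0 P \<Longrightarrow> (\<And>k. k < n \<Longrightarrow> x $ k = v (N ! k)) \<Longrightarrow> fe_fun x = v"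
  by (rule V0_eqI[OF fe_fun_V0]) (auto simp: fe_fun_node)

lemma fe_fun_zero: "x \<in> carrier_vec n \<Longrightarrow> fe_fun x = 0 \<Longrightarrow> x = 0\<^sub>v n"
proof (rule eq_vecI)
  assume x: "x \<in> carrier_vec n" "fe_fun x = 0"
  fix i assume i: "i < dim_vec (0\<^sub>v n :: real vec)"
  then have "x $ i = fe_fun x (N ! i)" using fe_fun_node by simp
  then show "x $ i = 0\<^sub>v n $ i" using x i by simp
qed simp

lemma stiffness_carrier: "stiffness P N \<in> carrier_mat n n"
  by (simp add: stiffness_def)

lemma stiffness_form:
  assumes "x \<in> carrier_vec n" "y \<in> carrier_vec n"
  shows "x \<bullet> (stiffness P N *\<^sub>v y) = a (fe_fun x) (fe_fun y)"
proof -
  have "x \<bullet> (stiffness P N *\<^sub>v y) = (\<Sum>k<n. x $ k * (\<Sum>l<n. stiffness P N $$ (k, l) * y $ l))"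
    using assms mult_mat_vec_sum[OF stiffness_carrier assms(2)] stiffness_carrier
    by (simp add: scalar_prod_def atLeast0LessThan stiffness_def)
  also have "\<dots> = (\<Sum>k<n. \<Sum>l<n. x $ k * (y $ l * a (hat P (N ! k)) (hat P (N ! l))))"
    by (auto simp: stiffness_def sum_distrib_left a.sym[OF hat_fe hat_fe] mult_ac intro!: sum.cong)
  also have "\<dots> = (\<Sum>l<n. y $ l * (\<Sum>k<n. x $ k * a (hat P (N ! k)) (hat P (N ! l))))"
    by (subst sum.swap) (simp add: sum_distrib_left mult_ac)
  also have "\<dots> = a (fe_fun x) (fe_fun y)"
    unfolding fe_fun_def by (simp add: a.sum_left a.sum_right a.mem a.bilin hat_fe)
  finally show ?thesis .
qed

text \<open>In terms of functions the range of \<open>E_coarse N L\<close> is the span of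
  \<open>L\<close>. Independence of \<open>L\<close> and definiteness of the energy on
  \<open>V0 P\<close> provide the positivity for \<open>schwarz_term_projection\<close>.\<close>

lemma schwarz_term_fe:
  assumes L: "set L \<subseteq> V0 P"
    and inj: "\<forall>c. (\<Sum>l<length L. c l *\<^sub>R L ! l) = 0 \<longrightarrow> (\<forall>l<length L. c l = 0)"
  shows "schwarz_term (stiffness P N) (E_coarse N L) \<in> carrier_mat n n"
    and "x \<in> carrier_vec n \<Longrightarrow> fe_fun (schwarz_term (stiffness P N) (E_coarse N L) *\<^sub>v x) \<in> span (set L)"
    and "x \<in> carrier_vec n \<Longrightarrow> v \<in> span (set L) \<Longrightarrow>
      a v (fe_fun (schwarz_term (stiffness P N) (E_coarse N L) *\<^sub>v x)) = a v (fe_fun x)"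
proof -
  let ?E = "E_coarse N L" and ?A = "stiffness P N" and ?k = "length L"
  have E: "?E \<in> carrier_mat n ?k" by (simp add: E_coarse_def)
  have LV: "L ! l \<in> V0 P" if "l < ?k" for l using L that by auto
  define comb where "comb c = (\<Sum>l<?k. c l *\<^sub>R L ! l)" for c
  have combV: "comb c \<in> V0 P" for c
    unfolding comb_def using LV subspace_V0 by (intro subspace_sum subspace_scale) auto
  have Ec: "fe_fun (?E *\<^sub>v c) = comb (($) c)" if c: "c \<in> carrier_vec ?k" for c
  proof (rule fe_fun_eqI[OF combV])
    fix k assume k: "k < n"
    show "(?E *\<^sub>v c) $ k = comb (($) c) (N ! k)"
      using mult_mat_vec_sum[OF E c k] k by (simp add: comb_def sum_fun_apply E_coarse_def mult.commute)
  qed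
  have sp: "span (set L) = range comb"
  proof
    have "set L = (!) L ` {..<?k}" by (auto simp: set_conv_nth)
    then have "\<exists>c. v = comb c" if "v \<in> span (set L)" for v
      using span_image_sum[of "{..<?k}" v "(!) L"] that by (simp add: comb_def)
    then show "span (set L) \<subseteq> range comb" by blast
    show "range comb \<subseteq> span (set L)"
      unfolding comb_def by (rule image_subsetI, intro span_sum span_scale span_base) auto
  qed
  have pd: "\<forall>c\<in>carrier_vec ?k. (?E *\<^sub>v c) \<bullet> (?A *\<^sub>v (?E *\<^sub>v c)) = 0 \<longrightarrow> c = 0\<^sub>v ?k"
  proof (intro ballI impI)
    fix c :: "real vec" assume c: "c \<in> carrier_vec ?k" and z: "(?E *\<^sub>v c) \<bullet> (?A *\<^sub>v (?E *\<^sub>v c)) = 0"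
    have "?E *\<^sub>v c \<in> carrier_vec n" using E c by simp
    then have "a (comb (($) c)) (comb (($) c)) = 0" using z stiffness_form Ec[OF c] by simp
    then have "comb (($) c) = 0" using energy_V0_definite[OF combV] by blast
    then have "\<forall>l<?k. c $ l = 0" unfolding comb_def using inj by blast
    then show "c = 0\<^sub>v ?k" using c by (intro eq_vecI) auto
  qed
  note proj = schwarz_term_projection[OF stiffness_carrier E pd]
  show "schwarz_term ?A ?E \<in> carrier_mat n n" by (rule proj(1))
  assume x: "x \<in> carrier_vec n"
  obtain c where c: "c \<in> carrier_vec ?k" "schwarz_term ?A ?E *\<^sub>v x = ?E *\<^sub>v c"
    "\<And>d. d \<in> carrier_vec ?k \<Longrightarrow> (?E *\<^sub>v d) \<bullet> (?A *\<^sub>v (?E *\<^sub>v c)) = (?E *\<^sub>v d) \<bullet> (?A *\<^sub>v x)"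
    using proj(2)[OF x] by blast
  show "fe_fun (schwarz_term ?A ?E *\<^sub>v x) \<in> span (set L)" unfolding c(2) Ec[OF c(1)] sp by simp
  assume "v \<in> span (set L)"
  then obtain d where d: "v = comb d" using sp by blast
  define d' where "d' = Matrix.vec ?k d"
  have d': "d' \<in> carrier_vec ?k" by (simp add: d'_def)
  have "comb (($) d') = comb d" by (simp add: comb_def d'_def)
  then have v: "v = fe_fun (?E *\<^sub>v d')" using Ec[OF d'] d by simp
  have cv: "?E *\<^sub>v d' \<in> carrier_vec n" "?E *\<^sub>v c \<in> carrier_vec n" using E c(1) d' by auto
  show "a v (fe_fun (schwarz_term ?A ?E *\<^sub>v x)) = a v (fe_fun x)"
    unfolding v c(2) using c(3)[OF d'] stiffness_form[OF cv] stiffness_form[OF cv(1) x] by simp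
qed

text \<open>Index 0 stands for the coarse space, so the Schwarz operator becomes one sum over
  \<open>0..nsub P\<close>.\<close>

definition W :: "nat \<Rightarrow> scalar_fun set"
  where "W i = (if i = 0 then X0 P else Vloc0 P (osub P i))"

definition M :: "nat \<Rightarrow> real mat"
  where "M i = schwarz_term (stiffness P N) (if i = 0 then E_coarse N B else E_loc N (Ns i))"

lemma set_sum_mono: "A \<subseteq> V \<Longrightarrow> C \<subseteq> V \<Longrightarrow> subspace V \<Longrightarrow> A + C \<subseteq> (V :: scalar_fun set)"
  by (auto simp: set_plus_def subset_iff subspace_add)

lemma X0_V0: "X0 P \<subseteq> V0 P"
proof -
  have h: "harmonic v \<Longrightarrow> v \<in> V0 P" for v by (simp add: harmonic_def)
  show ?thesis unfolding X0_def X_vert_def X_const_def X_dir_def X_tr_def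
    by (intro set_sum_mono span_minimal subspace_V0; use h vertex_ext(1) ext_edge(1) in blast)
qed

text \<open>A selection matrix holds the nodal values of hat functions, so the local terms have the
  same form as the coarse one.\<close>

lemma local_matrix: "i \<in> subs \<Longrightarrow> E_loc N (Ns i) = E_coarse N (map (hat P) (Ns i))"
  using N_node by (intro eq_matI) (auto simp: E_loc_def E_coarse_def hat_node)

lemma osub_subset_Omega: "i \<in> subs \<Longrightarrow> osub P i \<subseteq> Omega P"
  using elem_union_subset osub_elem_union by blast

lemma local_span:
  assumes i: "i \<in> subs"
  shows "span (set (map (hat P) (Ns i))) = Vloc0 P (osub P i)"
proof
  have Ni: "set (Ns i) = nodes P \<inter> osub P i" using local_enumerations i by blast
  show "span (set (map (hat P) (Ns i))) \<subseteq> Vloc0 P (osub P i)"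
    by (rule span_minimal)
      (use Ni in \<open>auto simp: Vloc0_nodes[OF osub_elem_union[OF i]] hat_fe hat_node subspace_Vloc0\<close>)
  show "Vloc0 P (osub P i) \<subseteq> span (set (map (hat P) (Ns i)))"
  proof
    fix v assume "v \<in> Vloc0 P (osub P i)"
    then have v: "v \<in> fe_space P" "\<And>p. p \<in> nodes P - osub P i \<Longrightarrow> v p = 0"
      using Vloc0_nodes[OF osub_elem_union[OF i]] by auto
    have fin: "finite (nodes P \<inter> osub P i)" using finite_nodes by simp
    have "v = (\<Sum>p\<in>nodes P \<inter> osub P i. v p *\<^sub>R hat P p)"
    proof (rule fe_space_eqI[OF v(1)])
      show "(\<Sum>p\<in>nodes P \<inter> osub P i. v p *\<^sub>R hat P p) \<in> fe_space P" by (intro a.mem_sum a.mem_scale hat_fe)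
      fix x assume x: "x \<in> nodes P"
      have "(\<Sum>p\<in>nodes P \<inter> osub P i. v p *\<^sub>R hat P p) x = (\<Sum>p\<in>nodes P \<inter> osub P i. if p = x then v x else 0)"
        unfolding sum_fun_apply by (rule sum.cong[OF refl]) (auto simp: hat_node x)
      also have "\<dots> = v x" using fin x v(2)[of x] by simp
      finally show "v x = (\<Sum>p\<in>nodes P \<inter> osub P i. v p *\<^sub>R hat P p) x" by simp
    qed
    also have "\<dots> \<in> span (set (map (hat P) (Ns i)))"
      using Ni by (intro span_sum span_scale span_base) auto
    finally show "v \<in> span (set (map (hat P) (Ns i)))" .
  qed
qed

lemma M_projection:
  assumes i: "i \<in> {0..nsub P}"
  shows "M i \<in> carrier_mat n n"
    and "x \<in> carrier_vec n \<Longrightarrow> fe_fun (M i *\<^sub>v x) \<in> W i"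
    and "x \<in> carrier_vec n \<Longrightarrow> v \<in> W i \<Longrightarrow> a v (fe_fun (M i *\<^sub>v x)) = a v (fe_fun x)"
proof -
  have "\<exists>L. M i = schwarz_term (stiffness P N) (E_coarse N L) \<and> span (set L) = W i \<and> set L \<subseteq> V0 P \<and>
    (\<forall>c. (\<Sum>l<length L. c l *\<^sub>R L ! l) = 0 \<longrightarrow> (\<forall>l<length L. c l = 0))"
  proof (cases "i = 0")
    case True
    have "\<forall>l<length B. c l = 0" if z: "(\<Sum>l<length B. c l *\<^sub>R B ! l) = 0" for c
    proof -
      \<comment> \<open>Moves coefficients from list positions to basis functions, possible since
        the list is distinct; \<open>independent\<close> speaks about sets.\<close>
      define g where "g b = c (THE l. l < length B \<and> B ! l = b)" for b
      have g: "g (B ! l) = c l" if "l < length B" for l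
      proof -
        have "(THE k. k < length B \<and> B ! k = B ! l) = l"
          using that coarse_basis(1) by (intro the_equality) (auto simp: nth_eq_iff_index_eq)
        then show ?thesis by (simp add: g_def)
      qed
      have "inj_on ((!) B) {..<length B}" using coarse_basis(1) by (auto simp: inj_on_def nth_eq_iff_index_eq)
      moreover have "set B = (!) B ` {..<length B}" by (auto simp: set_conv_nth)
      ultimately have "(\<Sum>b\<in>set B. g b *\<^sub>R b) = (\<Sum>l<length B. g (B ! l) *\<^sub>R B ! l)"
        by (simp add: sum.reindex)
      also have "\<dots> = (\<Sum>l<length B. c l *\<^sub>R B ! l)" by (rule sum.cong[OF refl]) (simp add: g)
      also note z
      finally have "g b = 0" if "b \<in> set B" for b
        using independentD[OF coarse_basis(2) finite_set subset_refl _ that] by blast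
      then show ?thesis using g nth_mem by metis
    qed
    moreover have "set B \<subseteq> V0 P" using span_superset[of "set B"] coarse_basis(3) X0_V0 by blast
    ultimately show ?thesis using True coarse_basis(3) unfolding M_def W_def by auto
  next
    case False
    then have iI: "i \<in> subs" using i by auto
    let ?L = "map (hat P) (Ns i)"
    have Ni: "distinct (Ns i)" "set (Ns i) = nodes P \<inter> osub P i" using local_enumerations iI by auto
    have "\<forall>l<length ?L. c l = 0" if z: "(\<Sum>l<length ?L. c l *\<^sub>R ?L ! l) = 0" for c
    proof (intro allI impI)
      fix l assume l: "l < length ?L"
      then have p: "Ns i ! l \<in> nodes P" using Ni(2) nth_mem by fastforce
      have "0 = (\<Sum>k<length ?L. c k *\<^sub>R ?L ! k) (Ns i ! l)" using z by simp
      also have "\<dots> = (\<Sum>k<length ?L. if k = l then c l else 0)"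
        unfolding sum_fun_apply
        by (rule sum.cong[OF refl]) (use l Ni(1) p in \<open>auto simp: hat_node nth_eq_iff_index_eq\<close>)
      finally show "c l = 0" using l by simp
    qed
    moreover have "set ?L \<subseteq> V0 P" using Ni(2) hat_V0 osub_subset_Omega[OF iI] by auto
    ultimately show ?thesis
      using False local_matrix[OF iI] local_span[OF iI] unfolding M_def W_def by (intro exI[of _ ?L]) simp
  qed
  then obtain L where L: "M i = schwarz_term (stiffness P N) (E_coarse N L)" "span (set L) = W i" "set L \<subseteq> V0 P"
    "\<forall>c. (\<Sum>l<length L. c l *\<^sub>R L ! l) = 0 \<longrightarrow> (\<forall>l<length L. c l = 0)" by blast
  show "M i \<in> carrier_mat n n"
    "x \<in> carrier_vec n \<Longrightarrow> fe_fun (M i *\<^sub>v x) \<in> W i"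
    "x \<in> carrier_vec n \<Longrightarrow> v \<in> W i \<Longrightarrow> a v (fe_fun (M i *\<^sub>v x)) = a v (fe_fun x)"
    using schwarz_term_fe[OF L(3,4)] unfolding L(1) L(2)[symmetric] by auto
qed

section \<open>Spectrum of the Schwarz operator\<close>

abbreviation K :: "real mat" where "K \<equiv> schwarz_operator P N Ns B"

abbreviation Pr :: "nat \<Rightarrow> real vec \<Rightarrow> scalar_fun" where "Pr i x \<equiv> fe_fun (M i *\<^sub>v x)"

lemma K_carrier: "K \<in> carrier_mat n n"
  using M_projection(1)[of 0] by (simp add: schwarz_operator_def M_def)

lemma K_fe_fun:
  assumes x: "x \<in> carrier_vec n"
  shows "fe_fun (K *\<^sub>v x) = (\<Sum>i=0..nsub P. Pr i x)"
proof (rule fe_fun_eqI)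
  show "(\<Sum>i=0..nsub P. Pr i x) \<in> V0 P" using fe_fun_V0 subspace_V0 by (intro subspace_sum)
  fix k assume k: "k < n"
  have M0: "M 0 \<in> carrier_mat n n" using M_projection(1) by simp
  have Kkl: "K $$ (k, l) = (\<Sum>i=0..nsub P. M i $$ (k, l))" if l: "l < n" for l
  proof -
    have "K $$ (k, l) = M 0 $$ (k, l) + (\<Sum>i=1..nsub P. M i $$ (k, l))"
      using k l M0 by (simp add: schwarz_operator_def M_def)
    then show ?thesis by (simp add: sum.atLeast_Suc_atMost)
  qed
  have "(K *\<^sub>v x) $ k = (\<Sum>l<n. (\<Sum>i=0..nsub P. M i $$ (k, l)) * x $ l)"
    unfolding mult_mat_vec_sum[OF K_carrier x k] by (rule sum.cong[OF refl]) (use Kkl in simp)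
  also have "\<dots> = (\<Sum>i=0..nsub P. \<Sum>l<n. M i $$ (k, l) * x $ l)"
    unfolding sum_distrib_right by (rule sum.swap)
  also have "\<dots> = (\<Sum>i=0..nsub P. Pr i x (N ! k))"
    by (rule sum.cong[OF refl]) (use mult_mat_vec_sum[OF M_projection(1) x k] fe_fun_node[OF k] in simp)
  finally show "(K *\<^sub>v x) $ k = (\<Sum>i=0..nsub P. Pr i x) (N ! k)" by (simp add: sum_fun_apply)
qed

text \<open>The projection lies in its own space \<open>W i\<close>, so it may be used as the test
  function.\<close>

lemma Pr_self: "i \<in> {0..nsub P} \<Longrightarrow> x \<in> carrier_vec n \<Longrightarrow> y \<in> carrier_vec n \<Longrightarrow> a (Pr i x) (fe_fun y) = a (Pr i x) (Pr i y)"
  using M_projection(2,3) by metis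

lemma K_selfadjoint:
  assumes x: "x \<in> carrier_vec n" and y: "y \<in> carrier_vec n"
  shows "a (fe_fun (K *\<^sub>v x)) (fe_fun y) = a (fe_fun x) (fe_fun (K *\<^sub>v y))"
proof -
  have "a (Pr i x) (fe_fun y) = a (fe_fun x) (Pr i y)" if "i \<in> {0..nsub P}" for i
    using Pr_self[OF that x y] Pr_self[OF that y x] a.sym[OF fe_fun_fe fe_fun_fe] by metis
  then show ?thesis
    unfolding K_fe_fun[OF x] K_fe_fun[OF y] a.sum_left[OF fe_fun_fe fe_fun_fe] a.sum_right[OF fe_fun_fe fe_fun_fe]
    by (rule sum.cong[OF refl])
qed

lemma fe_fun_lincomb:
  "x \<in> carrier_vec n \<Longrightarrow> y \<in> carrier_vec n \<Longrightarrow> fe_fun (c \<cdot>\<^sub>v x + d \<cdot>\<^sub>v y) = c *\<^sub>R fe_fun x + d *\<^sub>R fe_fun y"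
  by (rule fe_fun_eqI) (auto simp: fe_fun_node subspace_V0 subspace_add subspace_scale fe_fun_V0)

lemma fe_fun_scale: "x \<in> carrier_vec n \<Longrightarrow> fe_fun (c \<cdot>\<^sub>v x) = c *\<^sub>R fe_fun x"
  by (rule fe_fun_eqI) (auto simp: fe_fun_node subspace_V0 subspace_scale fe_fun_V0)

lemma fe_fun_energy_pos: "x \<in> carrier_vec n \<Longrightarrow> x \<noteq> 0\<^sub>v n \<Longrightarrow> 0 < a (fe_fun x) (fe_fun x)"
  using a.nonneg[OF fe_fun_fe, of x] energy_V0_definite[OF fe_fun_V0, of x] fe_fun_zero by fastforce

text \<open>\<open>Max\<close> and \<open>Min\<close> in \<open>cond_number\<close> need a real
  eigenvalue. For real and imaginary parts x, y of a complex eigenvector, equality of a(K x, y) and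
  a(x, K y) reads \<beta> (a(x, x) + a(y, y)) = 0, hence \<open>\<beta>\<close> vanishes.\<close>

lemma eigenvalue_exists:
  assumes "0 < n"
  shows "\<exists>k. eigenvalue K k"
proof -
  obtain x y \<alpha> \<beta> where xy: "x \<in> carrier_vec n" "y \<in> carrier_vec n" "x \<noteq> 0\<^sub>v n \<or> y \<noteq> 0\<^sub>v n"
    and K: "K *\<^sub>v x = \<alpha> \<cdot>\<^sub>v x - \<beta> \<cdot>\<^sub>v y" "K *\<^sub>v y = \<beta> \<cdot>\<^sub>v x + \<alpha> \<cdot>\<^sub>v y"
    using complex_eigenvector_parts[OF K_carrier assms] by metis
  let ?x = "fe_fun x" and ?y = "fe_fun y"
  have "\<alpha> \<cdot>\<^sub>v x - \<beta> \<cdot>\<^sub>v y = \<alpha> \<cdot>\<^sub>v x + (- \<beta>) \<cdot>\<^sub>v y" using xy by (intro eq_vecI) auto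
  then have f1: "fe_fun (K *\<^sub>v x) = \<alpha> *\<^sub>R ?x + (- \<beta>) *\<^sub>R ?y" using K(1) fe_fun_lincomb[OF xy(1,2)] by simp
  have f2: "fe_fun (K *\<^sub>v y) = \<beta> *\<^sub>R ?x + \<alpha> *\<^sub>R ?y" using K(2) fe_fun_lincomb[OF xy(1,2)] by simp
  have "a (\<alpha> *\<^sub>R ?x + (- \<beta>) *\<^sub>R ?y) ?y = a ?x (\<beta> *\<^sub>R ?x + \<alpha> *\<^sub>R ?y)"
    using K_selfadjoint[OF xy(1,2)] f1 f2 by simp
  then have "\<beta> * (a ?x ?x + a ?y ?y) = 0"
    by (simp add: a.add_left a.add_right a.scale_left a.scale_right a.mem fe_fun_fe algebra_simps del: scaleR_minus_left)
  moreover have "a ?x ?x + a ?y ?y > 0"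
    using fe_fun_energy_pos xy a.nonneg[OF fe_fun_fe] by (metis add_nonneg_pos add_pos_nonneg)
  ultimately have "\<beta> = 0" by simp
  then have "K *\<^sub>v x = \<alpha> \<cdot>\<^sub>v x" "K *\<^sub>v y = \<alpha> \<cdot>\<^sub>v y" using K xy by (auto intro!: eq_vecI)
  then show ?thesis using xy K_carrier unfolding eigenvalue_def eigenvector_def by (metis carrier_matD(1))
qed

text \<open>Element by element, at most \<open>m\<close> summands survive. As \<open>m\<close>
  controls only nodes inside the domain, elements with such a node are separated from those whose
  vertices all lie on the outer boundary.\<close>

lemma sum_osub_energy:
  assumes w: "\<And>i. i \<in> subs \<Longrightarrow> w i \<in> Vloc0 P (osub P i)"
  shows "a (\<Sum>i\<in>subs. w i) (\<Sum>i\<in>subs. w i) \<le> real m * (\<Sum>i\<in>subs. a (w i) (w i))"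
proof -
  have wf: "w i \<in> fe_space P" "\<And>x. x \<notin> osub P i \<Longrightarrow> w i x = 0" if "i \<in> subs" for i
    using w[OF that] Vloc0_iff[OF osub_elem_union[OF that]] by auto
  have sf: "(\<Sum>i\<in>I. w i) \<in> fe_space P" if "I \<subseteq> subs" for I using wf(1) that by (intro a.mem_sum) blast
  have br: "v \<in> broken P \<omega>" if "v \<in> fe_space P" for v \<omega> using that fe_space_broken by blast
  let ?e = "\<lambda>T. energy P (interior T)"
  have "?e T (\<Sum>i\<in>subs. w i) (\<Sum>i\<in>subs. w i) \<le> real m * (\<Sum>i\<in>subs. ?e T (w i) (w i))" if T: "T \<in> mesh P" for T
  proof -
    interpret t: psd_form "{u. fe_on T u}" "?e T" by (rule psd_energy_element[OF T])
    have wT: "w i \<in> {u. fe_on T u}" if "i \<in> subs" for i using fe_space_fe_on[OF wf(1)[OF that] T] by simp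
    have nn: "0 \<le> (\<Sum>i\<in>I. ?e T (w i) (w i))" if "I \<subseteq> subs" for I
      using that t.nonneg[OF wT] by (intro sum_nonneg) blast
    define J where "J = {i \<in> subs. T \<in> els P (osub P i)}"
    have out: "w i x = 0" if "i \<in> subs - J" "x \<in> T" for i x
    proof -
      have "T \<inter> osub P i = {}" using elem_union_meets[OF osub_elem_union T] that(1) unfolding J_def by blast
      then show ?thesis using wf(2)[of i x] that by blast
    qed
    show ?thesis
    proof (cases "\<exists>p. p extreme_point_of T \<and> p \<in> Omega P")
      case True
      then obtain p where p: "p extreme_point_of T" "p \<in> Omega P" by blast
      have pn: "p \<in> nodes P \<inter> Omega P" "p \<in> T" using p T by (auto simp: nodes_def extreme_point_of_def)
      have "J \<subseteq> {i \<in> subs. p \<in> closure (osub P i)}" using els_closure pn(2) unfolding J_def by blast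
      then have "card J \<le> card {i \<in> subs. p \<in> closure (osub P i)}" by (rule card_mono[rotated]) simp
      also have "\<dots> \<le> m" using overlap_bound pn(1) by blast
      finally have cJ: "card J \<le> m" .
      have "(\<Sum>i\<in>subs. w i) x = (\<Sum>i\<in>J. w i) x" if "x \<in> interior T" for x
        unfolding sum_fun_apply
      proof (rule sum.mono_neutral_right)
        show "\<forall>i\<in>subs - J. w i x = 0" using out[of _ x] that interior_subset[of T] by blast
      qed (auto simp: J_def)
      then have "?e T (\<Sum>i\<in>subs. w i) (\<Sum>i\<in>subs. w i) = ?e T (\<Sum>i\<in>J. w i) (\<Sum>i\<in>J. w i)"
        by (intro energy_cong open_interior) auto
      also have "\<dots> \<le> real (card J) * (\<Sum>i\<in>J. ?e T (w i) (w i))"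
        by (rule t.sum_le_card) (use wT in \<open>auto simp: J_def\<close>)
      also have "\<dots> \<le> real m * (\<Sum>i\<in>J. ?e T (w i) (w i))"
      proof (rule mult_right_mono)
        show "0 \<le> (\<Sum>i\<in>J. ?e T (w i) (w i))" by (rule nn) (auto simp: J_def)
      qed (use cJ in simp)
      also have "\<dots> \<le> real m * (\<Sum>i\<in>subs. ?e T (w i) (w i))"
        using t.nonneg[OF wT] by (intro mult_left_mono sum_mono2) (auto simp: J_def)
      finally show ?thesis .
    \<comment> \<open>Without a vertex inside the domain, every local function is zero at all
      vertices of the element, hence on it.\<close>
    next
      case False
      have w0: "w i x = 0" if i: "i \<in> subs" and x: "x \<in> T" for i x
      proof (rule fe_on_zero[OF mesh_element[OF T] fe_space_fe_on[OF wf(1)[OF i] T] _ x])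
        fix p assume "p extreme_point_of T"
        then have "p \<notin> osub P i" using False osub_subset_Omega[OF i] by blast
        then show "w i p = 0" by (rule wf(2)[OF i])
      qed
      then have "(\<Sum>i\<in>subs. w i) x = 0" if "x \<in> T" for x using that by (simp add: sum_fun_apply)
      then have "?e T (\<Sum>i\<in>subs. w i) (\<Sum>i\<in>subs. w i) = 0"
        using energy_element_zero(1)[OF T fe_space_fe_on[OF sf[OF subset_refl] T]] by blast
      then show ?thesis using nn[of subs] by simp
    qed
  qed
  then have "(\<Sum>T\<in>mesh P. ?e T (\<Sum>i\<in>subs. w i) (\<Sum>i\<in>subs. w i)) \<le> (\<Sum>T\<in>mesh P. real m * (\<Sum>i\<in>subs. ?e T (w i) (w i)))"
    by (rule sum_mono)
  also have "\<dots> = real m * (\<Sum>T\<in>mesh P. \<Sum>i\<in>subs. ?e T (w i) (w i))"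
    by (simp add: sum_distrib_left)
  also have "(\<Sum>T\<in>mesh P. \<Sum>i\<in>subs. ?e T (w i) (w i)) = (\<Sum>i\<in>subs. \<Sum>T\<in>mesh P. ?e T (w i) (w i))"
    by (rule sum.swap)
  also have "(\<Sum>i\<in>subs. \<Sum>T\<in>mesh P. ?e T (w i) (w i)) = (\<Sum>i\<in>subs. a (w i) (w i))"
    by (rule sum.cong[OF refl]) (use energy_sum[OF elem_union_Omega br br, OF wf(1) wf(1)] els_Omega in simp)
  finally show ?thesis
    using energy_sum[OF elem_union_Omega br br, OF sf[OF subset_refl] sf[OF subset_refl]] els_Omega by simp
qed

text \<open>The coarse projection contributes 1. For the sum \<open>?Q\<close> of the local ones the
  overlap gives a(Q, Q) <= m a(Q, u); Young's inequality with \<open>m\<close> times u then yields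
  a(Q, u) <= m a(u, u).\<close>

lemma eigenvalue_upper:
  assumes k: "eigenvalue K k"
  shows "k \<le> real m + 1"
proof -
  obtain x where x: "x \<in> carrier_vec n" "x \<noteq> 0\<^sub>v n" "K *\<^sub>v x = k \<cdot>\<^sub>v x"
    using k K_carrier unfolding eigenvalue_def eigenvector_def by auto
  let ?u = "fe_fun x" and ?Q = "\<Sum>i\<in>subs. Pr i x"
  have "fe_fun (k \<cdot>\<^sub>v x) = k *\<^sub>R ?u" by (rule fe_fun_scale[OF x(1)])
  then have ku: "k * a ?u ?u = a (\<Sum>i=0..nsub P. Pr i x) ?u"
    using K_fe_fun[OF x(1)] x(3) a.scale_left[OF fe_fun_fe fe_fun_fe, of k x x] by simp
  have split: "(\<Sum>i=0..nsub P. Pr i x) = Pr 0 x + ?Q" by (simp add: sum.atLeast_Suc_atMost)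
  have Qf: "?Q \<in> fe_space P" by (intro a.mem_sum fe_fun_fe)
  have 0: "a (Pr 0 x) ?u \<le> a ?u ?u"
    using a.two_le[OF fe_fun_fe fe_fun_fe, of "M 0 *\<^sub>v x" x] Pr_self[of 0, OF _ x(1,1)] by simp
  have W: "Pr i x \<in> Vloc0 P (osub P i)" if "i \<in> subs" for i
    using M_projection(2)[of i, OF _ x(1)] that by (simp add: W_def)
  have "a ?Q ?Q \<le> real m * (\<Sum>i\<in>subs. a (Pr i x) (Pr i x))" by (rule sum_osub_energy[OF W])
  also have "(\<Sum>i\<in>subs. a (Pr i x) (Pr i x)) = (\<Sum>i\<in>subs. a (Pr i x) ?u)"
    by (rule sum.cong[OF refl]) (use Pr_self[OF _ x(1,1)] in simp)
  also have "\<dots> = a ?Q ?u" by (simp add: a.sum_left fe_fun_fe)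
  finally have QQ: "a ?Q ?Q \<le> real m * a ?Q ?u" .
  have "a ?Q ?u \<le> real m * a ?u ?u"
  \<comment> \<open>The absorption divides by \<open>m\<close>; for \<open>m = 0\<close> the sum has
    zero energy and \<open>kernel\<close> applies.\<close>
  proof (cases "m = 0")
    case True
    then have "a ?Q ?Q = 0" using QQ a.nonneg[OF Qf] by simp
    then have "a ?u ?Q = 0" using a.kernel[OF fe_fun_fe Qf] by blast
    then show ?thesis using True a.sym[OF Qf fe_fun_fe] by simp
  next
    case False
    have "2 * a ?Q (real m *\<^sub>R ?u) \<le> a ?Q ?Q + a (real m *\<^sub>R ?u) (real m *\<^sub>R ?u)"
      by (rule a.two_le[OF Qf a.mem_scale[OF fe_fun_fe]])
    then have "2 * (real m * a ?Q ?u) \<le> real m * a ?Q ?u + real m * (real m * a ?u ?u)"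
      using QQ Qf by (simp add: a.bilin a.mem fe_fun_fe)
    then have "real m * a ?Q ?u \<le> real m * (real m * a ?u ?u)" by simp
    then show ?thesis using False by (simp only: mult_le_cancel_left_pos of_nat_0_less_iff)
  qed
  then have "k * a ?u ?u \<le> (real m + 1) * a ?u ?u"
    unfolding ku split a.add_left[OF fe_fun_fe Qf fe_fun_fe] using 0 by (simp add: algebra_simps)
  then show ?thesis using fe_fun_energy_pos[OF x(1,2)] by simp
qed

lemma ext_edge_span:
  assumes e: "e \<in> edges P" and v: "finite J" "v \<in> span (g ` J)"
  shows "ext_interface P (ext_edge_interface P e v) \<in> span ((\<lambda>i. ext_interface P (ext_edge_interface P e (g i))) ` J)"
proof -
  obtain c where c: "v = (\<Sum>i\<in>J. c i *\<^sub>R g i)" using span_image_sum[OF v] by blast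
  have "ext_interface P (ext_edge_interface P e v) = (\<Sum>i\<in>J. c i *\<^sub>R ext_interface P (ext_edge_interface P e (g i)))"
    unfolding c
    by (rule lincomb_sum[where V = UNIV and F = "\<lambda>\<eta>. ext_interface P (ext_edge_interface P e \<eta>)"])
      (use ext_edge_lincomb[OF e] in auto)
  then show ?thesis by (simp only:) (intro span_sum span_scale span_base imageI)
qed

text \<open>The terms are sorted into the four summands of \<open>X0\<close>; on each edge the
  spectral estimates locate the projections in the span of the selected eigenfunctions.\<close>

lemma u_coarse_X0:
  assumes u: "u \<in> V0 P"
  shows "u_coarse P u \<in> X0 P"
proof -
  define C where "C e = c_u P e u *\<^sub>R ext_interface P (ext_edge_interface P e (\<lambda>x. 1))" for e
  define R where "R e = ext_interface P (ext_edge_interface P e (proj_tr P e (edge_ha e u)))" for e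
  have eq: "u_coarse P u = interp_vertices P u + sum C (edges P) + (\<Sum>e\<in>edges P. u0_perp P e u) + sum R (edges P)"
    unfolding u_coarse_eq edge_coarse_def
    using u0_ha_eq by (simp add: C_def R_def sum.distrib algebra_simps cong: sum.cong)
  have "interp_vertices P u \<in> X_vert P"
    unfolding interp_vertices_def X_vert_def by (intro span_sum span_scale span_base) blast
  moreover have "sum C (edges P) \<in> X_const P"
    unfolding C_def X_const_def by (intro span_sum span_scale span_base) blast
  moreover have "(\<Sum>e\<in>edges P. u0_perp P e u) \<in> X_dir P"
    unfolding X_dir_def
  proof (rule span_sum)
    fix e assume e: "e \<in> edges P"
    let ?J = "{i \<in> {1..dim (Vedge0 P e)}. mu P e i \<le> tol_dir P}"
    have pE: "edge_perp e u \<in> Vedge0 P e" unfolding edge_perp_def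
      by (rule edge_part_Vedge0[OF e]) (use u_ha_props(3)[OF e u] in \<open>simp add: Vloc0_def\<close>)
    have "proj_dir P e (edge_perp e u) \<in> span (psi P e ` ?J)"
      using dirichlet_spectral_estimate(3)[OF e _ tolerances(1) pE] eigenpairs(1) e by blast
    then have "u0_perp P e u \<in> span ((\<lambda>i. ext_interface P (ext_edge_interface P e (psi P e i))) ` ?J)"
      unfolding u0_perp_def edge_perp_def[symmetric] by (intro ext_edge_span[OF e]) auto
    moreover have "(\<lambda>i. ext_interface P (ext_edge_interface P e (psi P e i))) ` ?J \<subseteq>
      {ext_interface P (ext_edge_interface P e (psi P e i)) |e i.
        e \<in> edges P \<and> i \<in> {1..dim (Vedge0 P e)} \<and> mu P e i \<le> tol_dir P}" using e by blast
    ultimately show "u0_perp P e u \<in> span {ext_interface P (ext_edge_interface P e (psi P e i)) |e i.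
        e \<in> edges P \<and> i \<in> {1..dim (Vedge0 P e)} \<and> mu P e i \<le> tol_dir P}" using span_mono by blast
  qed
  moreover have "sum R (edges P) \<in> X_tr P"
    unfolding X_tr_def
  proof (rule span_sum)
    fix e assume e: "e \<in> edges P"
    let ?J = "{i \<in> {1..dim (Vbd P e)}. lam P e i > tol_tr P}"
    have "proj_tr P e (edge_ha e u) \<in> span (varphi P e ` ?J)"
      unfolding edge_ha_def
      by (rule transfer_spectral_estimate(3)[OF e _ _ tolerances(2) u_hat_Vha[OF e u]])
        (use inner_products eigenpairs(2) e in auto)
    then have "R e \<in> span ((\<lambda>i. ext_interface P (ext_edge_interface P e (varphi P e i))) ` ?J)"
      unfolding R_def by (intro ext_edge_span[OF e]) auto
    moreover have "(\<lambda>i. ext_interface P (ext_edge_interface P e (varphi P e i))) ` ?J \<subseteq>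
      {ext_interface P (ext_edge_interface P e (varphi P e i)) |e i.
        e \<in> edges P \<and> i \<in> {1..dim (Vbd P e)} \<and> lam P e i > tol_tr P}" using e by blast
    ultimately show "R e \<in> span {ext_interface P (ext_edge_interface P e (varphi P e i)) |e i.
        e \<in> edges P \<and> i \<in> {1..dim (Vbd P e)} \<and> lam P e i > tol_tr P}" using span_mono by blast
  qed
  ultimately show ?thesis unfolding eq X0_def by (intro set_plus_intro)
qed

text \<open>Lions' lemma: for an eigenvector u, a(u, u) is the sum of a(v_i, P_i u) over the stable
  decomposition, where the energies of the v_i sum to at most C a(u, u) and those of the P_i u to k
  a(u, u).\<close>

lemma eigenvalue_lower:
  assumes k: "eigenvalue K k" and C: "0 < C"
    and stable: "\<And>u. u \<in> V0 P \<Longrightarrow> a (u_coarse P u) (u_coarse P u) +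
      (\<Sum>i\<in>subs. energy_osub P i (u_local P i u) (u_local P i u)) \<le> C * a u u"
  shows "1 / C \<le> k"
proof -
  obtain x where x: "x \<in> carrier_vec n" "x \<noteq> 0\<^sub>v n" "K *\<^sub>v x = k \<cdot>\<^sub>v x"
    using k K_carrier unfolding eigenvalue_def eigenvector_def by auto
  let ?u = "fe_fun x"
  interpret s: fe_splitting P \<alpha>min \<alpha>max c1 c2 ?u by unfold_locales (rule fe_fun_V0)
  define v where "v i = (if i = 0 then u_coarse P ?u else s.f i)" for i
  have vW: "v i \<in> W i" if "i \<in> {0..nsub P}" for i
    using u_coarse_X0[OF fe_fun_V0] s.f_osub[of i] that by (auto simp: v_def W_def)
  have vf: "v i \<in> fe_space P" if "i \<in> {0..nsub P}" for i
    using s.fe(2) s.f_V0[of i] V0_fe_space that by (auto simp: v_def)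
  have vs: "(\<Sum>i=0..nsub P. v i) = ?u"
  proof -
    have "(\<Sum>i=0..nsub P. v i) = u_coarse P ?u + (\<Sum>i\<in>subs. s.f i)"
      by (simp add: sum.atLeast_Suc_atMost v_def)
    also have "(\<Sum>i\<in>subs. s.f i) = (\<Sum>i\<in>subs. ext_osub P i (u_local P i ?u))"
      by (rule sum.cong[OF refl s.ext_osub_local[symmetric]])
    finally show ?thesis using s.decomposition[symmetric] by (rule trans)
  qed
  have ve: "(\<Sum>i=0..nsub P. a (v i) (v i)) \<le> C * a ?u ?u"
  proof -
    have "(\<Sum>i=0..nsub P. a (v i) (v i)) = a (u_coarse P ?u) (u_coarse P ?u) + (\<Sum>i\<in>subs. a (s.f i) (s.f i))"
      by (simp add: sum.atLeast_Suc_atMost v_def)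
    also have "(\<Sum>i\<in>subs. a (s.f i) (s.f i)) = (\<Sum>i\<in>subs. energy_osub P i (u_local P i ?u) (u_local P i ?u))"
      by (rule sum.cong[OF refl]) (simp add: energy_osub_def s.ext_osub_local)
    finally show ?thesis using stable[OF fe_fun_V0, of x] by simp
  qed
  have "fe_fun (k \<cdot>\<^sub>v x) = k *\<^sub>R ?u" by (rule fe_fun_scale[OF x(1)])
  then have ku: "k * a ?u ?u = a (\<Sum>i=0..nsub P. Pr i x) ?u"
    using K_fe_fun[OF x(1)] x(3) a.scale_left[OF fe_fun_fe fe_fun_fe, of k x x] by simp
  also have "\<dots> = (\<Sum>i=0..nsub P. a (Pr i x) (Pr i x))"
    unfolding a.sum_left[OF fe_fun_fe fe_fun_fe] by (rule sum.cong[OF refl]) (rule Pr_self[OF _ x(1,1)])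
  finally have PP: "(\<Sum>i=0..nsub P. a (Pr i x) (Pr i x)) = k * a ?u ?u" by simp
  \<comment> \<open>The extra factor \<open>C\<close> balances both sides of Young's inequality, so
    that no square roots appear.\<close>
  have "C * a ?u ?u = C * a (\<Sum>i=0..nsub P. v i) ?u" by (simp add: vs)
  also have "\<dots> = (\<Sum>i=0..nsub P. C * a (v i) (Pr i x))"
  proof -
    have "a (\<Sum>i=0..nsub P. v i) ?u = (\<Sum>i=0..nsub P. a (v i) ?u)"
      by (rule a.sum_left[OF _ fe_fun_fe]) (rule vf)
    also have "\<dots> = (\<Sum>i=0..nsub P. a (v i) (Pr i x))"
      by (rule sum.cong[OF refl]) (use M_projection(3)[OF _ x(1) vW] in simp)
    finally show ?thesis by (simp add: sum_distrib_left)
  qed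
  finally have "2 * (C * a ?u ?u) = (\<Sum>i=0..nsub P. 2 * (C * a (v i) (Pr i x)))" by (simp add: sum_distrib_left)
  also have "\<dots> \<le> (\<Sum>i=0..nsub P. a (v i) (v i) + C\<^sup>2 * a (Pr i x) (Pr i x))"
  proof (rule sum_mono)
    fix i assume i: "i \<in> {0..nsub P}"
    show "2 * (C * a (v i) (Pr i x)) \<le> a (v i) (v i) + C\<^sup>2 * a (Pr i x) (Pr i x)"
      using a.two_le[OF vf[OF i] a.mem_scale[OF fe_fun_fe], of C "M i *\<^sub>v x"] vf[OF i]
      by (simp add: a.scale_left a.scale_right a.mem_scale fe_fun_fe power2_eq_square mult.assoc)
  qed
  also have "\<dots> \<le> C * a ?u ?u + C\<^sup>2 * (k * a ?u ?u)"
    using ve PP by (simp add: sum.distrib flip: sum_distrib_left)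
  finally have "C * a ?u ?u * 1 \<le> C * a ?u ?u * (C * k)" by (simp add: power2_eq_square algebra_simps)
  moreover have "0 < C * a ?u ?u" using fe_fun_energy_pos[OF x(1,2)] C by simp
  ultimately have "1 \<le> C * k" by (simp only: mult_le_cancel_left_pos)
  then show ?thesis using C by (simp add: field_simps)
qed

lemma cond_number_bound:
  assumes C: "0 < C" and ne: "V0 P \<noteq> {0}"
    and stable: "\<And>u. u \<in> V0 P \<Longrightarrow> a (u_coarse P u) (u_coarse P u) +
      (\<Sum>i\<in>subs. energy_osub P i (u_local P i u) (u_local P i u)) \<le> C * a u u"
  shows "cond_number K \<le> C * (real m + 1)"
proof -
  let ?S = "{k. eigenvalue K k}"
  \<comment> \<open>A nonzero function in \<open>V0 P\<close> requires a node inside the domain, so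
    the matrices have positive dimension.\<close>
  have "0 < n"
  proof (rule ccontr)
    assume "\<not> 0 < n"
    then have "v = 0" if "v \<in> V0 P" for v
      using V0_eqI[OF that subspace_0[OF subspace_V0]] by simp
    then show False using ne subspace_0[OF subspace_V0] by blast
  qed
  then have S: "?S \<noteq> {}" using eigenvalue_exists by blast
  have "char_poly K \<noteq> 0" using degree_monic_char_poly[OF K_carrier] by auto
  then have fin: "finite ?S" using poly_roots_finite[of "char_poly K"] eigenvalue_root_char_poly[OF K_carrier] by simp
  have max: "Max ?S \<le> real m + 1" using Max_in[OF fin S] eigenvalue_upper by blast
  have min: "1 / C \<le> Min ?S" using Min_in[OF fin S] eigenvalue_lower[OF _ C stable] by blast
  have "0 < 1 / C" using C by simp
  then have pos: "0 < Min ?S" using min by linarith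
  have "cond_number K = Max ?S / Min ?S" by (simp add: cond_number_def)
  also have "\<dots> \<le> (real m + 1) / Min ?S" using max pos by (simp add: divide_right_mono)
  also have "\<dots> \<le> (real m + 1) / (1 / C)" using min pos C by (intro divide_left_mono) auto
  finally show ?thesis by (simp add: mult.commute)
qed

end

text \<open>If \<open>V0 P\<close> is trivial, the matrices have dimension 0 and no eigenvalues, and
  a condition number has no meaning; this explains the proviso of the last bound.\<close>

theorem proposition6p6:
  fixes P :: dd_setting
    and \<alpha>min \<alpha>max \<sigma> c1 c2 C0sq :: real
    and m :: nat
    and N :: "pt list" and Ns :: "nat \<Rightarrow> pt list" and B :: "scalar_fun list"
  assumes domain: "lipschitz_domain (Omega P)"
    and mesh: "conforming_mesh (Omega P) (mesh P)" "quasi_uniform \<sigma> (mesh P)"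
    and coefficient: "coefficient_ok P \<alpha>min \<alpha>max"
    and subdomains: "nonoverlapping_decomposition P" "overlapping_decomposition P"
      "oversampling_domains P"
    and inner_products: "\<forall>e\<in>edges P. inner_product_on (Vbd P e) (bip P e)"
    and norm_equivalence: "0 < c1" "0 < c2"
      "\<forall>e\<in>edges P. \<forall>\<zeta>\<in>Vbd P e.
         c1 * sqrt (bip P e \<zeta> \<zeta>) \<le> sqrt \<alpha>min * bd_L2_norm P (esub P e) \<zeta> \<and>
         sqrt \<alpha>min * bd_L2_norm P (esub P e) \<zeta> \<le> c2 * sqrt (bip P e \<zeta> \<zeta>)"
    and tolerances: "0 < tol_dir P" "0 < tol_tr P"
    and eigenpairs: "\<forall>e\<in>edges P. dirichlet_eigenpairs P e"
      "\<forall>e\<in>edges P. transfer_eigenpairs P e"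
    and overlap_bound: "\<forall>x\<in>nodes P \<inter> Omega P.
      card {i \<in> {1..nsub P}. x \<in> closure (osub P i)} \<le> m"
    and node_enumeration: "distinct N" "set N = nodes P \<inter> Omega P"
    and local_enumerations: "\<forall>i\<in>{1..nsub P}. distinct (Ns i) \<and> set (Ns i) = nodes P \<inter> osub P i"
    and coarse_basis: "distinct B" "independent (set B)" "span (set B) = X0 P"
    and C0sq: "C0sq = 20 + 34 * real (max_edges P) * real (max_subs_at_edge P) * real (max_esubs P) *
      max ((c_t P)\<^sup>2 * tol_tr P * (1 + (c_p P)\<^sup>2) / c1\<^sup>2) (1 / tol_dir P)"
  shows "(\<forall>u\<in>V0 P.
      u = u_coarse P u + (\<Sum>i=1..nsub P. ext_osub P i (u_local P i u)) \<and>
      energy P (Omega P) (u_coarse P u) (u_coarse P u) +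
        (\<Sum>i=1..nsub P. energy_osub P i (u_local P i u) (u_local P i u))
        \<le> C0sq * energy P (Omega P) u u) \<and>
    (V0 P \<noteq> {0} \<longrightarrow> cond_number (schwarz_operator P N Ns B) \<le> C0sq * (real m + 1))"
proof -
  interpret s: fe_schwarz P \<alpha>min \<alpha>max c1 c2 m N Ns B
    by unfold_locales fact+
  let ?a = "energy P (Omega P)"
  define D where "D = real (max_edges P) * real (max_subs_at_edge P) * real (max_esubs P) * s.spectral_bound"
  have D: "0 \<le> D" using s.spectral_bound_nonneg by (simp add: D_def)
  have C: "C0sq = 20 + 34 * D" by (simp add: C0sq D_def s.spectral_bound_def)
  have stable: "u = u_coarse P u + (\<Sum>i=1..nsub P. ext_osub P i (u_local P i u))"
    "?a (u_coarse P u) (u_coarse P u) + (\<Sum>i=1..nsub P. energy_osub P i (u_local P i u) (u_local P i u))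
      \<le> C0sq * ?a u u" if u: "u \<in> V0 P" for u
  proof -
    interpret t: fe_splitting P \<alpha>min \<alpha>max c1 c2 u by unfold_locales (rule u)
    show "u = u_coarse P u + (\<Sum>i=1..nsub P. ext_osub P i (u_local P i u))" by (rule t.decomposition)
    have "?a (u_coarse P u) (u_coarse P u) + (\<Sum>i=1..nsub P. energy_osub P i (u_local P i u) (u_local P i u))
        \<le> (4 + 9 * D) * ?a u u"
      using t.total_energy unfolding D_def .
    \<comment> \<open>As \<open>D\<close> and the energy are nonnegative, 4 + 9 D <= 20 + 34 D is
      enough.\<close>
    also have "\<dots> \<le> C0sq * ?a u u"
      using D s.a.nonneg[OF s.V0_fe_space[OF u]] unfolding C by (intro mult_right_mono) auto
    finally show "?a (u_coarse P u) (u_coarse P u) + (\<Sum>i=1..nsub P. energy_osub P i (u_local P i u) (u_local P i u))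
      \<le> C0sq * ?a u u" .
  qed
  show ?thesis
  proof (intro conjI ballI impI)
    assume ne: "V0 P \<noteq> {0}"
    show "cond_number (schwarz_operator P N Ns B) \<le> C0sq * (real m + 1)"
      by (rule s.cond_number_bound[OF _ ne stable(2)]) (use C D in auto)
  qed (fact stable)+
qed

end
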